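(* Let $\omega$ be a subadditive weight function and let $L=\frac{\partial}{\partial t}+\sum_{j=1}^{N}(a_j+ib_j)(t)\frac{\partial}{\partial x_j}$ on $\mathbb{T}^{N+1}$, with $a_j,b_j$ real-valued functions in $\mathcal{E}_{\{\omega\}}(\mathbb{T}^1)$. The following are equivalent: \begin{itemize} \item $L$ is strongly $\{\omega\}$-solvable; \item $L$ is globally $\{\omega\}$-hypoelliptic; \item for each $\xi\in\mathbb{Z}^N$ the function $t\mapsto\langle\xi,\beta(t)\rangle$ does not change sign, and the pair $(\alpha_0,\beta_0)$ satisfies $(EDC)_1^{\{\omega\}}$. \end{itemize}
   Context: $\mathbb{T}^n=(\mathbb{R}/2\pi\mathbb{Z})^n$; coordinates on $\mathbb{T}^{N+1}$ are $(t,x)$. A weight function is an increasing continuous $\omega:[0,\infty)\to[0,\infty)$ such that: there is $K\ge0$ with $\omega(2t)\le K(\omega(t)+1)$; $\omega(t)=O(t)$; $\log t=o(\omega(t))$ as $t\to\infty$; $\varphi(t)=\omega(e^t)$ convex (one may assume $\omega=0$ on $[0,1]$). Subadditive: $\omega(s+t)\le\omega(s)+\omega(t)$. $\varphi^*(t)=\sup_{s\ge0}\{st-\varphi(s)\}$. $\|f\|_\lambda=\sup_{x}\sup_{\alpha}|\partial^\alpha f(x)|\exp(-\lambda\varphi^*(|\alpha|/\lambda))$; $\mathcal{E}_{\{\omega\}}(\mathbb{T}^n)=\{f\in C^\infty(\mathbb{T}^n):\|f\|_\lambda<\infty$ for some $\lambda>0\}$ with the inductive limit topology of the Banach spaces $\{f:\|f\|_{1/k}<\infty\}$;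 $\mathcal{E}'_{\{\omega\}}$ its strong dual. ${}^tL$ is the transpose of $L$ on $\mathcal{E}'_{\{\omega\}}(\mathbb{T}^{N+1})$ (${}^tL=-L$). Strongly $\{\omega\}$-solvable: $L\mathcal{E}_{\{\omega\}}(\mathbb{T}^{N+1})$ closed and $\ker{}^tL\subset\mathcal{E}'_{\{\omega\}}(\mathbb{T}^{N+1})$ finite dimensional. Globally $\{\omega\}$-hypoelliptic: $\mu\in\mathcal{E}'_{\{\omega\}}(\mathbb{T}^{N+1})$, $L\mu\in\mathcal{E}_{\{\omega\}}(\mathbb{T}^{N+1})$ imply $\mu\in\mathcal{E}_{\{\omega\}}(\mathbb{T}^{N+1})$. $\beta(t)=(b_1(t),\dots,b_N(t))$; $\alpha_0,\beta_0$ are the vectors of means over $[0,2\pi]$ of $(a_j)$ and $(b_j)$. $(\alpha,\beta)$ satisfies $(EDC)_1^{\{\omega\}}$ if for every $\epsilon>0$ there is $C_\epsilon>0$ with $|\tau+\langle\xi,\alpha+i\beta\rangle|\ge C_\epsilon e^{-\epsilon\omega(|(\tau,\xi)|)}$ for all $(\tau,\xi)\in\mathbb{Z}^{N+1}\setminus\{0\}$. A real function changes sign if it takes both strictly positive and strictly negative values. *)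

theory Defs
  imports "HOL-Analysis.Analysis" "HOL-Library.Landau_Symbols"
begin

definition weight_function :: "(real \<Rightarrow> real) \<Rightarrow> bool" where
  "weight_function \<omega> \<longleftrightarrow>
     mono_on {0..} \<omega> \<and> continuous_on {0..} \<omega> \<and> (\<forall>t\<ge>0. \<omega> t \<ge> 0) \<and>
     (\<exists>K\<ge>0. \<forall>t\<ge>0. \<omega> (2*t) \<le> K * (\<omega> t + 1)) \<and>
     \<omega> \<in> O(\<lambda>t. t) \<and>
     (\<lambda>t. ln t) \<in> o(\<omega>) \<and>
     convex_on UNIV (\<lambda>t. \<omega> (exp t))"

definition subadditive :: "(real \<Rightarrow> real) \<Rightarrow> bool" where
  "subadditive \<omega> \<longleftrightarrow> (\<forall>s\<ge>0. \<forall>t\<ge>0. \<omega> (s + t) \<le> \<omega> s + \<omega> t)"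

definition phi_w :: "(real \<Rightarrow> real) \<Rightarrow> real \<Rightarrow> real" where
  "phi_w \<omega> t = \<omega> (exp t)"

definition phi_star :: "(real \<Rightarrow> real) \<Rightarrow> real \<Rightarrow> real" where
  "phi_star \<omega> t = Sup {s * t - phi_w \<omega> s | s. s \<ge> 0}"

fun Dl :: "'a::euclidean_space list \<Rightarrow> ('a \<Rightarrow> complex) \<Rightarrow> 'a \<Rightarrow> complex" where
  "Dl [] f = f"
| "Dl (b # bs) f = (\<lambda>x. vector_derivative (\<lambda>s::real. Dl bs f (x + s *\<^sub>R b)) (at 0))"

definition smooth_fn :: "('a::euclidean_space \<Rightarrow> complex) \<Rightarrow> bool" where
  "smooth_fn f \<longleftrightarrow> (\<forall>bs. set bs \<subseteq> Basis \<longrightarrow>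
      continuous_on UNIV (Dl bs f) \<and>
      (\<forall>b\<in>Basis. \<forall>x. ((\<lambda>s::real. Dl bs f (x + s *\<^sub>R b)) has_vector_derivative Dl (b # bs) f x) (at 0)))"

definition periodic_fn :: "('a::euclidean_space \<Rightarrow> complex) \<Rightarrow> bool" where
  "periodic_fn f \<longleftrightarrow> (\<forall>b\<in>Basis. \<forall>x. f (x + (2*pi) *\<^sub>R b) = f x)"

definition Cinf_torus :: "('a::euclidean_space \<Rightarrow> complex) set" where
  "Cinf_torus = {f. smooth_fn f \<and> periodic_fn f}"

text \<open>The set of values |d^alpha f(x)| exp(-lam phi*(|alpha|/lam)); the multi-indices alpha of
  order k are represented by lists of k basis vectors (for smooth f the mixed partials commute,
  so this gives exactly the set of all d^alpha f with |alpha| = k).\<close>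
definition seminorm_vals :: "(real \<Rightarrow> real) \<Rightarrow> real \<Rightarrow> ('a::euclidean_space \<Rightarrow> complex) \<Rightarrow> real set" where
  "seminorm_vals \<omega> lam f =
     {cmod (Dl bs f x) * exp (- lam * phi_star \<omega> (real (length bs) / lam)) | x bs. set bs \<subseteq> Basis}"

definition norm_lam :: "(real \<Rightarrow> real) \<Rightarrow> real \<Rightarrow> ('a::euclidean_space \<Rightarrow> complex) \<Rightarrow> real" where
  "norm_lam \<omega> lam f = Sup (seminorm_vals \<omega> lam f)"

definition Estep :: "(real \<Rightarrow> real) \<Rightarrow> nat \<Rightarrow> ('a::euclidean_space \<Rightarrow> complex) set" where
  "Estep \<omega> k = {f \<in> Cinf_torus. bdd_above (seminorm_vals \<omega> (1 / real k) f)}"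

definition E_om :: "(real \<Rightarrow> real) \<Rightarrow> ('a::euclidean_space \<Rightarrow> complex) set" where
  "E_om \<omega> = {f \<in> Cinf_torus. \<exists>lam>0. bdd_above (seminorm_vals \<omega> lam f)}"

definition abs_convex :: "('a \<Rightarrow> complex) set \<Rightarrow> bool" where
  "abs_convex W \<longleftrightarrow> (\<forall>f\<in>W. \<forall>g\<in>W. \<forall>c d :: complex. cmod c + cmod d \<le> 1 \<longrightarrow>
                         (\<lambda>x. c * f x + d * g x) \<in> W)"

definition LB_zero_nhd :: "(real \<Rightarrow> real) \<Rightarrow> ('a::euclidean_space \<Rightarrow> complex) set \<Rightarrow> bool" where
  "LB_zero_nhd \<omega> U \<longleftrightarrow> U \<subseteq> E_om \<omega> \<and>
     (\<exists>W\<subseteq>U. abs_convex W \<and>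
        (\<forall>k::nat. k \<ge> 1 \<longrightarrow> (\<exists>\<epsilon>>0. \<forall>f\<in>Estep \<omega> k. norm_lam \<omega> (1 / real k) f < \<epsilon> \<longrightarrow> f \<in> W)))"

definition LB_open :: "(real \<Rightarrow> real) \<Rightarrow> ('a::euclidean_space \<Rightarrow> complex) set \<Rightarrow> bool" where
  "LB_open \<omega> V \<longleftrightarrow> V \<subseteq> E_om \<omega> \<and>
     (\<forall>f\<in>V. LB_zero_nhd \<omega> ((\<lambda>g. (\<lambda>x. g x - f x)) ` V))"

definition LB_closed :: "(real \<Rightarrow> real) \<Rightarrow> ('a::euclidean_space \<Rightarrow> complex) set \<Rightarrow> bool" where
  "LB_closed \<omega> S \<longleftrightarrow> S \<subseteq> E_om \<omega> \<and> LB_open \<omega> (E_om \<omega> - S)"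

text \<open>Continuous linear functionals on E_{omega}; represented extensionally (value 0 outside E).\<close>
definition E_dual :: "(real \<Rightarrow> real) \<Rightarrow> (('a::euclidean_space \<Rightarrow> complex) \<Rightarrow> complex) set" where
  "E_dual \<omega> = {\<mu>.
     (\<forall>f\<in>E_om \<omega>. \<forall>g\<in>E_om \<omega>. \<forall>c d :: complex. \<mu> (\<lambda>x. c * f x + d * g x) = c * \<mu> f + d * \<mu> g) \<and>
     (\<forall>S :: complex set. open S \<longrightarrow> LB_open \<omega> {f \<in> E_om \<omega>. \<mu> f \<in> S}) \<and>
     (\<forall>f. f \<notin> E_om \<omega> \<longrightarrow> \<mu> f = 0)}"

definition fin_dim_fun :: "(('b \<Rightarrow> complex)) set \<Rightarrow> bool" where
  "fin_dim_fun K \<longleftrightarrow> (\<exists>B. finite B \<and> B \<subseteq> K \<and>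
       (\<forall>\<mu>\<in>K. \<exists>c. \<mu> = (\<lambda>f. \<Sum>\<nu>\<in>B. c \<nu> * \<nu> f)))"

definition torus_box :: "'a::euclidean_space set" where
  "torus_box = cbox 0 (\<Sum>i\<in>Basis. (2*pi) *\<^sub>R i)"

definition pairing :: "('a::euclidean_space \<Rightarrow> complex) \<Rightarrow> ('a \<Rightarrow> complex) \<Rightarrow> complex" where
  "pairing f \<phi> = integral torus_box (\<lambda>x. f x * \<phi> x)"

definition Lop :: "('n::finite \<Rightarrow> real \<Rightarrow> real) \<Rightarrow> ('n \<Rightarrow> real \<Rightarrow> real)
                   \<Rightarrow> (real \<times> (real^'n) \<Rightarrow> complex) \<Rightarrow> real \<times> (real^'n) \<Rightarrow> complex" where
  "Lop a b f = (\<lambda>(t, x). Dl [(1, 0)] f (t, x)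
                 + (\<Sum>j\<in>UNIV. Complex (a j t) (b j t) * Dl [(0, axis j 1)] f (t, x)))"

definition ker_tL :: "(real \<Rightarrow> real) \<Rightarrow> ('n::finite \<Rightarrow> real \<Rightarrow> real) \<Rightarrow> ('n \<Rightarrow> real \<Rightarrow> real)
                      \<Rightarrow> ((real \<times> (real^'n) \<Rightarrow> complex) \<Rightarrow> complex) set" where
  "ker_tL \<omega> a b = {\<mu> \<in> E_dual \<omega>. \<forall>\<phi>\<in>E_om \<omega>. \<mu> (Lop a b \<phi>) = 0}"

definition strongly_solvable :: "(real \<Rightarrow> real) \<Rightarrow> ('n::finite \<Rightarrow> real \<Rightarrow> real) \<Rightarrow> ('n \<Rightarrow> real \<Rightarrow> real) \<Rightarrow> bool" where
  "strongly_solvable \<omega> a b \<longleftrightarrow>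
     LB_closed \<omega> (Lop a b ` E_om \<omega>) \<and> fin_dim_fun (ker_tL \<omega> a b)"

text \<open>L acting on E': (L mu)(phi) = mu(tL phi) = - mu(L phi), since tL = -L.
  A functional mu "is" a function f of E if mu(phi) = pairing f phi for all phi in E.\<close>
definition globally_hypoelliptic :: "(real \<Rightarrow> real) \<Rightarrow> ('n::finite \<Rightarrow> real \<Rightarrow> real) \<Rightarrow> ('n \<Rightarrow> real \<Rightarrow> real) \<Rightarrow> bool" where
  "globally_hypoelliptic \<omega> a b \<longleftrightarrow>
     (\<forall>\<mu>\<in>E_dual \<omega>.
        (\<exists>g\<in>E_om \<omega>. \<forall>\<phi>\<in>E_om \<omega>. - \<mu> (Lop a b \<phi>) = pairing g \<phi>) \<longrightarrow>
        (\<exists>f\<in>E_om \<omega>. \<forall>\<phi>\<in>E_om \<omega>. \<mu> \<phi> = pairing f \<phi>))"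

definition changes_sign :: "(real \<Rightarrow> real) \<Rightarrow> bool" where
  "changes_sign g \<longleftrightarrow> (\<exists>t1 t2. g t1 > 0 \<and> g t2 < 0)"

definition mean_vec :: "('n \<Rightarrow> real \<Rightarrow> real) \<Rightarrow> 'n \<Rightarrow> real" where
  "mean_vec a j = integral {0..2*pi} (a j) / (2*pi)"

definition EDC1 :: "(real \<Rightarrow> real) \<Rightarrow> ('n::finite \<Rightarrow> real) \<Rightarrow> ('n \<Rightarrow> real) \<Rightarrow> bool" where
  "EDC1 \<omega> \<alpha> \<beta> \<longleftrightarrow> (\<forall>\<epsilon>>0. \<exists>C>0. \<forall>(\<tau>::int) (\<xi>::'n \<Rightarrow> int). (\<tau> \<noteq> 0 \<or> (\<exists>j. \<xi> j \<noteq> 0)) \<longrightarrow>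
      cmod (of_int \<tau> + (\<Sum>j\<in>UNIV. of_int (\<xi> j) * Complex (\<alpha> j) (\<beta> j)))
        \<ge> C * exp (- \<epsilon> * \<omega> (sqrt (real_of_int \<tau> ^ 2 + (\<Sum>j\<in>UNIV. real_of_int (\<xi> j) ^ 2)))))"

end

theory Submission
  imports Defs
begin

text \<open>
  Partial Fourier series in \<open>x\<close> identify the space \<open>E_om\<close> with families \<open>u \<xi>\<close> of periodic functions of \<open>t\<close>
  whose derivatives of order \<open>k\<close> are bounded by \<open>C * M l k * exp (- 2 * l * \<omega> |\<xi>|)\<close>, where
  \<open>M l k = exp (l * phi_star (k / l))\<close> is the supremum of \<open>t ^ k * exp (- l * \<omega> t)\<close> over \<open>t \<ge> 1\<close>; the operator
  becomes the family of ordinary differential operators \<open>d/dt + i \<langle>\<xi>, c t\<rangle>\<close>. Subadditivity of \<open>\<omega>\<close> gives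
  \<open>binomial (j + k) j * M l j * M l k \<le> M l (j + k)\<close>, so that solutions inherit the derivative bounds of
  the data at the cost of a factor \<open>exp (d * \<omega> |\<xi>|)\<close> with \<open>d\<close> as small as one likes.

  If no \<open>\<langle>\<xi>, b\<rangle>\<close> changes sign, the periodic solution can be written with a kernel of modulus at most one, and the
  diophantine condition bounds the denominators. Hence the operator maps onto the functions of mean zero, and both
  solvability and hypoellipticity follow by duality. Conversely, if the condition fails, infinitely many frequencies
  carry functions \<open>u \<xi>\<close> that do not decay although their images \<open>H \<xi>\<close> decay fast. For small denominators \<open>u \<xi>\<close>
  is a nearly homogeneous solution; for a sign change one prescribes a right-hand side of size \<open>exp (- k * Mx)\<close> whose
  phase cancels that of the kernel at a maximum point, so no cut-off functions are needed and the real-analytic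
  case is included. The sum of the \<open>u \<xi>\<close> violates hypoellipticity. If infinitely many \<open>H \<xi>\<close> vanish, the kernel is
  infinite dimensional; otherwise the sum of the \<open>H \<xi>\<close> lies in the closure of the range but not in the range.
\<close>

section \<open>Weights and lattice sums\<close>

text \<open>The difficulty is the bookkeeping of decay. The coefficient of the ordinary differential
  equation grows like \<open>norm (lat \<xi>)\<close>, so k derivatives of a solution bring in up to
  k powers of it. They are traded by \<open>y ^ i \<le> exp (d * \<omega> y) * M d i\<close>, which
  lowers the derivative parameter uniformly in \<xi> and costs decay only at the rate d. Since d is
  at one's disposal, the decay of the data survives both this loss and the small denominators. In
  the converse direction little is required of a bad mode: its maximum may shrink like
  \<open>1 / norm (lat \<xi>)\<close>, because the growth condition on \<omega> makes polynomial
  factors negligible. Moreover each bad mode is built so that its right-hand side vanishes or its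
  frequency is not resonant. In the second case periodic solutions are unique, so a preimage of the
  sum of the right-hand sides would have the \<open>u \<xi>\<close> as coefficients; this keeps that
  sum out of the range. For a sign change at \<open>\<xi>0\<close> only multiples
  \<open>k * \<xi>0\<close> are used, with k such that k times the mean of the real part of the
  symbol is within 1 / 8 of an integer.\<close>

definition weight_seq :: "(real \<Rightarrow> real) \<Rightarrow> real \<Rightarrow> nat \<Rightarrow> real" where
  "weight_seq \<omega> l k = exp (l * phi_star \<omega> (real k / l))"

definition lat :: "('n::finite \<Rightarrow> int) \<Rightarrow> real^'n" where
  "lat \<xi> = (\<chi> j. of_int (\<xi> j))"

text \<open>A fixed enumeration of the frequencies turns lattice sums into series over nat, to which
  the termwise theorems apply. The series formed with it converge absolutely, so the order is
  immaterial.\<close>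

definition lat_enum :: "nat \<Rightarrow> ('n::finite \<Rightarrow> int)" where
  "lat_enum = from_nat_into UNIV"

lemma infinite_lattice: "infinite (UNIV :: ('n::finite \<Rightarrow> int) set)"
proof
  assume "finite (UNIV :: ('n \<Rightarrow> int) set)"
  moreover have "inj (\<lambda>(k::int) (j::'n). k)" by (auto simp: inj_def fun_eq_iff)
  ultimately have "finite (UNIV :: int set)" by (metis finite_imageD finite_subset subset_UNIV)
  then show False by simp
qed

lemma bij_lat_enum: "bij (lat_enum :: nat \<Rightarrow> ('n::finite \<Rightarrow> int))"
  unfolding lat_enum_def by (rule bij_betw_from_nat_into) (auto simp: infinite_lattice)

lemma lat_component [simp]: "lat \<xi> $ j = of_int (\<xi> j)"
  by (simp add: lat_def)

lemma lat_le_norm: "\<bar>real_of_int (\<xi> j)\<bar> \<le> norm (lat \<xi>)"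
  using component_le_norm_cart[of "lat \<xi>" j] by simp

lemma norm_lat: "norm (lat \<xi>) = sqrt (\<Sum>j\<in>UNIV. real_of_int (\<xi> j) ^ 2)"
  by (simp add: norm_vec_def L2_set_def)

lemma norm_lat_ge_1: "\<xi> j \<noteq> 0 \<Longrightarrow> 1 \<le> norm (lat \<xi>)"
  using lat_le_norm[of \<xi> j] by (smt (verit) of_int_1_le_iff of_int_le_iff of_int_minus zero_less_abs_iff)

lemma norm_lat_cases: "lat \<xi> = 0 \<or> 1 \<le> norm (lat \<xi>)"
proof (cases "\<exists>j. \<xi> j \<noteq> 0")
  case False
  then show ?thesis by (auto simp: vec_eq_iff)
qed (auto dest: norm_lat_ge_1)

lemma lat_minus: "lat (\<lambda>j. - \<xi> j) = - lat \<xi>"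
  by (simp add: vec_eq_iff)

lemma lat_diff: "lat (\<lambda>j. \<xi> j - \<eta> j) = lat \<xi> - lat \<eta>"
  by (simp add: vec_eq_iff)

locale subadd_weight =
  fixes \<omega> :: "real \<Rightarrow> real"
  assumes weight: "weight_function \<omega>" and subadd: "subadditive \<omega>"
begin

abbreviation M :: "real \<Rightarrow> nat \<Rightarrow> real" where "M \<equiv> weight_seq \<omega>"

lemma w_mono: "0 \<le> s \<Longrightarrow> s \<le> t \<Longrightarrow> \<omega> s \<le> \<omega> t"
  using weight unfolding weight_function_def mono_on_def by auto

lemma w_nonneg: "0 \<le> t \<Longrightarrow> 0 \<le> \<omega> t"
  using weight unfolding weight_function_def by auto

lemma w_add: "0 \<le> s \<Longrightarrow> 0 \<le> t \<Longrightarrow> \<omega> (s + t) \<le> \<omega> s + \<omega> t"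
  using subadd unfolding subadditive_def by auto

text \<open>Subadditivity iterated. It gives dilations by n at the cost of the factor n, where the
  doubling condition would only give some constant depending on n.\<close>

lemma w_mult: 
  assumes "0 \<le> t" shows "\<omega> (real (Suc n) * t) \<le> real (Suc n) * \<omega> t"
proof (induction n)
  case (Suc n)
  have "\<omega> (real (Suc (Suc n)) * t) = \<omega> (real (Suc n) * t + t)" by (simp add: algebra_simps)
  also have "\<dots> \<le> \<omega> (real (Suc n) * t) + \<omega> t" using assms by (intro w_add) auto
  finally show ?case using Suc by (simp add: algebra_simps)
qed simp

lemma w_mult': "0 \<le> t \<Longrightarrow> 1 \<le> n \<Longrightarrow> \<omega> (real n * t) \<le> real n * \<omega> t"
  using w_mult[of t "n - 1"] by simp

lemma w_ln:
  assumes "c > 0"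
  obtains T where "T \<ge> 1" "\<And>t. t \<ge> T \<Longrightarrow> ln t \<le> c * \<omega> t"
proof -
  have "(\<lambda>t. ln t) \<in> o(\<omega>)" using weight unfolding weight_function_def by auto
  then have "eventually (\<lambda>t. norm (ln t) \<le> c * norm (\<omega> t)) at_top"
    using assms by (rule landau_o.smallD)
  then obtain T0 where T0: "\<And>t. t \<ge> T0 \<Longrightarrow> norm (ln t) \<le> c * norm (\<omega> t)"
    unfolding eventually_at_top_linorder by auto
  show ?thesis
  proof (rule that[of "max T0 1"])
    fix t assume "max T0 1 \<le> t"
    then show "ln t \<le> c * \<omega> t" using T0[of t] w_nonneg[of t] by (simp add: abs_le_iff)
  qed auto
qed

text \<open>The condition \<open>ln t = o(\<omega> t)\<close>, exponentiated: polynomial factors are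
  negligible against \<open>exp (d * \<omega> t)\<close> for every positive d. The summand
  \<open>(1 + T) ^ p\<close> of the constant covers the bounded range below T.\<close>

lemma power_le_exp_w:
  assumes "d > 0"
  obtains C where "C > 0" "\<And>t. t \<ge> 0 \<Longrightarrow> (1 + t) ^ p \<le> C * exp (d * \<omega> t)"
proof -
  obtain T where T: "T \<ge> 1" "\<And>t. t \<ge> T \<Longrightarrow> ln t \<le> d / (real p + 1) * \<omega> t"
    using w_ln[of "d / (real p + 1)"] assms by auto
  have "(1 + t) ^ p \<le> (2 ^ p + (1 + T) ^ p) * exp (d * \<omega> t)" if t: "t \<ge> 0" for t
  proof (cases "t \<ge> T")
    case True
    have w0: "0 \<le> \<omega> t" using w_nonneg t by auto
    have "real p * ln t \<le> real p * (d / (real p + 1) * \<omega> t)" using T(2)[OF True] by (intro mult_left_mono) auto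
    also have "\<dots> = real p / (real p + 1) * (d * \<omega> t)" by simp
    also have "\<dots> \<le> 1 * (d * \<omega> t)" using w0 assms by (intro mult_right_mono) auto
    finally have le: "real p * ln t \<le> d * \<omega> t" by simp
    have "(1 + t) ^ p \<le> (2 * t) ^ p" using True T(1) by (intro power_mono) auto
    also have "\<dots> = 2 ^ p * exp (real p * ln t)" using True T(1) by (simp add: power_mult_distrib exp_of_nat_mult)
    also have "\<dots> \<le> 2 ^ p * exp (d * \<omega> t)" using le by auto
    also have "\<dots> \<le> (2 ^ p + (1 + T) ^ p) * exp (d * \<omega> t)" using T(1) by (intro mult_right_mono) auto
    finally show ?thesis .
  next
    case False
    have "(1 + t) ^ p * 1 \<le> (2 ^ p + (1 + T) ^ p) * exp (d * \<omega> t)"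
    proof (rule mult_mono)
      have "(1 + t) ^ p \<le> (1 + T) ^ p" using False t by (intro power_mono) auto
      then show "(1 + t) ^ p \<le> 2 ^ p + (1 + T) ^ p" by (smt (verit) zero_le_power)
    qed (use T(1) t assms w_nonneg in auto)
    then show ?thesis by simp
  qed
  moreover have "0 < 2 ^ p + (1 + T) ^ p" using T(1) by (simp add: add_pos_pos)
  ultimately show ?thesis using that by blast
qed

text \<open>Without boundedness the \<open>Sup\<close> in \<open>phi_star\<close> would carry no
  information. The growth condition makes \<open>phi_w\<close> superlinear, so that the expression
  is at most zero once \<open>exp s \<ge> T\<close>.\<close>

lemma phi_star_bdd: "bdd_above {s * p - phi_w \<omega> s | s. s \<ge> 0}"
proof -
  obtain T where T: "T \<ge> 1" "\<And>t. t \<ge> T \<Longrightarrow> ln t \<le> 1 / (\<bar>p\<bar> + 1) * \<omega> t"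
    using w_ln[of "1 / (\<bar>p\<bar> + 1)"] by (metis abs_ge_zero add_nonneg_pos divide_pos_pos zero_less_one)
  have "s * p - phi_w \<omega> s \<le> ln T * \<bar>p\<bar>" if s: "s \<ge> 0" for s
  proof (cases "exp s \<ge> T")
    case True
    have w0: "0 \<le> \<omega> (exp s)" using w_nonneg by auto
    have "s * p \<le> s * \<bar>p\<bar>" using s by (intro mult_left_mono) auto
    also have "\<dots> \<le> (1 / (\<bar>p\<bar> + 1) * \<omega> (exp s)) * \<bar>p\<bar>" using T(2)[OF True] by (intro mult_right_mono) auto
    also have "\<dots> = \<bar>p\<bar> / (\<bar>p\<bar> + 1) * \<omega> (exp s)" by simp
    also have "\<dots> \<le> 1 * \<omega> (exp s)" using w0 by (intro mult_right_mono) auto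
    finally have "s * p - phi_w \<omega> s \<le> 0" by (simp add: phi_w_def)
    also have "0 \<le> ln T * \<bar>p\<bar>" using T(1) by auto
    finally show ?thesis .
  next
    case False
    have "s \<le> ln T" using False T(1) by (metis exp_gt_zero less_eq_real_def linorder_not_le ln_exp ln_mono)
    have "s * p \<le> s * \<bar>p\<bar>" using s by (intro mult_left_mono) auto
    also have "\<dots> \<le> ln T * \<bar>p\<bar>" using \<open>s \<le> ln T\<close> by (intro mult_right_mono) auto
    finally show ?thesis using w_nonneg[of "exp s"] by (simp add: phi_w_def)
  qed
  then show ?thesis by (intro bdd_aboveI[where M = "ln T * \<bar>p\<bar>"]) auto
qed

lemma M_pos [simp]: "0 < M l k" by (simp add: weight_seq_def)
lemma M_nonneg [simp]: "0 \<le> M l k" by (simp add: weight_seq_def)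

text \<open>Together with \<open>M_least\<close> this identifies the weight as a supremum over
  \<open>t \<ge> 1\<close>, by the substitution \<open>t = exp s\<close>. The later estimates of
  \<open>M\<close> go through these two bounds instead of \<open>phi_star\<close>.\<close>

lemma M_ge:
  assumes "l > 0" "t \<ge> 1"
  shows "t ^ k * exp (- l * \<omega> t) \<le> M l k"
proof -
  have "ln t * (real k / l) - phi_w \<omega> (ln t) \<le> phi_star \<omega> (real k / l)"
    unfolding phi_star_def by (rule cSup_upper[OF _ phi_star_bdd]) (use assms in auto)
  then have "l * (ln t * (real k / l) - \<omega> t) \<le> l * phi_star \<omega> (real k / l)"
    using assms by (intro mult_left_mono) (auto simp: phi_w_def)
  then have "real k * ln t - l * \<omega> t \<le> l * phi_star \<omega> (real k / l)"
    using assms by (simp add: algebra_simps)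
  then have "exp (real k * ln t - l * \<omega> t) \<le> M l k" by (simp add: weight_seq_def)
  then show ?thesis using assms by (simp add: exp_diff exp_of_nat_mult exp_minus field_simps)
qed

lemma M_least:
  assumes "l > 0" and B: "\<And>t. t \<ge> 1 \<Longrightarrow> t ^ k * exp (- l * \<omega> t) \<le> B"
  shows "M l k \<le> B"
proof -
  have "0 < B" using less_le_trans[OF exp_gt_zero[of "- l * \<omega> 1"]] B[of 1] by simp
  have "phi_star \<omega> (real k / l) \<le> ln B / l"
    unfolding phi_star_def
  proof (rule cSup_least)
    fix x assume "x \<in> {s * (real k / l) - phi_w \<omega> s |s. 0 \<le> s}"
    then obtain s where s: "s \<ge> 0" "x = s * (real k / l) - phi_w \<omega> s" by auto
    have "exp s ^ k * exp (- l * \<omega> (exp s)) \<le> B" using s by (intro B) auto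
    then have "exp (real k * s - l * \<omega> (exp s)) \<le> B"
      by (simp add: exp_diff exp_of_nat_mult exp_minus divide_inverse)
    then have "real k * s - l * \<omega> (exp s) \<le> ln B" using \<open>0 < B\<close> by (simp add: ln_ge_iff)
    then show "x \<le> ln B / l" using assms s by (simp add: field_simps phi_w_def)
  qed auto
  then have "l * phi_star \<omega> (real k / l) \<le> ln B" using assms by (simp add: field_simps)
  then have "M l k \<le> exp (ln B)" unfolding weight_seq_def by simp
  then show ?thesis using \<open>0 < B\<close> by simp
qed

text \<open>The supremum for \<open>M l (j + k)\<close> is tested at \<open>s + t\<close>: the
  expansion of \<open>(s + t) ^ (j + k)\<close> contains the required term, and subadditivity bounds
  the exponential from below. The suprema in s and t are then taken one after the other.\<close>

lemma M_binomial:
  assumes l: "l > 0"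
  shows "real ((j + k) choose j) * (M l j * M l k) \<le> M l (j + k)"
proof -
  let ?b = "real ((j + k) choose j)"
  have bpos: "?b > 0" by simp
  have main: "?b * (s ^ j * exp (- l * \<omega> s) * (t ^ k * exp (- l * \<omega> t))) \<le> M l (j + k)"
    if "s \<ge> 1" "t \<ge> 1" for s t
  proof -
    have "?b * s ^ j * t ^ (j + k - j) \<le> (\<Sum>i\<le>j + k. real ((j + k) choose i) * s ^ i * t ^ (j + k - i))"
      using that by (intro member_le_sum[where f = "\<lambda>i. real ((j + k) choose i) * s ^ i * t ^ (j + k - i)"]) auto
    then have 1: "?b * s ^ j * t ^ k \<le> (s + t) ^ (j + k)" by (simp add: binomial_ring)
    have "l * \<omega> (s + t) \<le> l * (\<omega> s + \<omega> t)" using w_add[of s t] that l by (intro mult_left_mono) auto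
    then have 2: "exp (- l * \<omega> s) * exp (- l * \<omega> t) \<le> exp (- l * \<omega> (s + t))"
      by (simp add: exp_add[symmetric] algebra_simps)
    have "?b * (s ^ j * exp (- l * \<omega> s) * (t ^ k * exp (- l * \<omega> t)))
        = (?b * s ^ j * t ^ k) * (exp (- l * \<omega> s) * exp (- l * \<omega> t))" by simp
    also have "\<dots> \<le> (s + t) ^ (j + k) * exp (- l * \<omega> (s + t))"
      using 1 2 that by (intro mult_mono) auto
    also have "\<dots> \<le> M l (j + k)" using that l by (intro M_ge) auto
    finally show ?thesis .
  qed
  have "M l j \<le> M l (j + k) / (?b * M l k)"
  proof (rule M_least[OF l])
    fix s :: real assume s: "s \<ge> 1"
    define A where "A = s ^ j * exp (- l * \<omega> s)"
    have A: "A > 0" using s by (simp add: A_def)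
    have "M l k \<le> M l (j + k) / (?b * A)"
    proof (rule M_least[OF l])
      fix t :: real assume "t \<ge> 1"
      from main[OF s this] show "t ^ k * exp (- l * \<omega> t) \<le> M l (j + k) / (?b * A)"
        unfolding A_def[symmetric] using A bpos by (simp add: pos_le_divide_eq mult_ac)
    qed
    then show "s ^ j * exp (- l * \<omega> s) \<le> M l (j + k) / (?b * M l k)"
      unfolding A_def[symmetric] using A bpos by (simp add: pos_le_divide_eq mult_ac)
  qed
  then show ?thesis using bpos by (simp add: pos_le_divide_eq mult_ac)
qed

lemma M_mult: "l > 0 \<Longrightarrow> M l j * M l k \<le> M l (j + k)"
proof -
  assume l: "l > 0"
  have "1 * (M l j * M l k) \<le> real ((j + k) choose j) * (M l j * M l k)"
    by (intro mult_right_mono) (auto simp: Suc_leI)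
  then show ?thesis using M_binomial[OF l, of j k] by linarith
qed

text \<open>Dilation of t by n: geometric factors \<open>n ^ k\<close> are paid for by dividing the
  parameter by n.\<close>

lemma M_scale:
  assumes "l > 0" "n \<ge> 1"
  shows "real n ^ k * M l k \<le> M (l / real n) k"
proof -
  have n: "real n > 0" using assms by auto
  have "M l k \<le> M (l / real n) k / real n ^ k"
  proof (rule M_least[OF assms(1)])
    fix t :: real assume t: "t \<ge> 1"
    have "\<omega> (real n * t) \<le> real n * \<omega> t" using t assms by (intro w_mult') auto
    then have "l / real n * \<omega> (real n * t) \<le> l / real n * (real n * \<omega> t)" 
      using assms by (intro mult_left_mono) auto
    then have *: "l / real n * \<omega> (real n * t) \<le> l * \<omega> t" using n by simp
    have "(real n ^ k * t ^ k) * exp (- l * \<omega> t) \<le> (real n * t) ^ k * exp (- (l / real n) * \<omega> (real n * t))"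
      unfolding power_mult_distrib using * t by (intro mult_left_mono) auto
    also have "\<dots> \<le> M (l / real n) k"
    proof (rule M_ge)
      have "1 * 1 \<le> real n * t" using t assms by (intro mult_mono) auto
      then show "1 \<le> real n * t" by simp
    qed (use assms n in auto)
    finally show "t ^ k * exp (- l * \<omega> t) \<le> M (l / real n) k / real n ^ k" using n by (simp add: field_simps)
  qed
  then show ?thesis using n by (simp add: field_simps)
qed

lemma M_antimono:
  assumes "0 < l'" "l' \<le> l"
  shows "M l k \<le> M l' k"
proof (rule M_least)
  fix t :: real assume t: "t \<ge> 1"
  have "l' * \<omega> t \<le> l * \<omega> t" using assms w_nonneg[of t] t by (intro mult_right_mono) auto
  then have "t ^ k * exp (- l * \<omega> t) \<le> t ^ k * exp (- l' * \<omega> t)" using t by (intro mult_left_mono) auto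
  also have "\<dots> \<le> M l' k" using assms t by (intro M_ge) auto
  finally show "t ^ k * exp (- l * \<omega> t) \<le> M l' k" .
qed (use assms in auto)

text \<open>A supremum of products is at most the product of suprema, each with half of the
  exponential. It serves to separate two groups of derivatives.\<close>

lemma M_split:
  assumes "l > 0"
  shows "M l (j + k) \<le> M (l / 2) j * M (l / 2) k"
proof (rule M_least[OF assms])
  fix t :: real assume t: "t \<ge> 1"
  have "t ^ (j + k) * exp (- l * \<omega> t) = (t ^ j * exp (- (l / 2) * \<omega> t)) * (t ^ k * exp (- (l / 2) * \<omega> t))"
    by (simp add: power_add exp_add[symmetric])
  also have "\<dots> \<le> M (l / 2) j * M (l / 2) k" using assms t by (intro mult_mono M_ge) auto
  finally show "t ^ (j + k) * exp (- l * \<omega> t) \<le> M (l / 2) j * M (l / 2) k" .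
qed

lemma M_Suc:
  assumes "l > 0" shows "M l k \<le> M l (Suc k)"
proof (rule M_least[OF assms])
  fix t :: real assume t: "t \<ge> 1"
  have "t ^ k * exp (- l * \<omega> t) \<le> t ^ Suc k * exp (- l * \<omega> t)" using t by (intro mult_right_mono power_increasing) auto
  also have "\<dots> \<le> M l (Suc k)" using assms t by (intro M_ge) auto
  finally show "t ^ k * exp (- l * \<omega> t) \<le> M l (Suc k)" .
qed

lemma M_0:
  assumes "l > 0" shows "M l 0 = exp (- l * \<omega> 1)"
proof (rule antisym)
  show "M l 0 \<le> exp (- l * \<omega> 1)"
  proof (rule M_least[OF assms])
    fix t :: real assume t: "t \<ge> 1"
    show "t ^ 0 * exp (- l * \<omega> t) \<le> exp (- l * \<omega> 1)" using w_mono[of 1 t] t assms by auto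
  qed
  show "exp (- l * \<omega> 1) \<le> M l 0" using M_ge[OF assms, of 1 0] by simp
qed

lemma M_power: \<comment> \<open>the exponential factor absorbs powers also for \<open>t = 0\<close>, where \<open>0 ^ 0 = 1\<close>\<close>
  assumes "l > 0" "t \<ge> 1 \<or> t = 0"
  shows "t ^ k \<le> exp (l * \<omega> 1) * (M l k * exp (l * \<omega> t))"
proof (cases "t \<ge> 1")
  case True
  have "1 * (t ^ k * exp (- l * \<omega> t)) \<le> exp (l * \<omega> 1) * M l k"
    using True assms M_ge[OF assms(1) True, of k] w_nonneg[of 1] by (intro mult_mono) auto
  then show ?thesis by (simp add: exp_minus field_simps)
next
  case False
  then have [simp]: "t = 0" using assms by auto
  show ?thesis
  proof (cases k)
    case 0
    show ?thesis using w_nonneg[of 0] assms by (simp add: 0 M_0 exp_add[symmetric])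
  qed auto
qed

text \<open>The slope is the right derivative of \<open>\<lambda>r. \<omega> (exp r)\<close> at s,
  obtained as an infimum of difference quotients; monotonicity of \<omega> makes it
  nonnegative.\<close>

lemma convex_subgradient:
  assumes "s \<ge> 0"
  obtains p where "p \<ge> 0" "\<And>r. \<omega> (exp r) \<ge> \<omega> (exp s) + p * (r - s)"
proof -
  define f where "f = (\<lambda>r. \<omega> (exp r))"
  have cvx: "convex_on UNIV f" using weight unfolding weight_function_def f_def by auto
  have mono: "f x \<le> f y" if "x \<le> y" for x y using that unfolding f_def by (intro w_mono) auto
  define D where "D = {(f r - f s) / (r - s) | r. r > s}"
  have Dne: "D \<noteq> {}" unfolding D_def by (auto intro: exI[of _ "s + 1"])
  have Dlb: "d \<ge> 0" if "d \<in> D" for d using that mono unfolding D_def by auto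
  have bdd: "bdd_below D" using Dlb by (intro bdd_belowI[of _ 0])
  define p where "p = Inf D"
  have "p \<ge> 0" unfolding p_def using Dne Dlb by (intro cInf_greatest)
  moreover have "f r \<ge> f s + p * (r - s)" for r
  proof (cases r s rule: linorder_cases)
    case greater
    then have "(f r - f s) / (r - s) \<in> D" unfolding D_def by auto
    then have "p \<le> (f r - f s) / (r - s)" unfolding p_def using bdd by (rule cInf_lower)
    then show ?thesis using greater by (simp add: field_simps)
  next
    case less
    have "(f s - f r) / (s - r) \<le> p" unfolding p_def
    proof (rule cInf_greatest[OF Dne])
      fix d assume "d \<in> D"
      then obtain q where q: "q > s" "d = (f q - f s) / (q - s)" unfolding D_def by auto
      have "(f r - f s) / (r - s) \<le> (f r - f q) / (r - q)"
        by (rule convex_on_slope_le[OF cvx]) (use less q in auto)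
      then have "(f s - f r) * (q - r) \<le> (f q - f r) * (s - r)" using less q by (simp add: field_simps)
      then have "(f s - f r) * (q - s) \<le> (f q - f s) * (s - r)" by (simp add: algebra_simps)
      then have "f s - f r \<le> (f q - f s) * (s - r) / (q - s)" using q by (subst pos_le_divide_eq) auto
      then have "f s - f r \<le> d * (s - r)" using q by simp
      then show "(f s - f r) / (s - r) \<le> d" using less by (subst pos_divide_le_eq) auto
    qed
    then show ?thesis using less by (simp add: field_simps)
  qed simp
  ultimately show ?thesis using that unfolding f_def by blast
qed

text \<open>Young's inequality is sharp by convexity; passing to integer exponents costs the factor \<open>t\<close>.\<close>
lemma decay_of_M:
  assumes l: "l > 0" and t: "t \<ge> 1" and C: "C \<ge> 0" and y: "\<And>k. t ^ k * y \<le> C * M l k"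
  shows "y \<le> C * (t * exp (- l * \<omega> t))"
proof -
  define s where "s = ln t"
  have s: "s \<ge> 0" "exp s = t" using t by (auto simp: s_def)
  obtain p where p: "p \<ge> 0" "\<And>r. \<omega> (exp r) \<ge> \<omega> (exp s) + p * (r - s)"
    using convex_subgradient[OF s(1)] by blast
  \<comment> \<open>\<open>l * p\<close> is the real exponent whose supremum is attained at t, by
    the subgradient inequality. Rounding it down keeps the upper bound for \<open>M l k\<close> and
    loses at most one power of t.\<close>
  define k where "k = nat \<lfloor>l * p\<rfloor>"
  have k: "real k \<le> l * p" "l * p \<le> real k + 1" using p l by (auto simp: k_def; linarith)+
  have "M l k \<le> exp (l * p * s - l * \<omega> t)"
  proof (rule M_least[OF l])
    fix r :: real assume r: "r \<ge> 1"
    define q where "q = ln r"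
    have q: "q \<ge> 0" "exp q = r" using r by (auto simp: q_def)
    have "real k * q \<le> l * p * q" using k q by (intro mult_right_mono) auto
    moreover have "l * \<omega> r \<ge> l * (\<omega> t + p * (q - s))" using p(2)[of q] l q s by (intro mult_left_mono) auto
    ultimately have "real k * q - l * \<omega> r \<le> l * p * s - l * \<omega> t" by (simp add: algebra_simps)
    then have "exp (real k * q - l * \<omega> r) \<le> exp (l * p * s - l * \<omega> t)" by simp
    then show "r ^ k * exp (- l * \<omega> r) \<le> exp (l * p * s - l * \<omega> t)"
      unfolding q(2)[symmetric] by (simp add: exp_diff exp_of_nat_mult exp_minus divide_inverse)
  qed
  have "l * p * s \<le> (real k + 1) * s" using k s by (intro mult_right_mono) auto
  then have "exp (l * p * s) \<le> exp ((real k + 1) * s)" by simp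
  also have "\<dots> = t ^ k * t" using s by (simp add: distrib_right exp_add exp_of_nat_mult)
  finally have tk: "exp (l * p * s) \<le> t ^ k * t" .
  have "t ^ k * y \<le> C * M l k" by (rule y)
  also have "\<dots> \<le> C * exp (l * p * s - l * \<omega> t)" using \<open>M l k \<le> _\<close> C by (intro mult_left_mono)
  also have "\<dots> = C * (exp (l * p * s) * exp (- l * \<omega> t))" by (simp add: exp_add[symmetric])
  also have "\<dots> \<le> C * (t ^ k * t * exp (- l * \<omega> t))" using tk C by (intro mult_left_mono mult_right_mono) auto
  finally have "t ^ k * y \<le> t ^ k * (C * (t * exp (- l * \<omega> t)))" by (simp add: mult_ac)
  then show ?thesis using t by (subst (asm) mult_le_cancel_left_pos) auto
qed

end

section \<open>Summability over the lattice\<close>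

lemma sum_inverse_square_int: "\<exists>B. \<forall>m::nat. (\<Sum>k\<in>{-int m..int m}. inverse ((1 + \<bar>real_of_int k\<bar>)\<^sup>2)) \<le> B"
proof -
  let ?f = "\<lambda>k::int. inverse ((1 + \<bar>real_of_int k\<bar>)\<^sup>2)"
  have sm: "summable (\<lambda>n::nat. ?f (int n))"
    using summable_Suc_iff[of "\<lambda>n. inverse ((real n)\<^sup>2)"] inverse_power_summable[of 2, where ?'a = real]
    by (simp add: add_ac)
  have "(\<Sum>k\<in>{-int m..int m}. ?f k) \<le> 2 * (\<Sum>n. ?f (int n))" for m
  proof -
    have *: "{-int m..int m} \<subseteq> int ` {..m} \<union> (\<lambda>n. - int n) ` {..m}"
    proof
      fix k assume "k \<in> {-int m..int m}"
      then show "k \<in> int ` {..m} \<union> (\<lambda>n. - int n) ` {..m}"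
        by (cases k rule: int_cases2) auto
    qed
    have "(\<Sum>k\<in>{-int m..int m}. ?f k) \<le> sum ?f (int ` {..m} \<union> (\<lambda>n. - int n) ` {..m})"
      using * by (intro sum_mono2) auto
    also have "\<dots> \<le> sum ?f (int ` {..m}) + sum ?f ((\<lambda>n. - int n) ` {..m})"
      by (subst sum_Un) (auto intro!: sum_nonneg)
    also have "\<dots> = 2 * (\<Sum>n\<le>m. ?f (int n))"
      by (subst (1 2) sum.reindex) (auto simp: inj_on_def)
    also have "(\<Sum>n\<le>m. ?f (int n)) \<le> (\<Sum>n. ?f (int n))" by (rule sum_le_suminf[OF sm]) auto
    finally show ?thesis by simp
  qed
  then show ?thesis by blast
qed

context subadd_weight
begin

text \<open>By \<open>power_le_exp_w\<close> with exponent \<open>2 * CARD('n)\<close>, each term is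
  dominated by a product over the coordinates of the one-dimensional summable factors
  \<open>inverse ((1 + \<bar>real_of_int k\<bar>)\<^sup>2)\<close>.\<close>

lemma summable_lattice:
  assumes d: "d > 0"
  shows "summable (\<lambda>n. exp (- d * \<omega> (norm (lat (lat_enum n :: 'n::finite \<Rightarrow> int)))))"
proof -
  let ?g = "\<lambda>\<xi>::'n \<Rightarrow> int. exp (- d * \<omega> (norm (lat \<xi>)))"
  let ?f = "\<lambda>k::int. inverse ((1 + \<bar>real_of_int k\<bar>)\<^sup>2)"
  obtain C where C: "C > 0" "\<And>t. t \<ge> 0 \<Longrightarrow> (1 + t) ^ (2 * CARD('n)) \<le> C * exp (d * \<omega> t)"
    using power_le_exp_w[OF d] by blast
  obtain B where B: "\<And>m::nat. (\<Sum>k\<in>{-int m..int m}. ?f k) \<le> B" using sum_inverse_square_int by blast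
  have pt: "?g \<xi> \<le> C * (\<Prod>j\<in>UNIV. ?f (\<xi> j))" for \<xi>
  proof -
    let ?y = "norm (lat \<xi>)"
    have "(\<Prod>j\<in>UNIV. (1 + \<bar>real_of_int (\<xi> j)\<bar>)\<^sup>2) \<le> (\<Prod>j\<in>(UNIV::'n set). (1 + ?y)\<^sup>2)"
      by (intro prod_mono conjI power_mono) (auto simp: lat_le_norm)
    also have "\<dots> = (1 + ?y) ^ (2 * CARD('n))" by (simp add: power_mult)
    also have "\<dots> \<le> C * exp (d * \<omega> ?y)" by (rule C) simp
    finally have "(\<Prod>j\<in>UNIV. (1 + \<bar>real_of_int (\<xi> j)\<bar>)\<^sup>2) \<le> C * exp (d * \<omega> ?y)" .
    moreover have "0 < (\<Prod>j\<in>UNIV. (1 + \<bar>real_of_int (\<xi> j)\<bar>)\<^sup>2)" by (intro prod_pos) (auto simp: add_pos_nonneg)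
    ultimately show ?thesis using C(1) prod_inversef[of "\<lambda>j. (1 + \<bar>real_of_int (\<xi> j)\<bar>)\<^sup>2" UNIV]
      by (simp add: o_def exp_minus field_simps)
  qed
  have fin: "sum ?g F \<le> C * B ^ CARD('n)" if "finite F" for F
  proof -
    \<comment> \<open>Any cube containing F will do, since the final bound does not depend on
      m.\<close>
    define m where "m = (\<Sum>\<xi>\<in>F. \<Sum>j\<in>UNIV. nat \<bar>\<xi> j\<bar>)"
    have sub: "F \<subseteq> PiE UNIV (\<lambda>_. {-int m..int m})"
    proof
      fix \<xi> assume "\<xi> \<in> F"
      have "\<bar>\<xi> j\<bar> \<le> int m" for j
      proof -
        have "nat \<bar>\<xi> j\<bar> \<le> (\<Sum>j\<in>UNIV. nat \<bar>\<xi> j\<bar>)" by (rule member_le_sum) auto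
        also have "\<dots> \<le> m" unfolding m_def using \<open>\<xi> \<in> F\<close> that 
          by (intro member_le_sum[where f = "\<lambda>\<xi>. \<Sum>j\<in>UNIV. nat \<bar>\<xi> j\<bar>"]) auto
        finally show ?thesis by simp
      qed
      then show "\<xi> \<in> PiE UNIV (\<lambda>_. {-int m..int m})" by (auto simp: abs_le_iff) (smt (verit))
    qed
    have "sum ?g F \<le> (\<Sum>\<xi>\<in>F. C * (\<Prod>j\<in>UNIV. ?f (\<xi> j)))" by (intro sum_mono pt)
    also have "\<dots> \<le> (\<Sum>\<xi>\<in>PiE UNIV (\<lambda>_::'n. {-int m..int m}). C * (\<Prod>j\<in>UNIV. ?f (\<xi> j)))"
      using sub C(1) by (intro sum_mono2) (auto intro!: finite_PiE mult_nonneg_nonneg prod_nonneg)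
    also have "\<dots> = C * (\<Prod>j\<in>(UNIV::'n set). (\<Sum>k\<in>{-int m..int m}. ?f k))"
      by (subst prod_sum_PiE) (auto simp: sum_distrib_left)
    also have "\<dots> = C * (\<Sum>k\<in>{-int m..int m}. ?f k) ^ CARD('n)" by simp
    also have "\<dots> \<le> C * B ^ CARD('n)" using B[of m] C(1)
      by (intro mult_left_mono power_mono) (auto intro!: sum_nonneg)
    finally show ?thesis .
  qed
  have inj: "inj (lat_enum :: nat \<Rightarrow> ('n \<Rightarrow> int))" using bij_lat_enum bij_is_inj by blast
  show ?thesis
  proof (rule summableI_nonneg_bounded)
    fix n
    have "(\<Sum>i<n. ?g (lat_enum i)) = sum ?g (lat_enum ` {..<n})"
      by (subst sum.reindex) (auto intro: inj_on_subset[OF inj])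
    also have "\<dots> \<le> C * B ^ CARD('n)" by (rule fin) auto
    finally show "(\<Sum>i<n. ?g (lat_enum i)) \<le> C * B ^ CARD('n)" .
  qed auto
qed

end

section \<open>Fourier uniqueness on the torus\<close>

definition torus_top :: "'a::euclidean_space" where
  "torus_top = (\<Sum>i\<in>Basis. (2*pi) *\<^sub>R i)"

lemma torus_box_eq: "torus_box = cbox 0 torus_top"
  by (simp add: torus_box_def torus_top_def)

lemma torus_top_inner [simp]: "b \<in> Basis \<Longrightarrow> torus_top \<bullet> b = 2 * pi"
  by (simp add: torus_top_def inner_sum_left inner_Basis if_distrib cong: if_cong)

lemma mem_torus_box: "x \<in> torus_box \<longleftrightarrow> (\<forall>b\<in>Basis. 0 \<le> x \<bullet> b \<and> x \<bullet> b \<le> 2 * pi)"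
  by (simp add: torus_box_eq mem_box)

lemma content_torus_box: "measure lborel (torus_box :: 'a::euclidean_space set) = (2 * pi) ^ DIM('a)"
  unfolding torus_box_eq by (subst content_cbox) auto

section \<open>Integration of periodic functions over the period box\<close>

lemma integrable_torus:
  fixes f :: "'a::euclidean_space \<Rightarrow> 'b::banach"
  shows "continuous_on UNIV f \<Longrightarrow> f integrable_on torus_box"
  unfolding torus_box_eq by (meson continuous_on_subset integrable_continuous subset_UNIV)

lemma periodic_fn_int:
  assumes "periodic_fn f" "b \<in> Basis"
  shows "f (x + (2 * pi * of_int n) *\<^sub>R b) = f x"
proof -
  have nat: "f (y + (2 * pi * of_nat m) *\<^sub>R b) = f y" for y m
  proof (induction m)
    case (Suc m)
    have "f (y + (2 * pi * of_nat (Suc m)) *\<^sub>R b) = f ((y + (2 * pi * of_nat m) *\<^sub>R b) + (2 * pi) *\<^sub>R b)"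
      by (simp add: algebra_simps)
    also have "\<dots> = f (y + (2 * pi * of_nat m) *\<^sub>R b)" using assms unfolding periodic_fn_def by blast
    finally show ?case using Suc by simp
  qed simp
  show ?thesis
  proof (cases n rule: int_cases2)
    case (nonneg m)
    then show ?thesis using nat[of x m] by simp
  next
    case (nonpos m)
    then show ?thesis using nat[of "x + (2 * pi * of_int n) *\<^sub>R b" m] by simp
  qed
qed

text \<open>The representative y depends on x only, so one choice serves all periodic functions at
  once.\<close>

lemma periodic_fn_reduce:
  fixes x :: "'a::euclidean_space"
  obtains y where "y \<in> torus_box" "\<And>f. periodic_fn f \<Longrightarrow> f x = f y"
proof -
  define n where "n = (\<lambda>b. \<lfloor>x \<bullet> b / (2 * pi)\<rfloor>)"
  define g where "g = (\<lambda>B. x + (\<Sum>b\<in>B. (2 * pi * of_int (- n b)) *\<^sub>R b))"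
  have "f (g B) = f x" if "B \<subseteq> Basis" "periodic_fn f" for B f
  proof -
    have "finite B" using finite_subset[OF that(1) finite_Basis] .
    then show ?thesis using that(1)
    proof (induction B rule: finite_induct)
      case (insert b B)
      have "g (insert b B) = g B + (2 * pi * of_int (- n b)) *\<^sub>R b" using insert by (simp add: g_def algebra_simps)
      then show ?case using insert periodic_fn_int[OF that(2), of b "g B" "- n b"] by simp
    qed (simp add: g_def)
  qed
  moreover have "g Basis \<in> torus_box"
    unfolding mem_torus_box
  proof
    fix b :: 'a assume b: "b \<in> Basis"
    have "g Basis \<bullet> b = x \<bullet> b - 2 * pi * of_int (n b)"
      unfolding g_def inner_add_left inner_sum_left_Basis[OF b] by simp
    moreover have "of_int (n b) \<le> x \<bullet> b / (2 * pi)" "x \<bullet> b / (2 * pi) \<le> of_int (n b) + 1"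
      unfolding n_def by linarith+
    ultimately show "0 \<le> g Basis \<bullet> b \<and> g Basis \<bullet> b \<le> 2 * pi" by (simp add: field_simps)
  qed
  ultimately show ?thesis using that[of "g Basis"] by (metis order_refl)
qed

lemma mem_cbox_remove:
  fixes b :: "'a::euclidean_space"
  assumes "b \<in> Basis"
  shows "x \<in> cbox p q \<longleftrightarrow> (p \<bullet> b \<le> x \<bullet> b \<and> x \<bullet> b \<le> q \<bullet> b) \<and> (\<forall>i\<in>Basis - {b}. p \<bullet> i \<le> x \<bullet> i \<and> x \<bullet> i \<le> q \<bullet> i)"
  using assms by (auto simp: mem_box)

text \<open>The shifted box is cut at \<open>x \<bullet> b = 2 * pi\<close>; the overhanging slab
  moves back by one period and fills the gap left at the bottom.\<close>

lemma integral_periodic_shift: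
  fixes f :: "'a::euclidean_space \<Rightarrow> complex"
  assumes cont: "continuous_on UNIV f" and per: "periodic_fn f" and b: "b \<in> Basis" and s: "0 \<le> s" "s \<le> 2 * pi"
  shows "integral torus_box (\<lambda>x. f (x + s *\<^sub>R b)) = integral torus_box f"
proof -
  let ?T = "torus_top :: 'a"
  have int: "f integrable_on cbox u v" for u v
    using cont by (meson continuous_on_subset integrable_continuous subset_UNIV)
  define u where "u = (\<Sum>i\<in>Basis. (if i = b then s else 2 * pi) *\<^sub>R i :: 'a)"
  have u: "i \<in> Basis \<Longrightarrow> u \<bullet> i = (if i = b then s else 2 * pi)" for i
    by (simp only: u_def inner_sum_left_Basis)
  have [simp]: "b \<bullet> b = 1" "u \<bullet> b = s" "?T \<bullet> b = 2 * pi" using b u by auto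
  have [simp]: "b \<bullet> i = 0" "u \<bullet> i = 2 * pi" "?T \<bullet> i = 2 * pi" if "i \<in> Basis - {b}" for i
    using that b u by (auto simp: inner_Basis)
  have "integral torus_box (\<lambda>x. f (x + s *\<^sub>R b)) = integral (cbox (s *\<^sub>R b) (?T + s *\<^sub>R b)) f"
    using integral_shift_cbox[of "s *\<^sub>R b" "s *\<^sub>R b" "?T + s *\<^sub>R b" f] by (simp add: torus_box_eq)
  also have "\<dots> = integral (cbox (s *\<^sub>R b) (?T + s *\<^sub>R b) \<inter> {x. x \<bullet> b \<le> 2 * pi}) f
      + integral (cbox (s *\<^sub>R b) (?T + s *\<^sub>R b) \<inter> {x. x \<bullet> b \<ge> 2 * pi}) f"
    by (rule integral_split[OF int b])
  also have "cbox (s *\<^sub>R b) (?T + s *\<^sub>R b) \<inter> {x. x \<bullet> b \<le> 2 * pi} = cbox 0 ?T \<inter> {x. x \<bullet> b \<ge> s}"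
    using s by (auto simp: mem_cbox_remove[OF b] inner_add_left)
  also have "cbox (s *\<^sub>R b) (?T + s *\<^sub>R b) \<inter> {x. x \<bullet> b \<ge> 2 * pi} = cbox ((2 * pi) *\<^sub>R b) (u + (2 * pi) *\<^sub>R b)"
    using s by (auto simp: mem_cbox_remove[OF b] inner_add_left)
  also have "integral \<dots> f = integral (cbox 0 u) (\<lambda>x. f (x + (2 * pi) *\<^sub>R b))"
    using integral_shift_cbox[of "(2 * pi) *\<^sub>R b" "(2 * pi) *\<^sub>R b" "u + (2 * pi) *\<^sub>R b" f] by simp
  also have "\<dots> = integral (cbox 0 u) f" using per b unfolding periodic_fn_def by simp
  also have "cbox 0 u = cbox 0 ?T \<inter> {x. x \<bullet> b \<le> s}"
    using s by (auto simp: mem_cbox_remove[OF b])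
  also have "integral (cbox 0 ?T \<inter> {x. x \<bullet> b \<ge> s}) f + integral (cbox 0 ?T \<inter> {x. x \<bullet> b \<le> s}) f = integral (cbox 0 ?T) f"
    using integral_split[OF int b, of 0 ?T s] by simp
  finally show ?thesis by (simp add: torus_box_eq)
qed

text \<open>\<open>smooth_fn\<close> speaks of derivatives along lines at parameter 0 only; moving
  the base point along the line gives all other parameters.\<close>

lemma has_vector_derivative_shift:
  fixes x b :: "'a::real_vector"
  shows
  "((\<lambda>s. f (x + s *\<^sub>R b)) has_vector_derivative D) (at t)
   \<longleftrightarrow> ((\<lambda>s. f ((x + t *\<^sub>R b) + s *\<^sub>R b)) has_vector_derivative D) (at 0)"
proof
  assume "((\<lambda>s. f (x + s *\<^sub>R b)) has_vector_derivative D) (at t)"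
  moreover have "((\<lambda>s. t + s) has_vector_derivative 1) (at 0)" by (auto intro!: derivative_eq_intros)
  ultimately show "((\<lambda>s. f ((x + t *\<^sub>R b) + s *\<^sub>R b)) has_vector_derivative D) (at 0)"
    using vector_diff_chain_at[of "\<lambda>s. t + s" 1 0 "\<lambda>s. f (x + s *\<^sub>R b)" D] by (simp add: o_def scaleR_left_distrib add.assoc)
next
  assume "((\<lambda>s. f ((x + t *\<^sub>R b) + s *\<^sub>R b)) has_vector_derivative D) (at 0)"
  moreover have "((\<lambda>s. s - t) has_vector_derivative 1) (at t)" by (auto intro!: derivative_eq_intros)
  ultimately show "((\<lambda>s. f (x + s *\<^sub>R b)) has_vector_derivative D) (at t)"
    using vector_diff_chain_at[of "\<lambda>s. s - t" 1 t "\<lambda>s. f ((x + t *\<^sub>R b) + s *\<^sub>R b)" D] by (simp add: o_def algebra_simps)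
qed

text \<open>Takes the place of integration by parts. The integral of the translate
  \<open>f (x + s *\<^sub>R b)\<close> is constant in s, and differentiation under the integral at s
  = 0 yields the integral of \<open>f'\<close>. A one-sided derivative is enough, since the
  translates are controlled for s between 0 and 2 pi.\<close>

lemma integral_deriv_periodic:
  fixes f :: "'a::euclidean_space \<Rightarrow> complex"
  assumes cont: "continuous_on UNIV f" and per: "periodic_fn f" and b: "b \<in> Basis"
    and der: "\<And>x. ((\<lambda>s::real. f (x + s *\<^sub>R b)) has_vector_derivative f' x) (at 0)"
    and cont': "continuous_on UNIV f'"
  shows "integral torus_box f' = 0"
proof -
  define h where "h = (\<lambda>s. integral torus_box (\<lambda>x. f (x + s *\<^sub>R b)))"
  have "((\<lambda>s. integral (cbox 0 torus_top) (\<lambda>x. f (x + s *\<^sub>R b))) has_vector_derivative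
          integral (cbox 0 torus_top) (\<lambda>x. f' (x + 0 *\<^sub>R b))) (at 0 within {0..2*pi})"
  proof (rule leibniz_rule_vector_derivative[where f = "\<lambda>s x. f (x + s *\<^sub>R b)" and fx = "\<lambda>s x. f' (x + s *\<^sub>R b)"])
    fix s :: real and x :: 'a
    have "((\<lambda>s. f (x + s *\<^sub>R b)) has_vector_derivative f' (x + s *\<^sub>R b)) (at s)"
      by (subst has_vector_derivative_shift) (rule der)
    then show "((\<lambda>s. f (x + s *\<^sub>R b)) has_vector_derivative f' (x + s *\<^sub>R b)) (at s within {0..2 * pi})"
      by (rule has_vector_derivative_at_within)
  next
    fix s :: real
    show "(\<lambda>x. f (x + s *\<^sub>R b)) integrable_on cbox 0 torus_top"
      by (intro integrable_continuous continuous_on_compose2[OF cont] continuous_intros) auto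
  next
    show "continuous_on ({0..2 * pi} \<times> cbox 0 torus_top) (\<lambda>(s, x). f' (x + s *\<^sub>R b))"
      unfolding split_def by (intro continuous_on_compose2[OF cont'] continuous_intros) auto
  qed auto
  then have "(h has_vector_derivative integral torus_box f') (at 0 within {0..2*pi})"
    by (simp add: h_def torus_box_eq)
  moreover have "(h has_vector_derivative 0) (at 0 within {0..2*pi})"
  proof (rule has_vector_derivative_transform[where f = "\<lambda>_. integral torus_box f"])
    show "h x = integral torus_box f" if "x \<in> {0..2 * pi}" for x
      unfolding h_def using that by (intro integral_periodic_shift[OF cont per b]) auto
  qed auto
  ultimately show ?thesis
    using vector_derivative_unique_within_closed_interval[of 0 "2 * pi" 0 h] by (metis atLeastAtMost_iff cbox_interval order_refl pi_gt_zero zero_less_mult_iff zero_less_numeral less_imp_le)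
qed

lemma cos_le_cos_of_far:
  assumes "0 \<le> \<eta>" "\<eta> \<le> pi" "\<eta> \<le> \<bar>t\<bar>" "\<bar>t\<bar> \<le> 2 * pi - \<eta>"
  shows "cos t \<le> cos \<eta>"
proof -
  have "cos \<bar>t\<bar> \<le> cos \<eta>"
  proof (cases "\<bar>t\<bar> \<le> pi")
    case True
    then show ?thesis using assms by (intro cos_monotone_0_pi_le) auto
  next
    case False
    have "cos (2 * pi - \<bar>t\<bar>) \<le> cos \<eta>" using assms False by (intro cos_monotone_0_pi_le) auto
    then show ?thesis by simp
  qed
  then show ?thesis by simp
qed

text \<open>The set A collects the multipliers p for which \<open>r * p\<close> is still orthogonal
  to every exponential. It is closed under multiplication by the factors of the kernel, because a
  cosine only shifts the frequency by b and \<open>- b\<close>; hence it contains all powers of the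
  kernel.\<close>

lemma fourier_kernel_has_integral:
  fixes r :: "'a::euclidean_space \<Rightarrow> complex"
  assumes coeff: "\<And>k. (\<forall>b\<in>Basis. k \<bullet> b \<in> \<int>) \<Longrightarrow> ((\<lambda>x. r x * cis (k \<bullet> x)) has_integral 0) S"
  shows "((\<lambda>x. r x * complex_of_real ((\<Prod>b\<in>Basis. (1 + cos ((x - y) \<bullet> b)) / 2) ^ m)) has_integral 0) S"
proof -
  define A where "A = {p. \<forall>k. (\<forall>b\<in>Basis. k \<bullet> b \<in> \<int>) \<longrightarrow> ((\<lambda>x. r x * p x * cis (k \<bullet> x)) has_integral 0) S}"
  have one: "(\<lambda>x. 1) \<in> A" using coeff by (simp add: A_def)
  have step: "(\<lambda>x. p x * complex_of_real ((1 + cos ((x - y) \<bullet> b)) / 2)) \<in> A" if p: "p \<in> A" and b: "b \<in> Basis" for p b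
  proof -
    have "((\<lambda>x. r x * (p x * complex_of_real ((1 + cos ((x - y) \<bullet> b)) / 2)) * cis (k \<bullet> x)) has_integral 0) S"
      if k: "\<forall>b\<in>Basis. k \<bullet> b \<in> \<int>" for k
    proof -
      have kb: "\<forall>c\<in>Basis. (k + b) \<bullet> c \<in> \<int>" "\<forall>c\<in>Basis. (k - b) \<bullet> c \<in> \<int>"
        using k b by (auto simp: inner_add_left inner_diff_left inner_Basis)
      have 1: "((\<lambda>x. r x * p x * cis (k \<bullet> x)) has_integral 0) S"
        "((\<lambda>x. r x * p x * cis ((k + b) \<bullet> x)) has_integral 0) S"
        "((\<lambda>x. r x * p x * cis ((k - b) \<bullet> x)) has_integral 0) S"
        using p k kb unfolding A_def by blast+
      have "((\<lambda>x. (1/2) * (r x * p x * cis (k \<bullet> x)) + ((1/4 * cis (- (y \<bullet> b))) * (r x * p x * cis ((k + b) \<bullet> x))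
          + (1/4 * cis (y \<bullet> b)) * (r x * p x * cis ((k - b) \<bullet> x)))) has_integral
          ((1/2) * 0 + ((1/4 * cis (- (y \<bullet> b))) * 0 + (1/4 * cis (y \<bullet> b)) * 0))) S"
        using 1 by (intro has_integral_add has_integral_mult_right)
      moreover have "(1/2) * (r x * p x * cis (k \<bullet> x)) + ((1/4 * cis (- (y \<bullet> b))) * (r x * p x * cis ((k + b) \<bullet> x))
          + (1/4 * cis (y \<bullet> b)) * (r x * p x * cis ((k - b) \<bullet> x)))
          = r x * (p x * complex_of_real ((1 + cos ((x - y) \<bullet> b)) / 2)) * cis (k \<bullet> x)" for x
      proof -
        have c: "complex_of_real (cos ((x - y) \<bullet> b)) = (cis (x \<bullet> b) * cis (- (y \<bullet> b)) + cis (- (x \<bullet> b)) * cis (y \<bullet> b)) / 2"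
          by (simp add: cis_mult complex_eq_iff inner_diff_left cos_diff sin_diff)
        have "cis ((k + b) \<bullet> x) = cis (k \<bullet> x) * cis (x \<bullet> b)" "cis ((k - b) \<bullet> x) = cis (k \<bullet> x) * cis (- (x \<bullet> b))"
          by (simp_all add: cis_mult inner_add_left inner_diff_left inner_commute[of b])
        then show ?thesis unfolding of_real_divide of_real_add c by (simp add: algebra_simps)
      qed
      ultimately show ?thesis by (simp only: mult_zero_right add_0)
    qed
    then show ?thesis by (auto simp: A_def)
  qed
  have prod: "(\<lambda>x. p x * complex_of_real (\<Prod>b\<in>B. (1 + cos ((x - y) \<bullet> b)) / 2)) \<in> A"
    if "finite B" "B \<subseteq> Basis" "p \<in> A" for p B
    using that(1,2)
  proof (induction B rule: finite_induct)
    case empty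
    then show ?case using that by simp
  next
    case (insert b B)
    have "b \<in> Basis" "B \<subseteq> Basis" using insert by auto
    then show ?case using step[of "\<lambda>x. p x * complex_of_real (\<Prod>b\<in>B. (1 + cos ((x - y) \<bullet> b)) / 2)" b] insert by (simp add: mult_ac)
  qed
  have "(\<lambda>x. complex_of_real ((\<Prod>b\<in>Basis. (1 + cos ((x - y) \<bullet> b)) / 2) ^ m)) \<in> A"
  proof (induction m)
    case 0
    then show ?case using one by simp
  next
    case (Suc m)
    from prod[OF finite_Basis order_refl Suc] show ?case by (simp add: mult_ac)
  qed
  then have "((\<lambda>x. r x * complex_of_real ((\<Prod>b\<in>Basis. (1 + cos ((x - y) \<bullet> b)) / 2) ^ m) * cis (0 \<bullet> x)) has_integral 0) S"
    unfolding A_def mem_Collect_eq by (drule_tac spec[of _ 0]) simp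
  then show ?thesis by simp
qed

text \<open>A peaking argument: the powers \<open>K ^ m\<close> concentrate at y, where
  \<open>R\<close>, the real part of \<open>r x * cnj (r y)\<close>, is positive. Outside the cube
  of radius \<eta> they are at most \<open>q1 ^ m\<close>, in a smaller cube at least
  \<open>q2 ^ m\<close> with \<open>q1 < q2\<close>, and in between the integrand is nonnegative. As
  the integral vanishes for every m, division by \<open>q2 ^ m\<close> gives a contradiction in the
  limit.\<close>

lemma fourier_unique_interior:
  fixes r :: "'a::euclidean_space \<Rightarrow> complex"
  assumes cont: "continuous_on UNIV r"
    and coeff: "\<And>k. (\<forall>b\<in>Basis. k \<bullet> b \<in> \<int>) \<Longrightarrow> ((\<lambda>x. r x * cis (k \<bullet> x)) has_integral 0) torus_box"
    and y: "\<And>b. b \<in> Basis \<Longrightarrow> 0 < y \<bullet> b \<and> y \<bullet> b < 2 * pi"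
  shows "r y = 0"
proof (rule ccontr)
  assume ry: "r y \<noteq> 0"
  define R where "R = (\<lambda>x. Re (r x * cnj (r y)))"
  define K where "K = (\<lambda>x. \<Prod>b\<in>Basis. (1 + cos ((x - y) \<bullet> b)) / 2)"
  have contR: "continuous_on UNIV R" unfolding R_def by (intro continuous_intros cont)
  have Ry: "R y > 0" using ry by (simp add: R_def sum_power2_gt_zero_iff complex_eq_iff power2_eq_square[symmetric])
  have K01: "0 \<le> (1 + cos t) / 2" "(1 + cos t) / 2 \<le> 1" for t :: real by auto (smt (verit) cos_ge_minus_one)
  have K0: "0 \<le> K x" for x unfolding K_def by (intro prod_nonneg) (use K01 in auto)
  have intRK: "((\<lambda>x. R x * K x ^ m) has_integral 0) torus_box" for m
  proof -
    have "((\<lambda>x. Re ((r x * complex_of_real (K x ^ m)) * cnj (r y))) has_integral Re (0 * cnj (r y))) torus_box"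
      using has_integral_linear[OF has_integral_mult_left[OF fourier_kernel_has_integral[OF coeff, of y m]] bounded_linear_Re, of "cnj (r y)"]
      by (simp add: K_def o_def)
    moreover have "Re ((r x * complex_of_real (K x ^ m)) * cnj (r y)) = R x * K x ^ m" for x
    proof -
      have "(r x * complex_of_real (K x ^ m)) * cnj (r y) = (r x * cnj (r y)) * complex_of_real (K x ^ m)" by (simp add: mult_ac)
      then show ?thesis by (simp add: R_def algebra_simps flip: of_real_power)
    qed
    ultimately show ?thesis by simp
  qed
  obtain B where B: "B > 0" "\<And>x. x \<in> torus_box \<Longrightarrow> \<bar>R x\<bar> \<le> B"
  proof -
    have "compact (R ` torus_box)" unfolding torus_box_eq
      by (intro compact_continuous_image continuous_on_subset[OF contR] compact_cbox) auto
    from bounded_pos[THEN iffD1, OF compact_imp_bounded[OF this]] show ?thesis using that by auto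
  qed
  obtain d where d: "d > 0" "\<And>x. dist x y < d \<Longrightarrow> R x > R y / 2"
  proof -
    have "isCont R y" using contR by (simp add: continuous_on_eq_continuous_at)
    from this[unfolded continuous_at_eps_delta, rule_format, of "R y / 2"] Ry obtain d where
      "d > 0" "\<And>x. dist x y < d \<Longrightarrow> dist (R x) (R y) < R y / 2" by auto
    then show ?thesis using that[of d] unfolding dist_real_def by (smt (verit) field_sum_of_halves)
  qed
  \<comment> \<open>\<eta> keeps the cube inside the period box and, by the l1 bound on the norm,
    inside the ball of radius d on which \<open>R\<close> exceeds half of
    \<open>R y\<close>.\<close>
  define \<eta> where "\<eta> = Min (insert (d / (2 * real DIM('a))) ((\<lambda>b. min (y \<bullet> b) (2 * pi - y \<bullet> b)) ` (Basis :: 'a set)))"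
  have \<eta>: "\<eta> > 0" "\<eta> \<le> d / (2 * real DIM('a))" "\<And>b. b \<in> Basis \<Longrightarrow> \<eta> \<le> y \<bullet> b" "\<And>b. b \<in> Basis \<Longrightarrow> \<eta> \<le> 2 * pi - y \<bullet> b"
  proof -
    show "\<eta> > 0" unfolding \<eta>_def using d(1) y by (subst Min_gr_iff) auto
    show "\<eta> \<le> d / (2 * real DIM('a))" unfolding \<eta>_def by (rule Min_le) auto
    have "\<eta> \<le> min (y \<bullet> b) (2 * pi - y \<bullet> b)" if "b \<in> Basis" for b unfolding \<eta>_def using that by (intro Min_le) auto
    then show "\<And>b. b \<in> Basis \<Longrightarrow> \<eta> \<le> y \<bullet> b" "\<And>b. b \<in> Basis \<Longrightarrow> \<eta> \<le> 2 * pi - y \<bullet> b" by auto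
  qed
  obtain b0 :: 'a where b0: "b0 \<in> Basis" using nonempty_Basis by blast
  have \<eta>pi: "\<eta> \<le> pi" using \<eta>(3,4)[OF b0] by linarith
  define cube where "cube = (\<lambda>e. {x. \<forall>b\<in>Basis. \<bar>(x - y) \<bullet> b\<bar> \<le> e})"
  have cube_R: "R x > R y / 2" if "x \<in> cube \<eta>" for x
  proof -
    have "norm (x - y) \<le> (\<Sum>b\<in>Basis. \<bar>(x - y) \<bullet> b\<bar>)" by (rule norm_le_l1)
    also have "\<dots> \<le> (\<Sum>b\<in>(Basis::'a set). \<eta>)" using that by (intro sum_mono) (auto simp: cube_def)
    also have "\<dots> = real DIM('a) * \<eta>" by simp
    also have "\<dots> \<le> real DIM('a) * (d / (2 * real DIM('a)))" using \<eta> by (intro mult_left_mono) auto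
    also have "\<dots> < d" using d(1) by simp
    finally show ?thesis by (intro d) (simp add: dist_norm)
  qed
  define q1 where "q1 = (1 + cos \<eta>) / 2"
  have q1: "q1 < 1" "0 \<le> q1"
  proof -
    have "cos \<eta> < cos 0" using \<eta>(1) \<eta>pi by (intro cos_monotone_0_pi) auto
    then show "q1 < 1" by (simp add: q1_def)
    show "0 \<le> q1" using K01 by (simp add: q1_def)
  qed
  have outer: "K x \<le> q1" if x: "x \<in> torus_box" "x \<notin> cube \<eta>" for x
  proof -
    obtain b where b: "b \<in> Basis" "\<bar>(x - y) \<bullet> b\<bar> > \<eta>" using x by (auto simp: cube_def not_le)
    \<comment> \<open>The difference must also stay away from 2 pi, where the cosine returns to 1;
      this holds because y has distance at least \<eta> from the faces of the box.\<close>
    have "\<bar>(x - y) \<bullet> b\<bar> \<le> 2 * pi - \<eta>"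
      using x(1)[unfolded mem_torus_box] b(1) \<eta>(3,4)[of b] by (auto simp: inner_diff_left abs_le_iff; smt (verit))
    then have "(1 + cos ((x - y) \<bullet> b)) / 2 \<le> q1" using cos_le_cos_of_far[of \<eta> "(x - y) \<bullet> b"] b \<eta>(1) \<eta>pi by (simp add: q1_def)
    moreover have "(\<Prod>c\<in>Basis - {b}. (1 + cos ((x - y) \<bullet> c)) / 2) \<le> 1" by (intro prod_le_1) (use K01 in auto)
    moreover have "K x = (1 + cos ((x - y) \<bullet> b)) / 2 * (\<Prod>c\<in>Basis - {b}. (1 + cos ((x - y) \<bullet> c)) / 2)"
      unfolding K_def using b(1) by (subst prod.remove[of _ b]) auto
    ultimately have "K x \<le> q1 * 1" using q1 K01 by (simp only:) (intro mult_mono prod_nonneg, auto)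
    then show ?thesis by simp
  qed
  obtain e where e: "0 < e" "e \<le> \<eta>" "q1 < ((1 + cos e) / 2) ^ DIM('a)"
  proof -
    have "isCont (\<lambda>t. ((1 + cos t) / 2) ^ DIM('a)) (0::real)" by (intro continuous_intros) auto
    then have "((\<lambda>t. ((1 + cos t) / 2) ^ DIM('a)) \<longlongrightarrow> 1) (at (0::real))" by (simp add: isCont_def)
    from order_tendstoD(1)[OF this q1(1)] obtain d where d: "d > 0" "\<And>t. t \<noteq> 0 \<Longrightarrow> dist t 0 < d \<Longrightarrow> q1 < ((1 + cos t) / 2) ^ DIM('a)"
      unfolding eventually_at by auto
    show ?thesis by (rule that[of "min \<eta> (d / 2)"]) (use d(1) \<eta>(1) in \<open>auto intro!: d(2)\<close>)
  qed
  define q2 where "q2 = ((1 + cos e) / 2) ^ DIM('a)"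
  have q2: "q1 < q2" "0 < q2" using e q1 by (auto simp: q2_def)
  have inner: "q2 \<le> K x" if "x \<in> cube e" for x
  proof -
    have "(\<Prod>b\<in>(Basis::'a set). (1 + cos e) / 2) \<le> K x" unfolding K_def
    proof (rule prod_mono)
      fix b :: 'a assume "b \<in> Basis"
      then have "\<bar>(x - y) \<bullet> b\<bar> \<le> e" using that by (auto simp: cube_def)
      then have "cos e \<le> cos \<bar>(x - y) \<bullet> b\<bar>" using e \<eta>pi by (intro cos_monotone_0_pi_le) auto
      then show "0 \<le> (1 + cos e) / 2 \<and> (1 + cos e) / 2 \<le> (1 + cos ((x - y) \<bullet> b)) / 2" using K01 by simp
    qed
    then show ?thesis by (simp add: q2_def)
  qed
  define u where "u = y - e *\<^sub>R One" define v where "v = y + e *\<^sub>R One"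
  have cube_box: "cube e = cbox u v"
    by (auto simp: cube_def mem_box u_def v_def inner_diff_left inner_add_left abs_le_iff; smt (verit))
  have sub: "cbox u v \<subseteq> torus_box"
  proof
    fix x assume "x \<in> cbox u v"
    then have *: "y \<bullet> b - e \<le> x \<bullet> b \<and> x \<bullet> b \<le> y \<bullet> b + e" if "b \<in> Basis" for b
      using that by (auto simp: mem_box u_def v_def inner_diff_left inner_add_left)
    show "x \<in> torus_box" unfolding mem_torus_box
    proof
      fix b :: 'a assume "b \<in> Basis"
      from *[OF this] \<eta>(3,4)[OF this] e show "0 \<le> x \<bullet> b \<and> x \<bullet> b \<le> 2 * pi" by linarith
    qed
  qed
  define V where "V = measure lborel (cbox u v)"
  have V: "V > 0" unfolding V_def using e by (subst content_pos_lt_eq) (auto simp: u_def v_def inner_diff_left inner_add_left)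
  define W where "W = measure lborel (torus_box :: 'a set)"
  have main: "R y / 2 * q2 ^ m * V - B * q1 ^ m * W \<le> 0" for m
  proof -
    have "((\<lambda>x. if x \<in> cbox u v then R y / 2 * q2 ^ m else 0) has_integral V * (R y / 2 * q2 ^ m)) torus_box"
      using has_integral_restrict[OF sub, of "\<lambda>_. R y / 2 * q2 ^ m"] has_integral_const_real has_integral_const[of "R y / 2 * q2 ^ m" u v]
      by (simp add: V_def)
    moreover have "((\<lambda>x. B * q1 ^ m) has_integral W * (B * q1 ^ m)) (torus_box :: 'a set)"
      using has_integral_const[of "B * q1 ^ m" 0 torus_top] unfolding W_def torus_box_eq by (simp only: real_scaleR_def)
    ultimately have "((\<lambda>x. (if x \<in> cbox u v then R y / 2 * q2 ^ m else 0) - B * q1 ^ m) has_integral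
      V * (R y / 2 * q2 ^ m) - W * (B * q1 ^ m)) torus_box" by (rule has_integral_diff)
    then have "V * (R y / 2 * q2 ^ m) - W * (B * q1 ^ m) \<le> 0"
    proof (rule has_integral_le[OF _ intRK[of m]])
      fix x :: 'a assume x: "x \<in> torus_box"
      have Bq: "0 \<le> B * q1 ^ m" using B q1 by simp
      show "(if x \<in> cbox u v then R y / 2 * q2 ^ m else 0) - B * q1 ^ m \<le> R x * K x ^ m"
      proof (cases "x \<in> cbox u v")
        case True
        then have "x \<in> cube e" by (simp add: cube_box)
        then have "x \<in> cube \<eta>" using e unfolding cube_def by auto
        have "R y / 2 * q2 ^ m \<le> R x * K x ^ m"
          using cube_R[OF \<open>x \<in> cube \<eta>\<close>] inner[OF \<open>x \<in> cube e\<close>] q2 Ry by (intro mult_mono power_mono) auto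
        then show ?thesis using True Bq by simp
      next
        case False
        have "- (B * q1 ^ m) \<le> R x * K x ^ m"
        proof (cases "x \<in> cube \<eta>")
          case True
          have "0 \<le> R x * K x ^ m" using cube_R[OF True] Ry K0 by (intro mult_nonneg_nonneg) auto
          then show ?thesis using Bq by linarith
        next
          case False
          have "\<bar>R x * K x ^ m\<bar> \<le> B * q1 ^ m"
            unfolding abs_mult using B(2)[OF x] outer[OF x False] K0 B(1) by (intro mult_mono) (auto intro: power_mono)
          then show ?thesis by linarith
        qed
        then show ?thesis using False by simp
      qed
    qed
    then show ?thesis by (simp add: mult_ac)
  qed
  have "(\<lambda>m. R y / 2 * V - B * W * (q1 / q2) ^ m) \<longlonglongrightarrow> R y / 2 * V - B * W * 0"
    using q1 q2 by (intro tendsto_intros LIMSEQ_power_zero) auto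
  moreover have "R y / 2 * V - B * W * (q1 / q2) ^ m \<le> 0" for m
  proof -
    have "(R y / 2 * V - B * W * (q1 / q2) ^ m) * q2 ^ m \<le> 0"
      using main[of m] q2 by (simp add: power_divide algebra_simps)
    moreover have "0 < q2 ^ m" using q2 by simp
    ultimately show ?thesis by (meson mult_pos_pos not_le)
  qed
  ultimately have "R y / 2 * V - B * W * 0 \<le> 0" by (intro LIMSEQ_le_const2) auto
  then show False using V Ry by (simp add: mult_le_0_iff)
qed

text \<open>Periodicity moves the point into the box, and continuity extends the vanishing from the
  interior to the faces.\<close>

theorem fourier_unique:
  fixes r :: "'a::euclidean_space \<Rightarrow> complex"
  assumes cont: "continuous_on UNIV r" and per: "periodic_fn r"
    and coeff: "\<And>k. (\<forall>b\<in>Basis. k \<bullet> b \<in> \<int>) \<Longrightarrow> integral torus_box (\<lambda>x. r x * cis (k \<bullet> x)) = 0"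
  shows "r x = 0"
proof -
  have hi: "((\<lambda>x. r x * cis (k \<bullet> x)) has_integral 0) torus_box" if "\<forall>b\<in>Basis. k \<bullet> b \<in> \<int>" for k
  proof -
    have "continuous_on UNIV (\<lambda>x. r x * cis (k \<bullet> x))" by (intro continuous_intros cont)
    then show ?thesis using coeff[OF that] integrable_torus by (metis integrable_integral)
  qed
  obtain y where y: "y \<in> torus_box" "r x = r y" using periodic_fn_reduce[of x] per by metis
  have int: "r z = 0" if "z \<in> box 0 torus_top" for z
    using that by (intro fourier_unique_interior[OF cont hi]) (auto simp: mem_box)
  have "box (0::'a) torus_top \<noteq> {}" by (simp add: box_ne_empty)
  then have "y \<in> closure (box 0 torus_top)" using y(1) closure_box[of 0 "torus_top::'a"] by (simp add: torus_box_eq)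
  then have "r y = 0" 
    by (rule continuous_constant_on_closure[rotated 2, where f = r and a = 0]) (auto intro: continuous_on_subset[OF cont] int)
  then show ?thesis using y by simp
qed

section \<open>The transport equation on the circle\<close>

text \<open>A smooth function of t is carried together with the sequence of its derivatives, so that
  products and solutions of equations come with explicit formulas for every order.\<close>

definition deriv_seq :: "(nat \<Rightarrow> real \<Rightarrow> complex) \<Rightarrow> bool" where
  "deriv_seq U \<longleftrightarrow> (\<forall>k t. (U k has_vector_derivative U (Suc k) t) (at t))"

definition leibniz :: "(nat \<Rightarrow> real \<Rightarrow> complex) \<Rightarrow> (nat \<Rightarrow> real \<Rightarrow> complex) \<Rightarrow> nat \<Rightarrow> real \<Rightarrow> complex" where
  "leibniz C U k t = (\<Sum>j\<le>k. of_nat (k choose j) * (C j t * U (k - j) t))"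

lemma deriv_seqD: "deriv_seq U \<Longrightarrow> (U k has_vector_derivative U (Suc k) t) (at t)"
  by (simp add: deriv_seq_def)

lemma deriv_seq_continuous: "deriv_seq U \<Longrightarrow> continuous_on S (U k)"
  by (meson continuous_at_imp_continuous_on deriv_seqD has_vector_derivative_continuous)

lemma leibniz_0 [simp]: "leibniz C U 0 t = C 0 t * U 0 t"
  by (simp add: leibniz_def)

text \<open>Derivatives are assumed up to order k only: \<open>deriv_seq_ode\<close> applies this
  inside an induction in which the higher orders are not yet known.\<close>

lemma leibniz_step:
  assumes "\<And>j. j \<le> k \<Longrightarrow> (C j has_vector_derivative C (Suc j) t) (at t)"
    and "\<And>j. j \<le> k \<Longrightarrow> (U j has_vector_derivative U (Suc j) t) (at t)"
  shows "(leibniz C U k has_vector_derivative leibniz C U (Suc k) t) (at t)"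
proof -
  define F where "F = (\<lambda>j. C j t * U (Suc k - j) t)"
  have "((\<lambda>t. \<Sum>j\<le>k. of_nat (k choose j) * (C j t * U (k - j) t)) has_vector_derivative
      (\<Sum>j\<le>k. of_nat (k choose j) * (C j t * U (Suc (k - j)) t + C (Suc j) t * U (k - j) t))) (at t)"
    using assms by (intro has_vector_derivative_sum has_vector_derivative_mult_right has_vector_derivative_mult) auto
  also have "(\<Sum>j\<le>k. of_nat (k choose j) * (C j t * U (Suc (k - j)) t + C (Suc j) t * U (k - j) t))
     = (\<Sum>j\<le>k. of_nat (k choose j) * F j + of_nat (k choose j) * F (Suc j))"
    unfolding F_def by (intro sum.cong refl) (simp add: Suc_diff_le distrib_left)
  also have "\<dots> = (\<Sum>j\<le>k. of_nat (k choose j) * F j) + (\<Sum>j\<le>k. of_nat (k choose j) * F (Suc j))"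
    by (rule sum.distrib)
  also have "(\<Sum>j\<le>k. of_nat (k choose j) * F j) = (\<Sum>j\<le>Suc k. of_nat (k choose j) * F j)" by simp
  also have "\<dots> = F 0 + (\<Sum>j\<le>k. of_nat (k choose Suc j) * F (Suc j))" by (subst sum.atMost_Suc_shift) simp
  also have "F 0 + (\<Sum>j\<le>k. of_nat (k choose Suc j) * F (Suc j)) + (\<Sum>j\<le>k. of_nat (k choose j) * F (Suc j))
      = F 0 + (\<Sum>j\<le>k. of_nat (Suc k choose Suc j) * F (Suc j))"
    unfolding add.assoc sum.distrib[symmetric] by (intro arg_cong2[of _ _ _ _ "(+)"] refl sum.cong) (simp add: distrib_right)
  also have "\<dots> = leibniz C U (Suc k) t"
    unfolding leibniz_def F_def by (subst sum.atMost_Suc_shift[of "\<lambda>j. of_nat (Suc k choose j) * (C j t * U (Suc k - j) t)"]) simp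
  finally show ?thesis unfolding leibniz_def .
qed

lemma deriv_seq_leibniz: "deriv_seq C \<Longrightarrow> deriv_seq U \<Longrightarrow> deriv_seq (leibniz C U)"
  unfolding deriv_seq_def using leibniz_step by blast

lemma deriv_seq_add: "deriv_seq C \<Longrightarrow> deriv_seq U \<Longrightarrow> deriv_seq (\<lambda>k t. C k t + U k t)"
  unfolding deriv_seq_def by (auto intro: has_vector_derivative_add)

lemma deriv_seq_cmult: "deriv_seq U \<Longrightarrow> deriv_seq (\<lambda>k t. c * U k t)"
  unfolding deriv_seq_def by (auto intro: has_vector_derivative_mult_right)

lemma deriv_seq_sum: "(\<And>j. j \<in> A \<Longrightarrow> deriv_seq (U j)) \<Longrightarrow> deriv_seq (\<lambda>k t. \<Sum>j\<in>A. U j k t)"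
  unfolding deriv_seq_def by (auto intro: has_vector_derivative_sum)

lemma deriv_seq_zero: "deriv_seq (\<lambda>k t. 0)"
  unfolding deriv_seq_def by auto

lemma deriv_seq_const: "deriv_seq (\<lambda>k t. if k = 0 then c else 0)"
  unfolding deriv_seq_def by auto

text \<open>Derivatives of a solution of \<open>u' = - C u + H\<close>, read off from the equation.\<close>
fun ode_seq :: "(nat \<Rightarrow> real \<Rightarrow> complex) \<Rightarrow> (nat \<Rightarrow> real \<Rightarrow> complex) \<Rightarrow> (real \<Rightarrow> complex) \<Rightarrow> nat \<Rightarrow> real \<Rightarrow> complex" where
  "ode_seq C H u 0 = u"
| "ode_seq C H u (Suc k) = (\<lambda>t. H k t - (\<Sum>j\<le>k. of_nat (k choose j) * (C j t * ode_seq C H u (k - j) t)))"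

lemma deriv_seq_ode:
  assumes C: "deriv_seq C" and H: "deriv_seq H"
    and u: "\<And>t. (u has_vector_derivative (H 0 t - C 0 t * u t)) (at t)"
  shows "deriv_seq (ode_seq C H u)"
proof -
  have "(ode_seq C H u k has_vector_derivative ode_seq C H u (Suc k) t) (at t)" for k t
  proof (induction k arbitrary: t rule: less_induct)
    case (less k)
    show ?case
    proof (cases k)
      case 0
      then show ?thesis using u by simp
    next
      case (Suc m)
      have "(leibniz C (ode_seq C H u) m has_vector_derivative leibniz C (ode_seq C H u) (Suc m) t) (at t)"
        using C less Suc by (intro leibniz_step) (auto simp: deriv_seq_def less_Suc_eq_le)
      then have "((\<lambda>t. H m t - leibniz C (ode_seq C H u) m t) has_vector_derivative
          H (Suc m) t - leibniz C (ode_seq C H u) (Suc m) t) (at t)"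
        using H by (intro has_vector_derivative_diff) (auto simp: deriv_seq_def)
      then show ?thesis unfolding Suc ode_seq.simps(2) leibniz_def .
    qed
  qed
  then show ?thesis by (simp add: deriv_seq_def)
qed

section \<open>Derivative bounds for solutions\<close>

context subadd_weight
begin

text \<open>Binomial convolution of the powers of X, which bounds the coefficient of the equation,
  with the weight sequence; \<open>X ^ i\<close> stands for i uses of the equation.\<close>

definition ode_majorant :: "real \<Rightarrow> real \<Rightarrow> nat \<Rightarrow> real" where
  "ode_majorant l X k = (\<Sum>i\<le>k. real (k choose i) * X ^ i * M l (k - i))"

lemma ode_majorant_nonneg: "0 \<le> X \<Longrightarrow> 0 \<le> ode_majorant l X k"
  unfolding ode_majorant_def by (intro sum_nonneg mult_nonneg_nonneg) auto

text \<open>The majorant absorbs one Leibniz factor: rearranging the two binomial coefficients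
  leaves \<open>(k - i) choose j\<close>, which \<open>M_binomial\<close> consumes.\<close>

lemma ode_majorant_mult:
  assumes l: "l > 0" and X: "0 \<le> X" and j: "j \<le> k"
  shows "real (k choose j) * (M l j * ode_majorant l X (k - j)) \<le> ode_majorant l X k"
proof -
  have "real (k choose j) * (M l j * ode_majorant l X (k - j))
    = (\<Sum>i\<le>k - j. (real (k choose j) * real ((k - j) choose i)) * X ^ i * (M l j * M l (k - j - i)))"
    unfolding ode_majorant_def by (simp add: sum_distrib_left mult_ac)
  also have "\<dots> \<le> (\<Sum>i\<le>k - j. real (k choose i) * X ^ i * M l (k - i))"
  proof (rule sum_mono)
    fix i assume "i \<in> {..k - j}"
    then have i: "i \<le> k - j" by simp
    have "(k choose j) * ((k - j) choose i) = (k choose (k - j)) * ((k - j) choose i)"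
      using binomial_symmetric[OF j] by simp
    also have "\<dots> = (k choose i) * ((k - i) choose (k - j - i))" using i j by (intro choose_mult) auto
    also have "(k - i) choose (k - j - i) = (k - i) choose j"
      using binomial_symmetric[of j "k - i"] i j by (simp add: diff_commute add.commute)
    finally have eq: "real (k choose j) * real ((k - j) choose i) = real (k choose i) * real ((k - i) choose j)"
      unfolding of_nat_mult[symmetric] by (rule arg_cong)
    have "real ((k - i) choose j) * (M l j * M l (k - j - i)) \<le> M l (k - i)"
      using M_binomial[OF l, of j "k - j - i"] i j by simp
    then have "(real (k choose i) * X ^ i) * (real ((k - i) choose j) * (M l j * M l (k - j - i))) \<le> (real (k choose i) * X ^ i) * M l (k - i)"
      using X by (intro mult_left_mono) auto
    then show "(real (k choose j) * real ((k - j) choose i)) * X ^ i * (M l j * M l (k - j - i)) \<le> real (k choose i) * X ^ i * M l (k - i)"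
      unfolding eq by (simp add: mult_ac)
  qed
  also have "\<dots> \<le> ode_majorant l X k" unfolding ode_majorant_def using X by (intro sum_mono2) auto
  finally show ?thesis .
qed

lemma ode_majorant_Suc:
  assumes l: "l > 0" and X: "0 \<le> X"
  shows "M l k + X * ode_majorant l X k \<le> ode_majorant l X (Suc k)"
proof -
  have "ode_majorant l X (Suc k) = M l (Suc k) + (\<Sum>i\<le>k. real (Suc k choose Suc i) * X ^ Suc i * M l (k - i))"
    unfolding ode_majorant_def by (subst sum.atMost_Suc_shift) simp
  moreover have "X * ode_majorant l X k \<le> (\<Sum>i\<le>k. real (Suc k choose Suc i) * X ^ Suc i * M l (k - i))"
    unfolding ode_majorant_def sum_distrib_left
  proof (rule sum_mono)
    fix i
    have "real (k choose i) * (X ^ Suc i * M l (k - i)) \<le> real (Suc k choose Suc i) * (X ^ Suc i * M l (k - i))"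
      using X by (intro mult_right_mono) auto
    then show "X * (real (k choose i) * X ^ i * M l (k - i)) \<le> real (Suc k choose Suc i) * X ^ Suc i * M l (k - i)"
      by (simp add: mult_ac)
  qed
  ultimately show ?thesis using M_Suc[OF l, of k] by linarith
qed

text \<open>The factor \<open>2 ^ k\<close> pays for the number of terms in the recursion: the term
  of index j carries \<open>2 ^ (m - j)\<close>, and the geometric sum stays below
  \<open>2 ^ Suc m\<close>.\<close>

lemma ode_seq_bound:
  assumes l: "l > 0" and X: "0 \<le> X" and S: "0 \<le> S" and H0: "0 \<le> H0"
    and C: "\<And>j. cmod (C j t) \<le> X * M l j" and H: "\<And>j. cmod (H j t) \<le> H0 * M l j"
    and u: "cmod (u t) \<le> S * M l 0"
  shows "cmod (ode_seq C H u k t) \<le> (S + H0) * 2 ^ k * ode_majorant l X k"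
proof (induction k rule: less_induct)
  case (less k)
  let ?Q = "ode_majorant l X"
  show ?case
  proof (cases k)
    case 0
    have "cmod (u t) \<le> (S + H0) * M l 0" using u H0 by (smt (verit) M_nonneg mult_right_mono)
    then show ?thesis by (simp add: 0 ode_majorant_def)
  next
    case (Suc m)
    have summand: "cmod (of_nat (m choose j) * (C j t * ode_seq C H u (m - j) t)) \<le> 2 ^ (m - j) * (X * (S + H0) * ?Q m)"
      if "j \<le> m" for j
    proof -
      have "cmod (of_nat (m choose j) * (C j t * ode_seq C H u (m - j) t))
         \<le> real (m choose j) * ((X * M l j) * ((S + H0) * 2 ^ (m - j) * ?Q (m - j)))"
        unfolding norm_mult norm_of_nat using Suc X
        by (intro mult_left_mono mult_mono C less) auto
      also have "\<dots> = 2 ^ (m - j) * (X * (S + H0) * (real (m choose j) * (M l j * ?Q (m - j))))" by simp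
      also have "\<dots> \<le> 2 ^ (m - j) * (X * (S + H0) * ?Q m)"
        using X S H0 l that by (intro mult_left_mono ode_majorant_mult) auto
      finally show ?thesis .
    qed
    have "cmod (ode_seq C H u k t) \<le> cmod (H m t) + (\<Sum>j\<le>m. cmod (of_nat (m choose j) * (C j t * ode_seq C H u (m - j) t)))"
      unfolding Suc ode_seq.simps(2) by (rule order_trans[OF norm_triangle_ineq4]) (intro add_mono order_refl norm_sum)
    also have "\<dots> \<le> H0 * M l m + (\<Sum>j\<le>m. 2 ^ (m - j) * (X * (S + H0) * ?Q m))"
      by (intro add_mono sum_mono H summand) auto
    also have "(\<Sum>j\<le>m. 2 ^ (m - j) * (X * (S + H0) * ?Q m)) = (\<Sum>j\<le>m. 2 ^ (m - j)) * (X * (S + H0) * ?Q m)"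
      by (rule sum_distrib_right[symmetric])
    also have "(\<Sum>j\<le>m. (2::real) ^ (m - j)) = 2 ^ Suc m - 1"
      by (induction m) (simp, subst sum.atMost_Suc_shift, simp)
    also have "H0 * M l m + (2 ^ Suc m - 1) * (X * (S + H0) * ?Q m) \<le> (S + H0) * 2 ^ Suc m * M l m + 2 ^ Suc m * (X * (S + H0) * ?Q m)"
    proof (rule add_mono)
      have "H0 * 1 \<le> (S + H0) * 2 ^ Suc m" using S H0 by (intro mult_mono one_le_power) auto
      then show "H0 * M l m \<le> (S + H0) * 2 ^ Suc m * M l m" by (intro mult_right_mono) auto
      show "(2 ^ Suc m - 1) * (X * (S + H0) * ?Q m) \<le> 2 ^ Suc m * (X * (S + H0) * ?Q m)"
        using X S H0 ode_majorant_nonneg[OF X] by (intro mult_right_mono mult_nonneg_nonneg) auto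
    qed
    also have "\<dots> = (S + H0) * 2 ^ Suc m * (M l m + X * ?Q m)" by (simp add: algebra_simps)
    also have "\<dots> \<le> (S + H0) * 2 ^ Suc m * ?Q (Suc m)"
      using S H0 l X by (intro mult_left_mono ode_majorant_Suc) auto
    finally show ?thesis by (simp add: Suc)
  qed
qed

text \<open>Powers of X become \<open>real A ^ k * (exp (d * \<omega> y) * M d i)\<close>, after
  which \<open>M_binomial\<close> gives every summand the same bound. The k + 1 summands cost
  \<open>2 ^ k\<close>; with the \<open>2 ^ k\<close> in front and \<open>real A ^ k\<close> this
  makes the divisor \<open>4 * real A\<close> of the parameter.\<close>

lemma ode_majorant_bound:
  assumes l: "0 < d" "d \<le> l" and A: "1 \<le> A" and y: "1 \<le> y" and X: "0 \<le> X" "X \<le> real A * y"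
  shows "2 ^ k * ode_majorant l X k \<le> exp (d * \<omega> y) * M (d / (4 * real A)) k"
proof -
  have "ode_majorant l X k \<le> (\<Sum>i\<le>k. exp (d * \<omega> y) * (real A ^ k * M d k))"
    unfolding ode_majorant_def
  proof (rule sum_mono)
    fix i assume "i \<in> {..k}" then have i: "i \<le> k" by simp
    have yi: "y ^ i \<le> exp (d * \<omega> y) * M d i" using M_ge[OF l(1) y, of i] by (simp add: exp_minus field_simps)
    have "X ^ i \<le> (real A * y) ^ i" using X by (intro power_mono) auto
    also have "\<dots> = real A ^ i * y ^ i" by (rule power_mult_distrib)
    also have "\<dots> \<le> real A ^ k * (exp (d * \<omega> y) * M d i)" using A i yi y by (intro mult_mono power_increasing) auto
    finally have "real (k choose i) * X ^ i * M l (k - i) \<le> real (k choose i) * (real A ^ k * (exp (d * \<omega> y) * M d i)) * M d (k - i)"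
      using l X by (intro mult_mono mult_left_mono M_antimono) auto
    also have "\<dots> = exp (d * \<omega> y) * (real A ^ k * (real (k choose i) * (M d i * M d (k - i))))" by simp
    also have "\<dots> \<le> exp (d * \<omega> y) * (real A ^ k * M d k)"
      using M_binomial[OF l(1), of i "k - i"] i by (intro mult_left_mono) auto
    finally show "real (k choose i) * X ^ i * M l (k - i) \<le> exp (d * \<omega> y) * (real A ^ k * M d k)" .
  qed
  also have "\<dots> = real (Suc k) * (exp (d * \<omega> y) * (real A ^ k * M d k))" by simp
  also have "\<dots> \<le> 2 ^ k * (exp (d * \<omega> y) * (real A ^ k * M d k))"
  proof (intro mult_right_mono)
    have "Suc k \<le> 2 ^ k" by (simp add: Suc_leI)
    then show "real (Suc k) \<le> 2 ^ k" by (metis of_nat_le_iff of_nat_numeral of_nat_power)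
  qed auto
  finally have "2 ^ k * ode_majorant l X k \<le> 2 ^ k * (2 ^ k * (exp (d * \<omega> y) * (real A ^ k * M d k)))"
    by (intro mult_left_mono) auto
  also have "\<dots> = exp (d * \<omega> y) * (real (4 * A) ^ k * M d k)"
    using power_mult_distrib[of "2::real" 2 k] by (simp add: power_mult_distrib)
  also have "\<dots> \<le> exp (d * \<omega> y) * M (d / real (4 * A)) k" using l A by (intro mult_left_mono M_scale) auto
  finally show ?thesis by simp
qed

text \<open>The loss is \<open>exp (d * \<omega> y)\<close> with d free in the range up to l, and
  the new parameter depends on d and A but not on y. The factor \<open>exp (l * \<omega> 1)\<close>
  turns the plain bound S into a multiple of \<open>M l 0\<close>, which equals
  \<open>exp (- l * \<omega> 1)\<close>.\<close>

lemma ode_regularity: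
  assumes l: "0 < d" "d \<le> l" and A: "1 \<le> A" and y: "1 \<le> y" and S: "0 \<le> S" and H0: "0 \<le> H0"
    and dC: "deriv_seq C" and dH: "deriv_seq H"
    and C: "\<And>j t. cmod (C j t) \<le> real A * y * M l j" and H: "\<And>j t. cmod (H j t) \<le> H0 * M l j"
    and u: "\<And>t. cmod (u t) \<le> S" "\<And>t. (u has_vector_derivative (H 0 t - C 0 t * u t)) (at t)"
  obtains U where "deriv_seq U" "U 0 = u"
    "\<And>k t. cmod (U k t) \<le> (S * exp (l * \<omega> 1) + H0) * exp (d * \<omega> y) * M (d / (4 * real A)) k"
proof (rule that[of "ode_seq C H u"])
  show "deriv_seq (ode_seq C H u)" by (rule deriv_seq_ode[OF dC dH u(2)])
  fix k t
  have X: "0 \<le> real A * y" using y by simp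
  have l0: "l > 0" using l by simp
  have "cmod (ode_seq C H u k t) \<le> (S * exp (l * \<omega> 1) + H0) * 2 ^ k * ode_majorant l (real A * y) k"
    by (rule ode_seq_bound[OF l0 X _ H0 C H]) (use u(1)[of t] S in \<open>simp_all add: M_0[OF l0] exp_minus mult.assoc\<close>)
  also have "\<dots> = (S * exp (l * \<omega> 1) + H0) * (2 ^ k * ode_majorant l (real A * y) k)" by simp
  also have "\<dots> \<le> (S * exp (l * \<omega> 1) + H0) * (exp (d * \<omega> y) * M (d / (4 * real A)) k)"
    using S H0 by (intro mult_left_mono ode_majorant_bound l A y X) auto
  finally show "cmod (ode_seq C H u k t) \<le> (S * exp (l * \<omega> 1) + H0) * exp (d * \<omega> y) * M (d / (4 * real A)) k" by simp
qed simp

end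

section \<open>Primitives and periodic solutions\<close>

definition primitive :: "(real \<Rightarrow> complex) \<Rightarrow> real \<Rightarrow> complex" where
  "primitive f t = integral {0..t} f - integral {t..0} f"

lemma primitive_0 [simp]: "primitive f 0 = 0"
  by (simp add: primitive_def)

lemma primitive_nonneg: "0 \<le> t \<Longrightarrow> primitive f t = integral {0..t} f"
  by (cases "t = 0") (auto simp: primitive_def)

lemma primitive_deriv:
  assumes "continuous_on UNIV f"
  shows "(primitive f has_vector_derivative f t) (at t)"
proof -
  define n where "n = \<bar>t\<bar> + 1"
  have cont: "continuous_on S f" for S using assms continuous_on_subset by blast
  have int: "f integrable_on {x..y}" for x y using cont by (intro integrable_continuous_interval)
  have eq: "primitive f s = integral {-n..s} f - integral {-n..0} f" if "s \<in> {-n<..<n}" for s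
  proof (cases "s \<ge> 0")
    case True
    then show ?thesis using Henstock_Kurzweil_Integration.integral_combine[of "-n" 0 s f] int
      by (cases "s = 0") (auto simp: primitive_def n_def algebra_simps)
  next
    case False
    then show ?thesis using Henstock_Kurzweil_Integration.integral_combine[of "-n" s 0 f] int that
      by (auto simp: primitive_def algebra_simps)
  qed
  have "((\<lambda>s. integral {-n..s} f) has_vector_derivative f t) (at t within {-n..n})"
    by (rule integral_has_vector_derivative[OF cont]) (auto simp: n_def)
  then have "((\<lambda>s. integral {-n..s} f) has_vector_derivative f t) (at t)"
    by (subst (asm) at_within_Icc_at) (auto simp: n_def)
  then have "((\<lambda>s. integral {-n..s} f - integral {-n..0} f) has_vector_derivative f t - 0) (at t)"
    by (intro has_vector_derivative_diff) auto
  then have "((\<lambda>s. integral {-n..s} f - integral {-n..0} f) has_vector_derivative f t) (at t)" by simp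
  then show ?thesis
    by (rule has_vector_derivative_transform_within_open[of _ _ _ "{-n<..<n}"]) (auto simp: eq, auto simp: n_def)
qed

lemma deriv_zero_const:
  fixes f :: "real \<Rightarrow> complex"
  assumes "\<And>t. (f has_vector_derivative 0) (at t)"
  shows "f t = f s"
proof -
  obtain c where "\<And>x. f x = c"
    using has_vector_derivative_zero_constant[of UNIV f] assms by auto
  then show ?thesis by simp
qed

lemma primitive_unique:
  assumes "continuous_on UNIV f" "\<And>t. (F has_vector_derivative f t) (at t)"
  shows "F t - F s = primitive f t - primitive f s"
proof -
  have "((\<lambda>t. F t - primitive f t) has_vector_derivative 0) (at t)" for t
    using has_vector_derivative_diff[OF assms(2) primitive_deriv[OF assms(1)], of t] by simp
  from deriv_zero_const[OF this, of t s] show ?thesis by (simp add: algebra_simps)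
qed

lemma primitive_period:
  assumes f: "continuous_on UNIV f" and per: "\<And>t. f (t + 2 * pi) = f t"
  shows "primitive f (t + 2 * pi) = primitive f t + primitive f (2 * pi)"
proof -
  have "((\<lambda>t. primitive f (t + 2 * pi)) has_vector_derivative f t) (at t)" for t
  proof -
    have "((\<lambda>t. t + 2 * pi) has_vector_derivative 1) (at t)" by (auto intro!: derivative_eq_intros)
    from vector_diff_chain_at[OF this primitive_deriv[OF f]] show ?thesis by (simp add: o_def per)
  qed
  from primitive_unique[OF f this, of t 0] show ?thesis by (simp add: algebra_simps)
qed

lemma primitive_diff_integral:
  assumes "continuous_on UNIV f" "a \<le> b"
  shows "(f has_integral (primitive f b - primitive f a)) {a..b}"
  by (rule fundamental_theorem_of_calculus[OF assms(2)])
     (auto intro: has_vector_derivative_at_within primitive_deriv[OF assms(1)])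

lemma has_vector_derivative_exp_primitive:
  assumes "continuous_on UNIV c"
  shows "((\<lambda>t. exp (z * primitive c t)) has_vector_derivative z * c t * exp (z * primitive c t)) (at t)"
proof -
  have "((\<lambda>t. z * primitive c t) has_vector_derivative z * c t) (at t)"
    by (intro has_vector_derivative_mult_right primitive_deriv assms)
  from field_vector_diff_chain_at[OF this DERIV_exp] show ?thesis by (simp add: o_def)
qed

text \<open>The integral of \<open>exp (- \<i> * (primitive c t - primitive c r)) * h r\<close> over
  the period ending at t. The usual division by
  \<open>1 - exp (- \<i> * primitive c (2 * pi))\<close> is left out: the formula then makes sense
  at resonant frequencies too, and this factor appears on the right-hand side of the equation
  instead.\<close>

definition periodic_sol :: "(real \<Rightarrow> complex) \<Rightarrow> (real \<Rightarrow> complex) \<Rightarrow> real \<Rightarrow> complex" where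
  "periodic_sol c h t = exp (- \<i> * primitive c t) *
     (primitive (\<lambda>r. exp (\<i> * primitive c r) * h r) t - primitive (\<lambda>r. exp (\<i> * primitive c r) * h r) (t - 2 * pi))"

context
  fixes c h :: "real \<Rightarrow> complex"
  assumes c: "continuous_on UNIV c" and h: "continuous_on UNIV h"
    and cper: "\<And>t. c (t + 2 * pi) = c t" and hper: "\<And>t. h (t + 2 * pi) = h t"
begin

lemma primitive_cont: "continuous_on UNIV (primitive c)"
  using primitive_deriv[OF c] by (meson continuous_at_imp_continuous_on has_vector_derivative_continuous)

lemma exp_primitive_h_cont: "continuous_on UNIV (\<lambda>r. exp (\<i> * primitive c r) * h r)"
  by (intro continuous_intros primitive_cont h)

lemma periodic_sol_integral:
  "((\<lambda>r. exp (- \<i> * (primitive c t - primitive c r)) * h r) has_integral periodic_sol c h t) {t - 2 * pi..t}"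
proof -
  have "((\<lambda>r. exp (- \<i> * primitive c t) * (exp (\<i> * primitive c r) * h r)) has_integral periodic_sol c h t) {t - 2 * pi..t}"
    unfolding periodic_sol_def using exp_primitive_h_cont
    by (intro has_integral_mult_right primitive_diff_integral) auto
  moreover have "exp (- \<i> * primitive c t) * (exp (\<i> * primitive c r) * h r) = exp (- \<i> * (primitive c t - primitive c r)) * h r" for r
    by (simp add: right_diff_distrib exp_diff exp_minus field_simps)
  ultimately show ?thesis by (simp only:)
qed

lemma periodic_sol_bound:
  assumes "0 \<le> B" "\<And>r. r \<in> {t - 2 * pi..t} \<Longrightarrow> cmod (exp (- \<i> * (primitive c t - primitive c r)) * h r) \<le> B"
  shows "cmod (periodic_sol c h t) \<le> 2 * pi * B"
  using has_integral_bound_real[OF assms(1) finite.emptyI periodic_sol_integral[of t]] assms(2)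
  by (simp add: mult.commute)

lemma periodic_sol_deriv:
  "(periodic_sol c h has_vector_derivative
     ((1 - exp (- \<i> * primitive c (2 * pi))) * h t - \<i> * c t * periodic_sol c h t)) (at t)"
proof -
  let ?g = "\<lambda>r. exp (\<i> * primitive c r) * h r"
  have 1: "((\<lambda>t. primitive ?g (t - 2 * pi)) has_vector_derivative ?g (t - 2 * pi)) (at t)"
  proof -
    have "((\<lambda>t. t - 2 * pi) has_vector_derivative 1) (at t)" by (auto intro!: derivative_eq_intros)
    from vector_diff_chain_at[OF this primitive_deriv[OF exp_primitive_h_cont]] show ?thesis by (simp add: o_def)
  qed
  have "(periodic_sol c h has_vector_derivative
     (exp (- \<i> * primitive c t) * (?g t - ?g (t - 2 * pi)) +
      (- \<i> * c t * exp (- \<i> * primitive c t)) * (primitive ?g t - primitive ?g (t - 2 * pi)))) (at t)"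
    unfolding periodic_sol_def[abs_def]
    by (intro has_vector_derivative_mult has_vector_derivative_diff has_vector_derivative_exp_primitive c 1 primitive_deriv exp_primitive_h_cont)
  moreover have "exp (- \<i> * primitive c t) * (?g t - ?g (t - 2 * pi)) = (1 - exp (- \<i> * primitive c (2 * pi))) * h t"
  proof -
    have hp: "h (t - 2 * pi) = h t" using hper[of "t - 2 * pi"] by simp
    have pp: "primitive c (t - 2 * pi) = primitive c t - primitive c (2 * pi)"
      using primitive_period[OF c cper, of "t - 2 * pi"] by simp
    have "exp (- \<i> * primitive c t) * ?g t = h t" by (simp add: exp_minus field_simps)
    moreover have "exp (- \<i> * primitive c t) * ?g (t - 2 * pi) = exp (- \<i> * primitive c (2 * pi)) * h t"
      unfolding pp hp by (simp add: right_diff_distrib exp_diff exp_minus field_simps)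
    ultimately show ?thesis by (simp add: algebra_simps)
  qed
  ultimately show ?thesis by (simp add: periodic_sol_def mult_ac)
qed

lemma periodic_sol_period: "periodic_sol c h (t + 2 * pi) = periodic_sol c h t"
proof -
  have "((\<lambda>r. exp (- \<i> * (primitive c (t + 2 * pi) - primitive c (r + 2 * pi))) * h (r + 2 * pi)) has_integral
       periodic_sol c h (t + 2 * pi)) {t + 2 * pi - 2 * pi - 2 * pi..t + 2 * pi - 2 * pi}"
    by (rule has_integral_shift_real_ivl[OF periodic_sol_integral])
  then have "((\<lambda>r. exp (- \<i> * (primitive c t - primitive c r)) * h r) has_integral
       periodic_sol c h (t + 2 * pi)) {t - 2 * pi..t}"
    by (simp add: primitive_period[OF c cper] hper)
  then show ?thesis using periodic_sol_integral has_integral_unique by blast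
qed

text \<open>The integrating factor makes \<open>w t * exp (\<i> * primitive c t)\<close> constant,
  whereas one period multiplies it by \<open>exp (\<i> * primitive c (2 * pi))\<close>.\<close>

lemma ode_periodic_unique:
  assumes w: "\<And>t. (w has_vector_derivative - \<i> * c t * w t) (at t)" and per: "\<And>t. w (t + 2 * pi) = w t"
    and ne: "exp (\<i> * primitive c (2 * pi)) \<noteq> 1"
  shows "w t = 0"
proof -
  have "((\<lambda>t. w t * exp (\<i> * primitive c t)) has_vector_derivative
     (w t * (\<i> * c t * exp (\<i> * primitive c t)) + (- \<i> * c t * w t) * exp (\<i> * primitive c t))) (at t)" for t
    by (intro has_vector_derivative_mult w has_vector_derivative_exp_primitive c)
  then have "((\<lambda>t. w t * exp (\<i> * primitive c t)) has_vector_derivative 0) (at t)" for t by simp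
  from deriv_zero_const[OF this, of "t + 2 * pi" t]
  have "w t * exp (\<i> * primitive c t) * exp (\<i> * primitive c (2 * pi)) = w t * exp (\<i> * primitive c t)"
    unfolding per primitive_period[OF c cper] distrib_left exp_add by (simp only: mult_ac)
  then show ?thesis using ne by auto
qed

lemma Im_primitive_mono:
  assumes "\<And>t. Im (c t) \<le> 0" "r \<le> t"
  shows "Im (primitive c t) \<le> Im (primitive c r)"
proof -
  have "((\<lambda>t. Im (primitive c t)) has_real_derivative Im (c t)) (at t)" for t
    using bounded_linear.has_vector_derivative[OF bounded_linear_Im primitive_deriv[OF c], of t]
    by (simp add: has_real_derivative_iff_has_vector_derivative)
  then show ?thesis using assms by (intro DERIV_nonpos_imp_nonincreasing[where f = "\<lambda>t. Im (primitive c t)"]) blast+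
qed

text \<open>The kernel has modulus \<open>exp (Im (primitive c t) - Im (primitive c r))\<close>.
  This is at most one, because r lies before t and the imaginary part of the primitive does not
  increase.\<close>

lemma periodic_solvable_neg:
  assumes sgn: "\<And>t. Im (c t) \<le> 0" and b: "\<And>t. cmod (h t) \<le> b" and D: "0 < D" "D \<le> cmod (1 - exp (- \<i> * primitive c (2 * pi)))"
  shows "\<exists>u. (\<forall>t. (u has_vector_derivative (h t - \<i> * c t * u t)) (at t)) \<and> (\<forall>t. u (t + 2 * pi) = u t) \<and> (\<forall>t. cmod (u t) \<le> 2 * pi * b / D)"
proof (intro exI conjI allI)
  let ?d = "1 - exp (- \<i> * primitive c (2 * pi))"
  let ?u = "\<lambda>t. (1 / ?d) * periodic_sol c h t"
  have d: "?d \<noteq> 0" using D by auto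
  fix t
  have "(?u has_vector_derivative (1 / ?d) * (?d * h t - \<i> * c t * periodic_sol c h t)) (at t)"
    by (intro has_vector_derivative_mult_right periodic_sol_deriv)
  moreover have "(1 / ?d) * (?d * h t - \<i> * c t * periodic_sol c h t) = h t - \<i> * c t * ?u t"
    using d by (simp add: field_simps)
  ultimately show "(?u has_vector_derivative (h t - \<i> * c t * ?u t)) (at t)" by simp
  show "?u (t + 2 * pi) = ?u t" by (simp add: periodic_sol_period)
  have b0: "0 \<le> b" using b[of 0] norm_ge_zero order_trans by blast
  have "cmod (periodic_sol c h t) \<le> 2 * pi * b"
  proof (rule periodic_sol_bound[OF b0])
    fix r assume "r \<in> {t - 2 * pi..t}"
    then have "Im (primitive c t) \<le> Im (primitive c r)" using Im_primitive_mono[OF sgn] by auto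
    then have "cmod (exp (- \<i> * (primitive c t - primitive c r))) \<le> 1" by (simp add: norm_exp_eq_Re)
    then have "cmod (exp (- \<i> * (primitive c t - primitive c r))) * cmod (h r) \<le> 1 * b" using b by (intro mult_mono) auto
    then show "cmod (exp (- \<i> * (primitive c t - primitive c r)) * h r) \<le> b" by (simp add: norm_mult)
  qed
  then have "cmod (periodic_sol c h t) / cmod ?d \<le> 2 * pi * b / D" using D b0 by (intro frac_le) auto
  then show "cmod (?u t) \<le> 2 * pi * b / D" by (simp add: norm_mult norm_divide)
qed

end

text \<open>The case of nonnegative imaginary part is reflected by replacing t with
  \<open>- t\<close>. This changes the sign of the integral of c over a period, which is why both
  denominators are bounded below.\<close>

lemma periodic_solvable:
  assumes c: "continuous_on UNIV c" and h: "continuous_on UNIV h"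
    and cper: "\<And>t. c (t + 2 * pi) = c t" and hper: "\<And>t. h (t + 2 * pi) = h t"
    and sgn: "(\<forall>t. Im (c t) \<le> 0) \<or> (\<forall>t. Im (c t) \<ge> 0)" and b: "\<And>t. cmod (h t) \<le> b"
    and D: "0 < D" "D \<le> cmod (1 - exp (- \<i> * primitive c (2 * pi)))" "D \<le> cmod (1 - exp (\<i> * primitive c (2 * pi)))"
  shows "\<exists>u. (\<forall>t. (u has_vector_derivative (h t - \<i> * c t * u t)) (at t)) \<and> (\<forall>t. u (t + 2 * pi) = u t) \<and> (\<forall>t. cmod (u t) \<le> 2 * pi * b / D)"
  using sgn
proof
  assume "\<forall>t. Im (c t) \<le> 0"
  then show ?thesis by (intro periodic_solvable_neg c h cper hper b D(1,2)) auto
next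
  assume s: "\<forall>t. Im (c t) \<ge> 0"
  define c' h' where "c' = (\<lambda>t. - c (- t))" and "h' = (\<lambda>t. - h (- t))"
  have c': "continuous_on UNIV c'" "continuous_on UNIV h'"
    unfolding c'_def h'_def by (intro continuous_intros continuous_on_compose2[OF c] continuous_on_compose2[OF h]; simp)+
  have per: "c' (t + 2 * pi) = c' t" "h' (t + 2 * pi) = h' t" for t
    using cper[of "- t - 2 * pi"] hper[of "- t - 2 * pi"] by (simp_all add: c'_def h'_def)
  have "((\<lambda>t. primitive c (- t)) has_vector_derivative c' t) (at t)" for t
  proof -
    have "((\<lambda>t. - t) has_vector_derivative - 1) (at t)" by (auto intro!: derivative_eq_intros)
    from vector_diff_chain_at[OF this primitive_deriv[OF c]] show ?thesis by (simp add: o_def c'_def)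
  qed
  from primitive_unique[OF c'(1) this, of "2 * pi" 0]
  have "primitive c' (2 * pi) = primitive c (- 2 * pi)" by simp
  also have "\<dots> = - primitive c (2 * pi)" using primitive_period[OF c cper, of "- 2 * pi"] by (simp add: eq_neg_iff_add_eq_0)
  finally have pc: "primitive c' (2 * pi) = - primitive c (2 * pi)" .
  have "\<exists>u. (\<forall>t. (u has_vector_derivative (h' t - \<i> * c' t * u t)) (at t)) \<and> (\<forall>t. u (t + 2 * pi) = u t) \<and> (\<forall>t. cmod (u t) \<le> 2 * pi * b / D)"
    by (rule periodic_solvable_neg[OF c' per]) (use s b D pc in \<open>auto simp: c'_def h'_def\<close>)
  then obtain u where u: "\<And>t. (u has_vector_derivative (h' t - \<i> * c' t * u t)) (at t)" "\<And>t. u (t + 2 * pi) = u t" "\<And>t. cmod (u t) \<le> 2 * pi * b / D"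
    by blast
  show ?thesis
  proof (intro exI[of _ "\<lambda>t. u (- t)"] conjI allI)
    fix t
    have "((\<lambda>t. - t) has_vector_derivative - 1) (at t)" by (auto intro!: derivative_eq_intros)
    from vector_diff_chain_at[OF this u(1)]
    show "((\<lambda>t. u (- t)) has_vector_derivative (h t - \<i> * c t * u (- t))) (at t)"
      by (simp add: o_def c'_def h'_def algebra_simps)
    show "u (- (t + 2 * pi)) = u (- t)" using u(2)[of "- t - 2 * pi"] by simp
    show "cmod (u (- t)) \<le> 2 * pi * b / D" by (rule u)
  qed
qed

text \<open>Links the denominators to the distance from the integers. If the exponential is close to
  1, its principal logarithm is \<open>2 * pi * \<i>\<close> times \<open>n + z\<close> for some
  integer n, and its modulus is at most twice the deviation from 1.\<close>

lemma one_minus_exp_lower: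
  "1 / 2 \<le> cmod (1 - exp (2 * of_real pi * \<i> * z)) \<or> (\<exists>n::int. cmod (of_int n + z) \<le> cmod (1 - exp (2 * of_real pi * \<i> * z)))"
proof (cases "1 / 2 \<le> cmod (1 - exp (2 * of_real pi * \<i> * z))")
  case False
  define q where "q = exp (2 * of_real pi * \<i> * z) - 1"
  have q: "cmod q < 1 / 2" "cmod q = cmod (1 - exp (2 * of_real pi * \<i> * z))" using False by (simp_all add: q_def norm_minus_commute)
  have "1 + q \<noteq> 0" by (simp add: q_def)
  then have "exp (Ln (1 + q)) = exp (2 * of_real pi * \<i> * z)" by (simp add: q_def)
  then obtain n :: int where n: "Ln (1 + q) = 2 * of_real pi * \<i> * z + (of_int (2 * n) * pi) * \<i>"
    unfolding exp_eq by auto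
  then have "Ln (1 + q) = (2 * of_real pi * \<i>) * (of_int n + z)" by (simp add: algebra_simps)
  then have "cmod (Ln (1 + q)) = 2 * pi * cmod (of_int n + z)" by (simp add: norm_mult)
  moreover have "cmod (Ln (1 + q)) \<le> 2 * cmod q" using q by (intro norm_Ln_le) auto
  ultimately have "pi * cmod (of_int n + z) \<le> cmod q" by simp
  moreover have "1 * cmod (of_int n + z) \<le> pi * cmod (of_int n + z)" using pi_gt3 by (intro mult_right_mono) auto
  ultimately have "cmod (of_int n + z) \<le> cmod q" by simp
  then show ?thesis using q by auto
qed auto

section \<open>Partial Fourier series\<close>

lemma has_vector_derivative_suminf:
  fixes f :: "nat \<Rightarrow> real \<Rightarrow> complex"
  assumes der: "\<And>n t. (f n has_vector_derivative f' n t) (at t)"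
    and bound: "\<And>n t. cmod (f n t) \<le> A n" "\<And>n t. cmod (f' n t) \<le> B n"
    and sm: "summable A" "summable B"
  shows "((\<lambda>t. \<Sum>n. f n t) has_vector_derivative (\<Sum>n. f' n t)) (at t)"
proof -
  have ul: "uniform_limit UNIV (\<lambda>n t. \<Sum>i<n. f' i t) (\<lambda>t. \<Sum>i. f' i t) sequentially"
    by (rule Weierstrass_m_test[OF bound(2) sm(2)])
  have sf: "summable (\<lambda>n. f n t)" for t by (rule summable_comparison_test'[OF sm(1), of 0]) (simp add: bound)
  have "\<exists>g. \<forall>t\<in>UNIV. (\<lambda>n. f n t) sums g t \<and> (g has_derivative (\<lambda>h. h *\<^sub>R (\<Sum>n. f' n t))) (at t within UNIV)"
  proof (rule has_derivative_series[where f' = "\<lambda>n t h. h *\<^sub>R f' n t"])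
    show "(f n has_derivative (\<lambda>h. h *\<^sub>R f' n t)) (at t within UNIV)" for n t
      using der by (simp add: has_vector_derivative_def)
    show "(\<lambda>n. f n t) sums (\<Sum>n. f n t)" using sf by (rule summable_sums)
    fix e :: real assume "e > 0"
    from uniform_limitD[OF ul this]
    show "\<forall>\<^sub>F n in sequentially. \<forall>t\<in>UNIV. \<forall>h. norm ((\<Sum>i<n. h *\<^sub>R f' i t) - h *\<^sub>R (\<Sum>n. f' n t)) \<le> e * norm h"
    proof eventually_elim
      case (elim n)
      show ?case
      proof (intro ballI allI)
        fix t h :: real
        have "(\<Sum>i<n. h *\<^sub>R f' i t) - h *\<^sub>R (\<Sum>n. f' n t) = h *\<^sub>R ((\<Sum>i<n. f' i t) - (\<Sum>n. f' n t))"
          by (simp add: scaleR_right_diff_distrib scaleR_sum_right)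
        moreover have "cmod ((\<Sum>i<n. f' i t) - (\<Sum>n. f' n t)) \<le> e" using elim by (auto simp: dist_norm intro: less_imp_le)
        ultimately show "norm ((\<Sum>i<n. h *\<^sub>R f' i t) - h *\<^sub>R (\<Sum>n. f' n t)) \<le> e * norm h"
          by (simp add: mult_left_mono mult.commute[of e])
      qed
    qed
  qed auto
  then obtain g where g: "\<And>t. (\<lambda>n. f n t) sums g t" "\<And>t. (g has_derivative (\<lambda>h. h *\<^sub>R (\<Sum>n. f' n t))) (at t)" by auto
  have "g = (\<lambda>t. \<Sum>n. f n t)" using g(1) by (auto simp: fun_eq_iff sums_unique)
  then show ?thesis using g(2) by (simp add: has_vector_derivative_def)
qed

lemma continuous_on_suminf:
  fixes f :: "nat \<Rightarrow> 'a::topological_space \<Rightarrow> complex"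
  assumes "\<And>n. continuous_on S (f n)" "\<And>n x. x \<in> S \<Longrightarrow> cmod (f n x) \<le> B n" "summable B"
  shows "continuous_on S (\<lambda>x. \<Sum>n. f n x)"
  by (rule uniform_limit_theorem[OF _ Weierstrass_m_test[OF assms(2,3)]]) (intro always_eventually allI continuous_on_sum assms(1), simp_all)

lemma integral_suminf:
  fixes f :: "nat \<Rightarrow> 'a::euclidean_space \<Rightarrow> complex"
  assumes "\<And>n. continuous_on (cbox a b) (f n)" "\<And>n x. x \<in> cbox a b \<Longrightarrow> cmod (f n x) \<le> B n" "summable B"
  shows "(\<lambda>n. integral (cbox a b) (f n)) sums integral (cbox a b) (\<lambda>x. \<Sum>n. f n x)"
proof -
  have c: "continuous_on (cbox a b) (\<lambda>x. \<Sum>i<n. f i x)" for n by (intro continuous_on_sum assms)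
  obtain I J where IJ: "\<And>n. ((\<lambda>x. \<Sum>i<n. f i x) has_integral I n) (cbox a b)"
    "((\<lambda>x. \<Sum>i. f i x) has_integral J) (cbox a b)" "I \<longlonglongrightarrow> J"
    using uniform_limit_integral_cbox[OF Weierstrass_m_test[OF assms(2,3)] c] by auto
  have "I n = (\<Sum>i<n. integral (cbox a b) (f i))" for n
  proof -
    have "integral (cbox a b) (\<lambda>x. \<Sum>i<n. f i x) = (\<Sum>i<n. integral (cbox a b) (f i))"
      by (intro integral_sum) (auto intro: integrable_continuous assms)
    then show ?thesis using IJ(1)[of n] by (simp add: integral_unique)
  qed
  then have "I = (\<lambda>n. \<Sum>i<n. integral (cbox a b) (f i))" by (rule ext)
  then have "(\<lambda>n. integral (cbox a b) (f n)) sums J" using IJ(3) by (simp add: sums_def)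
  then show ?thesis using IJ(2) by (simp add: integral_unique)
qed

type_synonym 'n cyl = "real \<times> (real^'n)"

definition synth :: "(('n::finite \<Rightarrow> int) \<Rightarrow> real \<Rightarrow> complex) \<Rightarrow> 'n cyl \<Rightarrow> complex" where
  "synth u p = (\<Sum>n. u (lat_enum n) (fst p) * cis (lat (lat_enum n) \<bullet> snd p))"

definition fcoef :: "('n::finite cyl \<Rightarrow> complex) \<Rightarrow> ('n \<Rightarrow> int) \<Rightarrow> real \<Rightarrow> complex" where
  "fcoef f \<xi> t = integral torus_box (\<lambda>x. f (t, x) * cis (- (lat \<xi> \<bullet> x))) / (2 * of_real pi) ^ CARD('n)"

lemma Basis_cyl: "(Basis :: 'n::finite cyl set) = insert (1, 0) (range (\<lambda>j. (0, axis j 1)))"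
  by (auto simp: Basis_prod_def Basis_vec_def)

lemma cyl_Basis_cases:
  assumes "b \<in> (Basis :: 'n::finite cyl set)"
  obtains "b = (1, 0)" | j where "b = (0, axis j 1)"
  using assms unfolding Basis_cyl by auto

lemma cis_lat_period: "cis (lat \<xi> \<bullet> (x + (2 * pi) *\<^sub>R axis j 1)) = cis (lat \<xi> \<bullet> x)"
proof -
  have "cis (lat \<xi> \<bullet> (x + (2 * pi) *\<^sub>R axis j 1)) = cis (lat \<xi> \<bullet> x) * cis (2 * pi * of_int (\<xi> j))"
    unfolding cis_mult by (simp add: inner_add_right inner_axis)
  then show ?thesis by simp
qed

lemma has_vector_derivative_cis_line:
  "((\<lambda>s. cis (lat \<xi> \<bullet> (x + s *\<^sub>R e))) has_vector_derivative (\<i> * of_real (lat \<xi> \<bullet> e)) * cis (lat \<xi> \<bullet> x)) (at 0)"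
proof -
  have "((\<lambda>s. lat \<xi> \<bullet> (x + s *\<^sub>R e)) has_derivative (\<lambda>h. h * (lat \<xi> \<bullet> e))) (at 0)"
    by (auto intro!: derivative_eq_intros simp: inner_add_right)
  from has_derivative_cis[OF this] show ?thesis
    by (simp add: has_vector_derivative_def scaleR_conv_of_real mult_ac)
qed

fun mono_factor :: "('n::finite \<Rightarrow> int) \<Rightarrow> 'n cyl list \<Rightarrow> complex" where
  "mono_factor \<xi> [] = 1"
| "mono_factor \<xi> (b # bs) = (if b = (1, 0) then 1 else \<i> * of_real (lat \<xi> \<bullet> snd b)) * mono_factor \<xi> bs"

fun t_order :: "'n::finite cyl list \<Rightarrow> nat" where
  "t_order [] = 0"
| "t_order (b # bs) = (if b = (1, 0) then Suc (t_order bs) else t_order bs)"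

text \<open>The derivative along the list \<open>bs\<close> of the single mode
  \<open>U 0 (fst p) * cis (lat \<xi> \<bullet> snd p)\<close>: directions in t raise the index of
  U, directions in x contribute the scalar \<open>mono_factor\<close>.\<close>

definition wave :: "(nat \<Rightarrow> real \<Rightarrow> complex) \<Rightarrow> ('n::finite \<Rightarrow> int) \<Rightarrow> 'n cyl list \<Rightarrow> 'n cyl \<Rightarrow> complex" where
  "wave U \<xi> bs p = U (t_order bs) (fst p) * mono_factor \<xi> bs * cis (lat \<xi> \<bullet> snd p)"

lemma t_order_le: "t_order bs \<le> length bs"
  by (induction bs) auto

lemma mono_factor_bound: "set bs \<subseteq> Basis \<Longrightarrow> cmod (mono_factor \<xi> bs) \<le> norm (lat \<xi>) ^ (length bs - t_order bs)"
proof (induction bs)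
  case (Cons b bs)
  have IH: "cmod (mono_factor \<xi> bs) \<le> norm (lat \<xi>) ^ (length bs - t_order bs)" using Cons by simp
  from Cons(2) have "b \<in> Basis" by simp
  then show ?case
  proof (cases b rule: cyl_Basis_cases)
    case 1
    then show ?thesis using IH by simp
  next
    case (2 j)
    have ne: "b \<noteq> (1, 0)" using 2 by simp
    have "cmod (mono_factor \<xi> (b # bs)) = \<bar>of_int (\<xi> j)\<bar> * cmod (mono_factor \<xi> bs)"
      using ne 2 by (simp add: norm_mult inner_axis)
    also have "\<dots> \<le> norm (lat \<xi>) * norm (lat \<xi>) ^ (length bs - t_order bs)"
      using IH lat_le_norm[of \<xi> j] by (intro mult_mono) auto
    also have "\<dots> = norm (lat \<xi>) ^ (length (b # bs) - t_order (b # bs))"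
      using ne t_order_le[of bs] by (simp add: Suc_diff_le)
    finally show ?thesis .
  qed
qed simp

lemma wave_deriv:
  assumes U: "deriv_seq U" and b: "b \<in> Basis"
  shows "((\<lambda>s. wave U \<xi> bs (p + s *\<^sub>R b)) has_vector_derivative wave U \<xi> (b # bs) (p + t *\<^sub>R b)) (at t)"
proof (subst has_vector_derivative_shift)
  define q where "q = p + t *\<^sub>R b"
  show "((\<lambda>s. wave U \<xi> bs (q + s *\<^sub>R b)) has_vector_derivative wave U \<xi> (b # bs) q) (at 0)"
    using b
  proof (cases b rule: cyl_Basis_cases)
    case 1
    have "((\<lambda>s. U (t_order bs) (fst q + s *\<^sub>R 1)) has_vector_derivative U (Suc (t_order bs)) (fst q)) (at 0)"
      using deriv_seqD[OF U, of "t_order bs" "fst q"] has_vector_derivative_shift[of "U (t_order bs)" 0 1 _ "fst q"] by simp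
    then have "((\<lambda>s. U (t_order bs) (fst q + s *\<^sub>R 1) * (mono_factor \<xi> bs * cis (lat \<xi> \<bullet> snd q))) has_vector_derivative
      U (Suc (t_order bs)) (fst q) * (mono_factor \<xi> bs * cis (lat \<xi> \<bullet> snd q))) (at 0)"
      by (rule has_vector_derivative_mult_left)
    then show ?thesis using 1 by (simp add: wave_def mult.assoc)
  next
    case (2 j)
    have "((\<lambda>s. (U (t_order bs) (fst q) * mono_factor \<xi> bs) * cis (lat \<xi> \<bullet> (snd q + s *\<^sub>R axis j 1))) has_vector_derivative
      (U (t_order bs) (fst q) * mono_factor \<xi> bs) * ((\<i> * of_real (lat \<xi> \<bullet> axis j 1)) * cis (lat \<xi> \<bullet> snd q))) (at 0)"
      by (intro has_vector_derivative_mult_right has_vector_derivative_cis_line)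
    then show ?thesis using 2 by (simp add: wave_def mult_ac)
  qed
qed

lemma wave_continuous: "deriv_seq U \<Longrightarrow> continuous_on UNIV (wave U \<xi> bs)"
  unfolding wave_def[abs_def]
  by (intro continuous_intros continuous_on_compose2[OF deriv_seq_continuous[where S = UNIV]]) auto

context subadd_weight
begin

text \<open>The decay rate is \<open>2 * l\<close> while derivatives are measured with parameter l:
  one l pays for the powers of the frequency that x-derivatives produce, the other for summation
  over the lattice. C may depend on \<xi>, as needed for finite sums and for tails.\<close>

definition coef_bounded :: "real \<Rightarrow> (('n::finite \<Rightarrow> int) \<Rightarrow> real) \<Rightarrow> (('n \<Rightarrow> int) \<Rightarrow> nat \<Rightarrow> real \<Rightarrow> complex) \<Rightarrow> bool" where
  "coef_bounded l C U \<longleftrightarrow> (\<forall>\<xi>. deriv_seq (U \<xi>)) \<and> (\<forall>\<xi> t. U \<xi> 0 (t + 2 * pi) = U \<xi> 0 t) \<and>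
     (\<forall>\<xi> k t. cmod (U \<xi> k t) \<le> C \<xi> * M l k * exp (- 2 * l * \<omega> (norm (lat \<xi>))))"

text \<open>The q derivatives in x produce \<open>norm (lat \<xi>) ^ q\<close>.
  \<open>M_power\<close> bounds this by \<open>M l q\<close> and an exponential, and
  \<open>M_mult\<close> recombines the weight with that of the t-derivatives.\<close>

lemma wave_bound:
  assumes l: "l > 0" and U: "coef_bounded l C U" and bs: "set bs \<subseteq> Basis"
  shows "cmod (wave (U \<xi>) \<xi> bs p) \<le> M l (length bs) * exp (l * \<omega> 1) * (C \<xi> * exp (- l * \<omega> (norm (lat \<xi>))))"
proof -
  let ?y = "norm (lat \<xi>)" and ?k = "t_order bs" and ?n = "length bs"
  have Ub: "cmod (U \<xi> k t) \<le> C \<xi> * M l k * exp (- 2 * l * \<omega> ?y)" for k t using U unfolding coef_bounded_def by blast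
  have C0: "0 \<le> C \<xi>"
  proof -
    have "0 \<le> C \<xi> * M l 0 * exp (- 2 * l * \<omega> ?y)" using Ub[of 0 0] norm_ge_zero order_trans by blast
    then show ?thesis by (simp add: zero_le_mult_iff)
      (metis M_pos not_less)
  qed
  have "?y \<ge> 1 \<or> ?y = 0" using norm_lat_cases[of \<xi>] by auto
  then have pw: "?y ^ (?n - ?k) \<le> exp (l * \<omega> 1) * (M l (?n - ?k) * exp (l * \<omega> ?y))" using M_power[OF l] by blast
  have "cmod (wave (U \<xi>) \<xi> bs p) = cmod (U \<xi> ?k (fst p)) * cmod (mono_factor \<xi> bs)" by (simp add: wave_def norm_mult)
  also have "\<dots> \<le> (C \<xi> * M l ?k * exp (- 2 * l * \<omega> ?y)) * (exp (l * \<omega> 1) * (M l (?n - ?k) * exp (l * \<omega> ?y)))"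
    using Ub[of ?k "fst p"] order_trans[OF mono_factor_bound[OF bs, of \<xi>] pw] C0 by (intro mult_mono) auto
  also have "\<dots> = C \<xi> * exp (l * \<omega> 1) * exp (- l * \<omega> ?y) * (M l ?k * M l (?n - ?k))"
  proof -
    have "exp (- l * \<omega> ?y) = exp (- 2 * l * \<omega> ?y) * exp (l * \<omega> ?y)" by (simp add: exp_add[symmetric])
    then show ?thesis by (simp only: mult_ac)
  qed
  also have "\<dots> \<le> C \<xi> * exp (l * \<omega> 1) * exp (- l * \<omega> ?y) * M l ?n"
    using M_mult[OF l, of ?k "?n - ?k"] t_order_le[of bs] C0 by (intro mult_left_mono) auto
  finally show ?thesis by (simp add: mult_ac)
qed

text \<open>The part of the seminorm bound that depends on C. It is kept explicit because it tends
  to zero for the tails of a series.\<close>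

definition decay_sum :: "real \<Rightarrow> (('n::finite \<Rightarrow> int) \<Rightarrow> real) \<Rightarrow> real" where
  "decay_sum l C = (\<Sum>n. C (lat_enum n) * exp (- l * \<omega> (norm (lat (lat_enum n :: 'n \<Rightarrow> int)))))"

context
  fixes l Cm and C :: "('n::finite \<Rightarrow> int) \<Rightarrow> real" and U
  assumes l: "l > 0" and U: "coef_bounded l C U" and Cm: "\<And>\<xi>. C \<xi> \<le> Cm"
begin

lemma coef_nonneg: "0 \<le> C \<xi>"
proof -
  have "0 \<le> C \<xi> * M l 0 * exp (- 2 * l * \<omega> (norm (lat \<xi>)))"
    using U norm_ge_zero order_trans unfolding coef_bounded_def by blast
  then show ?thesis by (simp add: zero_le_mult_iff) (metis M_pos not_less)
qed

lemma summable_decay: "summable (\<lambda>n. C (lat_enum n) * exp (- l * \<omega> (norm (lat (lat_enum n :: 'n \<Rightarrow> int)))))"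
  by (rule summable_comparison_test'[OF summable_mult[OF summable_lattice[OF l], where c = Cm], of 0])
     (auto intro!: mult_right_mono Cm simp: coef_nonneg abs_mult)

lemma wave_series_deriv:
  fixes bs :: "'n cyl list"
  assumes bs: "set bs \<subseteq> Basis" and b: "b \<in> Basis"
  shows "((\<lambda>s. \<Sum>n. wave (U (lat_enum n)) (lat_enum n) bs (p + s *\<^sub>R b)) has_vector_derivative
          (\<Sum>n. wave (U (lat_enum n)) (lat_enum n) (b # bs) p)) (at 0)"
proof -
  have dU: "deriv_seq (U \<xi>)" for \<xi> using U by (simp add: coef_bounded_def)
  have bs': "set (b # bs) \<subseteq> Basis" using bs b by simp
  have "((\<lambda>s. \<Sum>n. wave (U (lat_enum n)) (lat_enum n) bs (p + s *\<^sub>R b)) has_vector_derivative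
          (\<Sum>n. wave (U (lat_enum n)) (lat_enum n) (b # bs) (p + 0 *\<^sub>R b))) (at 0)"
    by (rule has_vector_derivative_suminf[where f = "\<lambda>n s. wave (U (lat_enum n)) (lat_enum n) bs (p + s *\<^sub>R b)" and
          f' = "\<lambda>n s. wave (U (lat_enum n)) (lat_enum n) (b # bs) (p + s *\<^sub>R b)", OF wave_deriv[OF dU b]
          wave_bound[OF l U bs] wave_bound[OF l U bs']]) (intro summable_mult summable_decay)+
  then show ?thesis by simp
qed

lemma Dl_synth:
  "set bs \<subseteq> Basis \<Longrightarrow> Dl bs (synth (\<lambda>\<xi>. U \<xi> 0)) = (\<lambda>p. \<Sum>n. wave (U (lat_enum n)) (lat_enum n) bs p)"
proof (induction bs)
  case Nil
  show ?case by (simp add: synth_def[abs_def] wave_def)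
next
  case (Cons b bs)
  then have bs: "set bs \<subseteq> Basis" "b \<in> Basis" by auto
  show ?case using Cons(1)[OF bs(1)] vector_derivative_at[OF wave_series_deriv[OF bs]] by simp
qed

lemma synth_smooth: "synth (\<lambda>\<xi>. U \<xi> 0) \<in> Cinf_torus"
proof -
  let ?f = "synth (\<lambda>\<xi>. U \<xi> 0)"
  have dU: "deriv_seq (U \<xi>)" for \<xi> using U by (simp add: coef_bounded_def)
  have "smooth_fn ?f" unfolding smooth_fn_def
  proof (intro allI impI conjI ballI)
    fix bs :: "'n cyl list" assume bs: "set bs \<subseteq> Basis"
    show "continuous_on UNIV (Dl bs ?f)" unfolding Dl_synth[OF bs]
      by (rule continuous_on_suminf[OF wave_continuous[OF dU] wave_bound[OF l U bs]]) (intro summable_mult summable_decay)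
    fix b x assume b: "b \<in> (Basis :: 'n cyl set)"
    then have bs': "set (b # bs) \<subseteq> Basis" using bs by simp
    show "((\<lambda>s. Dl bs ?f (x + s *\<^sub>R b)) has_vector_derivative Dl (b # bs) ?f x) (at 0)"
      unfolding Dl_synth[OF bs] Dl_synth[OF bs'] by (rule wave_series_deriv[OF bs b])
  qed
  moreover have "periodic_fn ?f" unfolding periodic_fn_def
  proof (intro ballI allI)
    fix b x assume "b \<in> (Basis :: 'n cyl set)"
    then show "?f (x + (2 * pi) *\<^sub>R b) = ?f x"
    proof (cases b rule: cyl_Basis_cases)
      case 1
      then show ?thesis using U by (simp add: synth_def coef_bounded_def)
    next
      case (2 j)
      then show ?thesis by (simp add: synth_def cis_lat_period)
    qed
  qed
  ultimately show ?thesis by (simp add: Cinf_torus_def)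
qed

lemma Dl_synth_bound:
  assumes bs: "set bs \<subseteq> Basis"
  shows "cmod (Dl bs (synth (\<lambda>\<xi>. U \<xi> 0)) p) \<le> (exp (l * \<omega> 1) * decay_sum l C) * M l (length bs)"
proof -
  have "cmod (\<Sum>n. wave (U (lat_enum n)) (lat_enum n) bs p) \<le> (\<Sum>n. M l (length bs) * exp (l * \<omega> 1) * (C (lat_enum n) * exp (- l * \<omega> (norm (lat (lat_enum n :: 'n \<Rightarrow> int))))))"
    by (rule norm_suminf_le[OF wave_bound[OF l U bs]]) (intro summable_mult summable_decay)
  also have "\<dots> = M l (length bs) * exp (l * \<omega> 1) * decay_sum l C"
    unfolding decay_sum_def by (rule suminf_mult[OF summable_decay])
  finally show ?thesis unfolding Dl_synth[OF bs] by (simp add: mult_ac)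
qed

lemma synth_sums: "(\<lambda>n. U (lat_enum n) k t * cis (lat (lat_enum n) \<bullet> x)) sums synth (\<lambda>\<xi>. U \<xi> k) (t, x)"
proof -
  have "summable (\<lambda>n. U (lat_enum n) k t * cis (lat (lat_enum n) \<bullet> x))"
  proof (rule summable_comparison_test'[OF summable_mult[OF summable_decay, where c = "M l k"], of 0])
    fix n
    have "cmod (U (lat_enum n) k t) \<le> C (lat_enum n) * M l k * exp (- 2 * l * \<omega> (norm (lat (lat_enum n :: 'n \<Rightarrow> int))))"
      using U by (simp add: coef_bounded_def)
    also have "\<dots> \<le> C (lat_enum n) * M l k * exp (- l * \<omega> (norm (lat (lat_enum n :: 'n \<Rightarrow> int))))"
      using l w_nonneg[of "norm (lat (lat_enum n :: 'n \<Rightarrow> int))"] coef_nonneg by (intro mult_left_mono) auto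
    finally show "norm (U (lat_enum n) k t * cis (lat (lat_enum n) \<bullet> x)) \<le> M l k * (C (lat_enum n) * exp (- l * \<omega> (norm (lat (lat_enum n :: 'n \<Rightarrow> int)))))"
      by (simp add: norm_mult mult_ac)
  qed
  then show ?thesis by (simp add: synth_def summable_sums)
qed

lemma Dl_synth_t: "Dl [(1, 0)] (synth (\<lambda>\<xi>. U \<xi> 0)) = synth (\<lambda>\<xi>. U \<xi> 1)"
  by (subst Dl_synth) (auto simp: Basis_cyl wave_def synth_def fun_eq_iff)

lemma Dl_synth_x: "Dl [(0, axis j 1)] (synth (\<lambda>\<xi>. U \<xi> 0)) (t, x) = (\<Sum>n. (\<i> * of_int (lat_enum n j)) * (U (lat_enum n) 0 t * cis (lat (lat_enum n) \<bullet> x)))"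
  by (subst Dl_synth) (auto simp: Basis_cyl wave_def inner_axis mult_ac)

lemma Dl_synth_x_summable:
  fixes j :: 'n and x :: "real^'n"
  shows "summable (\<lambda>n. (\<i> * of_int (lat_enum n j)) * (U (lat_enum n) 0 t * cis (lat (lat_enum n) \<bullet> x)))"
proof -
  have bs: "set [(0, axis j 1)] \<subseteq> (Basis :: 'n cyl set)" by (auto simp: Basis_cyl)
  have "summable (\<lambda>n. wave (U (lat_enum n)) (lat_enum n) [(0, axis j 1)] (t, x))"
    by (rule summable_comparison_test'[where N = 0, OF summable_mult[OF summable_decay, where c = "M l (length [(0, axis j 1) :: 'n cyl]) * exp (l * \<omega> 1)"]])
       (rule wave_bound[OF l U bs])
  then show ?thesis by (simp add: wave_def inner_axis mult_ac)
qed

end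

end

section \<open>Fourier coefficients in x\<close>

lemma integral_cis_lat:
  fixes \<xi> :: "'n::finite \<Rightarrow> int"
  shows "integral torus_box (\<lambda>x. cis (lat \<xi> \<bullet> x)) = (if \<xi> = (\<lambda>_. 0) then (2 * of_real pi) ^ CARD('n) else 0)"
proof (cases "\<xi> = (\<lambda>_. 0)")
  case True
  then have "lat \<xi> = 0" by (simp add: vec_eq_iff)
  then have "integral torus_box (\<lambda>x. cis (lat \<xi> \<bullet> x)) = of_real (measure lborel (torus_box :: (real^'n) set))"
    unfolding torus_box_eq by (simp add: scaleR_conv_of_real)
  then show ?thesis using True by (simp add: content_torus_box)
next
  case False
  then obtain j where j: "\<xi> j \<noteq> 0" by auto
  have "integral torus_box (\<lambda>x. (\<i> * of_real (lat \<xi> \<bullet> axis j 1)) * cis (lat \<xi> \<bullet> x)) = 0"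
  proof (rule integral_deriv_periodic[OF _ _ _ has_vector_derivative_cis_line])
    show "periodic_fn (\<lambda>x. cis (lat \<xi> \<bullet> x))" by (auto simp: periodic_fn_def Basis_vec_def cis_lat_period)
  qed (auto intro!: continuous_intros simp: Basis_vec_def)
  then have "of_int (\<xi> j) * integral torus_box (\<lambda>x. cis (lat \<xi> \<bullet> x)) = 0" 
    by (simp add: inner_axis)
  then show ?thesis using j False by simp
qed

lemma fcoef_series:
  fixes u :: "('n::finite \<Rightarrow> int) \<Rightarrow> real \<Rightarrow> complex"
  assumes bound: "\<And>n. cmod (u (lat_enum n) t) \<le> B n" and sm: "summable B"
  shows "fcoef (synth u) \<xi> t = u \<xi> t"
proof -
  let ?V = "(2 * of_real pi) ^ CARD('n) :: complex"
  obtain m where m: "lat_enum m = \<xi>" using bij_lat_enum by (metis bij_pointE)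
  have eq: "lat_enum n = \<xi> \<longleftrightarrow> n = m" for n using m injD[OF bij_is_inj[OF bij_lat_enum], of n m] by auto
  let ?f = "\<lambda>n x. u (lat_enum n) t * cis (lat (\<lambda>j. lat_enum n j - \<xi> j) \<bullet> x)"
  have "(\<lambda>n. integral (cbox 0 torus_top) (?f n)) sums integral (cbox 0 torus_top) (\<lambda>x. \<Sum>n. ?f n x)"
    by (rule integral_suminf[OF _ _ sm]) (auto intro!: continuous_intros simp: norm_mult bound)
  moreover have "integral (cbox 0 torus_top) (?f n) = (if n = m then u \<xi> t * ?V else 0)" for n
  proof -
    have "(\<lambda>j. lat_enum n j - \<xi> j) = (\<lambda>_. 0) \<longleftrightarrow> n = m" using eq[of n] by (auto simp: fun_eq_iff)
    then have "integral torus_box (\<lambda>x. cis (lat (\<lambda>j. lat_enum n j - \<xi> j) \<bullet> x)) = (if n = m then ?V else 0)"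
      by (simp add: integral_cis_lat)
    then show ?thesis using m by (simp add: torus_box_eq)
  qed
  moreover have "(\<lambda>n. if n = m then u \<xi> t * ?V else 0) sums (u \<xi> t * ?V)" using sums_single[of m "\<lambda>_. u \<xi> t * ?V"] by simp
  ultimately have "integral (cbox 0 torus_top) (\<lambda>x. \<Sum>n. ?f n x) = u \<xi> t * ?V"
    by (simp only:) (rule sums_unique2)
  then have I: "integral torus_box (\<lambda>x. \<Sum>n. ?f n x) = u \<xi> t * ?V" by (simp only: torus_box_eq)
  have "synth u (t, x) * cis (- (lat \<xi> \<bullet> x)) = (\<Sum>n. ?f n x)" for x
  proof -
    have "summable (\<lambda>n. u (lat_enum n) t * cis (lat (lat_enum n) \<bullet> x))"
      by (rule summable_comparison_test'[OF sm, of 0]) (simp add: norm_mult bound)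
    then have "synth u (t, x) * cis (- (lat \<xi> \<bullet> x)) = (\<Sum>n. u (lat_enum n) t * cis (lat (lat_enum n) \<bullet> x) * cis (- (lat \<xi> \<bullet> x)))"
      unfolding synth_def fst_conv snd_conv by (rule suminf_mult2)
    then show ?thesis by (simp add: lat_diff inner_diff_left cis_mult mult.assoc)
  qed
  then show ?thesis unfolding fcoef_def using I by simp
qed

lemma fourier_unique_lattice:
  fixes r :: "real^'n::finite \<Rightarrow> complex"
  assumes cont: "continuous_on UNIV r" and per: "periodic_fn r"
    and coeff: "\<And>\<xi>. integral torus_box (\<lambda>x. r x * cis (- (lat \<xi> \<bullet> x))) = 0"
  shows "r x = 0"
proof (rule fourier_unique[OF cont per])
  fix k :: "real^'n" assume "\<forall>b\<in>Basis. k \<bullet> b \<in> \<int>"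
  then have kj: "k $ j \<in> \<int>" for j using bspec[of Basis _ "axis j 1"] by (force simp: inner_axis Basis_vec_def)
  have fl: "of_int \<lfloor>k $ j\<rfloor> = k $ j" for j using kj[of j] by (rule of_int_floor)
  have "k = - lat (\<lambda>j. - \<lfloor>k $ j\<rfloor>)" unfolding vec_eq_iff vector_uminus_component lat_component of_int_minus minus_minus fl by blast
  then have "k \<bullet> x = - (lat (\<lambda>j. - \<lfloor>k $ j\<rfloor>) \<bullet> x)" for x by (metis inner_minus_left)
  then show "integral torus_box (\<lambda>x. r x * cis (k \<bullet> x)) = 0" using coeff[of "\<lambda>j. - \<lfloor>k $ j\<rfloor>"] by simp
qed

lemma Dl_periodic:
  assumes "periodic_fn f" shows "periodic_fn (Dl bs f)"
proof (induction bs)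
  case Nil
  show ?case using assms by simp
next
  case (Cons b bs)
  have "Dl bs f ((x + (2 * pi) *\<^sub>R e) + s *\<^sub>R b) = Dl bs f (x + s *\<^sub>R b)" if "e \<in> Basis" for x e s
  proof -
    have "Dl bs f ((x + s *\<^sub>R b) + (2 * pi) *\<^sub>R e) = Dl bs f (x + s *\<^sub>R b)"
      using Cons that unfolding periodic_fn_def by blast
    then show ?thesis by (simp add: add_ac)
  qed
  then show ?case by (simp add: periodic_fn_def)
qed

lemma Dl_smooth: 
  assumes "smooth_fn f" "set bs \<subseteq> Basis"
  shows "continuous_on UNIV (Dl bs f)"
    and "b \<in> Basis \<Longrightarrow> ((\<lambda>s::real. Dl bs f (x + s *\<^sub>R b)) has_vector_derivative Dl (b # bs) f (x + t *\<^sub>R b)) (at t)"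
proof -
  show "continuous_on UNIV (Dl bs f)" using assms unfolding smooth_fn_def by blast
  show "((\<lambda>s::real. Dl bs f (x + s *\<^sub>R b)) has_vector_derivative Dl (b # bs) f (x + t *\<^sub>R b)) (at t)" if "b \<in> Basis"
    unfolding has_vector_derivative_shift[of _ x b _ t] using assms that unfolding smooth_fn_def by blast
qed

lemma Dl_lincomb:
  assumes f: "smooth_fn f" and g: "smooth_fn g"
  shows "set bs \<subseteq> Basis \<Longrightarrow> Dl bs (\<lambda>x. c * f x + d * g x) = (\<lambda>x. c * Dl bs f x + d * Dl bs g x)"
proof (induction bs)
  case (Cons b bs)
  then have bs: "set bs \<subseteq> Basis" "b \<in> Basis" by auto
  have "((\<lambda>s. c * Dl bs f (x + s *\<^sub>R b) + d * Dl bs g (x + s *\<^sub>R b)) has_vector_derivative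
      c * Dl (b # bs) f (x + 0 *\<^sub>R b) + d * Dl (b # bs) g (x + 0 *\<^sub>R b)) (at 0)" for x
    by (intro has_vector_derivative_add has_vector_derivative_mult_right Dl_smooth f g bs)
  from vector_derivative_at[OF this] show ?case using Cons(1)[OF bs(1)] by simp
qed simp

lemma Cinf_lincomb:
  assumes f: "f \<in> Cinf_torus" and g: "g \<in> Cinf_torus"
  shows "(\<lambda>x. c * f x + d * g x) \<in> Cinf_torus"
proof -
  have s: "smooth_fn f" "smooth_fn g" and p: "periodic_fn f" "periodic_fn g" using f g by (auto simp: Cinf_torus_def)
  have "smooth_fn (\<lambda>x. c * f x + d * g x)"
    unfolding smooth_fn_def
  proof (intro allI impI conjI ballI)
    fix bs :: "'a list" assume bs: "set bs \<subseteq> Basis"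
    show "continuous_on UNIV (Dl bs (\<lambda>x. c * f x + d * g x))"
      unfolding Dl_lincomb[OF s bs] by (intro continuous_intros Dl_smooth s bs)
    fix b x assume b: "b \<in> (Basis :: 'a set)"
    then have bs': "set (b # bs) \<subseteq> Basis" using bs by simp
    have "((\<lambda>s. c * Dl bs f (x + s *\<^sub>R b) + d * Dl bs g (x + s *\<^sub>R b)) has_vector_derivative
      c * Dl (b # bs) f (x + 0 *\<^sub>R b) + d * Dl (b # bs) g (x + 0 *\<^sub>R b)) (at 0)"
      by (intro has_vector_derivative_add has_vector_derivative_mult_right Dl_smooth s b bs)
    then show "((\<lambda>s. Dl bs (\<lambda>x. c * f x + d * g x) (x + s *\<^sub>R b)) has_vector_derivative Dl (b # bs) (\<lambda>x. c * f x + d * g x) x) (at 0)"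
      unfolding Dl_lincomb[OF s bs] Dl_lincomb[OF s bs'] by simp
  qed
  then show ?thesis using p by (simp add: Cinf_torus_def periodic_fn_def)
qed

lemma fcoef_bound:
  fixes F :: "'n::finite cyl \<Rightarrow> complex"
  assumes F: "continuous_on UNIV F" and B: "\<And>x. cmod (F (t, x)) \<le> B"
  shows "cmod (fcoef F \<xi> t) \<le> B"
proof -
  have B0: "0 \<le> B" using B[of 0] norm_ge_zero order_trans by blast
  have "continuous_on UNIV (\<lambda>x. F (t, x) * cis (- (lat \<xi> \<bullet> x)))"
    by (intro continuous_intros continuous_on_compose2[OF F]) auto
  from integrable_integral[OF integrable_torus[OF this]]
  have "((\<lambda>x. F (t, x) * cis (- (lat \<xi> \<bullet> x))) has_integral integral torus_box (\<lambda>x. F (t, x) * cis (- (lat \<xi> \<bullet> x)))) (cbox 0 torus_top)"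
    by (simp only: torus_box_eq)
  from has_integral_bound[OF B0 this]
  have "cmod (integral torus_box (\<lambda>x. F (t, x) * cis (- (lat \<xi> \<bullet> x)))) \<le> B * measure lborel (torus_box :: (real^'n) set)"
    using B by (simp add: norm_mult torus_box_eq)
  also have "\<dots> = B * (2 * pi) ^ CARD('n)" by (simp add: content_torus_box)
  finally show ?thesis by (simp add: fcoef_def norm_divide norm_power norm_mult divide_le_eq)
qed

lemma fcoef_deriv_t:
  fixes f :: "'n::finite cyl \<Rightarrow> complex"
  assumes f: "smooth_fn f" and bs: "set bs \<subseteq> Basis"
  shows "(fcoef (Dl bs f) \<xi> has_vector_derivative fcoef (Dl ((1, 0) # bs) f) \<xi> t) (at t)"
proof -
  let ?g = "\<lambda>t x. Dl bs f (t, x) * cis (- (lat \<xi> \<bullet> x))"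
  let ?g' = "\<lambda>t x. Dl ((1, 0) # bs) f (t, x) * cis (- (lat \<xi> \<bullet> x))"
  have e: "(1, 0) \<in> (Basis :: 'n cyl set)" by (simp add: Basis_cyl)
  have bs': "set ((1, 0) # bs) \<subseteq> Basis" using bs e by simp
  note c = Dl_smooth(1)[OF f bs] and c' = Dl_smooth(1)[OF f bs']
  have "((\<lambda>t. integral (cbox 0 torus_top) (?g t)) has_vector_derivative integral (cbox 0 torus_top) (?g' t)) (at t within UNIV)"
  proof (rule leibniz_rule_vector_derivative)
    fix s :: real and x :: "real^'n"
    have "((\<lambda>s. Dl bs f ((0, x) + s *\<^sub>R (1, 0))) has_vector_derivative Dl ((1, 0) # bs) f ((0, x) + s *\<^sub>R (1, 0))) (at s)"
      by (rule Dl_smooth(2)[OF f bs e])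
    then have "((\<lambda>s. Dl bs f (s, x)) has_vector_derivative Dl ((1, 0) # bs) f (s, x)) (at s)" by (simp del: Dl.simps)
    then show "((\<lambda>s. ?g s x) has_vector_derivative ?g' s x) (at s within UNIV)"
      by (intro has_vector_derivative_mult_left) simp
  next
    show "?g s integrable_on cbox 0 torus_top" for s
      by (intro integrable_continuous continuous_intros continuous_on_compose2[OF c]) auto
    show "continuous_on (UNIV \<times> cbox 0 torus_top) (\<lambda>(s, x). ?g' s x)"
      unfolding split_def by (intro continuous_intros continuous_on_compose2[OF c']) auto
  qed auto
  then have "((\<lambda>t. integral torus_box (?g t) / (2 * of_real pi) ^ CARD('n)) has_vector_derivative
      integral torus_box (?g' t) / (2 * of_real pi) ^ CARD('n)) (at t)"
    unfolding torus_box_eq by (intro has_vector_derivative_divide) simp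
  then show ?thesis unfolding fcoef_def[abs_def] .
qed

text \<open>Integration by parts in x, in the form that the derivative of \<open>Dl bs f\<close>
  times the exponential has integral zero over the period box.\<close>

lemma fcoef_deriv_x:
  fixes f :: "'n::finite cyl \<Rightarrow> complex"
  assumes f: "smooth_fn f" "periodic_fn f" and bs: "set bs \<subseteq> Basis"
  shows "fcoef (Dl ((0, axis j 1) # bs) f) \<xi> t = \<i> * of_int (\<xi> j) * fcoef (Dl bs f) \<xi> t"
proof -
  let ?e = "axis j 1 :: real^'n"
  let ?G = "\<lambda>x. Dl bs f (t, x)" and ?G' = "\<lambda>x. Dl ((0, ?e) # bs) f (t, x)"
  let ?n = "\<lambda>i. - \<xi> i"
  have e: "(0, ?e) \<in> (Basis :: 'n cyl set)" by (simp add: Basis_cyl)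
  have bs': "set ((0, ?e) # bs) \<subseteq> Basis" using bs e by simp
  note c = Dl_smooth(1)[OF f(1) bs] and c' = Dl_smooth(1)[OF f(1) bs']
  have cG: "continuous_on UNIV ?G" "continuous_on UNIV ?G'"
    by (rule continuous_on_compose2[OF c] continuous_on_compose2[OF c']; auto intro!: continuous_intros)+
  have "integral torus_box (\<lambda>x. ?G x * ((\<i> * of_real (lat ?n \<bullet> ?e)) * cis (lat ?n \<bullet> x)) + ?G' x * cis (lat ?n \<bullet> x)) = 0"
  proof (rule integral_deriv_periodic[where f = "\<lambda>x. ?G x * cis (lat ?n \<bullet> x)" and b = ?e])
    show "continuous_on UNIV (\<lambda>x. ?G x * cis (lat ?n \<bullet> x))" by (intro continuous_intros cG)
    show "continuous_on UNIV (\<lambda>x. ?G x * ((\<i> * of_real (lat ?n \<bullet> ?e)) * cis (lat ?n \<bullet> x)) + ?G' x * cis (lat ?n \<bullet> x))"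
      by (intro continuous_intros cG)
    show "?e \<in> Basis" by (auto simp: Basis_vec_def)
    show "periodic_fn (\<lambda>x. ?G x * cis (lat ?n \<bullet> x))" unfolding periodic_fn_def
    proof (intro ballI allI)
      fix b x assume "b \<in> (Basis :: (real^'n) set)"
      then obtain i where b: "b = axis i 1" by (auto simp: Basis_vec_def)
      have "Dl bs f ((t, x) + (2 * pi) *\<^sub>R (0, axis i 1)) = Dl bs f (t, x)"
        using Dl_periodic[OF f(2), of bs] unfolding periodic_fn_def by (auto simp: Basis_cyl)
      then show "?G (x + (2 * pi) *\<^sub>R b) * cis (lat ?n \<bullet> (x + (2 * pi) *\<^sub>R b)) = ?G x * cis (lat ?n \<bullet> x)"
        unfolding b cis_lat_period by simp
    qed
    fix x
    have "((\<lambda>s. Dl bs f ((t, x) + s *\<^sub>R (0, ?e))) has_vector_derivative Dl ((0, ?e) # bs) f ((t, x) + 0 *\<^sub>R (0, ?e))) (at 0)"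
      by (rule Dl_smooth(2)[OF f(1) bs e])
    then have d: "((\<lambda>s. ?G (x + s *\<^sub>R ?e)) has_vector_derivative ?G' x) (at 0)" by (simp del: Dl.simps)
    show "((\<lambda>s. ?G (x + s *\<^sub>R ?e) * cis (lat ?n \<bullet> (x + s *\<^sub>R ?e))) has_vector_derivative
        ?G x * ((\<i> * of_real (lat ?n \<bullet> ?e)) * cis (lat ?n \<bullet> x)) + ?G' x * cis (lat ?n \<bullet> x)) (at 0)"
      using has_vector_derivative_mult[OF d has_vector_derivative_cis_line[of ?n x ?e]] by simp
  qed
  also have "(\<lambda>x. ?G x * ((\<i> * of_real (lat ?n \<bullet> ?e)) * cis (lat ?n \<bullet> x)) + ?G' x * cis (lat ?n \<bullet> x))
     = (\<lambda>x. (- \<i> * of_int (\<xi> j)) * (?G x * cis (- (lat \<xi> \<bullet> x))) + ?G' x * cis (- (lat \<xi> \<bullet> x)))"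
    by (simp add: lat_minus inner_axis fun_eq_iff mult_ac)
  also have "integral torus_box \<dots> = (- \<i> * of_int (\<xi> j)) * integral torus_box (\<lambda>x. ?G x * cis (- (lat \<xi> \<bullet> x)))
       + integral torus_box (\<lambda>x. ?G' x * cis (- (lat \<xi> \<bullet> x)))"
    by (subst integral_add) (auto intro!: integrable_torus continuous_intros cG simp del: Dl.simps)
  finally have "integral torus_box (\<lambda>x. ?G' x * cis (- (lat \<xi> \<bullet> x))) = \<i> * of_int (\<xi> j) * integral torus_box (\<lambda>x. ?G x * cis (- (lat \<xi> \<bullet> x)))"
    by (simp add: add_eq_0_iff del: Dl.simps)
  then show ?thesis unfolding fcoef_def by (simp del: Dl.simps)
qed

lemma fcoef_periodic:
  assumes "periodic_fn f" shows "fcoef f \<xi> (t + 2 * pi) = fcoef f \<xi> t"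
proof -
  have "f ((t, x) + (2 * pi) *\<^sub>R (1, 0)) = f (t, x)" for x
    using assms unfolding periodic_fn_def by (auto simp: Basis_cyl)
  then show ?thesis by (simp add: fcoef_def)
qed

section \<open>Seminorms and decay of coefficients\<close>

context subadd_weight
begin

text \<open>\<open>norm_lam\<close> is a \<open>Sup\<close> and only meaningful for bounded sets of
  values. Estimates are stated with this predicate, which contains the boundedness.\<close>

definition seminorm_le :: "real \<Rightarrow> real \<Rightarrow> ('a::euclidean_space \<Rightarrow> complex) \<Rightarrow> bool" where
  "seminorm_le l Q f \<longleftrightarrow> (\<forall>bs x. set bs \<subseteq> Basis \<longrightarrow> cmod (Dl bs f x) \<le> Q * M l (length bs))"

lemma seminorm_leD: "seminorm_le l Q f \<Longrightarrow> set bs \<subseteq> Basis \<Longrightarrow> cmod (Dl bs f x) \<le> Q * M l (length bs)"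
  by (simp add: seminorm_le_def)

lemma seminorm_vals_eq: "seminorm_vals \<omega> l f = {cmod (Dl bs f x) / M l (length bs) | x bs. set bs \<subseteq> Basis}"
  by (simp add: seminorm_vals_def weight_seq_def exp_minus divide_inverse)

lemma seminorm_le_iff: "seminorm_le l Q f \<longleftrightarrow> (\<forall>v\<in>seminorm_vals \<omega> l f. v \<le> Q)"
proof -
  have "(\<forall>v\<in>seminorm_vals \<omega> l f. v \<le> Q) \<longleftrightarrow> (\<forall>bs x. set bs \<subseteq> Basis \<longrightarrow> cmod (Dl bs f x) / M l (length bs) \<le> Q)"
    unfolding seminorm_vals_eq by blast
  then show ?thesis by (simp add: seminorm_le_def pos_divide_le_eq)
qed

lemma bdd_seminorm_iff: "bdd_above (seminorm_vals \<omega> l f) \<longleftrightarrow> (\<exists>Q. seminorm_le l Q f)"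
  by (simp add: seminorm_le_iff bdd_above_def)

lemma seminorm_vals_nonempty: "seminorm_vals \<omega> l f \<noteq> {}"
  unfolding seminorm_vals_eq by (auto intro: exI[of _ "[]"])

lemma norm_lam_le: "seminorm_le l Q f \<Longrightarrow> norm_lam \<omega> l f \<le> Q"
  unfolding norm_lam_def seminorm_le_iff using seminorm_vals_nonempty by (intro cSup_least) auto

lemma seminorm_le_norm: "f \<in> Estep \<omega> k \<Longrightarrow> seminorm_le (1 / real k) (norm_lam \<omega> (1 / real k) f) f"
  unfolding norm_lam_def seminorm_le_iff by (auto intro: cSup_upper simp: Estep_def)

lemma seminorm_le_nonneg: "seminorm_le l Q f \<Longrightarrow> 0 \<le> Q"
proof -
  assume "seminorm_le l Q f"
  then have "0 \<le> Q * M l 0" using order_trans[OF norm_ge_zero seminorm_leD[of l Q f "[]" 0]] by simp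
  then show ?thesis by (simp add: zero_le_mult_iff) (metis M_pos not_less)
qed

lemma seminorm_le_mono:
  fixes f :: "'a::euclidean_space \<Rightarrow> complex"
  assumes "seminorm_le l Q f" "0 < l'" "l' \<le> l" "Q \<le> Q'" shows "seminorm_le l' Q' f"
  unfolding seminorm_le_def
proof (intro allI impI)
  fix bs :: "'a list" and x assume "set bs \<subseteq> Basis"
  then have "cmod (Dl bs f x) \<le> Q * M l (length bs)" using assms(1) by (rule seminorm_leD[rotated])
  also have "\<dots> \<le> Q' * M l' (length bs)"
    using assms seminorm_le_nonneg[OF assms(1)] by (intro mult_mono M_antimono) auto
  finally show "cmod (Dl bs f x) \<le> Q' * M l' (length bs)" .
qed

lemma E_om_iff: "f \<in> E_om \<omega> \<longleftrightarrow> f \<in> Cinf_torus \<and> (\<exists>l>0. \<exists>Q. seminorm_le l Q f)"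
  by (auto simp: E_om_def bdd_seminorm_iff)

lemma Estep_iff: "f \<in> Estep \<omega> k \<longleftrightarrow> f \<in> Cinf_torus \<and> (\<exists>Q. seminorm_le (1 / real k) Q f)"
  by (auto simp: Estep_def bdd_seminorm_iff)

lemma Estep_E_om: "k \<ge> 1 \<Longrightarrow> f \<in> Estep \<omega> k \<Longrightarrow> f \<in> E_om \<omega>"
  unfolding E_om_iff Estep_iff by (metis of_nat_0_less_iff less_le_trans zero_less_one zero_less_divide_1_iff)

lemma small_step:
  assumes "l > 0" obtains k where "k \<ge> 1" "1 / real k \<le> l"
proof -
  obtain k where k: "1 / l < real k" using reals_Archimedean2 by blast
  then have "0 < real k" using assms by (smt (verit) divide_pos_pos)
  then show ?thesis using that[of k] k assms by (simp add: field_simps)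
qed

lemma seminorm_le_lincomb:
  fixes f g :: "'a::euclidean_space \<Rightarrow> complex"
  assumes "seminorm_le l P f" "seminorm_le l Q g" "f \<in> Cinf_torus" "g \<in> Cinf_torus"
  shows "seminorm_le l (cmod c * P + cmod d * Q) (\<lambda>x. c * f x + d * g x)"
  unfolding seminorm_le_def
proof (intro allI impI)
  fix bs x assume bs: "set bs \<subseteq> (Basis :: 'a set)"
  have s: "smooth_fn f" "smooth_fn g" using assms by (auto simp: Cinf_torus_def)
  have "cmod (c * Dl bs f x + d * Dl bs g x) \<le> cmod c * (P * M l (length bs)) + cmod d * (Q * M l (length bs))"
    unfolding norm_mult[symmetric]
    by (rule order_trans[OF norm_triangle_ineq]) (auto simp: norm_mult intro!: add_mono mult_left_mono seminorm_leD assms bs)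
  then show "cmod (Dl bs (\<lambda>x. c * f x + d * g x) x) \<le> (cmod c * P + cmod d * Q) * M l (length bs)"
    unfolding Dl_lincomb[OF s bs] by (simp add: algebra_simps)
qed

lemma E_om_lincomb:
  assumes "f \<in> E_om \<omega>" "g \<in> E_om \<omega>" shows "(\<lambda>x. c * f x + d * g x) \<in> E_om \<omega>"
proof -
  obtain l P l' Q where *: "l > 0" "seminorm_le l P f" "l' > 0" "seminorm_le l' Q g" "f \<in> Cinf_torus" "g \<in> Cinf_torus"
    using assms unfolding E_om_iff by auto
  have "seminorm_le (min l l') P f" "seminorm_le (min l l') Q g"
    using * by (auto intro: seminorm_le_mono)
  then have "seminorm_le (min l l') (cmod c * P + cmod d * Q) (\<lambda>x. c * f x + d * g x)" using * by (intro seminorm_le_lincomb) auto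
  moreover have "min l l' > 0" using * by simp
  ultimately show ?thesis unfolding E_om_iff using * Cinf_lincomb by blast
qed

lemma synth_E_om:
  assumes "l > 0" "coef_bounded l C U" "\<And>\<xi>. C \<xi> \<le> Cm"
  shows "seminorm_le l (exp (l * \<omega> 1) * decay_sum l C) (synth (\<lambda>\<xi>. U \<xi> 0))" "synth (\<lambda>\<xi>. U \<xi> 0) \<in> E_om \<omega>"
proof -
  show 1: "seminorm_le l (exp (l * \<omega> 1) * decay_sum l C) (synth (\<lambda>\<xi>. U \<xi> 0))"
    unfolding seminorm_le_def using Dl_synth_bound[OF assms] by blast
  show "synth (\<lambda>\<xi>. U \<xi> 0) \<in> E_om \<omega>" unfolding E_om_iff using 1 assms(1) synth_smooth[OF assms] by blast
qed

lemma coef_bounded_mono: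
  assumes U: "coef_bounded l C U" and l: "0 < l'" "l' \<le> l" and C: "\<And>\<xi>. C \<xi> \<le> C' \<xi>" "\<And>\<xi>. 0 \<le> C' \<xi>"
  shows "coef_bounded l' C' U"
proof -
  have "cmod (U \<xi> k t) \<le> C' \<xi> * M l' k * exp (- 2 * l' * \<omega> (norm (lat \<xi>)))" for \<xi> k t
  proof -
    have "cmod (U \<xi> k t) \<le> C \<xi> * M l k * exp (- 2 * l * \<omega> (norm (lat \<xi>)))" using U by (simp add: coef_bounded_def)
    also have "\<dots> \<le> C' \<xi> * M l' k * exp (- 2 * l' * \<omega> (norm (lat \<xi>)))"
      using l C w_nonneg[of "norm (lat \<xi>)"] by (intro mult_mono M_antimono mult_nonneg_nonneg) (auto intro!: mult_right_mono)
    finally show ?thesis .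
  qed
  then show ?thesis using U by (simp add: coef_bounded_def)
qed

text \<open>One coordinate is comparable with the whole frequency, so decay can be extracted from
  repeated derivatives in a single direction.\<close>

lemma max_component:
  fixes \<xi> :: "'n::finite \<Rightarrow> int"
  obtains j where "norm (lat \<xi>) \<le> real CARD('n) * \<bar>of_int (\<xi> j)\<bar>"
proof -
  have "Max (range (\<lambda>i. \<bar>\<xi> i\<bar>)) \<in> range (\<lambda>i. \<bar>\<xi> i\<bar>)" by (intro Max_in) auto
  then obtain j where j: "\<bar>\<xi> j\<bar> = Max (range (\<lambda>i. \<bar>\<xi> i\<bar>))" by (metis rangeE)
  have le: "\<bar>\<xi> i\<bar> \<le> \<bar>\<xi> j\<bar>" for i unfolding j by (intro Max_ge) auto
  have "norm (lat \<xi>) \<le> (\<Sum>i\<in>UNIV. \<bar>lat \<xi> $ i\<bar>)" by (rule norm_le_l1_cart)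
  also have "\<dots> \<le> (\<Sum>i\<in>(UNIV::'n set). \<bar>of_int (\<xi> j)\<bar>)"
    using le by (intro sum_mono) (simp flip: of_int_abs)
  finally show ?thesis using that[of j] by simp
qed

text \<open>Derivatives in the direction of the largest coordinate bound every power
  \<open>\<bar>of_int (\<xi> j)\<bar> ^ m\<close> times the coefficient by a multiple of
  \<open>M (l / 2) m\<close>, and \<open>decay_of_M\<close> converts this into exponential decay.
  \<open>K\<close> and \<open>l'\<close> are chosen before f and Q; this uniformity makes
  functionals given by series of coefficients continuous.\<close>

lemma coef_decay:
  assumes l: "l > 0"
  obtains l' K where "0 < l'" "l' \<le> l" "0 \<le> K"
    "\<And>(f :: 'n::finite cyl \<Rightarrow> complex) Q. f \<in> Cinf_torus \<Longrightarrow> seminorm_le l Q f \<Longrightarrow>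
      coef_bounded l' (\<lambda>_. K * Q) (\<lambda>\<xi> k. fcoef (Dl (replicate k (1, 0)) f) \<xi>)"
proof -
  define N where "N = real CARD('n)"
  have N: "N \<ge> 1" by (simp add: N_def Suc_leI)
  \<comment> \<open>\<open>decay_of_M\<close> yields the rate l / 2 in the coordinate up to a factor
    y, which uses up l / 4. Comparing the coordinate with the norm costs the factor N, and
    \<open>2 * l' * N = l / 4\<close>.\<close>
  define l' where "l' = l / (8 * N)"
  have l'0: "0 < l'" unfolding l'_def using l N by (intro divide_pos_pos) linarith+
  have l'2: "l' \<le> l / 2" unfolding l'_def by (rule frac_le) (use l N in linarith)+
  note l' = l'0 l'2
  have l4: "l / 4 > 0" using l by simp
  obtain C1 where C1: "C1 > 0" "\<And>t. t \<ge> 0 \<Longrightarrow> (1 + t) ^ 1 \<le> C1 * exp ((l / 4) * \<omega> t)"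
    using power_le_exp_w[OF l4, of 1] by blast
  \<comment> \<open>The second summand is for the zero frequency, where
    \<open>exp (- 2 * l' * \<omega> 0)\<close> may be less than one.\<close>
  define K where "K = C1 + exp (l * \<omega> 0)"
  have K: "0 \<le> K" "C1 \<le> K" "exp (l * \<omega> 0) \<le> K" using C1(1) by (auto simp: K_def)
  show ?thesis
  proof (rule that[of l' K])
    fix f :: "'n cyl \<Rightarrow> complex" and Q
    assume f: "f \<in> Cinf_torus" and Q: "seminorm_le l Q f"
    let ?U = "\<lambda>\<xi> k. fcoef (Dl (replicate k (1, 0)) f) \<xi>"
    have s: "smooth_fn f" "periodic_fn f" using f by (auto simp: Cinf_torus_def)
    have Q0: "0 \<le> Q" by (rule seminorm_le_nonneg[OF Q])
    have rep: "set (replicate k (1, 0)) \<subseteq> (Basis :: 'n cyl set)" for k by (auto simp: Basis_cyl)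
    have rep2: "set (replicate m (0, axis j 1) @ replicate k (1, 0)) \<subseteq> (Basis :: 'n cyl set)" for m k j by (auto simp: Basis_cyl)
    have "coef_bounded l' (\<lambda>_. K * Q) ?U" unfolding coef_bounded_def
    proof (intro conjI allI)
      show "deriv_seq (?U \<xi>)" for \<xi>
        unfolding deriv_seq_def replicate_Suc by (intro allI fcoef_deriv_t s rep)
      show "?U \<xi> 0 (t + 2 * pi) = ?U \<xi> 0 t" for \<xi> t by (simp add: fcoef_periodic s(2))
      fix \<xi> :: "'n \<Rightarrow> int" and k t
      obtain j where "norm (lat \<xi>) \<le> real CARD('n) * \<bar>of_int (\<xi> j)\<bar>" by (rule max_component[of \<xi>])
      then have j: "norm (lat \<xi>) \<le> N * \<bar>of_int (\<xi> j)\<bar>" by (simp only: N_def)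
      have pw: "fcoef (Dl (replicate m (0, axis j 1) @ replicate k (1, 0)) f) \<xi> t = (\<i> * of_int (\<xi> j)) ^ m * ?U \<xi> k t" for m
      proof (induction m)
        case (Suc m)
        show ?case unfolding replicate_Suc append_Cons fcoef_deriv_x[OF s rep2] Suc.IH by simp
      qed simp
      have main: "\<bar>of_int (\<xi> j)\<bar> ^ m * cmod (?U \<xi> k t) \<le> (Q * M (l / 2) k) * M (l / 2) m" for m
      proof -
        have "\<bar>of_int (\<xi> j)\<bar> ^ m * cmod (?U \<xi> k t) = cmod (fcoef (Dl (replicate m (0, axis j 1) @ replicate k (1, 0)) f) \<xi> t)"
          unfolding pw by (simp add: norm_mult norm_power)
        also have "\<dots> \<le> Q * M l (m + k)"
          using seminorm_leD[OF Q rep2, of m j k] by (intro fcoef_bound Dl_smooth s rep2) auto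
        also have "\<dots> \<le> Q * (M (l / 2) m * M (l / 2) k)" using Q0 l by (intro mult_left_mono M_split) auto
        finally show ?thesis by (simp add: mult_ac)
      qed
      have Mk: "M (l / 2) k \<le> M l' k" using l' by (intro M_antimono) auto
      show "cmod (?U \<xi> k t) \<le> K * Q * M l' k * exp (- 2 * l' * \<omega> (norm (lat \<xi>)))"
      proof (cases "\<xi> j = 0")
        case True
        then have z: "norm (lat \<xi>) = 0" using j by simp
        have "cmod (?U \<xi> k t) \<le> Q * M (l / 2) k * M (l / 2) 0" using main[of 0] by simp
        also have "\<dots> \<le> Q * M (l / 2) k * 1" using l Q0 w_nonneg[of 1] by (intro mult_left_mono) (auto simp: M_0)
        also have "\<dots> \<le> Q * M l' k * (exp (l * \<omega> 0) * exp (- 2 * l' * \<omega> 0))"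
        proof -
          have "2 * l' * \<omega> 0 \<le> l * \<omega> 0" using l' w_nonneg[of 0] by (intro mult_right_mono) auto
          then have "1 \<le> exp (l * \<omega> 0) * exp (- 2 * l' * \<omega> 0)" by (simp add: exp_add[symmetric])
          then show ?thesis using Mk Q0 by (intro mult_mono) auto
        qed
        also have "\<dots> \<le> Q * M l' k * (K * exp (- 2 * l' * \<omega> 0))" using K Q0 by (intro mult_left_mono mult_right_mono) auto
        finally show ?thesis unfolding z by (simp add: mult_ac)
      next
        case False
        define y where "y = \<bar>real_of_int (\<xi> j)\<bar>"
        have y: "y \<ge> 1" using False by (simp add: y_def flip: of_int_abs)
        have ye: "y * exp (- (l / 2) * \<omega> y) \<le> K * exp (- 2 * l' * \<omega> (norm (lat \<xi>)))"
        proof -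
          have "\<omega> (norm (lat \<xi>)) \<le> \<omega> (N * y)" using j by (intro w_mono) (auto simp: y_def)
          also have "\<dots> \<le> N * \<omega> y" unfolding N_def using y by (intro w_mult') (auto simp: Suc_leI)
          finally have "2 * l' * \<omega> (norm (lat \<xi>)) \<le> 2 * l' * (N * \<omega> y)" using l' by (intro mult_left_mono) auto
          also have "\<dots> = (l / 4) * \<omega> y" using N by (simp add: l'_def)
          finally have e: "exp (- (l / 4) * \<omega> y) \<le> exp (- 2 * l' * \<omega> (norm (lat \<xi>)))" by simp
          have "y * exp (- (l / 2) * \<omega> y) \<le> (C1 * exp ((l / 4) * \<omega> y)) * exp (- (l / 2) * \<omega> y)"
            using C1(2)[of y] y by (intro mult_right_mono) auto
          also have "\<dots> = C1 * exp (- (l / 4) * \<omega> y)" by (simp add: mult.assoc exp_add[symmetric])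
          also have "\<dots> \<le> K * exp (- 2 * l' * \<omega> (norm (lat \<xi>)))" using K e by (intro mult_mono) auto
          finally show ?thesis .
        qed
        have "cmod (?U \<xi> k t) \<le> (Q * M (l / 2) k) * (y * exp (- (l / 2) * \<omega> y))"
          using main l Q0 unfolding y_def[symmetric] by (intro decay_of_M y) auto
        also have "\<dots> \<le> (Q * M l' k) * (K * exp (- 2 * l' * \<omega> (norm (lat \<xi>))))"
          using Mk Q0 K y by (intro mult_mono mult_left_mono ye mult_nonneg_nonneg) auto
        finally show ?thesis by (simp only: mult_ac)
      qed
    qed
    then show "coef_bounded l' (\<lambda>_. K * Q) ?U" .
  qed (use l' l K in auto)
qed

lemma fcoef_synth:
  assumes l: "l > 0" and U: "coef_bounded l C U" and Cm: "\<And>\<xi>. C \<xi> \<le> Cm"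
  shows "fcoef (synth (\<lambda>\<xi>. U \<xi> 0)) \<xi> t = U \<xi> 0 t"
proof (rule fcoef_series[OF _ summable_mult[OF summable_decay[OF l U Cm], where c = "M l 0"]])
  fix n
  have "cmod (U (lat_enum n) 0 t) \<le> C (lat_enum n) * M l 0 * exp (- 2 * l * \<omega> (norm (lat (lat_enum n :: 'a \<Rightarrow> int))))"
    using U by (simp add: coef_bounded_def)
  also have "\<dots> \<le> C (lat_enum n) * M l 0 * exp (- l * \<omega> (norm (lat (lat_enum n :: 'a \<Rightarrow> int))))"
    using l w_nonneg[of "norm (lat (lat_enum n :: 'a \<Rightarrow> int))"] coef_nonneg[OF l U Cm] by (intro mult_left_mono) auto
  finally show "cmod (U (lat_enum n) 0 t) \<le> M l 0 * (C (lat_enum n) * exp (- l * \<omega> (norm (lat (lat_enum n :: 'a \<Rightarrow> int)))))"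
    by (simp add: mult_ac)
qed

text \<open>On each slice of fixed t both sides are continuous and periodic in x with the same
  coefficients, so \<open>fourier_unique_lattice\<close> applies.\<close>

lemma synth_fcoef:
  fixes f :: "'n::finite cyl \<Rightarrow> complex"
  assumes f: "f \<in> Cinf_torus" and l: "l > 0" and U: "coef_bounded l (\<lambda>_. C) (\<lambda>\<xi> k. fcoef (Dl (replicate k (1, 0)) f) \<xi>)"
  shows "synth (fcoef f) = f"
proof
  fix p :: "'n cyl"
  obtain t x where p: "p = (t, x)" by (cases p)
  let ?U = "\<lambda>\<xi> k. fcoef (Dl (replicate k (1, 0)) f) \<xi>"
  have g: "synth (fcoef f) \<in> Cinf_torus" using synth_smooth[OF l U order_refl] by simp
  have fg: "fcoef (synth (fcoef f)) \<xi> t = fcoef f \<xi> t" for \<xi> using fcoef_synth[OF l U order_refl, of \<xi> t] by simp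
  have cont: "continuous_on UNIV (\<lambda>x. h (t, x))" if "h \<in> Cinf_torus" for h :: "'n cyl \<Rightarrow> complex"
  proof -
    have "continuous_on UNIV (Dl [] h)" using that Dl_smooth(1)[of h "[]"] by (simp add: Cinf_torus_def)
    then have "continuous_on UNIV h" by simp
    then show ?thesis by (rule continuous_on_compose2) (auto intro!: continuous_intros)
  qed
  have per: "periodic_fn (\<lambda>x. h (t, x))" if "h \<in> Cinf_torus" for h :: "'n cyl \<Rightarrow> complex"
    unfolding periodic_fn_def
  proof (intro ballI allI)
    fix b x assume "b \<in> (Basis :: (real^'n) set)"
    then have "(0, b) \<in> (Basis :: 'n cyl set)" by (simp add: Basis_prod_def)
    then have "h ((t, x) + (2 * pi) *\<^sub>R (0, b)) = h (t, x)" using that unfolding Cinf_torus_def periodic_fn_def by blast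
    then show "h (t, x + (2 * pi) *\<^sub>R b) = h (t, x)" by simp
  qed
  have "synth (fcoef f) (t, x) - f (t, x) = 0"
  proof (rule fourier_unique_lattice[where r = "\<lambda>x. synth (fcoef f) (t, x) - f (t, x)"])
    show "continuous_on UNIV (\<lambda>x. synth (fcoef f) (t, x) - f (t, x))" by (intro continuous_intros cont f g)
    show "periodic_fn (\<lambda>x. synth (fcoef f) (t, x) - f (t, x))" using per[OF f] per[OF g] by (simp add: periodic_fn_def)
    fix \<xi>
    have "integral torus_box (\<lambda>x. synth (fcoef f) (t, x) * cis (- (lat \<xi> \<bullet> x))) = integral torus_box (\<lambda>x. f (t, x) * cis (- (lat \<xi> \<bullet> x)))"
      using fg[of \<xi>] by (simp add: fcoef_def)
    then show "integral torus_box (\<lambda>x. (synth (fcoef f) (t, x) - f (t, x)) * cis (- (lat \<xi> \<bullet> x))) = 0"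
      unfolding left_diff_distrib
      by (subst integral_diff) (auto intro!: integrable_torus continuous_intros cont f g)
  qed
  then show "synth (fcoef f) p = f p" by (simp add: p)
qed

lemma E_om_rep:
  fixes f :: "'n::finite cyl \<Rightarrow> complex"
  assumes "f \<in> E_om \<omega>"
  obtains l C U where "l > 0" "0 \<le> C" "coef_bounded l (\<lambda>_. C) U" "\<And>\<xi>. U \<xi> 0 = fcoef f \<xi>" "synth (\<lambda>\<xi>. U \<xi> 0) = f"
proof -
  obtain l Q where l: "l > 0" "seminorm_le l Q f" "f \<in> Cinf_torus" using assms unfolding E_om_iff by auto
  obtain l' K where l': "0 < l'" "l' \<le> l" "0 \<le> K" "\<And>(f :: 'n cyl \<Rightarrow> complex) Q. f \<in> Cinf_torus \<Longrightarrow> seminorm_le l Q f \<Longrightarrow>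
      coef_bounded l' (\<lambda>_. K * Q) (\<lambda>\<xi> k. fcoef (Dl (replicate k (1, 0)) f) \<xi>)"
    using coef_decay[OF l(1), where 'n = 'n] by blast
  note cb = l'(4)[OF l(3,2)]
  show ?thesis
    by (rule that[OF l'(1) _ cb]) (use l' seminorm_le_nonneg[OF l(2)] synth_fcoef[OF l(3) l'(1) cb] in auto)
qed

end

section \<open>Duality and the operator\<close>

context subadd_weight
begin

lemma E_om_continuous: "f \<in> E_om \<omega> \<Longrightarrow> continuous_on UNIV f"
  using Dl_smooth(1)[of f "[]"] by (simp add: E_om_def Cinf_torus_def)

lemma E_om_periodic: "f \<in> E_om \<omega> \<Longrightarrow> periodic_fn f"
  by (simp add: E_om_def Cinf_torus_def)

lemma E_om_smooth: "f \<in> E_om \<omega> \<Longrightarrow> smooth_fn f"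
  by (simp add: E_om_def Cinf_torus_def)

lemma E_om_Cinf: "f \<in> E_om \<omega> \<Longrightarrow> f \<in> Cinf_torus"
  by (simp add: E_om_def)

lemma E_om_diff: "f \<in> E_om \<omega> \<Longrightarrow> g \<in> E_om \<omega> \<Longrightarrow> (\<lambda>x. f x - g x) \<in> E_om \<omega>"
  using E_om_lincomb[of f g 1 "-1"] by simp

lemma E_om_add: "f \<in> E_om \<omega> \<Longrightarrow> g \<in> E_om \<omega> \<Longrightarrow> (\<lambda>x. f x + g x) \<in> E_om \<omega>"
  using E_om_lincomb[of f g 1 1] by simp

text \<open>The set \<open>W\<close> on which \<mu> has modulus less than r is absolutely convex and
  contains a ball of every step space, so it is a neighbourhood of zero for the inductive limit.
  Continuity thus reduces to one estimate per step.\<close>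

lemma linear_functional_open:
  fixes \<mu> :: "('a::euclidean_space \<Rightarrow> complex) \<Rightarrow> complex"
  assumes lin: "\<And>f g c d. f \<in> E_om \<omega> \<Longrightarrow> g \<in> E_om \<omega> \<Longrightarrow> \<mu> (\<lambda>x. c * f x + d * g x) = c * \<mu> f + d * \<mu> g"
    and bnd: "\<And>k. k \<ge> 1 \<Longrightarrow> \<exists>C\<ge>0. \<forall>f\<in>Estep \<omega> k. cmod (\<mu> f) \<le> C * norm_lam \<omega> (1 / real k) f"
    and S: "open S"
  shows "LB_open \<omega> {f \<in> E_om \<omega>. \<mu> f \<in> S}"
  unfolding LB_open_def
proof (intro conjI ballI)
  let ?V = "{f \<in> E_om \<omega>. \<mu> f \<in> S}"
  fix f assume f: "f \<in> ?V"
  obtain r where r: "r > 0" "ball (\<mu> f) r \<subseteq> S" using f S by (auto simp: open_contains_ball)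
  let ?U = "(\<lambda>g x. g x - f x) ` ?V"
  define W where "W = {g \<in> E_om \<omega>. cmod (\<mu> g) < r}"
  have "?U \<subseteq> E_om \<omega>" using f by (auto intro: E_om_diff)
  moreover have "W \<subseteq> ?U"
  proof
    fix g assume g: "g \<in> W"
    define h where "h = (\<lambda>x. g x + f x)"
    have hE: "h \<in> E_om \<omega>" unfolding h_def using g f by (intro E_om_add) (auto simp: W_def)
    have "\<mu> h = \<mu> g + \<mu> f" unfolding h_def using lin[of g f 1 1] g f by (simp add: W_def)
    then have "h \<in> ?V" using hE g r(2) by (auto simp: W_def dist_norm norm_minus_commute)
    then show "g \<in> ?U" by (intro image_eqI[of _ _ h]) (auto simp: h_def)
  qed
  moreover have "abs_convex W" unfolding abs_convex_def
  proof (intro ballI allI impI)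
    fix g h :: "'a \<Rightarrow> complex" and c d :: complex
    assume g: "g \<in> W" and h: "h \<in> W" and cd: "cmod c + cmod d \<le> 1"
    define m where "m = max (cmod (\<mu> g)) (cmod (\<mu> h))"
    have m: "m < r" "cmod (\<mu> g) \<le> m" "cmod (\<mu> h) \<le> m" "0 \<le> m" using g h by (auto simp: m_def W_def le_max_iff_disj)
    have "cmod (c * \<mu> g + d * \<mu> h) \<le> cmod c * m + cmod d * m"
      using m by (intro order_trans[OF norm_triangle_ineq] add_mono) (auto simp: norm_mult intro: mult_left_mono)
    also have "\<dots> = (cmod c + cmod d) * m" by (simp add: distrib_right)
    also have "\<dots> \<le> 1 * m" using cd m by (intro mult_right_mono) auto
    finally have "cmod (c * \<mu> g + d * \<mu> h) < r" using m by simp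
    then show "(\<lambda>x. c * g x + d * h x) \<in> W" using g h lin[of g h c d] by (auto simp: W_def intro: E_om_lincomb)
  qed
  moreover have "\<forall>k::nat. k \<ge> 1 \<longrightarrow> (\<exists>\<epsilon>>0. \<forall>f\<in>Estep \<omega> k. norm_lam \<omega> (1 / real k) f < \<epsilon> \<longrightarrow> f \<in> W)"
  proof (intro allI impI)
    fix k :: nat assume k: "k \<ge> 1"
    obtain C where C: "C \<ge> 0" "\<And>f. f \<in> Estep \<omega> k \<Longrightarrow> cmod (\<mu> f) \<le> C * norm_lam \<omega> (1 / real k) f" using bnd[OF k] by blast
    show "\<exists>\<epsilon>>0. \<forall>f\<in>Estep \<omega> k. norm_lam \<omega> (1 / real k) f < \<epsilon> \<longrightarrow> f \<in> W"
    proof (intro exI[of _ "r / (C + 1)"] conjI ballI impI)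
      show "0 < r / (C + 1)" using r C by simp
      fix g :: "'a \<Rightarrow> complex" assume g: "g \<in> Estep \<omega> k" and n: "norm_lam \<omega> (1 / real k) g < r / (C + 1)"
      have "cmod (\<mu> g) \<le> C * norm_lam \<omega> (1 / real k) g" by (rule C(2)[OF g])
      also have "\<dots> \<le> C * (r / (C + 1))" using n C by (intro mult_left_mono) auto
      also have "\<dots> < r" using r C by (simp add: field_simps)
      finally show "g \<in> W" using Estep_E_om[OF k g] by (simp add: W_def)
    qed
  qed
  ultimately show "LB_zero_nhd \<omega> ?U" unfolding LB_zero_nhd_def by blast
qed auto

lemma E_dualI:
  fixes \<mu> :: "('a::euclidean_space \<Rightarrow> complex) \<Rightarrow> complex"
  assumes lin: "\<And>f g c d. f \<in> E_om \<omega> \<Longrightarrow> g \<in> E_om \<omega> \<Longrightarrow> \<mu> (\<lambda>x. c * f x + d * g x) = c * \<mu> f + d * \<mu> g"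
    and bnd: "\<And>k. k \<ge> 1 \<Longrightarrow> \<exists>C\<ge>0. \<forall>f\<in>Estep \<omega> k. cmod (\<mu> f) \<le> C * norm_lam \<omega> (1 / real k) f"
    and out: "\<And>f. f \<notin> E_om \<omega> \<Longrightarrow> \<mu> f = 0"
  shows "\<mu> \<in> E_dual \<omega>"
  unfolding E_dual_def using lin out linear_functional_open[OF lin bnd] by blast

lemma Estep_sup_bound:
  assumes "f \<in> Estep \<omega> k" shows "cmod (f x) \<le> norm_lam \<omega> (1 / real k) f * M (1 / real k) 0"
  using seminorm_leD[OF seminorm_le_norm[OF assms], of "[]" x] by simp

end

lemma pairing_bound:
  fixes f g :: "'a::euclidean_space \<Rightarrow> complex"
  assumes c: "continuous_on UNIV f" "continuous_on UNIV g"
    and B: "\<And>x. x \<in> torus_box \<Longrightarrow> cmod (f x * g x) \<le> B"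
  shows "cmod (pairing f g) \<le> B * measure lborel (torus_box :: 'a::euclidean_space set)"
proof -
  have "(0::'a) \<in> torus_box" by (simp add: mem_torus_box)
  then have B0: "0 \<le> B" using B[of 0] norm_ge_zero order_trans by blast
  have "continuous_on UNIV (\<lambda>x. f x * g x)" by (intro continuous_intros c)
  from integrable_integral[OF integrable_torus[OF this]]
  have "((\<lambda>x. f x * g x) has_integral pairing f g) (cbox 0 torus_top)" by (simp only: torus_box_eq pairing_def)
  from has_integral_bound[OF B0 this] B show ?thesis by (simp only: torus_box_eq)
qed

lemma pairing_lincomb_right:
  assumes "continuous_on UNIV f" "continuous_on UNIV g" "continuous_on UNIV h"
  shows "pairing f (\<lambda>x. c * g x + d * h x) = c * pairing f g + d * pairing f h"
proof -
  have "integral torus_box (\<lambda>x. c * (f x * g x) + d * (f x * h x)) = c * pairing f g + d * pairing f h"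
    unfolding pairing_def by (subst integral_add) (auto intro!: integrable_torus continuous_intros assms)
  moreover have "(\<lambda>x. c * (f x * g x) + d * (f x * h x)) = (\<lambda>x. f x * (c * g x + d * h x))"
    by (simp add: fun_eq_iff algebra_simps)
  ultimately show ?thesis by (simp add: pairing_def)
qed

lemma pairing_commute: "pairing f g = pairing g f"
  by (simp add: pairing_def mult.commute)

lemma integral_torus_cyl:
  fixes F :: "'n::finite cyl \<Rightarrow> complex"
  assumes "continuous_on UNIV F"
  shows "integral torus_box F = integral {0..2*pi} (\<lambda>t. integral torus_box (\<lambda>x. F (t, x)))"
proof -
  have "(torus_box :: 'n cyl set) = cbox (0, 0) (2 * pi, torus_top)"
  proof -
    have "x \<in> torus_box \<longleftrightarrow> x \<in> cbox (0, 0) (2 * pi, torus_top)" for x :: "'n cyl"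
      unfolding mem_torus_box mem_box by (cases x) (auto simp: Basis_prod_def)
    then show ?thesis by blast
  qed
  then show ?thesis
    using integral_prod_continuous[of "(0::real)" "0::real^'n" "2 * pi" torus_top F] continuous_on_subset[OF assms]
    by (simp add: torus_box_eq)
qed

text \<open>The frequency \<open>- \<xi>\<close> appears because the pairing is bilinear, without a
  complex conjugate.\<close>

lemma pairing_mode:
  fixes \<phi> :: "'n::finite cyl \<Rightarrow> complex"
  assumes u: "continuous_on UNIV u" and \<phi>: "continuous_on UNIV \<phi>"
  shows "pairing (\<lambda>p. u (fst p) * cis (lat \<xi> \<bullet> snd p)) \<phi>
     = (2 * of_real pi) ^ CARD('n) * integral {0..2*pi} (\<lambda>t. u t * fcoef \<phi> (\<lambda>j. - \<xi> j) t)"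
proof -
  have "pairing (\<lambda>p. u (fst p) * cis (lat \<xi> \<bullet> snd p)) \<phi>
    = integral {0..2*pi} (\<lambda>t. integral torus_box (\<lambda>x. u t * cis (lat \<xi> \<bullet> x) * \<phi> (t, x)))"
    unfolding pairing_def
    by (subst integral_torus_cyl) (auto intro!: continuous_intros continuous_on_compose2[OF u] \<phi>)
  also have "(\<lambda>t. integral torus_box (\<lambda>x. u t * cis (lat \<xi> \<bullet> x) * \<phi> (t, x))) = (\<lambda>t. (2 * of_real pi) ^ CARD('n) * (u t * fcoef \<phi> (\<lambda>j. - \<xi> j) t))"
  proof
    fix t
    have "(\<lambda>x. u t * cis (lat \<xi> \<bullet> x) * \<phi> (t, x)) = (\<lambda>x. u t * (\<phi> (t, x) * cis (- (lat (\<lambda>j. - \<xi> j) \<bullet> x))))"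
      by (simp add: lat_minus fun_eq_iff mult_ac)
    then show "integral torus_box (\<lambda>x. u t * cis (lat \<xi> \<bullet> x) * \<phi> (t, x)) = (2 * of_real pi) ^ CARD('n) * (u t * fcoef \<phi> (\<lambda>j. - \<xi> j) t)"
      by (simp add: fcoef_def)
  qed
  finally show ?thesis by simp
qed

section \<open>The operator on Fourier coefficients\<close>

locale tube_operator = subadd_weight \<omega> for \<omega> :: "real \<Rightarrow> real" +
  fixes a b :: "'n::finite \<Rightarrow> real \<Rightarrow> real"
  assumes a_E: "\<And>j. (\<lambda>t. complex_of_real (a j t)) \<in> E_om \<omega>"
    and b_E: "\<And>j. (\<lambda>t. complex_of_real (b j t)) \<in> E_om \<omega>"
begin

abbreviation L :: "('n cyl \<Rightarrow> complex) \<Rightarrow> 'n cyl \<Rightarrow> complex" where "L \<equiv> Lop a b"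

definition symb :: "('n \<Rightarrow> int) \<Rightarrow> real \<Rightarrow> complex" where
  "symb \<xi> t = (\<Sum>j\<in>UNIV. of_int (\<xi> j) * Complex (a j t) (b j t))"

text \<open>The derivatives of \<open>\<i> * symb \<xi>\<close>, with the factor \<i> included
  because this is the coefficient C in the form of equation that \<open>ode_seq\<close>
  treats.\<close>

definition symb_seq :: "('n \<Rightarrow> int) \<Rightarrow> nat \<Rightarrow> real \<Rightarrow> complex" where
  "symb_seq \<xi> k t = (\<Sum>j\<in>UNIV. (\<i> * of_int (\<xi> j)) *
     (Dl (replicate k 1) (\<lambda>t. complex_of_real (a j t)) t + \<i> * Dl (replicate k 1) (\<lambda>t. complex_of_real (b j t)) t))"

lemma coeff_continuous: "continuous_on S (a j)" "continuous_on S (b j)"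
proof -
  have "continuous_on UNIV (\<lambda>t. Re (complex_of_real (a j t)))" "continuous_on UNIV (\<lambda>t. Re (complex_of_real (b j t)))"
    by (intro continuous_intros E_om_continuous a_E b_E)+
  then show "continuous_on S (a j)" "continuous_on S (b j)" by (auto intro: continuous_on_subset)
qed

lemma coeff_periodic: "a j (t + 2 * pi) = a j t" "b j (t + 2 * pi) = b j t"
  using E_om_periodic[OF a_E[of j]] E_om_periodic[OF b_E[of j]] by (auto simp: periodic_fn_def)

lemma Complex_coeff_continuous: "continuous_on S (\<lambda>t. Complex (a j t) (b j t))"
  unfolding Complex_eq by (intro continuous_intros coeff_continuous)

lemma symb_continuous: "continuous_on S (symb \<xi>)"
  unfolding symb_def[abs_def] by (intro continuous_intros Complex_coeff_continuous)

lemma symb_periodic: "symb \<xi> (t + 2 * pi) = symb \<xi> t"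
  by (simp add: symb_def coeff_periodic)

lemma symb_seq_0: "symb_seq \<xi> 0 t = \<i> * symb \<xi> t"
  by (simp add: symb_seq_def symb_def Complex_eq sum_distrib_left mult_ac)

lemma deriv_seq_Dl: 
  assumes "f \<in> E_om \<omega>" shows "deriv_seq (\<lambda>k. Dl (replicate k 1) f)"
  unfolding deriv_seq_def replicate_Suc
proof (intro allI)
  fix k t
  have "((\<lambda>s. Dl (replicate k 1) f (0 + s *\<^sub>R 1)) has_vector_derivative Dl (1 # replicate k 1) f (0 + t *\<^sub>R 1)) (at t)"
    by (rule Dl_smooth(2)[OF E_om_smooth[OF assms]]) auto
  then show "(Dl (replicate k 1) f has_vector_derivative Dl (1 # replicate k 1) f t) (at t)" by (simp del: Dl.simps)
qed

lemma deriv_seq_symb: "deriv_seq (symb_seq \<xi>)"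
  unfolding symb_seq_def[abs_def]
  by (intro deriv_seq_sum deriv_seq_cmult deriv_seq_add deriv_seq_Dl a_E b_E)

text \<open>A is a natural number so that \<open>M_scale\<close> applies to it, and
  \<open>1 + norm (lat \<xi>)\<close> replaces the norm to have a quantity that is at least
  one.\<close>

lemma symb_seq_bound:
  obtains l A where "l > 0" "A \<ge> (1::nat)" "\<And>\<xi> k t. cmod (symb_seq \<xi> k t) \<le> real A * (1 + norm (lat \<xi>)) * M l k"
proof -
  have "\<forall>j. \<exists>l>0. \<exists>Q. seminorm_le l Q (\<lambda>t. complex_of_real (a j t)) \<and> seminorm_le l Q (\<lambda>t. complex_of_real (b j t))"
  proof
    fix j
    obtain l Q l' Q' where *: "l > 0" "seminorm_le l Q (\<lambda>t. complex_of_real (a j t))" "l' > 0" "seminorm_le l' Q' (\<lambda>t. complex_of_real (b j t))"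
      using a_E[of j] b_E[of j] unfolding E_om_iff by blast
    have "seminorm_le (min l l') (max Q Q') (\<lambda>t. complex_of_real (a j t))" "seminorm_le (min l l') (max Q Q') (\<lambda>t. complex_of_real (b j t))"
      using * by (auto intro: seminorm_le_mono)
    then show "\<exists>l>0. \<exists>Q. seminorm_le l Q (\<lambda>t. complex_of_real (a j t)) \<and> seminorm_le l Q (\<lambda>t. complex_of_real (b j t))"
      using * by (intro exI[of _ "min l l'"]) auto
  qed
  then obtain l Q where lQ: "\<And>j. l j > 0" "\<And>j. seminorm_le (l j) (Q j) (\<lambda>t. complex_of_real (a j t))" "\<And>j. seminorm_le (l j) (Q j) (\<lambda>t. complex_of_real (b j t))"
    by metis
  define l0 where "l0 = Min (range l)"
  have l0: "l0 > 0" "\<And>j. l0 \<le> l j" unfolding l0_def using lQ(1) by (auto simp: Min_gr_iff)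
  have Q0: "0 \<le> Q j" for j by (rule seminorm_le_nonneg[OF lQ(2)])
  define A where "A = nat \<lceil>\<Sum>j\<in>UNIV. 2 * Q j\<rceil> + 1"
  have A: "(\<Sum>j\<in>UNIV. 2 * Q j) \<le> real A" unfolding A_def by linarith
  show ?thesis
  proof (rule that[of l0 A])
    fix \<xi> :: "'n \<Rightarrow> int" and k :: nat and t :: real
    let ?y = "norm (lat \<xi>)"
    have D: "cmod (Dl (replicate k 1) (\<lambda>t. complex_of_real (a j t)) t) \<le> Q j * M l0 k"
      "cmod (Dl (replicate k 1) (\<lambda>t. complex_of_real (b j t)) t) \<le> Q j * M l0 k" for j
    proof -
      have rep: "set (replicate k (1::real)) \<subseteq> Basis" by auto
      have "seminorm_le l0 (Q j) (\<lambda>t. complex_of_real (a j t))" "seminorm_le l0 (Q j) (\<lambda>t. complex_of_real (b j t))"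
        by (rule seminorm_le_mono[OF lQ(2) l0(1,2) order_refl], rule seminorm_le_mono[OF lQ(3) l0(1,2) order_refl])
      from this[THEN seminorm_leD, OF rep] show "cmod (Dl (replicate k 1) (\<lambda>t. complex_of_real (a j t)) t) \<le> Q j * M l0 k"
      "cmod (Dl (replicate k 1) (\<lambda>t. complex_of_real (b j t)) t) \<le> Q j * M l0 k" by auto
    qed
    have "cmod (symb_seq \<xi> k t) \<le> (\<Sum>j\<in>UNIV. (1 + ?y) * (2 * Q j * M l0 k))"
      unfolding symb_seq_def
    proof (rule order_trans[OF norm_sum sum_mono])
      fix j
      have "cmod (Dl (replicate k 1) (\<lambda>t. complex_of_real (a j t)) t + \<i> * Dl (replicate k 1) (\<lambda>t. complex_of_real (b j t)) t) \<le> Q j * M l0 k + Q j * M l0 k"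
        using D by (intro order_trans[OF norm_triangle_ineq] add_mono) (auto simp: norm_mult)
      then show "cmod ((\<i> * of_int (\<xi> j)) * (Dl (replicate k 1) (\<lambda>t. complex_of_real (a j t)) t + \<i> * Dl (replicate k 1) (\<lambda>t. complex_of_real (b j t)) t))
          \<le> (1 + ?y) * (2 * Q j * M l0 k)"
        unfolding norm_mult using lat_le_norm[of \<xi> j] by (intro mult_mono) auto
    qed
    also have "\<dots> = (\<Sum>j\<in>UNIV. 2 * Q j) * ((1 + ?y) * M l0 k)" unfolding sum_distrib_right by (intro sum.cong refl) simp
    also have "\<dots> \<le> real A * ((1 + ?y) * M l0 k)" using A by (intro mult_right_mono) auto
    finally show "cmod (symb_seq \<xi> k t) \<le> real A * (1 + norm (lat \<xi>)) * M l0 k" by (simp add: mult_ac)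
  qed (use l0 in \<open>auto simp: A_def\<close>)
qed

definition L_coef :: "(('n \<Rightarrow> int) \<Rightarrow> nat \<Rightarrow> real \<Rightarrow> complex) \<Rightarrow> ('n \<Rightarrow> int) \<Rightarrow> nat \<Rightarrow> real \<Rightarrow> complex" where
  "L_coef U \<xi> k t = U \<xi> (Suc k) t + leibniz (symb_seq \<xi>) (U \<xi>) k t"

text \<open>The additional derivative, the factor \<open>1 + norm (lat \<xi>)\<close> of the
  coefficient and the k + 1 Leibniz terms are all absorbed in passing from m to m / 2.\<close>

lemma L_coef_bounded:
  assumes l: "l > 0" and C: "0 \<le> C" and U: "coef_bounded l (\<lambda>_. C) U"
  obtains l' C' where "l' > 0" "0 \<le> C'" "coef_bounded l' (\<lambda>_. C') (L_coef U)"
proof -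
  obtain l1 A where A: "l1 > 0" "A \<ge> (1::nat)" "\<And>\<xi> k t. cmod (symb_seq \<xi> k t) \<le> real A * (1 + norm (lat \<xi>)) * M l1 k"
    using symb_seq_bound by blast
  define m where "m = min l l1"
  have m: "m > 0" "m \<le> l" "m \<le> l1" using l A by (auto simp: m_def)
  have U': "coef_bounded m (\<lambda>_. C) U" by (rule coef_bounded_mono[OF U m(1,2)]) (use C in auto)
  obtain C1 where C1: "C1 > 0" "\<And>t. t \<ge> 0 \<Longrightarrow> (1 + t) ^ 1 \<le> C1 * exp (m * \<omega> t)"
    using power_le_exp_w[OF m(1), of 1] by blast
  define C' where "C' = C * M (m / 2) 1 + C * real A * C1"
  show ?thesis
  proof (rule that[of "m / 2" C'])
    show "coef_bounded (m / 2) (\<lambda>_. C') (L_coef U)" unfolding coef_bounded_def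
    proof (intro conjI allI)
      have dU: "deriv_seq (U \<xi>)" for \<xi> using U by (simp add: coef_bounded_def)
      then have dU': "deriv_seq (\<lambda>k. U \<xi> (Suc k))" for \<xi> by (simp add: deriv_seq_def)
      show "deriv_seq (L_coef U \<xi>)" for \<xi> unfolding L_coef_def[abs_def]
        by (intro deriv_seq_add dU' deriv_seq_leibniz deriv_seq_symb dU)
      show "L_coef U \<xi> 0 (t + 2 * pi) = L_coef U \<xi> 0 t" for \<xi> t
      proof -
        have per: "U \<xi> 0 (s + 2 * pi) = U \<xi> 0 s" for s using U by (simp add: coef_bounded_def)
        have "((\<lambda>s. s + 2 * pi) has_vector_derivative 1) (at t)" by (auto intro!: derivative_eq_intros)
        from vector_diff_chain_at[OF this deriv_seqD[OF dU, of \<xi> 0]]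
        have "(U \<xi> 0 has_vector_derivative U \<xi> 1 (t + 2 * pi)) (at t)" by (simp add: o_def per)
        moreover have "(U \<xi> 0 has_vector_derivative U \<xi> 1 t) (at t)" using deriv_seqD[OF dU, of \<xi> 0] by simp
        ultimately have "U \<xi> 1 (t + 2 * pi) = U \<xi> 1 t" by (rule vector_derivative_unique_at)
        then show ?thesis by (simp add: L_coef_def symb_seq_0 symb_periodic per)
      qed
      fix \<xi> :: "'n \<Rightarrow> int" and k :: nat and t :: real
      let ?y = "norm (lat \<xi>)"
      let ?e = "exp (- 2 * m * \<omega> ?y)" and ?e2 = "exp (- 2 * (m / 2) * \<omega> ?y)"
      have Ub: "cmod (U \<xi> k t) \<le> C * M m k * ?e" for k using U' by (simp add: coef_bounded_def)
      have ee: "?e \<le> ?e2" using m w_nonneg[of ?y] by simp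
      have 1: "cmod (U \<xi> (Suc k) t) \<le> C * M (m / 2) 1 * (M (m / 2) k * ?e2)"
      proof -
        have "cmod (U \<xi> (Suc k) t) \<le> C * (M (m / 2) 1 * M (m / 2) k) * ?e2"
          using M_split[OF m(1), of 1 k] C ee by (intro order_trans[OF Ub] mult_mono) auto
        then show ?thesis by (simp only: mult_ac)
      qed
      have summand: "cmod (of_nat (k choose j) * (symb_seq \<xi> j t * U \<xi> (k - j) t)) \<le> real A * (1 + ?y) * C * M m k * ?e" if j: "j \<le> k" for j
      proof -
        have "cmod (symb_seq \<xi> j t) \<le> real A * (1 + ?y) * M m j"
          using M_antimono[OF m(1,3), of j] by (intro order_trans[OF A(3)] mult_left_mono) auto
        then have "cmod (of_nat (k choose j) * (symb_seq \<xi> j t * U \<xi> (k - j) t)) \<le> real (k choose j) * ((real A * (1 + ?y) * M m j) * (C * M m (k - j) * ?e))"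
          unfolding norm_mult norm_of_nat using C by (intro mult_left_mono mult_mono Ub) auto
        also have "\<dots> = real A * (1 + ?y) * C * (real (k choose j) * (M m j * M m (k - j))) * ?e" by (simp only: mult_ac)
        also have "\<dots> \<le> real A * (1 + ?y) * C * M m k * ?e"
          using M_binomial[OF m(1), of j "k - j"] j C by (intro mult_right_mono mult_left_mono) auto
        finally show ?thesis .
      qed
      have "cmod (leibniz (symb_seq \<xi>) (U \<xi>) k t) \<le> (\<Sum>j\<le>k. real A * (1 + ?y) * C * M m k * ?e)"
        unfolding leibniz_def by (rule order_trans[OF norm_sum sum_mono]) (use summand in auto)
      also have "\<dots> = real (Suc k) * (real A * C * ((1 + ?y) * ?e) * M m k)" by (simp add: mult_ac)
      also have "\<dots> \<le> 2 ^ k * (real A * C * (C1 * ?e2) * M m k)"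
      proof (rule mult_mono)
        have "Suc k \<le> 2 ^ k" by (simp add: Suc_leI)
        then show "real (Suc k) \<le> 2 ^ k" by (metis of_nat_le_iff of_nat_numeral of_nat_power)
        have "(1 + ?y) * ?e \<le> (C1 * exp (m * \<omega> ?y)) * ?e" using C1(2)[of ?y] by (intro mult_right_mono) auto
        also have "\<dots> = C1 * ?e2" by (simp add: mult.assoc exp_add[symmetric])
        finally show "real A * C * ((1 + ?y) * ?e) * M m k \<le> real A * C * (C1 * ?e2) * M m k"
          using C by (intro mult_right_mono mult_left_mono) auto
      qed (use C in auto)
      also have "\<dots> = real A * C * (C1 * ?e2) * (2 ^ k * M m k)" by (simp only: mult_ac)
      also have "\<dots> \<le> real A * C * (C1 * ?e2) * M (m / 2) k"
        using M_scale[OF m(1), of 2 k] C C1(1) by (intro mult_left_mono) auto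
      finally have 2: "cmod (leibniz (symb_seq \<xi>) (U \<xi>) k t) \<le> C * real A * C1 * (M (m / 2) k * ?e2)" by (simp only: mult_ac)
      have "cmod (L_coef U \<xi> k t) \<le> C' * (M (m / 2) k * ?e2)"
        unfolding L_coef_def C'_def distrib_right by (rule order_trans[OF norm_triangle_ineq add_mono[OF 1 2]])
      then show "cmod (L_coef U \<xi> k t) \<le> C' * M (m / 2) k * exp (- 2 * (m / 2) * \<omega> ?y)" by (simp only: mult_ac)
    qed
  qed (use m C C1 in \<open>auto simp: C'_def\<close>)
qed

lemma L_synth:
  assumes l: "l > 0" and U: "coef_bounded l C U" and Cm: "\<And>\<xi>. C \<xi> \<le> Cm"
  shows "L (synth (\<lambda>\<xi>. U \<xi> 0)) = synth (\<lambda>\<xi>. L_coef U \<xi> 0)"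
proof
  fix p :: "'n cyl"
  obtain t x where p: "p = (t, x)" by (cases p)
  let ?e = "lat_enum :: nat \<Rightarrow> 'n \<Rightarrow> int"
  let ?W = "\<lambda>n. U (?e n) 0 t * cis (lat (?e n) \<bullet> x)"
  note hyps = l U Cm
  have s1: "(\<lambda>n. U (?e n) 1 t * cis (lat (?e n) \<bullet> x)) sums Dl [(1, 0)] (synth (\<lambda>\<xi>. U \<xi> 0)) (t, x)"
    unfolding Dl_synth_t[OF hyps] by (rule synth_sums[OF hyps])
  have s2: "(\<lambda>n. Complex (a j t) (b j t) * ((\<i> * of_int (?e n j)) * ?W n)) sums
      (Complex (a j t) (b j t) * Dl [(0, axis j 1)] (synth (\<lambda>\<xi>. U \<xi> 0)) (t, x))" for j
    unfolding Dl_synth_x[OF hyps] by (intro sums_mult summable_sums Dl_synth_x_summable[OF hyps])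
  have "(\<lambda>n. U (?e n) 1 t * cis (lat (?e n) \<bullet> x) + (\<Sum>j\<in>UNIV. Complex (a j t) (b j t) * ((\<i> * of_int (?e n j)) * ?W n))) sums
      L (synth (\<lambda>\<xi>. U \<xi> 0)) (t, x)"
    unfolding Lop_def prod.case by (intro sums_add s1 sums_sum s2)
  also have "(\<lambda>n. U (?e n) 1 t * cis (lat (?e n) \<bullet> x) + (\<Sum>j\<in>UNIV. Complex (a j t) (b j t) * ((\<i> * of_int (?e n j)) * ?W n)))
     = (\<lambda>n. L_coef U (?e n) 0 t * cis (lat (?e n) \<bullet> x))"
  proof
    fix n
    have "(\<Sum>j\<in>UNIV. Complex (a j t) (b j t) * ((\<i> * of_int (?e n j)) * ?W n)) = (\<i> * symb (?e n) t) * ?W n"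
      unfolding symb_def sum_distrib_left sum_distrib_right by (intro sum.cong refl) (simp only: mult_ac)
    then show "U (?e n) 1 t * cis (lat (?e n) \<bullet> x) + (\<Sum>j\<in>UNIV. Complex (a j t) (b j t) * ((\<i> * of_int (?e n j)) * ?W n))
      = L_coef U (?e n) 0 t * cis (lat (?e n) \<bullet> x)"
      by (simp add: L_coef_def symb_seq_0 distrib_right mult.assoc)
  qed
  finally show "L (synth (\<lambda>\<xi>. U \<xi> 0)) p = synth (\<lambda>\<xi>. L_coef U \<xi> 0) p"
    unfolding p synth_def fst_conv snd_conv by (rule sums_unique)
qed

lemma L_E_om:
  assumes f: "f \<in> E_om \<omega>"
  shows "L f \<in> E_om \<omega>"
    and "(fcoef f \<xi> has_vector_derivative (fcoef (L f) \<xi> t - \<i> * symb \<xi> t * fcoef f \<xi> t)) (at t)"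
proof -
  obtain l C U where U: "l > 0" "0 \<le> C" "coef_bounded l (\<lambda>_. C) U" "\<And>\<xi>. U \<xi> 0 = fcoef f \<xi>" "synth (\<lambda>\<xi>. U \<xi> 0) = f"
    using E_om_rep[OF f] by blast
  obtain l' C' where V: "l' > 0" "0 \<le> C'" "coef_bounded l' (\<lambda>_. C') (L_coef U)" using L_coef_bounded[OF U(1,2,3)] by blast
  have Lf: "L f = synth (\<lambda>\<xi>. L_coef U \<xi> 0)" using L_synth[OF U(1,3) order_refl] U(5) by simp
  show "L f \<in> E_om \<omega>" unfolding Lf by (rule synth_E_om(2)[OF V(1,3) order_refl])
  have "fcoef (L f) \<xi> t = U \<xi> 1 t + \<i> * symb \<xi> t * U \<xi> 0 t"
    unfolding Lf fcoef_synth[OF V(1,3) order_refl] by (simp add: L_coef_def symb_seq_0)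
  moreover have "(U \<xi> 0 has_vector_derivative U \<xi> 1 t) (at t)" using U(3) by (simp add: coef_bounded_def deriv_seq_def)
  ultimately show "(fcoef f \<xi> has_vector_derivative (fcoef (L f) \<xi> t - \<i> * symb \<xi> t * fcoef f \<xi> t)) (at t)"
    by (simp add: U(4))
qed

lemma L_synth_eq:
  assumes l: "l > 0" and U: "coef_bounded l C U" and Cm: "\<And>\<xi>. C \<xi> \<le> Cm"
    and eq: "\<And>\<xi> t. (U \<xi> 0 has_vector_derivative (h \<xi> t - \<i> * symb \<xi> t * U \<xi> 0 t)) (at t)"
  shows "L (synth (\<lambda>\<xi>. U \<xi> 0)) = synth h"
proof -
  have "L_coef U \<xi> 0 t = h \<xi> t" for \<xi> t
  proof -
    have "(U \<xi> 0 has_vector_derivative U \<xi> 1 t) (at t)" using U by (simp add: coef_bounded_def deriv_seq_def)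
    from vector_derivative_unique_at[OF this eq] show ?thesis by (simp add: L_coef_def symb_seq_0)
  qed
  then show ?thesis unfolding L_synth[OF l U Cm] by (simp add: synth_def[abs_def])
qed

text \<open>\<open>L f * g + f * L g\<close> is a sum of total derivatives: the coefficients depend
  on t only and therefore pass under the x-derivatives. Each of these terms integrates to zero by
  periodicity.\<close>

lemma pairing_transpose:
  assumes f: "f \<in> E_om \<omega>" and g: "g \<in> E_om \<omega>"
  shows "pairing (L f) g = - pairing f (L g)"
proof -
  have B: "(1, 0) \<in> (Basis :: 'n cyl set)" "\<And>j. (0, axis j 1) \<in> (Basis :: 'n cyl set)" by (auto simp: Basis_cyl)
  have cD: "continuous_on UNIV (Dl [e] h)" "((\<lambda>s. h (p + s *\<^sub>R e)) has_vector_derivative Dl [e] h p) (at 0)"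
    if "h \<in> E_om \<omega>" "e \<in> Basis" for h :: "'n cyl \<Rightarrow> complex" and e p
    using Dl_smooth(1)[OF E_om_smooth[OF that(1)], of "[e]"] Dl_smooth(2)[OF E_om_smooth[OF that(1)], of "[]" e p 0] that(2)
    by (auto simp del: Dl.simps(2))
  note c = E_om_continuous[OF f] E_om_continuous[OF g] cD(1)[OF f] cD(1)[OF g]
  have pf: "f (p + (2 * pi) *\<^sub>R e) = f p" "g (p + (2 * pi) *\<^sub>R e) = g p" if "e \<in> Basis" for e p
    using E_om_periodic[OF f] E_om_periodic[OF g] that unfolding periodic_fn_def by blast+
  define Gt where "Gt = (\<lambda>p. f p * Dl [(1, 0)] g p + Dl [(1, 0)] f p * g p)"
  define Gx where "Gx = (\<lambda>j p. Complex (a j (fst p)) (b j (fst p)) * (f p * Dl [(0, axis j 1)] g p + Dl [(0, axis j 1)] f p * g p))"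
  have cc: "continuous_on UNIV (\<lambda>p :: 'n cyl. Complex (a j (fst p)) (b j (fst p)))" for j
    by (rule continuous_on_compose2[OF Complex_coeff_continuous[of UNIV j]]) (auto intro!: continuous_intros)
  have cGt: "continuous_on UNIV Gt" unfolding Gt_def by (intro continuous_intros c B)
  have cGx: "continuous_on UNIV (Gx j)" for j unfolding Gx_def by (intro continuous_intros c B cc)
  have "integral torus_box Gt = 0"
  proof (rule integral_deriv_periodic[where f = "\<lambda>p. f p * g p" and b = "(1, 0)"])
    show "continuous_on UNIV (\<lambda>p. f p * g p)" by (intro continuous_intros c)
    show "periodic_fn (\<lambda>p. f p * g p)" using pf by (simp add: periodic_fn_def)
    show "((\<lambda>s. f (p + s *\<^sub>R (1, 0)) * g (p + s *\<^sub>R (1, 0))) has_vector_derivative Gt p) (at 0)" for p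
      using has_vector_derivative_mult[OF cD(2)[OF f B(1), of p] cD(2)[OF g B(1), of p]] by (simp add: Gt_def del: Dl.simps flip: zero_prod_def)
  qed (use B cGt in auto)
  moreover have "integral torus_box (Gx j) = 0" for j
  proof (rule integral_deriv_periodic[where f = "\<lambda>p. Complex (a j (fst p)) (b j (fst p)) * (f p * g p)" and b = "(0, axis j 1)"])
    show "continuous_on UNIV (\<lambda>p. Complex (a j (fst p)) (b j (fst p)) * (f p * g p))" by (intro continuous_intros c cc)
    show "periodic_fn (\<lambda>p. Complex (a j (fst p)) (b j (fst p)) * (f p * g p))"
      unfolding periodic_fn_def
    proof (intro ballI allI)
      fix e p assume e: "e \<in> (Basis :: 'n cyl set)"
      have "a j (fst (p + (2 * pi) *\<^sub>R e)) = a j (fst p) \<and> b j (fst (p + (2 * pi) *\<^sub>R e)) = b j (fst p)"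
        using e by (cases e rule: cyl_Basis_cases) (auto simp: coeff_periodic)
      then show "Complex (a j (fst (p + (2 * pi) *\<^sub>R e))) (b j (fst (p + (2 * pi) *\<^sub>R e))) * (f (p + (2 * pi) *\<^sub>R e) * g (p + (2 * pi) *\<^sub>R e))
        = Complex (a j (fst p)) (b j (fst p)) * (f p * g p)" using pf[OF e] by simp
    qed
    fix p :: "'n cyl"
    have "((\<lambda>s. Complex (a j (fst p)) (b j (fst p)) * (f (p + s *\<^sub>R (0, axis j 1)) * g (p + s *\<^sub>R (0, axis j 1)))) has_vector_derivative Gx j p) (at 0)"
      unfolding Gx_def
      using has_vector_derivative_mult[OF cD(2)[OF f B(2), of p j] cD(2)[OF g B(2), of p j]]
      by (intro has_vector_derivative_mult_right) (simp del: Dl.simps flip: zero_prod_def)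
    then show "((\<lambda>s. Complex (a j (fst (p + s *\<^sub>R (0, axis j 1)))) (b j (fst (p + s *\<^sub>R (0, axis j 1)))) *
         (f (p + s *\<^sub>R (0, axis j 1)) * g (p + s *\<^sub>R (0, axis j 1)))) has_vector_derivative Gx j p) (at 0)" by simp
  qed (use B cGx in auto)
  moreover have "integral torus_box (\<lambda>p. Gt p + (\<Sum>j\<in>UNIV. Gx j p)) = integral torus_box Gt + (\<Sum>j\<in>UNIV. integral torus_box (Gx j))"
    by (subst integral_add, intro integrable_torus cGt, intro integrable_torus continuous_on_sum cGx)
       (subst integral_sum, simp, intro integrable_torus cGx, simp)
  ultimately have "integral torus_box (\<lambda>p. Gt p + (\<Sum>j\<in>UNIV. Gx j p)) = 0" by simp
  moreover have "(\<lambda>p. Gt p + (\<Sum>j\<in>UNIV. Gx j p)) = (\<lambda>p. L f p * g p + f p * L g p)"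
    by (auto simp: fun_eq_iff Gt_def Gx_def Lop_def algebra_simps sum.distrib sum_distrib_left simp del: Dl.simps)
  moreover have "integral torus_box (\<lambda>p. L f p * g p + f p * L g p) = pairing (L f) g + pairing f (L g)"
    unfolding pairing_def
    by (rule integral_add) (intro integrable_torus continuous_intros E_om_continuous f g L_E_om)+
  ultimately show ?thesis by (simp add: add_eq_0_iff2)
qed

end

section \<open>Sufficiency\<close>

lemma Dl_const: "Dl bs (\<lambda>_. c) = (\<lambda>_. if bs = [] then c else 0)"
  by (induction bs) (auto simp: vector_derivative_const_at fun_eq_iff)

lemma bounded_of_periodic:
  fixes u :: "real \<Rightarrow> complex"
  assumes "continuous_on UNIV u" "\<And>t. u (t + 2 * pi) = u t"
  obtains B where "B > 0" "\<And>t. cmod (u t) \<le> B"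
proof -
  have per: "periodic_fn u" using assms(2) by (simp add: periodic_fn_def)
  have "compact (u ` torus_box)" unfolding torus_box_eq
    by (intro compact_continuous_image continuous_on_subset[OF assms(1)] compact_cbox) auto
  then obtain B where B: "B > 0" "\<And>t. t \<in> torus_box \<Longrightarrow> cmod (u t) \<le> B"
    using bounded_pos[THEN iffD1, OF compact_imp_bounded] by (metis imageI)
  have "cmod (u t) \<le> B" for t
  proof -
    obtain y where "y \<in> torus_box" "\<And>f :: real \<Rightarrow> complex. periodic_fn f \<Longrightarrow> f t = f y" using periodic_fn_reduce[of t] by metis
    then show ?thesis using B(2) per by metis
  qed
  then show ?thesis using that B(1) by blast
qed

context subadd_weight
begin

lemma const_E_om: "(\<lambda>_. c) \<in> E_om \<omega>"
proof -
  have "smooth_fn (\<lambda>_ :: 'a. c)" unfolding smooth_fn_def Dl_const by auto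
  then have C: "(\<lambda>_ :: 'a. c) \<in> Cinf_torus" by (simp add: Cinf_torus_def periodic_fn_def)
  have "seminorm_le 1 (cmod c / M 1 0) (\<lambda>_ :: 'a. c)"
    unfolding seminorm_le_def Dl_const by (auto simp: less_imp_neq[OF M_pos, symmetric])
  then show ?thesis unfolding E_om_iff using C by (meson zero_less_one)
qed

lemma pairing_functional_bound:
  fixes f :: "'a::euclidean_space \<Rightarrow> complex"
  assumes f: "continuous_on UNIV f" and k: "k \<ge> 1"
  shows "\<exists>C\<ge>0. \<forall>g\<in>Estep \<omega> k. cmod (pairing f g) \<le> C * norm_lam \<omega> (1 / real k) g"
proof -
  have "compact (f ` torus_box)" unfolding torus_box_eq
    by (intro compact_continuous_image continuous_on_subset[OF f] compact_cbox) auto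
  then obtain B where B: "B > 0" "\<And>x. x \<in> torus_box \<Longrightarrow> cmod (f x) \<le> B"
    using bounded_pos[THEN iffD1, OF compact_imp_bounded] by (metis imageI)
  let ?m = "measure lborel (torus_box :: 'a set)"
  show ?thesis
  proof (intro exI[of _ "B * M (1 / real k) 0 * ?m"] conjI ballI)
    show "0 \<le> B * M (1 / real k) 0 * ?m" using B by simp
    fix g :: "'a \<Rightarrow> complex" assume g: "g \<in> Estep \<omega> k"
    have "cmod (pairing f g) \<le> (B * (norm_lam \<omega> (1 / real k) g * M (1 / real k) 0)) * ?m"
    proof (rule pairing_bound[OF f E_om_continuous[OF Estep_E_om[OF k g]]])
      fix x :: 'a assume "x \<in> torus_box"
      then show "cmod (f x * g x) \<le> B * (norm_lam \<omega> (1 / real k) g * M (1 / real k) 0)"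
        unfolding norm_mult using B Estep_sup_bound[OF g] by (intro mult_mono) auto
    qed
    then show "cmod (pairing f g) \<le> B * M (1 / real k) 0 * ?m * norm_lam \<omega> (1 / real k) g" by (simp only: mult_ac)
  qed
qed

text \<open>The value is zero outside \<open>E_om\<close>, as the extensional representation in
  \<open>E_dual\<close> demands.\<close>

definition functional_of :: "('a::euclidean_space \<Rightarrow> complex) \<Rightarrow> ('a \<Rightarrow> complex) \<Rightarrow> complex" where
  "functional_of f = (\<lambda>\<phi>. if \<phi> \<in> E_om \<omega> then pairing f \<phi> else 0)"

lemma functional_of_E_dual:
  fixes f :: "'a::euclidean_space \<Rightarrow> complex"
  assumes "f \<in> E_om \<omega>" shows "functional_of f \<in> E_dual \<omega>"
proof (rule E_dualI)
  fix g h :: "'a \<Rightarrow> complex" and c d :: complex assume "g \<in> E_om \<omega>" "h \<in> E_om \<omega>"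
  then show "functional_of f (\<lambda>x. c * g x + d * h x) = c * functional_of f g + d * functional_of f h"
    by (simp add: functional_of_def E_om_lincomb pairing_lincomb_right E_om_continuous assms)
next
  fix k :: nat assume k: "k \<ge> 1"
  obtain C where C: "C \<ge> 0" "\<And>g. g \<in> Estep \<omega> k \<Longrightarrow> cmod (pairing f g) \<le> C * norm_lam \<omega> (1 / real k) g"
    using pairing_functional_bound[OF E_om_continuous[OF assms] k] by blast
  then show "\<exists>C\<ge>0. \<forall>g\<in>Estep \<omega> k. cmod (functional_of f g) \<le> C * norm_lam \<omega> (1 / real k) g"
    using Estep_E_om[OF k] by (auto simp: functional_of_def)
qed (simp add: functional_of_def)

end

section \<open>Denominators and surjectivity onto mean zero\<close>

context tube_operator
begin

definition msymb :: "('n \<Rightarrow> int) \<Rightarrow> complex" where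
  "msymb \<xi> = (\<Sum>j\<in>UNIV. of_int (\<xi> j) * Complex (mean_vec a j) (mean_vec b j))"

lemma Im_symb: "Im (symb \<xi> t) = (\<Sum>j\<in>UNIV. of_int (\<xi> j) * b j t)"
  by (simp add: symb_def)

lemma primitive_symb: "primitive (symb \<xi>) (2 * pi) = 2 * of_real pi * msymb \<xi>"
proof -
  have "((\<lambda>t. complex_of_real (f t)) has_integral of_real (integral {0..2*pi} f)) {0..2*pi}"
    if "continuous_on {0..2*pi} f" for f :: "real \<Rightarrow> real"
    using has_integral_linear[OF integrable_integral[OF integrable_continuous_interval[OF that]] bounded_linear_of_real]
    by (simp add: o_def)
  note I = this[OF coeff_continuous(1)] this[OF coeff_continuous(2)]
  have "((\<lambda>t. \<Sum>j\<in>UNIV. of_int (\<xi> j) * (complex_of_real (a j t) + \<i> * complex_of_real (b j t))) has_integral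
     (\<Sum>j\<in>UNIV. of_int (\<xi> j) * (complex_of_real (integral {0..2*pi} (a j)) + \<i> * complex_of_real (integral {0..2*pi} (b j))))) {0..2*pi}"
    by (intro has_integral_sum has_integral_mult_right has_integral_add I) auto
  moreover have "(\<lambda>t. \<Sum>j\<in>UNIV. of_int (\<xi> j) * (complex_of_real (a j t) + \<i> * complex_of_real (b j t))) = symb \<xi>"
    by (simp add: symb_def[abs_def] Complex_eq)
  moreover have "(\<Sum>j\<in>UNIV. of_int (\<xi> j) * (complex_of_real (integral {0..2*pi} (a j)) + \<i> * complex_of_real (integral {0..2*pi} (b j))))
     = 2 * of_real pi * msymb \<xi>"
    unfolding msymb_def sum_distrib_left by (intro sum.cong refl) (simp add: mean_vec_def Complex_eq field_simps)
  ultimately have "(symb \<xi> has_integral 2 * of_real pi * msymb \<xi>) {0..2*pi}" by simp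
  then show ?thesis by (simp add: primitive_nonneg integral_unique)
qed

lemma msymb_bound: obtains B where "B > 0" "\<And>\<xi>. cmod (msymb \<xi>) \<le> B * norm (lat \<xi>)"
proof (rule that[of "(\<Sum>j\<in>UNIV. cmod (Complex (mean_vec a j) (mean_vec b j))) + 1"])
  let ?S = "\<Sum>j\<in>UNIV. cmod (Complex (mean_vec a j) (mean_vec b j))"
  show "?S + 1 > 0" by (intro add_nonneg_pos sum_nonneg) auto
  fix \<xi> :: "'n \<Rightarrow> int"
  have "cmod (msymb \<xi>) \<le> (\<Sum>j\<in>UNIV. norm (lat \<xi>) * cmod (Complex (mean_vec a j) (mean_vec b j)))"
    unfolding msymb_def by (rule order_trans[OF norm_sum sum_mono]) (auto simp: norm_mult intro!: mult_right_mono lat_le_norm)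
  also have "\<dots> = ?S * norm (lat \<xi>)" by (simp add: sum_distrib_left mult.commute)
  also have "\<dots> \<le> (?S + 1) * norm (lat \<xi>)" by (intro mult_right_mono) auto
  finally show "cmod (msymb \<xi>) \<le> (?S + 1) * norm (lat \<xi>)" .
qed

text \<open>The condition measures the pair of \<tau> and \<xi>, the conclusion \<xi> alone. A near
  resonance forces \<tau> to be at most a multiple of the norm of \<xi>, so \<open>w_mult'\<close>
  compares the two weights after \<epsilon> has been divided by N. Without near resonance the
  denominator is at least 1 / 2.\<close>

lemma EDC_bound:
  assumes EDC: "EDC1 \<omega> (mean_vec a) (mean_vec b)" and \<epsilon>: "\<epsilon> > 0"
  obtains D where "D > 0" "\<And>\<xi>. \<xi> \<noteq> (\<lambda>_. 0) \<Longrightarrow> D * exp (- \<epsilon> * \<omega> (norm (lat \<xi>))) \<le> cmod (1 - exp (- \<i> * (2 * of_real pi * msymb \<xi>)))"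
    "\<And>\<xi>. \<xi> \<noteq> (\<lambda>_. 0) \<Longrightarrow> D * exp (- \<epsilon> * \<omega> (norm (lat \<xi>))) \<le> cmod (1 - exp (\<i> * (2 * of_real pi * msymb \<xi>)))"
proof -
  obtain B where B: "B > 0" "\<And>\<xi>. cmod (msymb \<xi>) \<le> B * norm (lat \<xi>)" using msymb_bound by blast
  \<comment> \<open>\<open>B + 1\<close> times the norm of \<xi> bounds \<tau> in modulus; one more
    multiple accounts for \<xi> itself.\<close>
  define N where "N = nat \<lceil>B\<rceil> + 2"
  have N: "real N \<ge> B + 2" "N \<ge> 1" unfolding N_def by linarith+
  have "\<epsilon> / real N > 0" using \<epsilon> N by simp
  then obtain C where C: "C > 0" "\<And>\<tau> \<xi>. \<tau> \<noteq> 0 \<or> (\<exists>j. \<xi> j \<noteq> 0) \<Longrightarrow>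
      cmod (of_int \<tau> + msymb \<xi>) \<ge> C * exp (- (\<epsilon> / real N) * \<omega> (sqrt (real_of_int \<tau> ^ 2 + (\<Sum>j\<in>UNIV. real_of_int (\<xi> j) ^ 2))))"
    using EDC unfolding EDC1_def msymb_def by blast
  define D where "D = min C (1 / 2)"
  have D: "0 < D" "D \<le> C" "D \<le> 1 / 2" using C(1) by (auto simp: D_def)
  have key: "D * exp (- \<epsilon> * \<omega> (norm (lat \<xi>))) \<le> cmod (1 - exp (2 * of_real pi * \<i> * z))"
    if \<xi>: "\<xi> \<noteq> (\<lambda>_. 0)" and z: "z = msymb \<xi> \<or> z = - msymb \<xi>" for \<xi> z
  proof -
    let ?y = "norm (lat \<xi>)"
    have y: "?y \<ge> 1" using \<xi> norm_lat_ge_1[of \<xi>] by auto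
    have w: "0 \<le> \<omega> ?y" by (intro w_nonneg) simp
    consider "1 / 2 \<le> cmod (1 - exp (2 * of_real pi * \<i> * z))"
      | n :: int where "cmod (of_int n + z) \<le> cmod (1 - exp (2 * of_real pi * \<i> * z))" "cmod (1 - exp (2 * of_real pi * \<i> * z)) < 1 / 2"
      using one_minus_exp_lower[of z] by force
    then show ?thesis
    proof cases
      case 1
      have "D * exp (- \<epsilon> * \<omega> ?y) \<le> (1 / 2) * 1" using D \<epsilon> w by (intro mult_mono) auto
      then show ?thesis using 1 by simp
    next
      case 2
      \<comment> \<open>For \<open>z = - msymb \<xi>\<close> the integer changes sign, so that both
        denominators are governed by the same form
        \<open>of_int \<tau> + msymb \<xi>\<close>.\<close>
      define \<tau> where "\<tau> = (if z = msymb \<xi> then n else - n)"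
      have tz: "cmod (of_int \<tau> + msymb \<xi>) = cmod (of_int n + z)"
      proof (cases "z = msymb \<xi>")
        case False
        then have "of_int \<tau> + msymb \<xi> = - (of_int n + z)" using z by (auto simp: \<tau>_def)
        then show ?thesis by (simp only: norm_minus_cancel)
      qed (simp add: \<tau>_def)
      have "\<bar>real_of_int \<tau>\<bar> = cmod (of_int \<tau>)" by simp
      also have "\<dots> \<le> cmod (of_int \<tau> + msymb \<xi>) + cmod (msymb \<xi>)"
        using norm_triangle_ineq4[of "of_int \<tau> + msymb \<xi>" "msymb \<xi>"] by simp
      also have "\<dots> \<le> 1 + B * ?y" using 2 tz B(2)[of \<xi>] by simp
      finally have t: "\<bar>real_of_int \<tau>\<bar> \<le> (1 + B) * ?y" using y by (simp add: distrib_right)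
      have "sqrt (real_of_int \<tau> ^ 2 + (\<Sum>j\<in>UNIV. real_of_int (\<xi> j) ^ 2)) = sqrt (real_of_int \<tau> ^ 2 + ?y ^ 2)"
        by (simp add: norm_lat sum_nonneg)
      also have "\<dots> \<le> \<bar>real_of_int \<tau>\<bar> + \<bar>?y\<bar>" by (rule sqrt_sum_squares_le_sum_abs)
      also have "\<dots> \<le> (B + 2) * ?y" using t by (simp add: distrib_right)
      also have "\<dots> \<le> real N * ?y" using N by (intro mult_right_mono) auto
      finally have "\<omega> (sqrt (real_of_int \<tau> ^ 2 + (\<Sum>j\<in>UNIV. real_of_int (\<xi> j) ^ 2))) \<le> \<omega> (real N * ?y)"
        by (intro w_mono) (auto intro!: add_nonneg_nonneg sum_nonneg)
      also have "\<dots> \<le> real N * \<omega> ?y" using N by (intro w_mult') auto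
      finally have "(\<epsilon> / real N) * \<omega> (sqrt (real_of_int \<tau> ^ 2 + (\<Sum>j\<in>UNIV. real_of_int (\<xi> j) ^ 2))) \<le> (\<epsilon> / real N) * (real N * \<omega> ?y)"
        using \<epsilon> by (intro mult_left_mono) auto
      then have e: "exp (- \<epsilon> * \<omega> ?y) \<le> exp (- (\<epsilon> / real N) * \<omega> (sqrt (real_of_int \<tau> ^ 2 + (\<Sum>j\<in>UNIV. real_of_int (\<xi> j) ^ 2))))"
        using N by simp
      have "D * exp (- \<epsilon> * \<omega> ?y) \<le> C * exp (- (\<epsilon> / real N) * \<omega> (sqrt (real_of_int \<tau> ^ 2 + (\<Sum>j\<in>UNIV. real_of_int (\<xi> j) ^ 2))))"
        using D e by (intro mult_mono) auto
      also have "\<dots> \<le> cmod (of_int \<tau> + msymb \<xi>)" using \<xi> by (intro C(2)) auto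
      finally show ?thesis using 2 tz by simp
    qed
  qed
  show ?thesis
  proof (rule that[OF D(1)])
    fix \<xi> :: "'n \<Rightarrow> int" assume "\<xi> \<noteq> (\<lambda>_. 0)"
    from key[OF this, of "- msymb \<xi>"] key[OF this, of "msymb \<xi>"]
    show "D * exp (- \<epsilon> * \<omega> (norm (lat \<xi>))) \<le> cmod (1 - exp (- \<i> * (2 * of_real pi * msymb \<xi>)))"
      "D * exp (- \<epsilon> * \<omega> (norm (lat \<xi>))) \<le> cmod (1 - exp (\<i> * (2 * of_real pi * msymb \<xi>)))"
      by (simp_all add: mult_ac)
  qed
qed

lemma mean_eq_zero_mode:
  fixes \<psi> :: "'n cyl \<Rightarrow> complex"
  assumes \<psi>: "\<psi> \<in> E_om \<omega>"
  shows "pairing (\<lambda>_. 1) \<psi> = (2 * of_real pi) ^ CARD('n) * integral {0..2*pi} (fcoef \<psi> (\<lambda>_. 0))"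
proof -
  have "lat (\<lambda>_. 0) = (0 :: real^'n)" by (simp add: vec_eq_iff)
  then show ?thesis using pairing_mode[of "\<lambda>_. 1" \<psi> "\<lambda>_ :: 'n. 0"] E_om_continuous[OF \<psi>] by simp
qed

text \<open>Budget of decay: the data decay at the rate \<open>2 * m\<close>, the denominators cost
  m / 2, and \<open>ode_regularity\<close> with d = m / 2 costs another m / 2. The remaining rate m
  is at least \<open>2 * l'\<close>.\<close>

theorem L_onto_mean_zero:
  assumes sgn: "\<And>\<xi>::'n \<Rightarrow> int. \<not> changes_sign (\<lambda>t. \<Sum>j\<in>UNIV. of_int (\<xi> j) * b j t)"
    and EDC: "EDC1 \<omega> (mean_vec a) (mean_vec b)"
    and \<psi>: "\<psi> \<in> E_om \<omega>" and mean: "pairing (\<lambda>_. 1) \<psi> = 0"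
  shows "\<exists>\<phi>\<in>E_om \<omega>. L \<phi> = \<psi>"
proof -
  obtain l C U where U: "l > 0" "0 \<le> C" "coef_bounded l (\<lambda>_. C) U" "\<And>\<xi>. U \<xi> 0 = fcoef \<psi> \<xi>" "synth (\<lambda>\<xi>. U \<xi> 0) = \<psi>"
    using E_om_rep[OF \<psi>] by blast
  obtain l1 A where A: "l1 > 0" "A \<ge> (1::nat)" "\<And>\<xi> k t. cmod (symb_seq \<xi> k t) \<le> real A * (1 + norm (lat \<xi>)) * M l1 k"
    using symb_seq_bound by blast
  define m where "m = min l l1"
  have m: "m > 0" "m \<le> l" "m \<le> l1" using U A by (auto simp: m_def)
  have Um: "coef_bounded m (\<lambda>_. C) U" by (rule coef_bounded_mono[OF U(3) m(1,2)]) (use U in auto)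
  have dU: "deriv_seq (U \<xi>)" and perU: "U \<xi> 0 (t + 2 * pi) = U \<xi> 0 t"
    and Ub: "cmod (U \<xi> k t) \<le> C * M m k * exp (- 2 * m * \<omega> (norm (lat \<xi>)))" for \<xi> k t
    using Um by (auto simp: coef_bounded_def)
  have Ucont: "continuous_on S (U \<xi> 0)" for S \<xi> by (rule deriv_seq_continuous[OF dU])
  have "m / 2 > 0" using m by simp
  then obtain D where D: "D > 0" 
    "\<And>\<xi>. \<xi> \<noteq> (\<lambda>_. 0) \<Longrightarrow> D * exp (- (m / 2) * \<omega> (norm (lat \<xi>))) \<le> cmod (1 - exp (- \<i> * (2 * of_real pi * msymb \<xi>)))"
    "\<And>\<xi>. \<xi> \<noteq> (\<lambda>_. 0) \<Longrightarrow> D * exp (- (m / 2) * \<omega> (norm (lat \<xi>))) \<le> cmod (1 - exp (\<i> * (2 * of_real pi * msymb \<xi>)))"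
    using EDC_bound[OF EDC] by blast
  let ?\<rho> = "\<lambda>\<xi>. exp (- (3 / 2) * m * \<omega> (norm (lat \<xi>)))"
  have nonzero: "\<exists>u. (\<forall>t. (u has_vector_derivative (U \<xi> 0 t - \<i> * symb \<xi> t * u t)) (at t)) \<and> (\<forall>t. u (t + 2 * pi) = u t)
      \<and> (\<forall>t. cmod (u t) \<le> 2 * pi * C * M m 0 / D * ?\<rho> \<xi>)" if \<xi>: "\<xi> \<noteq> (\<lambda>_. 0)" for \<xi>
  proof -
    let ?y = "norm (lat \<xi>)"
    have s: "(\<forall>t. Im (symb \<xi> t) \<le> 0) \<or> (\<forall>t. Im (symb \<xi> t) \<ge> 0)"
      using sgn[of \<xi>] unfolding Im_symb changes_sign_def by (meson not_le)
    have "\<exists>u. (\<forall>t. (u has_vector_derivative (U \<xi> 0 t - \<i> * symb \<xi> t * u t)) (at t)) \<and> (\<forall>t. u (t + 2 * pi) = u t)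
      \<and> (\<forall>t. cmod (u t) \<le> 2 * pi * (C * M m 0 * exp (- 2 * m * \<omega> ?y)) / (D * exp (- (m / 2) * \<omega> ?y)))"
      by (rule periodic_solvable[OF symb_continuous Ucont symb_periodic perU s Ub])
         (use D \<xi> in \<open>simp_all add: primitive_symb\<close>)
    moreover have "2 * pi * (C * M m 0 * exp (- 2 * m * \<omega> ?y)) / (D * exp (- (m / 2) * \<omega> ?y)) = 2 * pi * C * M m 0 / D * ?\<rho> \<xi>"
    proof -
      have "exp (- 2 * m * \<omega> ?y) = exp (- (m / 2) * \<omega> ?y) * ?\<rho> \<xi>" by (simp add: exp_add[symmetric])
      then show ?thesis using D(1) by simp
    qed
    ultimately show ?thesis by simp
  qed
  \<comment> \<open>At the zero frequency the symbol vanishes and a primitive solves the equation;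
    the vanishing of the mean is exactly its periodicity.\<close>
  obtain u0 where u0: "\<And>t. (u0 has_vector_derivative (U (\<lambda>_. 0) 0 t - \<i> * symb (\<lambda>_. 0) t * u0 t)) (at t)" "\<And>t. u0 (t + 2 * pi) = u0 t"
  proof (rule that[of "primitive (U (\<lambda>_. 0) 0)"])
    have "integral {0..2*pi} (fcoef \<psi> (\<lambda>_. 0)) = 0" using mean mean_eq_zero_mode[OF \<psi>] by simp
    then have "primitive (U (\<lambda>_. 0) 0) (2 * pi) = 0" by (simp add: primitive_nonneg U(4))
    then show "primitive (U (\<lambda>_. 0) 0) (t + 2 * pi) = primitive (U (\<lambda>_. 0) 0) t" for t
      by (simp add: primitive_period[OF Ucont perU])
    show "(primitive (U (\<lambda>_. 0) 0) has_vector_derivative U (\<lambda>_. 0) 0 t - \<i> * symb (\<lambda>_. 0) t * primitive (U (\<lambda>_. 0) 0) t) (at t)" for t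
      using primitive_deriv[OF Ucont] by (simp add: symb_def)
  qed
  have "continuous_on UNIV u0" using u0(1) by (meson continuous_at_imp_continuous_on has_vector_derivative_continuous)
  then obtain B0 where B0: "B0 > 0" "\<And>t. cmod (u0 t) \<le> B0" using bounded_of_periodic u0(2) by blast
  \<comment> \<open>The second summand extends the bound \<open>S * ?\<rho> \<xi>\<close> to the
    zero frequency.\<close>
  define S where "S = 2 * pi * C * M m 0 / D + B0 / ?\<rho> (\<lambda>_ :: 'n. 0)"
  have "0 \<le> 2 * pi * C * M m 0 / D" "0 \<le> B0 / ?\<rho> (\<lambda>_ :: 'n. 0)" using U(2) D(1) B0(1) by auto
  then have S: "0 \<le> S" "2 * pi * C * M m 0 / D \<le> S" "B0 / ?\<rho> (\<lambda>_ :: 'n. 0) \<le> S"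
    unfolding S_def by linarith+
  have "\<forall>\<xi>. \<exists>u. (\<forall>t. (u has_vector_derivative (U \<xi> 0 t - \<i> * symb \<xi> t * u t)) (at t)) \<and> (\<forall>t. u (t + 2 * pi) = u t)
      \<and> (\<forall>t. cmod (u t) \<le> S * ?\<rho> \<xi>)"
  proof
    fix \<xi>
    show "\<exists>u. (\<forall>t. (u has_vector_derivative (U \<xi> 0 t - \<i> * symb \<xi> t * u t)) (at t)) \<and> (\<forall>t. u (t + 2 * pi) = u t)
      \<and> (\<forall>t. cmod (u t) \<le> S * ?\<rho> \<xi>)"
    proof (cases "\<xi> = (\<lambda>_. 0)")
      case True
      have "B0 \<le> S * ?\<rho> (\<lambda>_ :: 'n. 0)" using S(3) by (simp add: pos_divide_le_eq)
      then show ?thesis using u0 B0 unfolding True by (meson order_trans)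
    next
      case False
      have "2 * pi * C * M m 0 / D * ?\<rho> \<xi> \<le> S * ?\<rho> \<xi>" using S by (intro mult_right_mono) auto
      then show ?thesis using nonzero[OF False] by (meson order_trans)
    qed
  qed
  then obtain u where u: "\<And>\<xi> t. (u \<xi> has_vector_derivative (U \<xi> 0 t - \<i> * symb \<xi> t * u \<xi> t)) (at t)"
    "\<And>\<xi> t. u \<xi> (t + 2 * pi) = u \<xi> t" "\<And>\<xi> t. cmod (u \<xi> t) \<le> S * ?\<rho> \<xi>" by metis
  define l' where "l' = m / 2 / (4 * real A)"
  have l': "l' > 0" "2 * l' \<le> m"
  proof -
    show "l' > 0" using m A by (simp add: l'_def)
    have "m / 2 / (4 * real A) \<le> m / 2 / 1" using m A by (intro divide_left_mono) auto
    then show "2 * l' \<le> m" by (simp add: l'_def)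
  qed
  define C' where "C' = (S * exp (m * \<omega> 1) + C) * exp (m / 2 * \<omega> 1)"
  have C': "0 \<le> C'" using S U(2) by (simp add: C'_def)
  have "\<forall>\<xi>. \<exists>V. deriv_seq V \<and> V 0 = u \<xi> \<and> (\<forall>k t. cmod (V k t) \<le> C' * M l' k * exp (- 2 * l' * \<omega> (norm (lat \<xi>))))"
  proof
    fix \<xi> :: "'n \<Rightarrow> int"
    let ?y = "norm (lat \<xi>)"
    have w: "0 \<le> \<omega> ?y" by (intro w_nonneg) simp
    have "cmod (symb_seq \<xi> j t) \<le> real A * (1 + ?y) * M m j" for j t
      using M_antimono[OF m(1,3), of j] by (intro order_trans[OF A(3)] mult_left_mono) auto
    moreover have "cmod (U \<xi> j t) \<le> (C * ?\<rho> \<xi>) * M m j" for j t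
    proof -
      have "exp (- 2 * m * \<omega> ?y) \<le> ?\<rho> \<xi>" using m w by simp
      then have "C * M m j * exp (- 2 * m * \<omega> ?y) \<le> C * M m j * ?\<rho> \<xi>" using U(2) by (intro mult_left_mono) auto
      then show ?thesis using Ub[of \<xi> j t] by (simp only: mult_ac)
    qed
    moreover have "(u \<xi> has_vector_derivative (U \<xi> 0 t - symb_seq \<xi> 0 t * u \<xi> t)) (at t)" for t
      using u(1) by (simp add: symb_seq_0)
    ultimately obtain V where V: "deriv_seq V" "V 0 = u \<xi>"
      "\<And>k t. cmod (V k t) \<le> ((S * ?\<rho> \<xi>) * exp (m * \<omega> 1) + C * ?\<rho> \<xi>) * exp (m / 2 * \<omega> (1 + ?y)) * M (m / 2 / (4 * real A)) k"
      using ode_regularity[of "m / 2" m A "1 + ?y" "S * ?\<rho> \<xi>" "C * ?\<rho> \<xi>" "symb_seq \<xi>" "U \<xi>" "u \<xi>"]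
        m A(2) S(1) U(2) deriv_seq_symb dU u(3) by (metis (no_types, lifting) add_increasing2 field_sum_of_halves
          half_gt_zero le_add_same_cancel1 less_eq_real_def mult_nonneg_nonneg norm_ge_zero exp_ge_zero)
    have "((S * ?\<rho> \<xi>) * exp (m * \<omega> 1) + C * ?\<rho> \<xi>) * exp (m / 2 * \<omega> (1 + ?y)) \<le> C' * exp (- 2 * l' * \<omega> ?y)"
    proof -
      have "m / 2 * \<omega> (1 + ?y) \<le> m / 2 * (\<omega> 1 + \<omega> ?y)" using w_add[of 1 ?y] m by (intro mult_left_mono) auto
      then have "exp (m / 2 * \<omega> (1 + ?y)) \<le> exp (m / 2 * \<omega> 1) * exp (m / 2 * \<omega> ?y)" by (simp add: exp_add[symmetric] distrib_left)
      then have "((S * ?\<rho> \<xi>) * exp (m * \<omega> 1) + C * ?\<rho> \<xi>) * exp (m / 2 * \<omega> (1 + ?y))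
        \<le> ((S * ?\<rho> \<xi>) * exp (m * \<omega> 1) + C * ?\<rho> \<xi>) * (exp (m / 2 * \<omega> 1) * exp (m / 2 * \<omega> ?y))"
        using S U(2) by (intro mult_left_mono) auto
      also have "\<dots> = C' * (?\<rho> \<xi> * exp (m / 2 * \<omega> ?y))" by (simp add: C'_def algebra_simps)
      also have "?\<rho> \<xi> * exp (m / 2 * \<omega> ?y) = exp (- m * \<omega> ?y)" by (simp add: exp_add[symmetric])
      also have "C' * exp (- m * \<omega> ?y) \<le> C' * exp (- 2 * l' * \<omega> ?y)" 
        using C' mult_right_mono[OF l'(2) w] by (intro mult_left_mono) auto
      finally show ?thesis .
    qed
    then have "cmod (V k t) \<le> C' * exp (- 2 * l' * \<omega> ?y) * M l' k" for k t
      using V(3)[of k t] unfolding l'_def[symmetric] by (meson M_nonneg mult_right_mono order_trans)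
    then show "\<exists>V. deriv_seq V \<and> V 0 = u \<xi> \<and> (\<forall>k t. cmod (V k t) \<le> C' * M l' k * exp (- 2 * l' * \<omega> (norm (lat \<xi>))))"
      using V(1,2) by (intro exI[of _ V]) (simp add: mult_ac)
  qed
  then obtain V where V: "\<And>\<xi>. deriv_seq (V \<xi>)" "\<And>\<xi>. V \<xi> 0 = u \<xi>"
    "\<And>\<xi> k t. cmod (V \<xi> k t) \<le> C' * M l' k * exp (- 2 * l' * \<omega> (norm (lat \<xi>)))" by metis
  have cb: "coef_bounded l' (\<lambda>_. C') V" unfolding coef_bounded_def using V u(2) by simp
  have "L (synth (\<lambda>\<xi>. V \<xi> 0)) = synth (\<lambda>\<xi>. U \<xi> 0)"
    by (rule L_synth_eq[OF l'(1) cb order_refl]) (use u(1) V(2) in simp)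
  then show ?thesis using synth_E_om(2)[OF l'(1) cb order_refl] U(5) by blast
qed

lemma L_const: "L (\<lambda>_. c) = (\<lambda>_. 0)"
  unfolding Lop_def Dl_const by (auto simp: fun_eq_iff)

lemma pairing_one_L: "f \<in> E_om \<omega> \<Longrightarrow> pairing (\<lambda>_. 1) (L f) = 0"
  using pairing_transpose[OF const_E_om[of 1], of f] unfolding L_const by (simp add: pairing_def)

definition vol :: complex where "vol = pairing (\<lambda>_ :: 'n cyl. 1) (\<lambda>_. 1)"

lemma vol_nonzero: "vol \<noteq> 0"
proof -
  have "vol = of_real (measure lborel (torus_box :: 'n cyl set))"
    unfolding vol_def pairing_def torus_box_eq by (simp add: scaleR_conv_of_real)
  then show ?thesis unfolding content_torus_box by simp
qed

text \<open>The literal form \<open>1 * \<psi> x + (- c) * 1\<close> is the one to which the rules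
  for linear combinations apply.\<close>

lemma mean_correction:
  fixes \<psi> :: "'n cyl \<Rightarrow> complex"
  assumes "\<psi> \<in> E_om \<omega>"
  defines "c \<equiv> pairing (\<lambda>_. 1) \<psi> / vol"
  shows "(\<lambda>x. 1 * \<psi> x + (- c) * 1) \<in> E_om \<omega>" "pairing (\<lambda>_. 1) (\<lambda>x. 1 * \<psi> x + (- c) * 1) = 0"
proof -
  show "(\<lambda>x. 1 * \<psi> x + (- c) * 1) \<in> E_om \<omega>" by (intro E_om_lincomb assms const_E_om)
  have "pairing (\<lambda>_. 1) (\<lambda>x. 1 * \<psi> x + (- c) * 1) = 1 * pairing (\<lambda>_. 1) \<psi> + (- c) * vol"
    unfolding vol_def by (intro pairing_lincomb_right E_om_continuous assms const_E_om)
  then show "pairing (\<lambda>_. 1) (\<lambda>x. 1 * \<psi> x + (- c) * 1) = 0" using vol_nonzero by (simp add: c_def)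
qed

lemma E_dual_lin:
  assumes "\<mu> \<in> E_dual \<omega>" "f \<in> E_om \<omega>" "g \<in> E_om \<omega>"
  shows "\<mu> (\<lambda>x. c * f x + d * g x) = c * \<mu> f + d * \<mu> g"
  using assms unfolding E_dual_def by blast

text \<open>A functional that vanishes on the range sees only the mean, since every function is a
  constant plus an element of the range.\<close>

lemma functional_via_mean:
  assumes onto: "\<And>\<psi>. \<psi> \<in> E_om \<omega> \<Longrightarrow> pairing (\<lambda>_. 1) \<psi> = 0 \<Longrightarrow> \<exists>\<phi>\<in>E_om \<omega>. L \<phi> = \<psi>"
    and \<mu>: "\<mu> \<in> E_dual \<omega>" and ker: "\<And>\<phi>. \<phi> \<in> E_om \<omega> \<Longrightarrow> \<mu> (L \<phi>) = 0" and \<psi>: "\<psi> \<in> E_om \<omega>"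
  shows "\<mu> \<psi> = \<mu> (\<lambda>_. 1) / vol * pairing (\<lambda>_. 1) \<psi>"
proof -
  let ?c = "pairing (\<lambda>_. 1) \<psi> / vol"
  obtain \<phi> where "\<phi> \<in> E_om \<omega>" "L \<phi> = (\<lambda>x. 1 * \<psi> x + (- ?c) * 1)" using onto mean_correction[OF \<psi>] by blast
  then have "\<mu> (\<lambda>x. 1 * \<psi> x + (- ?c) * 1) = 0" using ker by metis
  then show ?thesis unfolding E_dual_lin[OF \<mu> \<psi> const_E_om] by simp
qed

text \<open>The range is the null space of the continuous functional
  \<open>pairing (\<lambda>_. 1)\<close>, hence closed, and by \<open>functional_via_mean\<close>
  this functional spans the kernel of the transpose.\<close>

theorem solvable_of_onto:
  assumes onto: "\<And>\<psi>. \<psi> \<in> E_om \<omega> \<Longrightarrow> pairing (\<lambda>_. 1) \<psi> = 0 \<Longrightarrow> \<exists>\<phi>\<in>E_om \<omega>. L \<phi> = \<psi>"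
  shows "strongly_solvable \<omega> a b"
  unfolding strongly_solvable_def
proof
  have range: "L ` E_om \<omega> = {\<psi> \<in> E_om \<omega>. pairing (\<lambda>_. 1) \<psi> = 0}"
    using onto L_E_om(1) pairing_one_L by blast
  have "LB_open \<omega> {\<psi> \<in> E_om \<omega>. pairing (\<lambda>_ :: 'n cyl. 1) \<psi> \<in> - {0}}"
    by (rule linear_functional_open[OF pairing_lincomb_right pairing_functional_bound])
       (auto intro: E_om_continuous)
  moreover have "E_om \<omega> - L ` E_om \<omega> = {\<psi> \<in> E_om \<omega>. pairing (\<lambda>_. 1) \<psi> \<in> - {0}}" unfolding range by auto
  ultimately show "LB_closed \<omega> (L ` E_om \<omega>)" unfolding LB_closed_def range by auto
  let ?\<mu> = "functional_of (\<lambda>_ :: 'n cyl. 1)"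
  have "?\<mu> \<in> ker_tL \<omega> a b"
    unfolding ker_tL_def using functional_of_E_dual[OF const_E_om] L_E_om(1) pairing_one_L by (auto simp: functional_of_def)
  moreover have "\<exists>c. \<mu> = (\<lambda>f. \<Sum>\<nu>\<in>{?\<mu>}. c \<nu> * \<nu> f)" if "\<mu> \<in> ker_tL \<omega> a b" for \<mu>
  proof (intro exI[of _ "\<lambda>_. \<mu> (\<lambda>_. 1) / vol"] ext)
    fix f :: "'n cyl \<Rightarrow> complex"
    have \<mu>: "\<mu> \<in> E_dual \<omega>" "\<And>\<phi>. \<phi> \<in> E_om \<omega> \<Longrightarrow> \<mu> (L \<phi>) = 0" using that by (auto simp: ker_tL_def)
    show "\<mu> f = (\<Sum>\<nu>\<in>{?\<mu>}. \<mu> (\<lambda>_. 1) / vol * \<nu> f)"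
    proof (cases "f \<in> E_om \<omega>")
      case True
      then show ?thesis using functional_via_mean[OF onto \<mu> True] by (simp add: functional_of_def)
    next
      case False
      then show ?thesis using \<mu>(1) by (simp add: functional_of_def E_dual_def)
    qed
  qed
  ultimately show "fin_dim_fun (ker_tL \<omega> a b)" unfolding fin_dim_fun_def by (intro exI[of _ "{?\<mu>}"]) auto
qed

text \<open>Testing with the constant 1 shows that g has mean zero, so \<open>g = L f\<close> for
  some f in \<open>E_om\<close>. Then \<mu> and f agree on the range and differ by a multiple of the
  mean, which is the pairing with the constant c.\<close>

theorem hypoelliptic_of_onto:
  assumes onto: "\<And>\<psi>. \<psi> \<in> E_om \<omega> \<Longrightarrow> pairing (\<lambda>_. 1) \<psi> = 0 \<Longrightarrow> \<exists>\<phi>\<in>E_om \<omega>. L \<phi> = \<psi>"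
  shows "globally_hypoelliptic \<omega> a b"
  unfolding globally_hypoelliptic_def
proof (intro ballI impI)
  fix \<mu> :: "('n cyl \<Rightarrow> complex) \<Rightarrow> complex" assume \<mu>: "\<mu> \<in> E_dual \<omega>" and "\<exists>g\<in>E_om \<omega>. \<forall>\<phi>\<in>E_om \<omega>. - \<mu> (L \<phi>) = pairing g \<phi>"
  then obtain g where g: "g \<in> E_om \<omega>" "\<And>\<phi>. \<phi> \<in> E_om \<omega> \<Longrightarrow> - \<mu> (L \<phi>) = pairing g \<phi>" by blast
  have z: "(\<lambda>_ :: 'n cyl. 0) \<in> E_om \<omega>" by (rule const_E_om)
  have "\<mu> (\<lambda>_. 0) = 0" using E_dual_lin[OF \<mu> z z, of 0 0] by simp
  then have "pairing g (\<lambda>_. 1) = 0" using g(2)[OF const_E_om[of 1]] unfolding L_const by simp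
  then obtain f where f: "f \<in> E_om \<omega>" "L f = g" using onto[OF g(1)] pairing_commute by metis
  have key: "\<mu> (L \<phi>) = pairing f (L \<phi>)" if "\<phi> \<in> E_om \<omega>" for \<phi>
    using g(2)[OF that] pairing_transpose[OF f(1) that] f(2) by (metis minus_minus)
  define c where "c = (\<mu> (\<lambda>_. 1) - pairing f (\<lambda>_. 1)) / vol"
  show "\<exists>f\<in>E_om \<omega>. \<forall>\<phi>\<in>E_om \<omega>. \<mu> \<phi> = pairing f \<phi>"
  proof (intro bexI[of _ "\<lambda>x. 1 * f x + c * 1"] ballI)
    show "(\<lambda>x. 1 * f x + c * 1) \<in> E_om \<omega>" by (intro E_om_lincomb f const_E_om)
    fix \<psi> :: "'n cyl \<Rightarrow> complex" assume \<psi>: "\<psi> \<in> E_om \<omega>"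
    let ?c = "pairing (\<lambda>_. 1) \<psi> / vol"
    obtain \<phi> where \<phi>: "\<phi> \<in> E_om \<omega>" "L \<phi> = (\<lambda>x. 1 * \<psi> x + (- ?c) * 1)" using onto mean_correction[OF \<psi>] by blast
    have "1 * \<mu> \<psi> + (- ?c) * \<mu> (\<lambda>_. 1) = \<mu> (\<lambda>x. 1 * \<psi> x + (- ?c) * 1)" by (rule E_dual_lin[OF \<mu> \<psi> const_E_om, symmetric])
    also have "\<dots> = pairing f (\<lambda>x. 1 * \<psi> x + (- ?c) * 1)" using key[OF \<phi>(1)] unfolding \<phi>(2) .
    also have "\<dots> = 1 * pairing f \<psi> + (- ?c) * pairing f (\<lambda>_. 1)"
      by (intro pairing_lincomb_right E_om_continuous f \<psi> const_E_om)
    finally have "\<mu> \<psi> = pairing f \<psi> + c * pairing (\<lambda>_. 1) \<psi>" by (simp add: c_def diff_divide_distrib algebra_simps)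
    also have "\<dots> = 1 * pairing \<psi> f + c * pairing \<psi> (\<lambda>_. 1)" by (simp add: pairing_commute)
    also have "\<dots> = pairing \<psi> (\<lambda>x. 1 * f x + c * 1)"
      by (intro pairing_lincomb_right[symmetric] E_om_continuous f \<psi> const_E_om)
    finally show "\<mu> \<psi> = pairing (\<lambda>x. 1 * f x + c * 1) \<psi>" by (simp only: pairing_commute)
  qed
qed

end

section \<open>Necessity\<close>

text \<open>Gaussian elimination: a nonzero coefficient \<open>c k v\<close> is the pivot, and
  \<open>c'\<close> is the system after the unknown k has been eliminated.\<close>

lemma homogeneous_solution:
  fixes c :: "'i \<Rightarrow> 'j \<Rightarrow> complex"
  assumes "finite B" "finite T" "card B < card T"
  shows "\<exists>d. (\<exists>i\<in>T. d i \<noteq> 0) \<and> (\<forall>j\<in>B. (\<Sum>i\<in>T. d i * c i j) = 0)"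
  using assms
proof (induction B arbitrary: T c rule: finite_induct)
  case empty
  then have "T \<noteq> {}" by auto
  then show ?case by (intro exI[of _ "\<lambda>_. 1"]) auto
next
  case (insert v B)
  show ?case
  proof (cases "\<forall>i\<in>T. c i v = 0")
    case True
    obtain d where "\<exists>i\<in>T. d i \<noteq> 0" "\<forall>j\<in>B. (\<Sum>i\<in>T. d i * c i j) = 0"
      using insert.IH[of T c] insert.prems insert.hyps by auto
    then show ?thesis using True by (intro exI[of _ d]) auto
  next
    case False
    then obtain k where k: "k \<in> T" "c k v \<noteq> 0" by auto
    define T' where "T' = T - {k}"
    define c' where "c' = (\<lambda>i j. c i j - c i v / c k v * c k j)"
    have T': "finite T'" "card B < card T'" using insert k by (auto simp: T'_def)
    obtain d where d: "\<exists>i\<in>T'. d i \<noteq> 0" "\<forall>j\<in>B. (\<Sum>i\<in>T'. d i * c' i j) = 0" using insert.IH[OF T', of c'] by auto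
    define s where "s = - (\<Sum>i\<in>T'. d i * c i v / c k v)"
    define e where "e = (\<lambda>i. if i = k then s else d i)"
    have sum: "(\<Sum>i\<in>T. e i * c i j) = s * c k j + (\<Sum>i\<in>T'. d i * c i j)" for j
    proof -
      have "(\<Sum>i\<in>T. e i * c i j) = e k * c k j + (\<Sum>i\<in>T'. e i * c i j)"
        unfolding T'_def using insert.prems k by (subst sum.remove[of _ k]) auto
      also have "(\<Sum>i\<in>T'. e i * c i j) = (\<Sum>i\<in>T'. d i * c i j)" by (intro sum.cong) (auto simp: e_def T'_def)
      finally show ?thesis by (simp add: e_def)
    qed
    have "(\<Sum>i\<in>T. e i * c i j) = 0" if "j \<in> insert v B" for j
    proof (cases "j = v")
      case True
      then show ?thesis unfolding sum using k by (simp add: s_def sum_divide_distrib[symmetric])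
    next
      case False
      then have "j \<in> B" using that by auto
      then have "(\<Sum>i\<in>T'. d i * c' i j) = 0" using d by auto
      moreover have "(\<Sum>i\<in>T'. d i * c' i j) = (\<Sum>i\<in>T'. d i * c i j) + s * c k j"
        unfolding c'_def s_def by (simp add: algebra_simps sum_subtractf sum_distrib_left sum_distrib_right)
      ultimately show ?thesis unfolding sum by (simp add: add.commute)
    qed
    moreover have "\<exists>i\<in>T. e i \<noteq> 0" using d(1) by (auto simp: e_def T'_def)
    ultimately show ?thesis by blast
  qed
qed

section \<open>Consequences of infinitely many bad modes\<close>

lemma (in tube_operator) fcoef_continuous:
  fixes f :: "'n cyl \<Rightarrow> complex"
  assumes "f \<in> E_om \<omega>" shows "continuous_on X (fcoef f \<xi>)"
proof (rule continuous_at_imp_continuous_on, rule ballI)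
  show "isCont (fcoef f \<xi>) t" for t
    by (rule has_vector_derivative_continuous[OF L_E_om(2)[OF assms]])
qed

text \<open>The right-hand sides decay uniformly, while the lower bound c prevents the
  \<open>u \<xi>\<close> from decaying; the factor \<open>1 + norm (lat \<xi>)\<close> is what the
  construction for sign changes loses. No relation between the frequencies is assumed, so one can
  pass to infinite subsets, as \<open>not_solvable\<close> does.\<close>

locale singular_modes = tube_operator \<omega> a b for \<omega> :: "real \<Rightarrow> real" and a b :: "'n::finite \<Rightarrow> real \<Rightarrow> real" +
  fixes S :: "('n \<Rightarrow> int) set" and u :: "('n \<Rightarrow> int) \<Rightarrow> real \<Rightarrow> complex" and H :: "('n \<Rightarrow> int) \<Rightarrow> nat \<Rightarrow> real \<Rightarrow> complex"
    and l C B c :: real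
  assumes S_infinite: "infinite S" and l_pos: "l > 0" and C_nonneg: "0 \<le> C" and c_pos: "0 < c"
    and H_deriv: "\<And>\<xi>. \<xi> \<in> S \<Longrightarrow> deriv_seq (H \<xi>)"
    and H_period: "\<And>\<xi> t. \<xi> \<in> S \<Longrightarrow> H \<xi> 0 (t + 2 * pi) = H \<xi> 0 t"
    and H_bound: "\<And>\<xi> k t. \<xi> \<in> S \<Longrightarrow> cmod (H \<xi> k t) \<le> C * M l k * exp (- 2 * l * \<omega> (norm (lat \<xi>)))"
    and u_period: "\<And>\<xi> t. \<xi> \<in> S \<Longrightarrow> u \<xi> (t + 2 * pi) = u \<xi> t"
    and u_ode: "\<And>\<xi> t. \<xi> \<in> S \<Longrightarrow> (u \<xi> has_vector_derivative (H \<xi> 0 t - \<i> * symb \<xi> t * u \<xi> t)) (at t)"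
    and u_bound: "\<And>\<xi> t. \<xi> \<in> S \<Longrightarrow> cmod (u \<xi> t) \<le> B"
    and u_large: "\<And>\<xi>. \<xi> \<in> S \<Longrightarrow> \<exists>t. c \<le> (1 + norm (lat \<xi>)) * cmod (u \<xi> t)"
begin

lemma u_continuous: "\<xi> \<in> S \<Longrightarrow> continuous_on X (u \<xi>)"
  using u_ode by (meson continuous_at_imp_continuous_on has_vector_derivative_continuous)

lemma B_nonneg: "0 \<le> B"
proof -
  obtain \<xi> where "\<xi> \<in> S" using S_infinite by (metis all_not_in_conv finite.emptyI)
  then show ?thesis using order_trans[OF norm_ge_zero u_bound[of \<xi> 0]] by simp
qed

text \<open>The coefficients of an element of \<open>E_om\<close> decay at a rate
  \<open>2 * m\<close>. Half of this absorbs the factor \<open>1 + norm (lat \<xi>)\<close>; the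
  other half tends to zero along the lattice and leaves room for finitely many members of S
  only.\<close>

lemma no_smooth_representative:
  assumes f: "f \<in> E_om \<omega>" and eq: "\<And>\<xi> t. \<xi> \<in> S \<Longrightarrow> fcoef f \<xi> t = u \<xi> t"
  shows False
proof -
  obtain m K U where U: "m > 0" "0 \<le> K" "coef_bounded m (\<lambda>_. K) U" "\<And>\<xi>. U \<xi> 0 = fcoef f \<xi>" "synth (\<lambda>\<xi>. U \<xi> 0) = f"
    using E_om_rep[OF f] by blast
  obtain C1 where C1: "C1 > 0" "\<And>t. t \<ge> 0 \<Longrightarrow> (1 + t) ^ 1 \<le> C1 * exp (m * \<omega> t)" using power_le_exp_w[OF U(1), of 1] by blast
  define D where "D = C1 * K * M m 0 + 1"
  have D: "D > 0" "C1 * K * M m 0 \<le> D" using C1 U by (auto simp: D_def intro!: add_nonneg_pos)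
  have low: "c / D \<le> exp (- m * \<omega> (norm (lat \<xi>)))" if \<xi>: "\<xi> \<in> S" for \<xi>
  proof -
    let ?y = "norm (lat \<xi>)"
    obtain t where t: "c \<le> (1 + ?y) * cmod (u \<xi> t)" using u_large[OF \<xi>] by blast
    have "cmod (u \<xi> t) \<le> K * M m 0 * exp (- 2 * m * \<omega> ?y)"
      using U(3,4) eq[OF \<xi>, of t] unfolding coef_bounded_def by metis
    then have "(1 + ?y) * cmod (u \<xi> t) \<le> (C1 * exp (m * \<omega> ?y)) * (K * M m 0 * exp (- 2 * m * \<omega> ?y))"
      using C1(2)[of ?y] C1(1) by (intro mult_mono) auto
    also have "\<dots> = (C1 * K * M m 0) * (exp (m * \<omega> ?y) * exp (- 2 * m * \<omega> ?y))" by (simp only: mult_ac)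
    also have "exp (m * \<omega> ?y) * exp (- 2 * m * \<omega> ?y) = exp (- m * \<omega> ?y)" by (simp add: exp_add[symmetric])
    also have "(C1 * K * M m 0) * exp (- m * \<omega> ?y) \<le> D * exp (- m * \<omega> ?y)" using D by (intro mult_right_mono) auto
    finally have "c \<le> D * exp (- m * \<omega> ?y)" using t by linarith
    then show ?thesis using D by (simp add: pos_divide_le_eq mult.commute)
  qed
  have "(\<lambda>n. exp (- m * \<omega> (norm (lat (lat_enum n :: 'n \<Rightarrow> int))))) \<longlonglongrightarrow> 0"
    by (rule summable_LIMSEQ_zero[OF summable_lattice[OF U(1)]])
  moreover have "0 < c / D" using c_pos D by simp
  ultimately have "\<forall>\<^sub>F n in sequentially. exp (- m * \<omega> (norm (lat (lat_enum n :: 'n \<Rightarrow> int)))) < c / D"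
    by (rule order_tendstoD(2))
  then obtain N where N: "\<And>n. n \<ge> N \<Longrightarrow> exp (- m * \<omega> (norm (lat (lat_enum n :: 'n \<Rightarrow> int)))) < c / D"
    unfolding eventually_sequentially by blast
  have "S \<subseteq> lat_enum ` {..<N}"
  proof
    fix \<xi> assume \<xi>: "\<xi> \<in> S"
    obtain n where n: "lat_enum n = \<xi>" using bij_lat_enum by (metis bij_pointE)
    then have "n < N" using N[of n] low[OF \<xi>] by (metis not_le not_less)
    then show "\<xi> \<in> lat_enum ` {..<N}" using n by auto
  qed
  then show False using S_infinite finite_subset by blast
qed

text \<open>K may depend on \<xi> but m may not, which is what finite sums of modes require.\<close>

lemma mode_regularity:
  obtains m where "m > 0" "m \<le> l" "\<forall>\<xi>\<in>S. \<exists>V K. deriv_seq V \<and> V 0 = u \<xi> \<and> 0 \<le> K \<and> (\<forall>k t. cmod (V k t) \<le> K * M m k)"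
proof -
  obtain l1 A where A: "l1 > 0" "A \<ge> (1::nat)" "\<And>\<xi> k t. cmod (symb_seq \<xi> k t) \<le> real A * (1 + norm (lat \<xi>)) * M l1 k"
    using symb_seq_bound by blast
  define d where "d = min l l1"
  have d: "0 < d" "d \<le> l" "d \<le> l1" using l_pos A by (auto simp: d_def)
  show ?thesis
  proof (rule that[of "d / (4 * real A)"])
    show "d / (4 * real A) > 0" using d A by simp
    have "d / (4 * real A) \<le> d / 1" using d A by (intro divide_left_mono) auto
    then show "d / (4 * real A) \<le> l" using d by simp
    show "\<forall>\<xi>\<in>S. \<exists>V K. deriv_seq V \<and> V 0 = u \<xi> \<and> 0 \<le> K \<and> (\<forall>k t. cmod (V k t) \<le> K * M (d / (4 * real A)) k)"
    proof
      fix \<xi> assume \<xi>: "\<xi> \<in> S"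
      let ?y = "1 + norm (lat \<xi>)"
      have y: "1 \<le> ?y" by simp
      have sb: "cmod (symb_seq \<xi> j t) \<le> real A * ?y * M d j" for j t
        using M_antimono[OF d(1,3), of j] by (intro order_trans[OF A(3)] mult_left_mono) auto
      have hb: "cmod (H \<xi> j t) \<le> C * M d j" for j t
      proof -
        have "C * M l j * exp (- 2 * l * \<omega> (norm (lat \<xi>))) \<le> C * M d j * 1"
          using C_nonneg M_antimono[OF d(1,2), of j] l_pos w_nonneg[of "norm (lat \<xi>)"] by (intro mult_mono mult_left_mono) auto
        then show ?thesis using H_bound[OF \<xi>, of j t] by simp
    qed
    have ode: "(u \<xi> has_vector_derivative (H \<xi> 0 t - symb_seq \<xi> 0 t * u \<xi> t)) (at t)" for t
      using u_ode[OF \<xi>] by (simp add: symb_seq_0)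
    obtain V where V: "deriv_seq V" "V 0 = u \<xi>" "\<And>k t. cmod (V k t) \<le> (B * exp (d * \<omega> 1) + C) * exp (d * \<omega> ?y) * M (d / (4 * real A)) k"
      using ode_regularity[OF d(1) order_refl A(2) y B_nonneg C_nonneg deriv_seq_symb H_deriv[OF \<xi>] sb hb u_bound[OF \<xi>] ode] by blast
    then show "\<exists>V K. deriv_seq V \<and> V 0 = u \<xi> \<and> 0 \<le> K \<and> (\<forall>k t. cmod (V k t) \<le> K * M (d / (4 * real A)) k)"
      using B_nonneg C_nonneg by (intro exI[of _ V] exI[of _ "(B * exp (d * \<omega> 1) + C) * exp (d * \<omega> ?y)"]) auto
    qed
  qed
qed

definition partial :: "('n \<Rightarrow> int) set \<Rightarrow> 'n cyl \<Rightarrow> complex" where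
  "partial F = synth (\<lambda>\<xi> t. if \<xi> \<in> F then u \<xi> t else 0)"

definition rhs :: "('n \<Rightarrow> int) set \<Rightarrow> 'n cyl \<Rightarrow> complex" where
  "rhs F = synth (\<lambda>\<xi> t. if \<xi> \<in> F then H \<xi> 0 t else 0)"

lemma partial_E_om:
  assumes F: "finite F" "F \<subseteq> S"
  shows "partial F \<in> E_om \<omega>" "L (partial F) = rhs F"
proof -
  obtain m where m: "m > 0" "m \<le> l" "\<forall>\<xi>\<in>S. \<exists>V K. deriv_seq V \<and> V 0 = u \<xi> \<and> 0 \<le> K \<and> (\<forall>k t. cmod (V k t) \<le> K * M m k)"
    by (rule mode_regularity)
  have "\<exists>V K. \<xi> \<in> S \<longrightarrow> deriv_seq V \<and> V 0 = u \<xi> \<and> 0 \<le> K \<and> (\<forall>k t. cmod (V k t) \<le> K * M m k)" for \<xi>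
  proof (cases "\<xi> \<in> S")
    case True
    from bspec[OF m(3) this] obtain V K where "deriv_seq V \<and> V 0 = u \<xi> \<and> 0 \<le> K \<and> (\<forall>k t. cmod (V k t) \<le> K * M m k)" by (elim exE)
    then show ?thesis by (intro exI[of _ V] exI[of _ K] impI)
  qed simp
  then have "\<forall>\<xi>. \<exists>V K. \<xi> \<in> S \<longrightarrow> deriv_seq V \<and> V 0 = u \<xi> \<and> 0 \<le> K \<and> (\<forall>k t. cmod (V k t) \<le> K * M m k)" by (rule allI)
  then obtain V K where VK: "\<forall>\<xi>. \<xi> \<in> S \<longrightarrow> deriv_seq (V \<xi>) \<and> V \<xi> 0 = u \<xi> \<and> 0 \<le> K \<xi> \<and> (\<forall>k t. cmod (V \<xi> k t) \<le> K \<xi> * M m k)"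
    unfolding choice_iff by blast
  then have V: "\<And>\<xi>. \<xi> \<in> S \<Longrightarrow> deriv_seq (V \<xi>)" "\<And>\<xi>. \<xi> \<in> S \<Longrightarrow> V \<xi> 0 = u \<xi>" "\<And>\<xi>. \<xi> \<in> S \<Longrightarrow> 0 \<le> K \<xi>"
    "\<And>\<xi> k t. \<xi> \<in> S \<Longrightarrow> cmod (V \<xi> k t) \<le> K \<xi> * M m k" by blast+
  \<comment> \<open>The exponential undoes the decay that \<open>coef_bounded\<close> asks for; as F
    is finite, the resulting constants are still bounded.\<close>
  define K' where "K' = (\<lambda>\<xi>. if \<xi> \<in> F then K \<xi> * exp (2 * m * \<omega> (norm (lat \<xi>))) else 0)"
  define W where "W = (\<lambda>\<xi> k t. if \<xi> \<in> F then V \<xi> k t else 0)"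
  have K'0: "0 \<le> K' \<xi>" for \<xi> using F V(3) by (auto simp: K'_def)
  have K'le: "K' \<xi> \<le> (\<Sum>\<eta>\<in>F. K' \<eta>)" for \<xi>
  proof (cases "\<xi> \<in> F")
    case True
    then show ?thesis using F K'0 by (intro member_le_sum) auto
  next
    case False
    then have "K' \<xi> = 0" by (simp add: K'_def)
    then show ?thesis using K'0 by (simp add: sum_nonneg)
  qed
  have cb: "coef_bounded m K' W" unfolding coef_bounded_def
  proof (intro conjI allI)
    show "deriv_seq (W \<xi>)" for \<xi>
    proof (cases "\<xi> \<in> F")
      case True
      then have "W \<xi> = V \<xi>" by (simp add: W_def)
      then show ?thesis using V(1)[of \<xi>] F True by auto
    next
      case False
      then have "W \<xi> = (\<lambda>k t. 0)" by (simp add: W_def)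
      then show ?thesis by (simp add: deriv_seq_zero)
    qed
    show "W \<xi> 0 (t + 2 * pi) = W \<xi> 0 t" for \<xi> t
      using F V(2)[of \<xi>] u_period[of \<xi> t] by (cases "\<xi> \<in> F") (auto simp: W_def)
    show "cmod (W \<xi> k t) \<le> K' \<xi> * M m k * exp (- 2 * m * \<omega> (norm (lat \<xi>)))" for \<xi> k t
    proof (cases "\<xi> \<in> F")
      case True
      then have "cmod (W \<xi> k t) \<le> K \<xi> * M m k" using F V(4) by (auto simp: W_def)
      also have "\<dots> = K' \<xi> * M m k * exp (- 2 * m * \<omega> (norm (lat \<xi>)))" using True by (simp add: K'_def exp_minus)
      finally show ?thesis .
    qed (simp add: W_def K'_def)
  qed
  have W0: "(\<lambda>\<xi>. W \<xi> 0) = (\<lambda>\<xi> t. if \<xi> \<in> F then u \<xi> t else 0)"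
  proof (intro ext)
    show "W \<xi> 0 t = (if \<xi> \<in> F then u \<xi> t else 0)" for \<xi> t
      using F V(2)[of \<xi>] by (cases "\<xi> \<in> F") (auto simp: W_def)
  qed
  show "partial F \<in> E_om \<omega>" unfolding partial_def W0[symmetric] by (rule synth_E_om(2)[OF m(1) cb K'le])
  show "L (partial F) = rhs F" unfolding partial_def W0[symmetric] rhs_def
  proof (rule L_synth_eq[OF m(1) cb K'le])
    fix \<xi> t
    show "(W \<xi> 0 has_vector_derivative ((if \<xi> \<in> F then H \<xi> 0 t else 0) - \<i> * symb \<xi> t * W \<xi> 0 t)) (at t)"
      unfolding fun_cong[OF W0, of \<xi>] using F u_ode[of \<xi> t] by (cases "\<xi> \<in> F") auto
  qed
qed

lemma rhs_coef_bounded: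
  assumes "F \<subseteq> S" shows "coef_bounded l (\<lambda>\<xi>. if \<xi> \<in> F then C else 0) (\<lambda>\<xi> k t. if \<xi> \<in> F then H \<xi> k t else 0)"
  unfolding coef_bounded_def
proof (intro conjI allI)
  show "deriv_seq (\<lambda>k t. if \<xi> \<in> F then H \<xi> k t else 0)" for \<xi>
    using assms H_deriv[of \<xi>] deriv_seq_zero by (cases "\<xi> \<in> F") auto
qed (use assms H_period H_bound in auto)

lemma if_C_le: "(if P then C else 0) \<le> C"
  using C_nonneg by simp

lemma rhs_E_om: "F \<subseteq> S \<Longrightarrow> rhs F \<in> E_om \<omega>"
  unfolding rhs_def using synth_E_om(2)[OF l_pos rhs_coef_bounded if_C_le] by simp

lemma fcoef_rhs: "F \<subseteq> S \<Longrightarrow> fcoef (rhs F) \<xi> t = (if \<xi> \<in> F then H \<xi> 0 t else 0)"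
  unfolding rhs_def using fcoef_synth[OF l_pos rhs_coef_bounded if_C_le, of F \<xi> t] by simp

text \<open>Zero off S, so that series over the whole lattice can be formed.\<close>

definition mode :: "('n \<Rightarrow> int) \<Rightarrow> 'n cyl \<Rightarrow> complex" where
  "mode \<xi> p = (if \<xi> \<in> S then u \<xi> (fst p) else 0) * cis (lat \<xi> \<bullet> snd p)"

lemma synth_single:
  fixes \<xi> :: "'n \<Rightarrow> int"
  shows "synth (\<lambda>\<eta> t. if \<eta> \<in> {\<xi>} then w \<eta> t else 0) p = w \<xi> (fst p) * cis (lat \<xi> \<bullet> snd p)"
proof -
  obtain m where m: "lat_enum m = \<xi>" using bij_lat_enum by (metis bij_pointE)
  have eq: "lat_enum n = \<xi> \<longleftrightarrow> n = m" for n using m injD[OF bij_is_inj[OF bij_lat_enum], of n m] by auto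
  have "(\<lambda>n. if n = m then w \<xi> (fst p) * cis (lat \<xi> \<bullet> snd p) else 0) sums (w \<xi> (fst p) * cis (lat \<xi> \<bullet> snd p))"
    using sums_single[of m "\<lambda>_. w \<xi> (fst p) * cis (lat \<xi> \<bullet> snd p)"] by simp
  moreover have "(\<lambda>n. if n = m then w \<xi> (fst p) * cis (lat \<xi> \<bullet> snd p) else 0)
    = (\<lambda>n. (if lat_enum n \<in> {\<xi>} then w (lat_enum n) (fst p) else 0) * cis (lat (lat_enum n) \<bullet> snd p))"
  proof
    show "(if n = m then w \<xi> (fst p) * cis (lat \<xi> \<bullet> snd p) else 0) = (if lat_enum n \<in> {\<xi>} then w (lat_enum n) (fst p) else 0) * cis (lat (lat_enum n) \<bullet> snd p)" for n
      using eq[of n] m by (cases "n = m") auto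
  qed
  ultimately show ?thesis unfolding synth_def by (simp add: sums_iff)
qed

lemma mode_partial: "\<xi> \<in> S \<Longrightarrow> mode \<xi> = partial {\<xi>}"
  unfolding partial_def by (rule ext) (subst synth_single, simp add: mode_def)

lemma mode_E_om: "mode \<xi> \<in> E_om \<omega>"
proof (cases "\<xi> \<in> S")
  case True
  then show ?thesis using partial_E_om(1)[of "{\<xi>}"] by (simp add: mode_partial)
next
  case False
  then have "mode \<xi> = (\<lambda>_. 0)" by (auto simp: mode_def)
  then show ?thesis using const_E_om by simp
qed

lemma L_mode: "L (mode \<xi>) p = (if \<xi> \<in> S then H \<xi> 0 (fst p) else 0) * cis (lat \<xi> \<bullet> snd p)"
proof (cases "\<xi> \<in> S")
  case True
  then show ?thesis using partial_E_om(2)[of "{\<xi>}"] synth_single[of \<xi> "\<lambda>\<eta>. H \<eta> 0" p] by (simp add: mode_partial rhs_def)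
next
  case False
  then have "mode \<xi> = (\<lambda>_. 0)" by (auto simp: mode_def)
  then show ?thesis using False by (simp add: L_const)
qed

lemma pairing_mode_eq:
  assumes "\<phi> \<in> E_om \<omega>"
  shows "pairing (mode \<xi>) \<phi> = (2 * of_real pi) ^ CARD('n) * integral {0..2*pi} (\<lambda>t. (if \<xi> \<in> S then u \<xi> t else 0) * fcoef \<phi> (\<lambda>j. - \<xi> j) t)"
  unfolding mode_def[abs_def]
  by (rule pairing_mode[where u = "\<lambda>t. if \<xi> \<in> S then u \<xi> t else 0"]) (use u_continuous E_om_continuous[OF assms] in \<open>cases "\<xi> \<in> S"; simp\<close>)+

text \<open>Pairing it with the mode of frequency \<xi> picks out a Fourier coefficient in t of
  \<open>u \<xi>\<close>; in this way the modes are recovered from functionals.\<close>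

definition tester :: "('n \<Rightarrow> int) \<Rightarrow> int \<Rightarrow> 'n cyl \<Rightarrow> complex" where
  "tester \<xi> \<tau> = synth (\<lambda>\<eta> t. if \<eta> \<in> {\<lambda>j. - \<xi> j} then cis (of_int \<tau> * t) else 0)"

lemma tester:
  shows "tester \<xi> \<tau> \<in> E_om \<omega>"
    and "fcoef (tester \<xi> \<tau>) \<eta> t = (if \<eta> = (\<lambda>j. - \<xi> j) then cis (of_int \<tau> * t) else 0)"
    and "tester \<xi> \<tau> = (\<lambda>p. cis (of_int \<tau> * fst p) * cis (lat (\<lambda>j. - \<xi> j) \<bullet> snd p))"
proof -
  define T where "T = (\<lambda>\<eta> k t. if \<eta> \<in> {\<lambda>j. - \<xi> j} then (\<i> * of_int \<tau>) ^ k * cis (of_int \<tau> * t) else 0)"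
  define K where "K = exp (1 * \<omega> 1) * exp (1 * \<omega> \<bar>of_int \<tau>\<bar>) * exp (2 * 1 * \<omega> (norm (lat (\<lambda>j. - \<xi> j))))"
  have cb: "coef_bounded 1 (\<lambda>_. K) T" unfolding coef_bounded_def
  proof (intro conjI allI)
    fix \<eta> :: "'n \<Rightarrow> int"
    have "((\<lambda>t. (\<i> * of_int \<tau>) ^ k * cis (of_int \<tau> * t)) has_vector_derivative (\<i> * of_int \<tau>) ^ k * (\<i> * of_int \<tau> * cis (of_int \<tau> * t))) (at t)" for k t
    proof (rule has_vector_derivative_mult_right)
      have "((\<lambda>t. of_int \<tau> * t) has_derivative (\<lambda>h. h * of_int \<tau>)) (at t)" by (auto intro!: derivative_eq_intros)
      from has_derivative_cis[OF this] show "((\<lambda>t. cis (of_int \<tau> * t)) has_vector_derivative \<i> * of_int \<tau> * cis (of_int \<tau> * t)) (at t)"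
        by (simp add: has_vector_derivative_def scaleR_conv_of_real mult_ac)
    qed
    then show "deriv_seq (T \<eta>)" using deriv_seq_zero
      by (cases "\<eta> = (\<lambda>j. - \<xi> j)") (auto simp: T_def deriv_seq_def mult_ac)
    show "T \<eta> 0 (t + 2 * pi) = T \<eta> 0 t" for t
    proof -
      have "cis (of_int \<tau> * (t + 2 * pi)) = cis (of_int \<tau> * t) * cis (2 * pi * of_int \<tau>)"
        unfolding cis_mult by (simp add: algebra_simps)
      then show ?thesis by (simp add: T_def)
    qed
    fix k t
    have ti: "\<bar>real_of_int \<tau>\<bar> \<ge> 1 \<or> \<bar>real_of_int \<tau>\<bar> = 0" by (cases "\<tau> = 0") (auto simp flip: of_int_abs)
    show "cmod (T \<eta> k t) \<le> K * M 1 k * exp (- 2 * 1 * \<omega> (norm (lat \<eta>)))"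
    proof (cases "\<eta> = (\<lambda>j. - \<xi> j)")
      case True
      have "cmod (T \<eta> k t) = \<bar>real_of_int \<tau>\<bar> ^ k" using True by (simp add: T_def norm_mult norm_power)
      also have "\<dots> \<le> exp (1 * \<omega> 1) * (M 1 k * exp (1 * \<omega> \<bar>of_int \<tau>\<bar>))" by (rule M_power[OF zero_less_one ti])
      also have "\<dots> = K * M 1 k * exp (- 2 * 1 * \<omega> (norm (lat \<eta>)))" unfolding True by (simp add: K_def exp_minus)
      finally show ?thesis .
    qed (simp add: T_def K_def)
  qed
  have T0: "(\<lambda>\<eta>. T \<eta> 0) = (\<lambda>\<eta> t. if \<eta> \<in> {\<lambda>j. - \<xi> j} then cis (of_int \<tau> * t) else 0)" by (auto simp: T_def fun_eq_iff)
  show "tester \<xi> \<tau> \<in> E_om \<omega>" unfolding tester_def T0[symmetric] by (rule synth_E_om(2)[OF zero_less_one cb order_refl])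
  show "fcoef (tester \<xi> \<tau>) \<eta> t = (if \<eta> = (\<lambda>j. - \<xi> j) then cis (of_int \<tau> * t) else 0)"
    unfolding tester_def T0[symmetric] fcoef_synth[OF zero_less_one cb order_refl] by (simp add: T_def)
  show "tester \<xi> \<tau> = (\<lambda>p. cis (of_int \<tau> * fst p) * cis (lat (\<lambda>j. - \<xi> j) \<bullet> snd p))"
    unfolding tester_def by (rule ext) (rule synth_single)
qed

lemma pairing_mode_tester:
  assumes "\<xi> \<in> S"
  shows "pairing (mode \<eta>) (tester \<xi> \<tau>) = (if \<eta> = \<xi> then (2 * of_real pi) ^ CARD('n) * integral {0..2*pi} (\<lambda>t. u \<xi> t * cis (of_int \<tau> * t)) else 0)"
proof -
  have "(\<lambda>j. - \<eta> j) = (\<lambda>j. - \<xi> j) \<longleftrightarrow> \<eta> = \<xi>" by (auto simp: fun_eq_iff)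
  then show ?thesis unfolding pairing_mode_eq[OF tester(1)] tester(2) using assms by auto
qed

lemma real_fourier_unique:
  fixes r :: "real \<Rightarrow> complex"
  assumes "continuous_on UNIV r" "\<And>t. r (t + 2 * pi) = r t" "\<And>\<tau>::int. integral {0..2*pi} (\<lambda>t. r t * cis (of_int \<tau> * t)) = 0"
  shows "r t = 0"
proof (rule fourier_unique[OF assms(1)])
  show "periodic_fn r" using assms(2) by (simp add: periodic_fn_def)
  fix k :: real assume "\<forall>b\<in>Basis. k \<bullet> b \<in> \<int>"
  then obtain \<tau> :: int where "k = of_int \<tau>" by (auto elim: Ints_cases)
  then show "integral torus_box (\<lambda>x. r x * cis (k \<bullet> x)) = 0" using assms(3)[of \<tau>] by (simp add: torus_box_def)
qed

text \<open>The pairings with the modes lie in the kernel because \<open>L (mode \<xi>)\<close>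
  vanishes. If a finite set X spanned the kernel, one more mode than X has elements would satisfy a
  linear relation, and the testers at a frequency with nonzero coefficient would give
  \<open>u \<xi> = 0\<close>.\<close>

lemma infinite_kernel:
  assumes H0: "\<And>\<xi> t. \<xi> \<in> S \<Longrightarrow> H \<xi> 0 t = 0"
  shows "\<not> fin_dim_fun (ker_tL \<omega> a b)"
proof
  let ?\<mu> = "\<lambda>\<xi>. functional_of (mode \<xi>)"
  have ker: "?\<mu> \<xi> \<in> ker_tL \<omega> a b" if \<xi>: "\<xi> \<in> S" for \<xi>
  proof -
    have "L (mode \<xi>) = (\<lambda>_. 0)" using H0[OF \<xi>] by (auto simp: L_mode)
    then have "pairing (mode \<xi>) (L \<phi>) = 0" if "\<phi> \<in> E_om \<omega>" for \<phi>
      using pairing_transpose[OF mode_E_om that, of \<xi>] by (simp add: pairing_def)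
    then show ?thesis unfolding ker_tL_def using functional_of_E_dual[OF mode_E_om] L_E_om(1) by (auto simp: functional_of_def)
  qed
  assume "fin_dim_fun (ker_tL \<omega> a b)"
  then obtain X where X: "finite X" "\<And>\<mu>. \<mu> \<in> ker_tL \<omega> a b \<Longrightarrow> \<exists>c. \<mu> = (\<lambda>f. \<Sum>\<nu>\<in>X. c \<nu> * \<nu> f)"
    unfolding fin_dim_fun_def by blast
  have "\<forall>\<xi>\<in>S. \<exists>c. ?\<mu> \<xi> = (\<lambda>f. \<Sum>\<nu>\<in>X. c \<nu> * \<nu> f)" by (intro ballI X(2) ker)
  from bchoice[OF this] obtain cc where cc0: "\<forall>\<xi>\<in>S. ?\<mu> \<xi> = (\<lambda>f. \<Sum>\<nu>\<in>X. cc \<xi> \<nu> * \<nu> f)" ..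
  have cc: "?\<mu> \<xi> f = (\<Sum>\<nu>\<in>X. cc \<xi> \<nu> * \<nu> f)" if "\<xi> \<in> S" for \<xi> f
    by (rule fun_cong[OF bspec[OF cc0 that]])
  obtain T where T: "T \<subseteq> S" "finite T" "card T = Suc (card X)" using infinite_arbitrarily_large[OF S_infinite] by blast
  have "card X < card T" using T by simp
  from homogeneous_solution[OF X(1) T(2) this, of cc]
  obtain d where d: "\<exists>i\<in>T. d i \<noteq> 0" "\<And>\<nu>. \<nu> \<in> X \<Longrightarrow> (\<Sum>\<xi>\<in>T. d \<xi> * cc \<xi> \<nu>) = 0" by auto
  then obtain \<xi> where \<xi>: "\<xi> \<in> T" "d \<xi> \<noteq> 0" by auto
  have \<xi>S: "\<xi> \<in> S" using \<xi> T by auto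
  have zero: "(\<Sum>\<eta>\<in>T. d \<eta> * ?\<mu> \<eta> f) = 0" for f
  proof -
    have "(\<Sum>\<eta>\<in>T. d \<eta> * ?\<mu> \<eta> f) = (\<Sum>\<eta>\<in>T. \<Sum>\<nu>\<in>X. (d \<eta> * cc \<eta> \<nu>) * \<nu> f)"
    proof (rule sum.cong[OF refl])
      fix \<eta> assume "\<eta> \<in> T"
      then have "\<eta> \<in> S" using T(1) by auto
      then show "d \<eta> * ?\<mu> \<eta> f = (\<Sum>\<nu>\<in>X. (d \<eta> * cc \<eta> \<nu>) * \<nu> f)"
        by (simp only: cc sum_distrib_left mult.assoc)
    qed
    also have "\<dots> = (\<Sum>\<nu>\<in>X. (\<Sum>\<eta>\<in>T. d \<eta> * cc \<eta> \<nu>) * \<nu> f)" by (subst sum.swap) (simp add: sum_distrib_right)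
    finally show ?thesis using d(2) by simp
  qed
  have "integral {0..2*pi} (\<lambda>t. u \<xi> t * cis (of_int \<tau> * t)) = 0" for \<tau>
  proof -
    have "(\<Sum>\<eta>\<in>T. d \<eta> * ?\<mu> \<eta> (tester \<xi> \<tau>)) = (\<Sum>\<eta>\<in>T. if \<eta> = \<xi> then d \<xi> * ((2 * of_real pi) ^ CARD('n) * integral {0..2*pi} (\<lambda>t. u \<xi> t * cis (of_int \<tau> * t))) else 0)"
      by (intro sum.cong refl) (simp add: functional_of_def tester(1) pairing_mode_tester[OF \<xi>S])
    also have "\<dots> = d \<xi> * ((2 * of_real pi) ^ CARD('n) * integral {0..2*pi} (\<lambda>t. u \<xi> t * cis (of_int \<tau> * t)))"
      using T(2) \<xi>(1) by simp
    finally show ?thesis using zero \<xi>(2) by simp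
  qed
  from real_fourier_unique[OF u_continuous[OF \<xi>S] u_period[OF \<xi>S] this] have "u \<xi> t = 0" for t .
  then show False using u_large[OF \<xi>S] c_pos by simp
qed

text \<open>If the complement of the range were open at \<open>rhs S\<close>, the neighbourhood
  \<open>W\<close> of zero would contain \<open>- rhs (S - F)\<close> for large finite F, and
  \<open>rhs F\<close>, the difference of \<open>rhs S\<close> and \<open>rhs (S - F)\<close>, would
  lie outside the range, although it is \<open>L (partial F)\<close>.\<close>

lemma range_not_closed:
  assumes ne: "\<And>\<xi>. \<xi> \<in> S \<Longrightarrow> exp (\<i> * (2 * of_real pi * msymb \<xi>)) \<noteq> 1"
  shows "\<not> LB_closed \<omega> (L ` E_om \<omega>)"
proof
  assume closed: "LB_closed \<omega> (L ` E_om \<omega>)"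
  let ?g = "rhs S"
  have gE: "?g \<in> E_om \<omega>" by (rule rhs_E_om) simp
  have "?g \<notin> L ` E_om \<omega>"
  proof
    assume "?g \<in> L ` E_om \<omega>"
    then obtain f where f: "f \<in> E_om \<omega>" "L f = ?g" by auto
    show False
    proof (rule no_smooth_representative[OF f(1)])
      fix \<xi> t assume \<xi>: "\<xi> \<in> S"
      have "fcoef f \<xi> t - u \<xi> t = 0"
      proof (rule ode_periodic_unique[where c = "symb \<xi>" and w = "\<lambda>t. fcoef f \<xi> t - u \<xi> t" and h = "\<lambda>_. 0"])
        show "((\<lambda>t. fcoef f \<xi> t - u \<xi> t) has_vector_derivative - \<i> * symb \<xi> t * (fcoef f \<xi> t - u \<xi> t)) (at t)" for t
          using has_vector_derivative_diff[OF L_E_om(2)[OF f(1), of \<xi> t] u_ode[OF \<xi>, of t]]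
          by (simp add: f(2) fcoef_rhs \<xi> algebra_simps)
        show "fcoef f \<xi> (t + 2 * pi) - u \<xi> (t + 2 * pi) = fcoef f \<xi> t - u \<xi> t" for t
          using fcoef_periodic[OF E_om_periodic[OF f(1)]] u_period[OF \<xi>] by simp
        show "exp (\<i> * primitive (symb \<xi>) (2 * pi)) \<noteq> 1" using ne[OF \<xi>] by (simp add: primitive_symb)
      qed (auto simp: symb_continuous symb_periodic)
      then show "fcoef f \<xi> t = u \<xi> t" by simp
    qed
  qed
  then have "LB_zero_nhd \<omega> ((\<lambda>h x. h x - ?g x) ` (E_om \<omega> - L ` E_om \<omega>))"
    using closed gE unfolding LB_closed_def LB_open_def by blast
  then obtain W where W: "W \<subseteq> (\<lambda>h x. h x - ?g x) ` (E_om \<omega> - L ` E_om \<omega>)"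
    "\<And>k::nat. k \<ge> 1 \<Longrightarrow> \<exists>\<epsilon>>0. \<forall>f\<in>Estep \<omega> k. norm_lam \<omega> (1 / real k) f < \<epsilon> \<longrightarrow> f \<in> W"
    unfolding LB_zero_nhd_def by blast
  obtain k where k: "k \<ge> 1" "1 / real k \<le> l" using small_step[OF l_pos] by blast
  obtain \<epsilon> where \<epsilon>: "\<epsilon> > 0" "\<And>f. f \<in> Estep \<omega> k \<Longrightarrow> norm_lam \<omega> (1 / real k) f < \<epsilon> \<Longrightarrow> f \<in> W" using W(2)[OF k(1)] by blast
  let ?E = "\<lambda>n. exp (- l * \<omega> (norm (lat (lat_enum n :: 'n \<Rightarrow> int))))"
  have smE: "summable ?E" by (rule summable_lattice[OF l_pos])
  define K where "K = exp (l * \<omega> 1) * C + 1"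
  have K: "K > 0" using C_nonneg by (auto simp: K_def intro!: add_nonneg_pos)
  have "0 < \<epsilon> / K" using \<epsilon> K by simp
  \<comment> \<open>K times the lattice sum beyond N is below \<epsilon>; F keeps the frequencies of
    S that are enumerated before N.\<close>
  then obtain N where N: "norm (\<Sum>n. ?E (n + N)) < \<epsilon> / K" using suminf_exist_split[OF _ smE] by blast
  define F where "F = S \<inter> lat_enum ` {..<N}"
  have F: "finite F" "F \<subseteq> S" by (auto simp: F_def)
  have SF: "S - F \<subseteq> S" by auto
  let ?C = "\<lambda>\<xi>. if \<xi> \<in> S - F then C else 0"
  have tail: "decay_sum l ?C \<le> C * (\<Sum>n. ?E (n + N))"
  proof -
    have sm: "summable (\<lambda>n. ?C (lat_enum n) * ?E n)" by (rule summable_decay[OF l_pos rhs_coef_bounded[OF SF] if_C_le])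
    have "?C (lat_enum n) = 0" if "n < N" for n using that by (auto simp: F_def)
    then have "(\<Sum>n<N. ?C (lat_enum n) * ?E n) = 0" by (intro sum.neutral) auto
    then have "decay_sum l ?C = (\<Sum>n. ?C (lat_enum (n + N)) * ?E (n + N))"
      unfolding decay_sum_def suminf_split_initial_segment[OF sm, of N] by simp
    also have "\<dots> \<le> (\<Sum>n. C * ?E (n + N))"
    proof (rule suminf_le)
      show "summable (\<lambda>n. ?C (lat_enum (n + N)) * ?E (n + N))" using sm by (subst summable_iff_shift)
      show "summable (\<lambda>n. C * ?E (n + N))" by (intro summable_mult) (use smE in \<open>subst summable_iff_shift\<close>)
    qed (intro mult_right_mono if_C_le, simp)
    also have "\<dots> = C * (\<Sum>n. ?E (n + N))" by (rule suminf_mult) (use smE in \<open>subst summable_iff_shift\<close>)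
    finally show ?thesis .
  qed
  \<comment> \<open>This is \<open>- rhs (S - F)\<close>, written as a linear combination to fit
    \<open>seminorm_le_lincomb\<close>.\<close>
  let ?r = "\<lambda>x. 0 * rhs (S - F) x + (-1) * rhs (S - F) x"
  have rE: "rhs (S - F) \<in> Cinf_torus" using rhs_E_om[OF SF] E_om_Cinf by blast
  have "seminorm_le l (exp (l * \<omega> 1) * decay_sum l ?C) (rhs (S - F))"
    unfolding rhs_def using synth_E_om(1)[OF l_pos rhs_coef_bounded[OF SF] if_C_le] by simp
  then have "seminorm_le (1 / real k) (exp (l * \<omega> 1) * decay_sum l ?C) (rhs (S - F))"
    using k by (rule_tac seminorm_le_mono) auto
  then have sr: "seminorm_le (1 / real k) (exp (l * \<omega> 1) * decay_sum l ?C) ?r"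
    using seminorm_le_lincomb[OF _ _ rE rE, of "1 / real k" _ _ 0 "-1"] by force
  have "norm_lam \<omega> (1 / real k) ?r \<le> exp (l * \<omega> 1) * decay_sum l ?C" by (rule norm_lam_le[OF sr])
  also have "\<dots> \<le> exp (l * \<omega> 1) * (C * (\<Sum>n. ?E (n + N)))" using tail by (intro mult_left_mono) auto
  also have "\<dots> \<le> K * norm (\<Sum>n. ?E (n + N))"
  proof -
    have "exp (l * \<omega> 1) * (C * (\<Sum>n. ?E (n + N))) \<le> (exp (l * \<omega> 1) * C) * norm (\<Sum>n. ?E (n + N))"
      unfolding mult.assoc[symmetric] using C_nonneg by (intro mult_left_mono) auto
    also have "\<dots> \<le> K * norm (\<Sum>n. ?E (n + N))" by (intro mult_right_mono) (auto simp: K_def)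
    finally show ?thesis .
  qed
  also have "\<dots> < \<epsilon>" using N K by (simp add: pos_less_divide_eq mult.commute)
  finally have "?r \<in> W" using \<epsilon>(2)[of ?r] sr Cinf_lincomb[OF rE rE] unfolding Estep_iff by blast
  then obtain h where h: "h \<in> E_om \<omega> - L ` E_om \<omega>" "?r = (\<lambda>x. h x - ?g x)" using W(1) by auto
  have "h = L (partial F)"
  proof
    fix p :: "'n cyl"
    obtain t x where p: "p = (t, x)" by (cases p)
    have s: "(\<lambda>n. (if lat_enum n \<in> X then H (lat_enum n) 0 t else 0) * cis (lat (lat_enum n) \<bullet> x)) sums rhs X (t, x)" if "X \<subseteq> S" for X
      unfolding rhs_def using synth_sums[OF l_pos rhs_coef_bounded[OF that] if_C_le, of 0 t x] by simp
    have "(\<lambda>n. (if lat_enum n \<in> S then H (lat_enum n) 0 t else 0) * cis (lat (lat_enum n) \<bullet> x)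
        - (if lat_enum n \<in> S - F then H (lat_enum n) 0 t else 0) * cis (lat (lat_enum n) \<bullet> x)) sums (?g (t, x) - rhs (S - F) (t, x))"
      by (intro sums_diff s) auto
    also have "(\<lambda>n. (if lat_enum n \<in> S then H (lat_enum n) 0 t else 0) * cis (lat (lat_enum n) \<bullet> x)
        - (if lat_enum n \<in> S - F then H (lat_enum n) 0 t else 0) * cis (lat (lat_enum n) \<bullet> x))
        = (\<lambda>n. (if lat_enum n \<in> F then H (lat_enum n) 0 t else 0) * cis (lat (lat_enum n) \<bullet> x))"
      using F by (auto simp: fun_eq_iff)
    finally have "?g (t, x) - rhs (S - F) (t, x) = rhs F (t, x)" using s[OF F(2)] sums_unique2 by blast
    moreover have "h (t, x) = ?g (t, x) - rhs (S - F) (t, x)" using fun_cong[OF h(2), of "(t, x)"] by (simp add: algebra_simps)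
    ultimately show "h p = L (partial F) p" unfolding p partial_E_om(2)[OF F] by simp
  qed
  then show False using h(1) partial_E_om(1)[OF F] by blast
qed

text \<open>The functional \<mu> is the formal sum of the modes. It converges because the
  coefficients of a test function decay while the \<open>u \<xi>\<close> are bounded, and termwise
  transposition shows that the operator maps it to \<open>rhs S\<close>, which lies in
  \<open>E_om\<close>. A representing function would have the \<open>u \<xi>\<close> as
  coefficients.\<close>

lemma not_hypoelliptic: "\<not> globally_hypoelliptic \<omega> a b"
proof
  assume hypo: "globally_hypoelliptic \<omega> a b"
  let ?V = "(2 * pi) ^ CARD('n)"
  \<comment> \<open>m and K depend on the parameter \<open>l'\<close> only, and the bound is linear
    in Q; with Q the norm of a step space this becomes the continuity estimate for \<mu>.\<close>
  have pb: "\<exists>m>0. \<exists>K\<ge>0. \<forall>\<phi> Q. \<phi> \<in> Cinf_torus \<longrightarrow> seminorm_le l' Q \<phi> \<longrightarrow>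
      (\<forall>\<xi>. cmod (pairing (mode \<xi>) \<phi>) \<le> K * Q * exp (- m * \<omega> (norm (lat \<xi>))))" if l': "l' > 0" for l'
  proof -
    obtain m K where m: "0 < m" "m \<le> l'" "0 \<le> K" "\<And>(f :: 'n cyl \<Rightarrow> complex) Q. f \<in> Cinf_torus \<Longrightarrow> seminorm_le l' Q f \<Longrightarrow>
      coef_bounded m (\<lambda>_. K * Q) (\<lambda>\<xi> k. fcoef (Dl (replicate k (1, 0)) f) \<xi>)" using coef_decay[OF l', where 'n = 'n] by blast
    show ?thesis
    proof (rule exI[of _ m], rule conjI, rule m(1), rule exI[of _ "?V * (B * (K * M m 0) * (2 * pi))"], rule conjI, goal_cases)
      case 1
      show "0 \<le> ?V * (B * (K * M m 0) * (2 * pi))" using m B_nonneg by simp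
    next
      case 2
      show ?case
      proof (intro allI impI)
        fix \<phi> :: "'n cyl \<Rightarrow> complex" and Q \<xi>
        assume \<phi>: "\<phi> \<in> Cinf_torus" and Q: "seminorm_le l' Q \<phi>"
        have \<phi>E: "\<phi> \<in> E_om \<omega>" unfolding E_om_iff using \<phi> Q l' by blast
        have Q0: "0 \<le> Q" by (rule seminorm_le_nonneg[OF Q])
        let ?e = "exp (- m * \<omega> (norm (lat \<xi>)))" and ?f = "fcoef \<phi> (\<lambda>j. - \<xi> j)"
        have fb: "cmod (?f t) \<le> K * Q * M m 0 * ?e" for t
        proof -
          have "cmod (fcoef (Dl (replicate 0 (1, 0)) \<phi>) (\<lambda>j. - \<xi> j) t) \<le> K * Q * M m 0 * exp (- 2 * m * \<omega> (norm (lat (\<lambda>j. - \<xi> j))))"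
            using m(4)[OF \<phi> Q] unfolding coef_bounded_def by blast
          then have "cmod (?f t) \<le> K * Q * M m 0 * exp (- 2 * m * \<omega> (norm (lat (\<lambda>j. - \<xi> j))))" by simp
          also have "\<dots> \<le> K * Q * M m 0 * ?e"
            using m Q0 w_nonneg[of "norm (lat \<xi>)"] by (intro mult_left_mono) (auto simp: lat_minus)
          finally show ?thesis .
      qed
      have ub: "cmod (if \<xi> \<in> S then u \<xi> t else 0) \<le> B" for t using u_bound[of \<xi> t] B_nonneg by (cases "\<xi> \<in> S") auto
      have fc: "continuous_on UNIV ?f" by (rule fcoef_continuous[OF \<phi>E])
      have uc: "continuous_on UNIV (\<lambda>t. if \<xi> \<in> S then u \<xi> t else 0)" using u_continuous[of \<xi> UNIV] by (cases "\<xi> \<in> S") auto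
      have "cmod (integral (cbox 0 (2*pi)) (\<lambda>t. (if \<xi> \<in> S then u \<xi> t else 0) * ?f t)) \<le> (B * (K * Q * M m 0 * ?e)) * measure lborel (cbox 0 (2 * pi :: real))"
      proof (rule has_integral_bound[OF _ integrable_integral])
        show "0 \<le> B * (K * Q * M m 0 * ?e)" using B_nonneg m Q0 by simp
        show "(\<lambda>t. (if \<xi> \<in> S then u \<xi> t else 0) * ?f t) integrable_on cbox 0 (2 * pi)"
          by (intro integrable_continuous continuous_on_mult continuous_on_subset[OF uc] continuous_on_subset[OF fc]) auto
        show "cmod ((if \<xi> \<in> S then u \<xi> t else 0) * ?f t) \<le> B * (K * Q * M m 0 * ?e)" for t
          unfolding norm_mult using ub fb B_nonneg by (intro mult_mono) auto
      qed
      then have "?V * cmod (integral {0..2*pi} (\<lambda>t. (if \<xi> \<in> S then u \<xi> t else 0) * ?f t)) \<le> ?V * ((B * (K * Q * M m 0 * ?e)) * (2 * pi))"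
        by (intro mult_left_mono) auto
      moreover have "cmod (pairing (mode \<xi>) \<phi>) = ?V * cmod (integral {0..2*pi} (\<lambda>t. (if \<xi> \<in> S then u \<xi> t else 0) * ?f t))"
        unfolding pairing_mode_eq[OF \<phi>E] by (simp add: norm_mult norm_power)
      ultimately show "cmod (pairing (mode \<xi>) \<phi>) \<le> ?V * (B * (K * M m 0) * (2 * pi)) * Q * ?e"
        by (simp only: mult_ac)
      qed
    qed
  qed
  have sm: "summable (\<lambda>n. pairing (mode (lat_enum n)) \<phi>)" if \<phi>: "\<phi> \<in> E_om \<omega>" for \<phi> :: "'n cyl \<Rightarrow> complex"
  proof -
    obtain l' Q where l': "l' > 0" "seminorm_le l' Q \<phi>" "\<phi> \<in> Cinf_torus" using \<phi> unfolding E_om_iff by blast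
    obtain m K where m: "m > 0" "\<And>\<xi>. cmod (pairing (mode \<xi>) \<phi>) \<le> K * Q * exp (- m * \<omega> (norm (lat \<xi>)))"
      using pb[OF l'(1)] l'(2,3) by blast
    show ?thesis
      by (rule summable_comparison_test'[OF summable_mult[OF summable_lattice[OF m(1), where 'n = 'n], of "K * Q"], of 0]) (rule m(2))
  qed
  define \<mu> where "\<mu> = (\<lambda>\<phi>. if \<phi> \<in> E_om \<omega> then (\<Sum>n. pairing (mode (lat_enum n)) \<phi>) else 0)"
  have \<mu>: "\<mu> \<in> E_dual \<omega>"
  proof (rule E_dualI)
    fix f g :: "'n cyl \<Rightarrow> complex" and c d assume fg: "f \<in> E_om \<omega>" "g \<in> E_om \<omega>"
    have "(\<lambda>n. c * pairing (mode (lat_enum n)) f + d * pairing (mode (lat_enum n)) g) sums (c * \<mu> f + d * \<mu> g)"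
      using fg by (auto simp: \<mu>_def intro!: sums_add sums_mult summable_sums sm)
    then show "\<mu> (\<lambda>x. c * f x + d * g x) = c * \<mu> f + d * \<mu> g"
      using fg E_om_lincomb[OF fg] by (simp add: \<mu>_def pairing_lincomb_right E_om_continuous mode_E_om sums_iff)
  next
    fix k :: nat assume k: "k \<ge> 1"
    then have "1 / real k > 0" by simp
    then obtain m K where m: "m > 0" "K \<ge> 0" "\<And>\<phi> Q \<xi>. \<phi> \<in> Cinf_torus \<Longrightarrow> seminorm_le (1 / real k) Q \<phi> \<Longrightarrow>
      cmod (pairing (mode \<xi>) \<phi>) \<le> K * Q * exp (- m * \<omega> (norm (lat \<xi>)))" using pb by meson
    let ?T = "\<Sum>n. exp (- m * \<omega> (norm (lat (lat_enum n :: 'n \<Rightarrow> int))))"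
    have smT: "summable (\<lambda>n. exp (- m * \<omega> (norm (lat (lat_enum n :: 'n \<Rightarrow> int)))))" by (rule summable_lattice[OF m(1)])
    show "\<exists>C\<ge>0. \<forall>f\<in>Estep \<omega> k. cmod (\<mu> f) \<le> C * norm_lam \<omega> (1 / real k) f"
    proof (intro exI[of _ "K * ?T"] conjI ballI)
      show "0 \<le> K * ?T" using m smT by (intro mult_nonneg_nonneg suminf_nonneg) auto
      fix f :: "'n cyl \<Rightarrow> complex" assume f: "f \<in> Estep \<omega> k"
      let ?Q = "norm_lam \<omega> (1 / real k) f"
      have fC: "f \<in> Cinf_torus" using f by (simp add: Estep_def)
      have "cmod (\<Sum>n. pairing (mode (lat_enum n)) f) \<le> (\<Sum>n. K * ?Q * exp (- m * \<omega> (norm (lat (lat_enum n :: 'n \<Rightarrow> int)))))"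
        by (rule norm_suminf_le[OF m(3)[OF fC seminorm_le_norm[OF f]]]) (intro summable_mult smT)
      also have "\<dots> = K * ?Q * ?T" by (rule suminf_mult[OF smT])
      finally show "cmod (\<mu> f) \<le> K * ?T * ?Q" using Estep_E_om[OF k f] by (simp add: \<mu>_def mult_ac)
    qed
  qed (simp add: \<mu>_def)
  have transp: "- \<mu> (L \<phi>) = pairing (rhs S) \<phi>" if \<phi>: "\<phi> \<in> E_om \<omega>" for \<phi>
  proof -
    obtain l' Q where Q: "seminorm_le l' Q \<phi>" using \<phi> unfolding E_om_iff by blast
    define Q0 where "Q0 = Q * M l' 0"
    have Qb: "cmod (\<phi> x) \<le> Q0" for x using seminorm_leD[OF Q, of "[]" x] by (simp add: Q0_def)
    have Q00: "0 \<le> Q0" using Qb norm_ge_zero order_trans by blast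
    let ?h = "\<lambda>n p. ((if lat_enum n \<in> S then H (lat_enum n) 0 (fst p) else 0) * cis (lat (lat_enum n) \<bullet> snd p)) * \<phi> p"
    have "(\<lambda>n. integral (cbox 0 torus_top) (?h n)) sums integral (cbox 0 torus_top) (\<lambda>p. \<Sum>n. ?h n p)"
    proof (rule integral_suminf[where B = "\<lambda>n. (C * M l 0 * Q0) * exp (- l * \<omega> (norm (lat (lat_enum n :: 'n \<Rightarrow> int))))"])
      show "continuous_on (cbox 0 torus_top) (?h n)" for n
        using continuous_on_mult[OF E_om_continuous[OF L_E_om(1)[OF mode_E_om[of "lat_enum n"]]] E_om_continuous[OF \<phi>]]
        unfolding L_mode by (rule continuous_on_subset) simp
      show "summable (\<lambda>n. (C * M l 0 * Q0) * exp (- l * \<omega> (norm (lat (lat_enum n :: 'n \<Rightarrow> int)))))"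
        by (intro summable_mult summable_lattice l_pos)
      fix n and p :: "'n cyl"
      have "cmod (if lat_enum n \<in> S then H (lat_enum n) 0 (fst p) else 0) \<le> C * M l 0 * exp (- l * \<omega> (norm (lat (lat_enum n :: 'n \<Rightarrow> int))))"
      proof (cases "lat_enum n \<in> S")
        case True
        have "C * M l 0 * exp (- 2 * l * \<omega> (norm (lat (lat_enum n :: 'n \<Rightarrow> int)))) \<le> C * M l 0 * exp (- l * \<omega> (norm (lat (lat_enum n :: 'n \<Rightarrow> int))))"
          using l_pos C_nonneg w_nonneg[of "norm (lat (lat_enum n :: 'n \<Rightarrow> int))"] by (intro mult_left_mono) auto
        then show ?thesis using H_bound[OF True, of 0 "fst p"] True by simp
      qed (use C_nonneg in simp)
      then have "cmod (if lat_enum n \<in> S then H (lat_enum n) 0 (fst p) else 0) * cmod (\<phi> p)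
          \<le> (C * M l 0 * exp (- l * \<omega> (norm (lat (lat_enum n :: 'n \<Rightarrow> int))))) * Q0"
        using Qb[of p] C_nonneg by (intro mult_mono) auto
      then show "cmod (?h n p) \<le> (C * M l 0 * Q0) * exp (- l * \<omega> (norm (lat (lat_enum n :: 'n \<Rightarrow> int))))"
        unfolding norm_mult norm_cis mult_1_right by (simp only: mult_ac)
    qed
    moreover have "(\<lambda>n. integral (cbox 0 torus_top) (?h n)) = (\<lambda>n. - pairing (mode (lat_enum n)) (L \<phi>))"
    proof
      fix n
      have "integral (cbox 0 torus_top) (?h n) = pairing (L (mode (lat_enum n))) \<phi>" by (simp only: pairing_def L_mode torus_box_eq)
      then show "integral (cbox 0 torus_top) (?h n) = - pairing (mode (lat_enum n)) (L \<phi>)" using pairing_transpose[OF mode_E_om \<phi>] by simp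
    qed
    moreover have "integral (cbox 0 torus_top) (\<lambda>p. \<Sum>n. ?h n p) = pairing (rhs S) \<phi>"
    proof -
      have "(\<Sum>n. ?h n p) = rhs S p * \<phi> p" for p
      proof -
        have "(\<lambda>n. (if lat_enum n \<in> S then H (lat_enum n) 0 (fst p) else 0) * cis (lat (lat_enum n) \<bullet> snd p)) sums rhs S (fst p, snd p)"
          unfolding rhs_def using synth_sums[OF l_pos rhs_coef_bounded[OF order_refl] if_C_le, of 0 "fst p" "snd p"] by simp
        from sums_mult2[OF this, of "\<phi> p"] show ?thesis by (simp add: sums_iff)
      qed
      then show ?thesis by (simp only: pairing_def torus_box_eq)
    qed
    ultimately have "(\<lambda>n. - pairing (mode (lat_enum n)) (L \<phi>)) sums pairing (rhs S) \<phi>" by simp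
    from sums_minus[OF this] have "(\<lambda>n. pairing (mode (lat_enum n)) (L \<phi>)) sums (- pairing (rhs S) \<phi>)" by simp
    then show ?thesis using L_E_om(1)[OF \<phi>] by (simp add: \<mu>_def sums_iff)
  qed
  obtain f where f: "f \<in> E_om \<omega>" "\<And>\<phi>. \<phi> \<in> E_om \<omega> \<Longrightarrow> \<mu> \<phi> = pairing f \<phi>"
    using hypo \<mu> transp rhs_E_om[OF order_refl] unfolding globally_hypoelliptic_def by blast
  show False
  proof (rule no_smooth_representative[OF f(1)])
    fix \<xi> t assume \<xi>: "\<xi> \<in> S"
    have fc: "continuous_on X (fcoef f \<xi>)" for X by (rule fcoef_continuous[OF f(1)])
    have "u \<xi> t - fcoef f \<xi> t = 0"
    proof (rule real_fourier_unique[where r = "\<lambda>t. u \<xi> t - fcoef f \<xi> t"])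
      show "continuous_on UNIV (\<lambda>t. u \<xi> t - fcoef f \<xi> t)" by (intro continuous_intros u_continuous \<xi> fc)
      show "u \<xi> (t + 2 * pi) - fcoef f \<xi> (t + 2 * pi) = u \<xi> t - fcoef f \<xi> t" for t
        using fcoef_periodic[OF E_om_periodic[OF f(1)]] u_period[OF \<xi>] by simp
      fix \<tau> :: int
      let ?Iu = "integral {0..2*pi} (\<lambda>t. u \<xi> t * cis (of_int \<tau> * t))" and ?If = "integral {0..2*pi} (\<lambda>t. fcoef f \<xi> t * cis (of_int \<tau> * t))"
      obtain m where m: "lat_enum m = \<xi>" using bij_lat_enum by (metis bij_pointE)
      have eq: "lat_enum n = \<xi> \<longleftrightarrow> n = m" for n using m injD[OF bij_is_inj[OF bij_lat_enum], of n m] by auto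
      have "(\<lambda>n. if n = m then (2 * of_real pi) ^ CARD('n) * ?Iu else 0) sums ((2 * of_real pi) ^ CARD('n) * ?Iu)"
        using sums_single[of m "\<lambda>_. (2 * of_real pi) ^ CARD('n) * ?Iu"] by simp
      then have mt: "\<mu> (tester \<xi> \<tau>) = (2 * of_real pi) ^ CARD('n) * ?Iu"
        by (simp add: \<mu>_def tester(1) pairing_mode_tester[OF \<xi>] eq sums_iff)
      have pt: "pairing f (tester \<xi> \<tau>) = (2 * of_real pi) ^ CARD('n) * ?If"
      proof -
        have "pairing (tester \<xi> \<tau>) f = (2 * of_real pi) ^ CARD('n) * integral {0..2*pi} (\<lambda>t. cis (of_int \<tau> * t) * fcoef f (\<lambda>j. - (- \<xi> j)) t)"
          unfolding tester(3) by (rule pairing_mode[OF _ E_om_continuous[OF f(1)]]) (intro continuous_intros)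
        then show ?thesis by (simp add: pairing_commute mult.commute)
      qed
      have "(2 * of_real pi) ^ CARD('n) * ?Iu = (2 * of_real pi) ^ CARD('n) * ?If"
        unfolding mt[symmetric] pt[symmetric] by (rule f(2)[OF tester(1)])
      then have "?Iu = ?If" by simp
      moreover have "integral {0..2*pi} (\<lambda>t. (u \<xi> t - fcoef f \<xi> t) * cis (of_int \<tau> * t)) = ?Iu - ?If"
        unfolding left_diff_distrib
        by (rule integral_diff) (intro integrable_continuous_interval continuous_intros u_continuous \<xi> fc)+
      ultimately show "integral {0..2*pi} (\<lambda>t. (u \<xi> t - fcoef f \<xi> t) * cis (of_int \<tau> * t)) = 0" by simp
    qed
    then show "fcoef f \<xi> t = u \<xi> t" by simp
  qed
qed

lemma restrict_modes:
  assumes "infinite S'" "S' \<subseteq> S" shows "singular_modes \<omega> a b S' u H l C B c"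
  by unfold_locales
     (use assms l_pos C_nonneg c_pos H_deriv H_period H_bound u_period u_ode u_bound u_large in \<open>auto simp: subset_iff\<close>)

theorem not_solvable:
  assumes alt: "\<And>\<xi>. \<xi> \<in> S \<Longrightarrow> (\<forall>t. H \<xi> 0 t = 0) \<or> exp (\<i> * (2 * of_real pi * msymb \<xi>)) \<noteq> 1"
  shows "\<not> strongly_solvable \<omega> a b"
proof (cases "infinite {\<xi>\<in>S. \<forall>t. H \<xi> 0 t = 0}")
  case True
  then interpret K: singular_modes \<omega> a b "{\<xi>\<in>S. \<forall>t. H \<xi> 0 t = 0}" u H l C B c by (rule restrict_modes) auto
  have "\<not> fin_dim_fun (ker_tL \<omega> a b)" by (rule K.infinite_kernel) simp
  then show ?thesis unfolding strongly_solvable_def by blast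
next
  case False
  then have "infinite (S - {\<xi>\<in>S. \<forall>t. H \<xi> 0 t = 0})" by (intro Diff_infinite_finite S_infinite) simp
  then interpret K: singular_modes \<omega> a b "S - {\<xi>\<in>S. \<forall>t. H \<xi> 0 t = 0}" u H l C B c by (rule restrict_modes) auto
  have "\<not> LB_closed \<omega> (L ` E_om \<omega>)" by (rule K.range_not_closed) (use alt in blast)
  then show ?thesis unfolding strongly_solvable_def by blast
qed

end

section \<open>Construction of bad modes\<close>

lemma infinite_almost_integer_multiples:
  fixes \<theta> :: real
  shows "infinite {k::nat. k \<ge> 1 \<and> (\<exists>m::int. \<bar>real k * \<theta> - of_int m\<bar> \<le> 1 / 8)}"
  unfolding infinite_nat_iff_unbounded_le
proof
  fix K0 :: nat
  define K where "K = Suc K0"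
  have "0 < 8 * K" by (simp add: K_def)
  \<comment> \<open>The error of q is below \<open>1 / real (8 * K)\<close>, so the multiple
    \<open>K * nat q\<close> has error at most 1 / 8; being at least K, such multiples are
    unbounded.\<close>
  then obtain h q where hq: "0 < q" "q \<le> int (8 * K)" "\<bar>of_int q * \<theta> - of_int h\<bar> < 1 / real (8 * K)"
    using Dirichlet_approx by blast
  have "real K * \<bar>of_int q * \<theta> - of_int h\<bar> \<le> real K * (1 / real (8 * K))" using hq(3) by (intro mult_left_mono) auto
  also have "\<dots> = 1 / 8" by (simp add: K_def)
  also have "real K * \<bar>of_int q * \<theta> - of_int h\<bar> = \<bar>real K * (of_int q * \<theta> - of_int h)\<bar>" by (simp add: abs_mult)
  also have "real K * (of_int q * \<theta> - of_int h) = real (K * nat q) * \<theta> - of_int (int K * h)" using hq(1) by (simp add: algebra_simps)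
  finally have *: "\<bar>real (K * nat q) * \<theta> - of_int (int K * h)\<bar> \<le> 1 / 8" .
  have "1 \<le> nat q" using hq(1) by simp
  then have "K \<le> K * nat q" by simp
  moreover have "K = Suc K0" by (simp add: K_def)
  ultimately have "K0 \<le> K * nat q" "1 \<le> K * nat q" by linarith+
  then show "\<exists>k\<ge>K0. k \<in> {k::nat. k \<ge> 1 \<and> (\<exists>m::int. \<bar>real k * \<theta> - of_int m\<bar> \<le> 1 / 8)}" using * by blast
qed

lemma primitive_cmult: "primitive (\<lambda>t. c * f t) t = c * primitive f t"
  by (simp add: primitive_def right_diff_distrib)

lemma deriv_seq_Im: "deriv_seq U \<Longrightarrow> deriv_seq (\<lambda>k t. complex_of_real (Im (U k t)))"
  unfolding deriv_seq_def
  using bounded_linear.has_vector_derivative[OF bounded_linear_compose[OF bounded_linear_of_real bounded_linear_Im]] by blast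

lemma has_vector_derivative_exp:
  assumes "(f has_vector_derivative f') (at t)"
  shows "((\<lambda>t. exp (f t :: complex)) has_vector_derivative f' * exp (f t)) (at t)"
  using field_vector_diff_chain_at[OF assms DERIV_exp] by (simp add: o_def)

lemma sum_eq_norm_lat: "(\<Sum>j\<in>UNIV. real_of_int (\<xi> j) ^ 2) = norm (lat \<xi>) ^ 2"
  by (simp add: norm_lat sum_nonneg)

context tube_operator
begin

text \<open>The assumptions of \<open>singular_modes\<close> at a single frequency, with constants
  that are to be independent of it, and the alternative between a vanishing right-hand side and
  nonresonance on which \<open>not_solvable\<close> rests.\<close>

definition singular_mode :: "real \<Rightarrow> real \<Rightarrow> real \<Rightarrow> real \<Rightarrow> ('n \<Rightarrow> int) \<Rightarrow> (real \<Rightarrow> complex) \<Rightarrow> (nat \<Rightarrow> real \<Rightarrow> complex) \<Rightarrow> bool" where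
  "singular_mode l C B c \<xi> u H \<longleftrightarrow> deriv_seq H \<and> (\<forall>t. H 0 (t + 2 * pi) = H 0 t) \<and>
     (\<forall>k t. cmod (H k t) \<le> C * M l k * exp (- 2 * l * \<omega> (norm (lat \<xi>)))) \<and>
     (\<forall>t. u (t + 2 * pi) = u t) \<and> (\<forall>t. (u has_vector_derivative (H 0 t - \<i> * symb \<xi> t * u t)) (at t)) \<and>
     (\<forall>t. cmod (u t) \<le> B) \<and> (\<exists>t. c \<le> (1 + norm (lat \<xi>)) * cmod (u t)) \<and>
     ((\<forall>t. H 0 t = 0) \<or> exp (\<i> * (2 * of_real pi * msymb \<xi>)) \<noteq> 1)"

lemma singular_mode_conclusion:
  assumes "infinite S" "l > 0" "0 \<le> C" "0 < c" and ex: "\<And>\<xi>. \<xi> \<in> S \<Longrightarrow> \<exists>u H. singular_mode l C B c \<xi> u H"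
  shows "\<not> globally_hypoelliptic \<omega> a b" "\<not> strongly_solvable \<omega> a b"
proof -
  have "\<forall>\<xi>\<in>S. \<exists>p. singular_mode l C B c \<xi> (fst p) (snd p)" using ex by fastforce
  from bchoice[OF this] obtain p where p0: "\<forall>\<xi>\<in>S. singular_mode l C B c \<xi> (fst (p \<xi>)) (snd (p \<xi>))" ..
  then have p: "singular_mode l C B c \<xi> (fst (p \<xi>)) (snd (p \<xi>))" if "\<xi> \<in> S" for \<xi> using that by (rule bspec)
  interpret K: singular_modes \<omega> a b S "\<lambda>\<xi>. fst (p \<xi>)" "\<lambda>\<xi>. snd (p \<xi>)" l C B c
    by unfold_locales (use assms(1-4) in \<open>auto dest!: p simp: singular_mode_def\<close>)
  show "\<not> globally_hypoelliptic \<omega> a b" by (rule K.not_hypoelliptic)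
  show "\<not> strongly_solvable \<omega> a b" by (rule K.not_solvable) (auto dest!: p simp: singular_mode_def)
qed

text \<open>The bound is proportional to s, so the derivatives of a small solution carry the same
  small factor. The construction for sign changes relies on this with
  \<open>s = exp (- (real k * Mx))\<close>.\<close>

lemma homogeneous_regularity:
  assumes d: "0 < d" and A: "1 \<le> A" and y: "1 \<le> y" and s: "0 \<le> s" and dG: "deriv_seq G"
    and G: "\<And>j t. cmod (G j t) \<le> real A * y * M d j"
    and f: "\<And>t. cmod (f t) \<le> s" "\<And>t. (f has_vector_derivative (- G 0 t * f t)) (at t)"
  obtains F where "deriv_seq F" "F 0 = f" "\<And>k t. cmod (F k t) \<le> s * exp (d * \<omega> 1) * exp (d * \<omega> y) * M (d / (4 * real A)) k"
proof -
  have f': "(f has_vector_derivative (0 - G 0 t * f t)) (at t)" for t using f(2)[of t] by simp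
  have z: "cmod 0 \<le> 0 * M d j" for j by simp
  obtain F where F: "deriv_seq F" "F 0 = f" "\<And>k t. cmod (F k t) \<le> (s * exp (d * \<omega> 1) + 0) * exp (d * \<omega> y) * M (d / (4 * real A)) k"
    using ode_regularity[OF d order_refl A y s order_refl dG deriv_seq_zero G z f(1) f'] by blast
  show ?thesis by (rule that[OF F(1,2)]) (use F(3) in simp)
qed

text \<open>Lets a constant of modulus at most one count as a multiple of \<open>M d 0\<close> in
  the bounds for a derivative sequence.\<close>

lemma one_le_M: obtains A where "A \<ge> (1::nat)" "1 \<le> real A * M d 0"
proof (rule that[of "nat \<lceil>1 / M d 0\<rceil> + 1"])
  have "1 / M d 0 \<le> real (nat \<lceil>1 / M d 0\<rceil> + 1)" by linarith
  then show "1 \<le> real (nat \<lceil>1 / M d 0\<rceil> + 1) * M d 0" by (simp add: pos_divide_le_eq)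
qed simp

text \<open>Negating the condition gives a bad pair for each constant C, possibly with few distinct
  \<xi>. Suppose the set S of bad \<xi> is finite. An exact resonance would put infinitely many
  multiples into S. Without one, the finitely many candidate pairs have a positive minimal distance,
  which the pair obtained for that constant contradicts.\<close>

lemma EDC_failure:
  assumes "\<not> EDC1 \<omega> (mean_vec a) (mean_vec b)"
  obtains \<epsilon> where "\<epsilon> > 0" "infinite {\<xi>. \<xi> \<noteq> (\<lambda>_. 0) \<and> (\<exists>\<tau>::int. cmod (of_int \<tau> + msymb \<xi>) < 1 \<and>
      cmod (of_int \<tau> + msymb \<xi>) \<le> exp (- \<epsilon> * \<omega> (norm (lat \<xi>))))}"
proof -
  obtain \<epsilon> where \<epsilon>: "\<epsilon> > 0" and fail: "\<And>C. C > 0 \<Longrightarrow> \<exists>(\<tau>::int) (\<xi>::'n \<Rightarrow> int). (\<tau> \<noteq> 0 \<or> (\<exists>j. \<xi> j \<noteq> 0)) \<and>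
      cmod (of_int \<tau> + msymb \<xi>) < C * exp (- \<epsilon> * \<omega> (sqrt (real_of_int \<tau> ^ 2 + norm (lat \<xi>) ^ 2)))"
    using assms unfolding EDC1_def msymb_def[symmetric] sum_eq_norm_lat by (meson not_le)
  define S where "S = {\<xi>. \<xi> \<noteq> (\<lambda>_. 0) \<and> (\<exists>\<tau>::int. cmod (of_int \<tau> + msymb \<xi>) < 1 \<and>
      cmod (of_int \<tau> + msymb \<xi>) \<le> exp (- \<epsilon> * \<omega> (norm (lat \<xi>))))}"
  have small: "\<exists>(\<tau>::int) \<xi>. \<xi> \<in> S \<and> cmod (of_int \<tau> + msymb \<xi>) < C" if C: "0 < C" "C \<le> 1" for C
  proof -
    obtain \<tau> :: int and \<xi> :: "'n \<Rightarrow> int" where *: "\<tau> \<noteq> 0 \<or> (\<exists>j. \<xi> j \<noteq> 0)"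
      "cmod (of_int \<tau> + msymb \<xi>) < C * exp (- \<epsilon> * \<omega> (sqrt (real_of_int \<tau> ^ 2 + norm (lat \<xi>) ^ 2)))" using fail[OF C(1)] by blast
    have "norm (lat \<xi>) \<le> sqrt (real_of_int \<tau> ^ 2 + norm (lat \<xi>) ^ 2)" by (rule real_le_rsqrt) simp
    then have "\<epsilon> * \<omega> (norm (lat \<xi>)) \<le> \<epsilon> * \<omega> (sqrt (real_of_int \<tau> ^ 2 + norm (lat \<xi>) ^ 2))"
      using \<epsilon> by (intro mult_left_mono w_mono) auto
    then have e: "exp (- \<epsilon> * \<omega> (sqrt (real_of_int \<tau> ^ 2 + norm (lat \<xi>) ^ 2))) \<le> exp (- \<epsilon> * \<omega> (norm (lat \<xi>)))" by simp
    have e1: "exp (- \<epsilon> * \<omega> (norm (lat \<xi>))) \<le> 1" using \<epsilon> w_nonneg[of "norm (lat \<xi>)"] by simp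
    have l1: "cmod (of_int \<tau> + msymb \<xi>) < C * exp (- \<epsilon> * \<omega> (norm (lat \<xi>)))"
      using *(2) mult_left_mono[OF e, of C] C by linarith
    have l2: "C * exp (- \<epsilon> * \<omega> (norm (lat \<xi>))) \<le> C * 1" using e1 C by (intro mult_left_mono) auto
    have l3: "C * exp (- \<epsilon> * \<omega> (norm (lat \<xi>))) \<le> 1 * exp (- \<epsilon> * \<omega> (norm (lat \<xi>)))" using C by (intro mult_right_mono) auto
    have "\<xi> \<noteq> (\<lambda>_. 0)"
    proof
      assume z: "\<xi> = (\<lambda>_. 0)"
      then have "\<tau> \<noteq> 0" using * by auto
      then have "1 \<le> cmod (of_int \<tau> :: complex)" by (simp flip: of_int_abs)
      moreover have "msymb \<xi> = 0" by (simp add: msymb_def z)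
      moreover have "cmod (of_int \<tau> + msymb \<xi>) < 1" using l1 l2 C by linarith
      ultimately show False by simp
    qed
    moreover have "cmod (of_int \<tau> + msymb \<xi>) < 1" using l1 l2 C by linarith
    moreover have "cmod (of_int \<tau> + msymb \<xi>) \<le> exp (- \<epsilon> * \<omega> (norm (lat \<xi>)))" using l1 l3 by linarith
    ultimately have "\<xi> \<in> S" unfolding S_def by blast
    then show ?thesis using l1 l2 by (intro exI[of _ \<tau>] exI[of _ \<xi>]) auto
  qed
  have "infinite S"
  proof
    assume fin: "finite S"
    show False
    proof (cases "\<exists>(\<tau>::int) \<xi>. \<xi> \<noteq> (\<lambda>_. 0) \<and> of_int \<tau> + msymb \<xi> = 0")
      case True
      then obtain \<tau> :: int and \<xi> where z: "\<xi> \<noteq> (\<lambda>_. 0)" "of_int \<tau> + msymb \<xi> = 0" by blast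
      then obtain j where j: "\<xi> j \<noteq> 0" by auto
      define g where "g = (\<lambda>(k::nat) j. int (Suc k) * \<xi> j)"
      have "inj g"
      proof (rule injI)
        fix k k' assume "g k = g k'"
        then have "g k j = g k' j" by simp
        then show "k = k'" using j by (simp add: g_def)
      qed
      moreover have "range g \<subseteq> S"
      proof
        fix \<eta> assume "\<eta> \<in> range g"
        then obtain k where k: "\<eta> = g k" by auto
        have "msymb \<eta> = of_nat (Suc k) * msymb \<xi>" unfolding msymb_def k g_def sum_distrib_left
          by (intro sum.cong refl) simp
        then have "of_int (int (Suc k) * \<tau>) + msymb \<eta> = of_nat (Suc k) * (of_int \<tau> + msymb \<xi>)" by (simp add: algebra_simps)
        then have "of_int (int (Suc k) * \<tau>) + msymb \<eta> = 0" using z(2) by simp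
        moreover have "\<eta> \<noteq> (\<lambda>_. 0)"
        proof
          assume "\<eta> = (\<lambda>_. 0)"
          then have "\<eta> j = 0" by simp
          then show False using j by (simp add: k g_def)
        qed
        ultimately show "\<eta> \<in> S" unfolding S_def by (intro CollectI conjI exI[of _ "int (Suc k) * \<tau>"]) auto
      qed
      ultimately show False using fin by (meson finite_imageD finite_subset infinite_UNIV_nat)
    next
      case False
      define N where "N = \<lceil>1 + (\<Sum>\<xi>\<in>S. cmod (msymb \<xi>))\<rceil>"
      define P where "P = {(\<tau>::int, \<xi>). \<xi> \<in> S \<and> cmod (of_int \<tau> + msymb \<xi>) < 1}"
      have "P \<subseteq> {-N..N} \<times> S"
      proof
        fix x assume "x \<in> P"
        then obtain \<tau> \<xi> where x: "x = (\<tau>, \<xi>)" "\<xi> \<in> S" "cmod (of_int \<tau> + msymb \<xi>) < 1" by (auto simp: P_def)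
        have "cmod (of_int \<tau>) \<le> cmod (of_int \<tau> + msymb \<xi>) + cmod (msymb \<xi>)"
          using norm_triangle_ineq4[of "of_int \<tau> + msymb \<xi>" "msymb \<xi>"] by simp
        also have "\<dots> \<le> 1 + (\<Sum>\<xi>\<in>S. cmod (msymb \<xi>))" using x fin member_le_sum[of \<xi> S "\<lambda>\<xi>. cmod (msymb \<xi>)"] by simp
        also have "\<dots> \<le> of_int N" by (simp add: N_def)
        finally have "\<bar>\<tau>\<bar> \<le> N" by (simp flip: of_int_abs)
        then show "x \<in> {-N..N} \<times> S" using x by auto
      qed
      then have Pf: "finite P" using fin by (meson finite_SigmaI finite_atLeastAtMost_int finite_subset)
      \<comment> \<open>The entry 1 keeps m an admissible constant in \<open>small\<close> and
        covers the case of empty P.\<close>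
      define m where "m = Min (insert 1 ((\<lambda>(\<tau>, \<xi>). cmod (of_int \<tau> + msymb \<xi>)) ` P))"
      have pos: "0 < cmod (of_int \<tau> + msymb \<xi>)" if "(\<tau>, \<xi>) \<in> P" for \<tau> \<xi>
      proof -
        have "\<xi> \<noteq> (\<lambda>_. 0)" using that by (simp add: P_def S_def)
        then have "of_int \<tau> + msymb \<xi> \<noteq> 0" using False by blast
        then show ?thesis by simp
      qed
      have "0 < x" if "x \<in> insert 1 ((\<lambda>(\<tau>, \<xi>). cmod (of_int \<tau> + msymb \<xi>)) ` P)" for x
        using that pos by auto
      then have m0: "0 < m" unfolding m_def using Pf by (subst Min_gr_iff) auto
      have m1: "m \<le> 1" unfolding m_def using Pf by (intro Min_le) auto
      obtain \<tau> :: int and \<xi> where *: "\<xi> \<in> S" "cmod (of_int \<tau> + msymb \<xi>) < m" using small[OF m0 m1] by blast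
      then have "(\<tau>, \<xi>) \<in> P" using m1 by (auto simp: P_def)
      then have "m \<le> cmod (of_int \<tau> + msymb \<xi>)" unfolding m_def using Pf by (intro Min_le) (auto intro!: image_eqI[of _ _ "(\<tau>, \<xi>)"])
      then show False using * by simp
    qed
  qed
  then show ?thesis using that[OF \<epsilon>] by (simp add: S_def)
qed

text \<open>Without a sign change the imaginary part of the primitive is monotone, and it starts at
  zero.\<close>

lemma Im_primitive_between:
  assumes sgn: "(\<forall>t. Im (symb \<xi> t) \<le> 0) \<or> (\<forall>t. Im (symb \<xi> t) \<ge> 0)" and t: "0 \<le> t" "t \<le> 2 * pi"
  shows "Im (primitive (symb \<xi>) t) \<le> max 0 (Im (primitive (symb \<xi>) (2 * pi)))"
  using sgn
proof
  assume "\<forall>t. Im (symb \<xi> t) \<le> 0"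
  then have "Im (primitive (symb \<xi>) t) \<le> Im (primitive (symb \<xi>) 0)"
    using t by (intro Im_primitive_mono[where h = "\<lambda>_. 0"]) (auto simp: symb_continuous symb_periodic)
  then show ?thesis by simp
next
  assume s: "\<forall>t. Im (symb \<xi> t) \<ge> 0"
  have "Im (primitive (\<lambda>t. (-1) * symb \<xi> t) (2 * pi)) \<le> Im (primitive (\<lambda>t. (-1) * symb \<xi> t) t)"
    using s t by (intro Im_primitive_mono[where h = "\<lambda>_. 0"] continuous_intros symb_continuous) (auto simp: symb_periodic)
  then show ?thesis unfolding primitive_cmult by simp
qed

text \<open>The homogeneous solution \<open>exp (- \<i> * P t)\<close> is made periodic by the
  factor \<open>exp (\<i> * \<delta> * t)\<close>, where
  \<open>\<delta> = of_int \<tau> + msymb \<xi>\<close>. The price is the right-hand side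
  \<open>\<i> * \<delta> * u\<close>, small because \<delta> is. Absence of sign changes provides
  the bound \<open>exp (2 * pi)\<close> on u, uniform in \<xi>.\<close>

lemma small_denominator_modes:
  assumes sgn: "\<And>\<xi>::'n \<Rightarrow> int. \<not> changes_sign (\<lambda>t. \<Sum>j\<in>UNIV. of_int (\<xi> j) * b j t)"
    and nEDC: "\<not> EDC1 \<omega> (mean_vec a) (mean_vec b)"
  shows "\<not> globally_hypoelliptic \<omega> a b" "\<not> strongly_solvable \<omega> a b"
proof -
  obtain \<epsilon> where \<epsilon>: "\<epsilon> > 0" "infinite {\<xi>. \<xi> \<noteq> (\<lambda>_. 0) \<and> (\<exists>\<tau>::int. cmod (of_int \<tau> + msymb \<xi>) < 1 \<and>
      cmod (of_int \<tau> + msymb \<xi>) \<le> exp (- \<epsilon> * \<omega> (norm (lat \<xi>))))}" using EDC_failure[OF nEDC] by blast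
  define S where "S = {\<xi>. \<xi> \<noteq> (\<lambda>_. 0) \<and> (\<exists>\<tau>::int. cmod (of_int \<tau> + msymb \<xi>) < 1 \<and>
      cmod (of_int \<tau> + msymb \<xi>) \<le> exp (- \<epsilon> * \<omega> (norm (lat \<xi>))))}"
  obtain l1 A where A: "l1 > 0" "A \<ge> (1::nat)" "\<And>\<xi> k t. cmod (symb_seq \<xi> k t) \<le> real A * (1 + norm (lat \<xi>)) * M l1 k"
    using symb_seq_bound by blast
  \<comment> \<open>The rate \<epsilon> at which \<delta> is small has to pay for the loss d in the
    derivative bounds and for the decay \<open>2 * l\<close> required of H; both are at most
    \<epsilon> / 2.\<close>
  define d where "d = min l1 (\<epsilon> / 2)"
  have d: "0 < d" "d \<le> l1" "d \<le> \<epsilon> / 2" using A \<epsilon> by (auto simp: d_def)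
  obtain A' where A': "A' \<ge> (1::nat)" "1 \<le> real A' * M d 0" using one_le_M by blast
  \<comment> \<open>A' accounts for the constant \<open>- (\<i> * \<delta>)\<close> in the
    coefficient of the equation that u solves.\<close>
  define A2 where "A2 = A + A'"
  define l where "l = d / (4 * real A2)"
  have l: "l > 0" "2 * l \<le> d"
  proof -
    show "l > 0" using d A by (simp add: l_def A2_def)
    have "d / (4 * real A2) \<le> d / 2" using d A by (intro divide_left_mono) (auto simp: A2_def)
    then show "2 * l \<le> d" by (simp add: l_def)
  qed
  define C where "C = exp (2 * pi) * exp (d * \<omega> 1) * exp (d * \<omega> 1)"
  have ex: "\<exists>u H. singular_mode l C (exp (2 * pi)) 1 \<xi> u H" if \<xi>: "\<xi> \<in> S" for \<xi>
  proof -
    let ?y = "norm (lat \<xi>)"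
    obtain \<tau> :: int where \<tau>: "cmod (of_int \<tau> + msymb \<xi>) < 1" "cmod (of_int \<tau> + msymb \<xi>) \<le> exp (- \<epsilon> * \<omega> ?y)" using \<xi> by (auto simp: S_def)
    define \<delta> where "\<delta> = of_int \<tau> + msymb \<xi>"
    define P where "P = primitive (symb \<xi>)"
    have dP: "(P has_vector_derivative symb \<xi> t) (at t)" for t unfolding P_def by (rule primitive_deriv[OF symb_continuous])
    have perP: "P (t + 2 * pi) = P t + 2 * of_real pi * msymb \<xi>" for t
      unfolding P_def by (subst primitive_period[OF symb_continuous symb_periodic]) (simp add: primitive_symb)
    define u where "u = (\<lambda>t. exp (\<i> * (\<delta> * of_real t - P t)))"
    have du: "(u has_vector_derivative (\<i> * (\<delta> - symb \<xi> t)) * u t) (at t)" for t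
    proof -
      have "((\<lambda>t. complex_of_real t) has_vector_derivative of_real 1) (at t)"
        by (intro has_vector_derivative_of_real DERIV_ident)
      then have "((\<lambda>t. \<i> * (\<delta> * of_real t - P t)) has_vector_derivative \<i> * (\<delta> * of_real 1 - symb \<xi> t)) (at t)"
        by (intro has_vector_derivative_mult_right has_vector_derivative_diff dP)
      from has_vector_derivative_exp[OF this] show ?thesis unfolding u_def by simp
    qed
    have peru: "u (t + 2 * pi) = u t" for t
    proof -
      have "\<i> * (\<delta> * of_real (t + 2 * pi) - P (t + 2 * pi)) = \<i> * (\<delta> * of_real t - P t) + 2 * of_int \<tau> * of_real pi * \<i>"
        unfolding perP by (simp add: \<delta>_def algebra_simps)
      moreover have "exp (2 * of_int \<tau> * of_real pi * \<i>) = (1::complex)" using exp_integer_2pi[of "of_int \<tau>"] by simp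
      ultimately show ?thesis unfolding u_def by (simp only: exp_add mult_1_right)
    qed
    have s: "(\<forall>t. Im (symb \<xi> t) \<le> 0) \<or> (\<forall>t. Im (symb \<xi> t) \<ge> 0)"
      using sgn[of \<xi>] unfolding Im_symb changes_sign_def by (meson not_le)
    have Imd: "Im \<delta> = Im (msymb \<xi>)" "\<bar>Im \<delta>\<bar> \<le> 1" using \<tau>(1) abs_Im_le_cmod[of \<delta>] by (auto simp: \<delta>_def)
    have ubox: "cmod (u t) \<le> exp (2 * pi)" if t: "0 \<le> t" "t \<le> 2 * pi" for t
    proof -
      have "Im (P t) \<le> max 0 (2 * pi * Im \<delta>)" using Im_primitive_between[OF s t] unfolding P_def primitive_symb Imd by simp
      moreover have "Im (P t) - t * Im \<delta> \<le> 2 * pi"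
      proof (cases "Im \<delta> \<ge> 0")
        case True
        have "2 * pi * Im \<delta> \<le> 2 * pi * 1" using Imd by (intro mult_left_mono) auto
        moreover have "0 \<le> t * Im \<delta>" using True t by simp
        moreover have "max 0 (2 * pi * Im \<delta>) = 2 * pi * Im \<delta>" using True by simp
        ultimately show ?thesis using \<open>Im (P t) \<le> _\<close> by linarith
      next
        case False
        have "t * (- Im \<delta>) \<le> 2 * pi * 1" using False t Imd by (intro mult_mono) auto
        moreover have "2 * pi * Im \<delta> \<le> 0" using False by (simp add: mult_le_0_iff)
        moreover have "max 0 (2 * pi * Im \<delta>) = 0" using False by (simp add: mult_le_0_iff)
        ultimately show ?thesis using \<open>Im (P t) \<le> _\<close> by linarith
      qed
      ultimately show ?thesis unfolding u_def by (simp add: norm_exp_eq_Re mult.commute)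
    qed
    have ub: "cmod (u t) \<le> exp (2 * pi)" for t
    proof -
      have "periodic_fn u" using peru by (simp add: periodic_fn_def)
      moreover obtain z where z: "z \<in> torus_box" "\<And>f :: real \<Rightarrow> complex. periodic_fn f \<Longrightarrow> f t = f z" using periodic_fn_reduce[of t] by metis
      ultimately have "u t = u z" by blast
      then show ?thesis using z(1) ubox[of z] by (simp add: torus_box_def)
    qed
    define G where "G = (\<lambda>j t. symb_seq \<xi> j t + (if j = 0 then - (\<i> * \<delta>) else 0))"
    have dG: "deriv_seq G" unfolding G_def by (intro deriv_seq_add deriv_seq_symb deriv_seq_const)
    have y1: "1 \<le> 1 + ?y" by simp
    have Gb: "cmod (G j t) \<le> real A2 * (1 + ?y) * M d j" for j t
    proof -
      have 1: "cmod (symb_seq \<xi> j t) \<le> real A * (1 + ?y) * M d j"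
        using M_antimono[OF d(1,2), of j] by (intro order_trans[OF A(3)] mult_left_mono) auto
      have 2: "cmod (if j = 0 then - (\<i> * \<delta>) else 0) \<le> real A' * (1 + ?y) * M d j"
      proof (cases "j = 0")
        case True
        have "cmod \<delta> \<le> 1" using \<tau>(1) by (simp add: \<delta>_def)
        also have "\<dots> \<le> (real A' * M d 0) * (1 + ?y)" using mult_mono[OF A'(2) y1] by simp
        finally show ?thesis using True by (simp add: norm_mult mult_ac)
      qed simp
      show ?thesis unfolding G_def A2_def of_nat_add distrib_right
        by (rule order_trans[OF norm_triangle_ineq add_mono[OF 1 2, unfolded distrib_right]])
    qed
    have ode: "(u has_vector_derivative (- G 0 t * u t)) (at t)" for t
      using du[of t] by (simp add: G_def symb_seq_0 algebra_simps)
    have "1 \<le> A2" "0 \<le> exp (2 * pi)" using A by (auto simp: A2_def)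
    from homogeneous_regularity[OF d(1) this(1) y1 this(2) dG Gb ub ode]
    obtain F where F: "deriv_seq F" "F 0 = u" "\<And>k t. cmod (F k t) \<le> exp (2 * pi) * exp (d * \<omega> 1) * exp (d * \<omega> (1 + ?y)) * M l k"
      unfolding l_def by blast
    define H where "H = (\<lambda>k t. (\<i> * \<delta>) * F k t)"
    have w: "0 \<le> \<omega> ?y" by (intro w_nonneg) simp
    have Hb: "cmod (H k t) \<le> C * M l k * exp (- 2 * l * \<omega> ?y)" for k t
    proof -
      have "d * \<omega> (1 + ?y) \<le> d * (\<omega> 1 + \<omega> ?y)" using w_add[of 1 ?y] d by (intro mult_left_mono) auto
      moreover have "(2 * l + d) * \<omega> ?y \<le> \<epsilon> * \<omega> ?y" using l d w by (intro mult_right_mono) auto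
      ultimately have "- \<epsilon> * \<omega> ?y + d * \<omega> (1 + ?y) \<le> d * \<omega> 1 + - 2 * l * \<omega> ?y" by (simp add: algebra_simps)
      then have e: "exp (- \<epsilon> * \<omega> ?y) * exp (d * \<omega> (1 + ?y)) \<le> exp (d * \<omega> 1) * exp (- 2 * l * \<omega> ?y)"
        unfolding exp_add[symmetric] by simp
      have "cmod (H k t) \<le> exp (- \<epsilon> * \<omega> ?y) * (exp (2 * pi) * exp (d * \<omega> 1) * exp (d * \<omega> (1 + ?y)) * M l k)"
        unfolding H_def norm_mult using \<tau>(2) F(3)[of k t] by (intro mult_mono) (auto simp: \<delta>_def)
      also have "\<dots> = (exp (2 * pi) * exp (d * \<omega> 1) * M l k) * (exp (- \<epsilon> * \<omega> ?y) * exp (d * \<omega> (1 + ?y)))" by (simp only: mult_ac)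
      also have "\<dots> \<le> (exp (2 * pi) * exp (d * \<omega> 1) * M l k) * (exp (d * \<omega> 1) * exp (- 2 * l * \<omega> ?y))"
        using e by (intro mult_left_mono) auto
      also have "\<dots> = C * M l k * exp (- 2 * l * \<omega> ?y)" unfolding C_def by (simp only: mult_ac)
      finally show ?thesis .
    qed
    have "singular_mode l C (exp (2 * pi)) 1 \<xi> u H" unfolding singular_mode_def
    proof (intro conjI allI)
      show "deriv_seq H" unfolding H_def by (intro deriv_seq_cmult F)
      show "H 0 (t + 2 * pi) = H 0 t" for t by (simp add: H_def F(2) peru)
      show "cmod (H k t) \<le> C * M l k * exp (- 2 * l * \<omega> ?y)" for k t by (rule Hb)
      show "u (t + 2 * pi) = u t" for t by (rule peru)
      show "(u has_vector_derivative (H 0 t - \<i> * symb \<xi> t * u t)) (at t)" for t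
        using du[of t] by (simp add: H_def F(2) algebra_simps)
      show "cmod (u t) \<le> exp (2 * pi)" for t by (rule ub)
      have "u 0 = 1" by (simp add: u_def P_def)
      then show "\<exists>t. 1 \<le> (1 + ?y) * cmod (u t)" by (intro exI[of _ 0]) simp
      show "(\<forall>t. H 0 t = 0) \<or> exp (\<i> * (2 * of_real pi * msymb \<xi>)) \<noteq> 1"
      proof (cases "\<delta> = 0")
        case True
        then show ?thesis by (simp add: H_def)
      next
        case False
        \<comment> \<open>A resonance would make \<delta> a nonzero integer, although its modulus is
          less than one.\<close>
        have "exp (\<i> * (2 * of_real pi * msymb \<xi>)) \<noteq> 1"
        proof
          assume "exp (\<i> * (2 * of_real pi * msymb \<xi>)) = 1"
          then have "exp (\<i> * (2 * of_real pi * msymb \<xi>)) = exp 0" by simp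
          then obtain n :: int where "\<i> * (2 * of_real pi * msymb \<xi>) = 0 + (of_int (2 * n) * of_real pi) * \<i>" unfolding exp_eq by auto
          then have "(2 * of_real pi * \<i>) * msymb \<xi> = (2 * of_real pi * \<i>) * of_int n" by (simp add: mult_ac)
          then have "msymb \<xi> = of_int n" by simp
          then have dn: "\<delta> = of_int (\<tau> + n)" by (simp add: \<delta>_def)
          then have "\<tau> + n \<noteq> 0" using False by (metis of_int_0)
          then have "1 \<le> cmod \<delta>" unfolding dn norm_of_int by (simp flip: of_int_abs)
          then show False using \<tau>(1) by (simp add: \<delta>_def)
        qed
        then show ?thesis by blast
      qed
    qed
    then show ?thesis by blast
  qed
  have inf: "infinite S" using \<epsilon>(2) by (simp add: S_def)
  have C0: "0 \<le> C" by (simp add: C_def)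
  show "\<not> globally_hypoelliptic \<omega> a b" "\<not> strongly_solvable \<omega> a b"
    using singular_mode_conclusion[OF inf l(1) C0 zero_less_one ex] by auto
qed

end

section \<open>Modes for a symbol that changes sign\<close>

context tube_operator
begin

text \<open>The kernel of \<open>periodic_sol\<close> at \<open>k * \<xi>0\<close> has modulus
  \<open>exp (real k * (G t - G r))\<close>, which reaches \<open>exp (real k * Mx)\<close> within a
  period; \<open>Mx\<close> is positive because G increases somewhere. The datum f has the
  reciprocal size and cancels the phase, so u stays bounded, while at \<open>ts\<close> the
  integrand is bounded below over an interval of length \<open>1 / real k\<close>. The mean is taken
  nonpositive so that \<open>cmod D \<le> 2\<close>: the right-hand side \<open>D * f\<close> is
  then as small as f.\<close>

lemma sign_change_modes_aux:
  fixes \<xi>0 :: "'n \<Rightarrow> int"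
  assumes pos: "Im (symb \<xi>0 t1) > 0" and mean: "Im (msymb \<xi>0) \<le> 0"
  shows "\<not> globally_hypoelliptic \<omega> a b \<and> \<not> strongly_solvable \<omega> a b"
proof -
  define P where "P = primitive (symb \<xi>0)"
  define A where "A = (\<lambda>t. Re (P t))"
  define G where "G = (\<lambda>t. Im (P t))"
  define a0 where "a0 = Re (msymb \<xi>0)"
  have dP: "(P has_vector_derivative symb \<xi>0 t) (at t)" for t unfolding P_def by (rule primitive_deriv[OF symb_continuous])
  have cP: "continuous_on X P" for X
    by (rule continuous_at_imp_continuous_on) (use dP has_vector_derivative_continuous in blast)
  have perP: "P (t + 2 * pi) = P t + 2 * of_real pi * msymb \<xi>0" for t
    unfolding P_def by (subst primitive_period[OF symb_continuous symb_periodic]) (simp add: primitive_symb)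
  have cG: "continuous_on X G" for X unfolding G_def by (intro continuous_intros cP)
  have dA: "(A has_real_derivative Re (symb \<xi>0 t)) (at t)" for t
    using bounded_linear.has_vector_derivative[OF bounded_linear_Re dP[of t]] unfolding A_def
    by (simp add: has_real_derivative_iff_has_vector_derivative)
  have dG: "(G has_real_derivative Im (symb \<xi>0 t)) (at t)" for t
    using bounded_linear.has_vector_derivative[OF bounded_linear_Im dP[of t]] unfolding G_def
    by (simp add: has_real_derivative_iff_has_vector_derivative)
  have perA: "A (t + 2 * pi) = A t + 2 * pi * a0" and perG: "G (t + 2 * pi) = G t + 2 * pi * Im (msymb \<xi>0)" for t
    by (simp_all add: A_def G_def a0_def perP)
  \<comment> \<open>The second variable is the delay \<open>t - r\<close>, which runs over one
    period. As \<open>G t - G (t - s)\<close> is periodic in t, a maximum over this compact square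
    bounds the exponent of the kernel everywhere.\<close>
  let ?Q = "{0..2 * pi} \<times> {0..2 * pi}"
  let ?g = "\<lambda>z. G (fst z) - G (fst z - snd z)"
  have "continuous_on ?Q ?g" by (intro continuous_intros continuous_on_compose2[OF cG[of UNIV]]) auto
  moreover have "compact ?Q" by (intro compact_Times compact_Icc)
  moreover have "(0, 0) \<in> ?Q" by simp
  ultimately obtain z where z: "z \<in> ?Q" "\<And>y. y \<in> ?Q \<Longrightarrow> ?g y \<le> ?g z"
    using continuous_attains_sup[of ?Q ?g] by blast
  define ts where "ts = fst z" define ss where "ss = snd z"
  have ss: "0 \<le> ss" "ss \<le> 2 * pi" using z(1) by (auto simp: ss_def mem_Times_iff)
  define Mx where "Mx = G ts - G (ts - ss)"
  have max: "G t - G (t - s) \<le> Mx" if s: "0 \<le> s" "s \<le> 2 * pi" for t s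
  proof -
    have "periodic_fn (\<lambda>t. complex_of_real (G t - G (t - s)))" unfolding periodic_fn_def
    proof (intro ballI allI)
      fix e t :: real assume "e \<in> Basis"
      then have e: "e = 1" by simp
      have "G (t - s + 2 * pi) = G (t - s) + 2 * pi * Im (msymb \<xi>0)" by (rule perG)
      then show "complex_of_real (G (t + (2 * pi) *\<^sub>R e) - G (t + (2 * pi) *\<^sub>R e - s)) = complex_of_real (G t - G (t - s))"
        using perG[of t] by (simp add: e algebra_simps)
    qed
    moreover obtain y where y: "y \<in> torus_box" "\<And>f :: real \<Rightarrow> complex. periodic_fn f \<Longrightarrow> f t = f y" using periodic_fn_reduce[of t] by metis
    ultimately have "complex_of_real (G t - G (t - s)) = complex_of_real (G y - G (y - s))" by blast
    then have "G t - G (t - s) = G y - G (y - s)" by (simp only: of_real_eq_iff)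
    also have "\<dots> \<le> Mx" using z(2)[of "(y, s)"] y(1) s by (simp add: Mx_def ts_def ss_def torus_box_def)
    finally show ?thesis .
  qed
  have Mx: "Mx > 0"
  proof -
    obtain e where e: "e > 0" "\<And>h. h > 0 \<Longrightarrow> h < e \<Longrightarrow> G (t1 - h) < G t1" using DERIV_pos_inc_left[OF dG pos] by blast
    define h where "h = min (e / 2) pi"
    have h: "0 < h" "h < e" "h \<le> 2 * pi" using e(1) by (auto simp: h_def min_def)
    then have "0 < G t1 - G (t1 - h)" using e(2)[of h] by simp
    also have "\<dots> \<le> Mx" using h by (intro max) auto
    finally show ?thesis .
  qed
  obtain \<Lambda> where \<Lambda>: "\<Lambda> > 0" "\<And>t. cmod (symb \<xi>0 t) \<le> \<Lambda>" using bounded_of_periodic[OF symb_continuous symb_periodic] by blast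
  have lip0: "G y - G x \<le> \<Lambda> * (y - x) \<and> G x - G y \<le> \<Lambda> * (y - x)" if "x \<le> y" for x y
  proof -
    have "(symb \<xi>0 has_integral (P y - P x)) {x..y}" unfolding P_def by (rule primitive_diff_integral[OF symb_continuous that])
    then have "cmod (P y - P x) \<le> \<Lambda> * (y - x)"
      using has_integral_bound_real[of \<Lambda> "{}" "symb \<xi>0" "P y - P x" x y] \<Lambda> that by simp
    then show ?thesis using abs_Im_le_cmod[of "P y - P x"] by (auto simp: G_def)
  qed
  have lip: "G y - G x \<le> \<Lambda> * \<bar>y - x\<bar>" for x y
    using lip0[of x y] lip0[of y x] by (cases "x \<le> y") auto
  have \<xi>0: "1 \<le> norm (lat \<xi>0)"
  proof -
    have "\<exists>j. \<xi>0 j \<noteq> 0"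
    proof (rule ccontr)
      assume "\<nexists>j. \<xi>0 j \<noteq> 0"
      then have "symb \<xi>0 t1 = 0" by (simp add: symb_def)
      then show False using pos by simp
    qed
    then show ?thesis using norm_lat_ge_1 by blast
  qed
  obtain l1 A1 where A1: "l1 > 0" "A1 \<ge> (1::nat)" "\<And>\<xi> k t. cmod (symb_seq \<xi> k t) \<le> real A1 * (1 + norm (lat \<xi>)) * M l1 k"
    using symb_seq_bound by blast
  \<comment> \<open>Half of the exponent \<open>real k * Mx\<close> pays for the loss
    \<open>exp (d * \<omega> (real k))\<close>, where
    \<open>\<omega> (real k) \<le> real k * \<omega> 1\<close> by subadditivity. The other half
    covers the decay required of H and fixes l below. The added 1 keeps the denominator
    positive.\<close>
  define d where "d = min l1 (Mx / (2 * (\<omega> 1 + 1)))"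
  have w1: "0 \<le> \<omega> 1" "0 \<le> \<omega> (norm (lat \<xi>0))" by (auto intro: w_nonneg)
  have cancel: "x / (y * p) * p = x / y" if "0 < p" for x y p :: real using that by simp
  have d: "0 < d" "d \<le> l1" "d * \<omega> 1 \<le> Mx / 2"
  proof -
    show "0 < d" "d \<le> l1" using A1 Mx w1 by (auto simp: d_def)
    have "d * \<omega> 1 \<le> Mx / (2 * (\<omega> 1 + 1)) * (\<omega> 1 + 1)" using w1 Mx by (intro mult_mono) (auto simp: d_def)
    also have "\<dots> = Mx / 2" by (rule cancel) (use w1 in simp)
    finally show "d * \<omega> 1 \<le> Mx / 2" .
  qed
  obtain A' where A': "A' \<ge> (1::nat)" "1 \<le> real A' * M d 0" using one_le_M by blast
  \<comment> \<open>Here k takes the role of y, and the fixed norm of \<open>\<xi>0\<close> goes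
    into the constant; A' covers the constant term in \<theta>.\<close>
  define A2 where "A2 = nat \<lceil>real A1 * (1 + norm (lat \<xi>0))\<rceil> + A'"
  have A2: "1 \<le> A2" "real A1 * (1 + norm (lat \<xi>0)) + real A' \<le> real A2"
    using A' by (auto simp: A2_def)
  define l where "l = min (d / (4 * real A2)) (Mx / (4 * (\<omega> (norm (lat \<xi>0)) + 1)))"
  have l: "0 < l" "l \<le> d / (4 * real A2)" "2 * l * \<omega> (norm (lat \<xi>0)) \<le> Mx / 2"
  proof -
    show "0 < l" "l \<le> d / (4 * real A2)" using d A2 Mx w1 by (auto simp: l_def)
    have "l * \<omega> (norm (lat \<xi>0)) \<le> Mx / (4 * (\<omega> (norm (lat \<xi>0)) + 1)) * (\<omega> (norm (lat \<xi>0)) + 1)"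
      using w1 Mx by (intro mult_mono) (auto simp: l_def)
    also have "\<dots> = Mx / 4" by (rule cancel) (use w1 in simp)
    finally show "2 * l * \<omega> (norm (lat \<xi>0)) \<le> Mx / 2" by simp
  qed
  define C where "C = 2 * exp (d * \<omega> 1)"
  define c where "c = exp (- \<Lambda>) / 2"
  define good where "good = {k::nat. k \<ge> 1 \<and> (\<exists>m::int. \<bar>real k * a0 - of_int m\<bar> \<le> 1 / 8)}"
  have ex: "\<exists>u H. singular_mode l C (2 * pi) c (\<lambda>j. int k * \<xi>0 j) u H" if k: "k \<in> good" for k
  proof -
    let ?\<xi> = "\<lambda>j. int k * \<xi>0 j"
    have k1: "1 \<le> k" "1 \<le> real k" using k by (auto simp: good_def)
    obtain m :: int where m: "\<bar>real k * a0 - of_int m\<bar> \<le> 1 / 8" using k by (auto simp: good_def)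
    define \<theta> where "\<theta> = real k * a0 - of_int m"
    have \<theta>: "\<bar>\<theta>\<bar> \<le> 1 / 8" using m by (simp add: \<theta>_def)
    have symbk: "symb ?\<xi> = (\<lambda>t. of_nat k * symb \<xi>0 t)" by (simp add: symb_def fun_eq_iff sum_distrib_left mult.assoc)
    have msymbk: "msymb ?\<xi> = of_nat k * msymb \<xi>0" by (simp add: msymb_def sum_distrib_left mult.assoc)
    have primk: "primitive (symb ?\<xi>) t = of_nat k * P t" for t unfolding symbk P_def by (rule primitive_cmult)
    have latk: "norm (lat ?\<xi>) = real k * norm (lat \<xi>0)"
    proof -
      have "lat ?\<xi> = real k *\<^sub>R lat \<xi>0" by (simp add: vec_eq_iff)
      then show ?thesis by simp
    qed
    \<comment> \<open>The phase \<open>- real k * A r\<close> cancels the dependence on r of the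
      phase of the kernel. The correction \<open>\<theta> * r\<close> makes f periodic, because
      \<open>\<theta> - real k * a0\<close> is an integer.\<close>
    define f where "f = (\<lambda>r. exp (of_real (- (real k * Mx)) + \<i> * of_real (\<theta> * r - real k * A r)))"
    have fn: "cmod (f r) = exp (- (real k * Mx))" for r by (simp add: f_def norm_exp_eq_Re)
    have df: "(f has_vector_derivative (\<i> * of_real (\<theta> - real k * Re (symb \<xi>0 r))) * f r) (at r)" for r
    proof -
      have "((\<lambda>r. \<theta> * r - real k * A r) has_real_derivative (\<theta> - real k * Re (symb \<xi>0 r))) (at r)"
        by (auto intro!: derivative_eq_intros dA)
      then have "((\<lambda>r. of_real (- (real k * Mx)) + \<i> * of_real (\<theta> * r - real k * A r)) has_vector_derivative
         0 + \<i> * of_real (\<theta> - real k * Re (symb \<xi>0 r))) (at r)"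
        by (intro has_vector_derivative_add has_vector_derivative_const has_vector_derivative_mult_right has_vector_derivative_of_real)
      from has_vector_derivative_exp[OF this] show ?thesis unfolding f_def by simp
    qed
    have cf: "continuous_on UNIV f"
      by (rule continuous_at_imp_continuous_on) (use df has_vector_derivative_continuous in blast)
    have perf: "f (r + 2 * pi) = f r" for r
    proof -
      have "of_real (- (real k * Mx)) + \<i> * of_real (\<theta> * (r + 2 * pi) - real k * A (r + 2 * pi))
        = (of_real (- (real k * Mx)) + \<i> * of_real (\<theta> * r - real k * A r)) + (2 * of_int (- m) * of_real pi * \<i> :: complex)"
        unfolding perA by (simp add: \<theta>_def algebra_simps)
      moreover have "exp (2 * of_int (- m) * of_real pi * \<i>) = (1::complex)" using exp_integer_2pi[of "of_int (- m)"] by simp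
      ultimately show ?thesis unfolding f_def by (simp only: exp_add mult_1_right)
    qed
    \<comment> \<open>f solves a homogeneous equation whose coefficient involves the symbol through
      its real part only; as \<open>symb_seq\<close> contains a factor \<i>, that part is the
      imaginary part of its terms.\<close>
    define Gc where "Gc = (\<lambda>j t. (\<i> * of_nat k) * of_real (Im (symb_seq \<xi>0 j t)) + (if j = 0 then - (\<i> * of_real \<theta>) else 0))"
    have dGc: "deriv_seq Gc" unfolding Gc_def
      by (intro deriv_seq_add deriv_seq_cmult deriv_seq_Im deriv_seq_symb deriv_seq_const)
    have Gcb: "cmod (Gc j t) \<le> real A2 * real k * M d j" for j t
    proof -
      have "cmod (of_real (Im (symb_seq \<xi>0 j t))) \<le> cmod (symb_seq \<xi>0 j t)" using abs_Im_le_cmod[of "symb_seq \<xi>0 j t"] by simp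
      also have "\<dots> \<le> real A1 * (1 + norm (lat \<xi>0)) * M d j"
        using M_antimono[OF d(1,2), of j] by (intro order_trans[OF A1(3)] mult_left_mono) auto
      finally have "real k * cmod (of_real (Im (symb_seq \<xi>0 j t))) \<le> real k * (real A1 * (1 + norm (lat \<xi>0)) * M d j)"
        by (intro mult_left_mono) auto
      then have 1: "cmod ((\<i> * of_nat k) * of_real (Im (symb_seq \<xi>0 j t))) \<le> real A1 * (1 + norm (lat \<xi>0)) * (real k * M d j)"
        by (simp only: norm_mult norm_ii norm_of_nat mult_1_left) (simp only: mult_ac)
      have 2: "cmod (if j = 0 then - (\<i> * of_real \<theta>) else 0) \<le> real A' * (real k * M d j)"
      proof (cases "j = 0")
        case True
        have "\<bar>\<theta>\<bar> \<le> 1 * 1" using \<theta> by simp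
        also have "\<dots> \<le> real k * (real A' * M d 0)" using k1(2) A'(2) by (rule mult_mono) auto
        finally show ?thesis using True by (simp add: norm_mult mult_ac)
      qed simp
      have "cmod (Gc j t) \<le> (real A1 * (1 + norm (lat \<xi>0)) + real A') * (real k * M d j)"
        unfolding Gc_def distrib_right[of "real A1 * (1 + norm (lat \<xi>0))"] by (rule order_trans[OF norm_triangle_ineq add_mono[OF 1 2]])
      also have "\<dots> \<le> real A2 * (real k * M d j)" using A2(2) by (intro mult_right_mono) auto
      finally show ?thesis by (simp only: mult.assoc)
    qed
    have odef: "(f has_vector_derivative (- Gc 0 r * f r)) (at r)" for r
      using df[of r] by (simp add: Gc_def symb_seq_0 algebra_simps)
    have fb: "cmod (f r) \<le> exp (- (real k * Mx))" for r by (simp add: fn)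
    obtain F where F: "deriv_seq F" "F 0 = f"
      "\<And>j t. cmod (F j t) \<le> exp (- (real k * Mx)) * exp (d * \<omega> 1) * exp (d * \<omega> (real k)) * M (d / (4 * real A2)) j"
      using homogeneous_regularity[OF d(1) A2(1) k1(2) exp_ge_zero dGc Gcb fb odef] by blast
    define D where "D = 1 - exp (- \<i> * primitive (symb ?\<xi>) (2 * pi))"
    have Db: "cmod D \<le> 2"
    proof -
      have "cmod (exp (- \<i> * primitive (symb ?\<xi>) (2 * pi))) \<le> 1"
        unfolding primitive_symb msymbk using mean by (simp add: norm_exp_eq_Re mult_nonneg_nonpos)
      then have "cmod (1 :: complex) + cmod (exp (- \<i> * primitive (symb ?\<xi>) (2 * pi))) \<le> 1 + 1" by (intro add_mono) simp_all
      then show ?thesis unfolding D_def using norm_triangle_ineq4[of 1 "exp (- \<i> * primitive (symb ?\<xi>) (2 * pi))"] by linarith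
    qed
    define H where "H = (\<lambda>j t. D * F j t)"
    define u where "u = periodic_sol (symb ?\<xi>) f"
    have Hb: "cmod (H j t) \<le> C * M l j * exp (- 2 * l * \<omega> (norm (lat ?\<xi>)))" for j t
    proof -
      have "\<omega> (real k) \<le> real k * \<omega> 1" using w_mult'[of 1 k] k1 by simp
      then have "d * \<omega> (real k) \<le> d * (real k * \<omega> 1)" using d by (intro mult_left_mono) auto
      also have "\<dots> = real k * (d * \<omega> 1)" by simp
      also have "\<dots> \<le> real k * (Mx / 2)" using d by (intro mult_left_mono) auto
      finally have e1: "d * \<omega> (real k) \<le> real k * (Mx / 2)" .
      have "\<omega> (norm (lat ?\<xi>)) \<le> real k * \<omega> (norm (lat \<xi>0))" unfolding latk using k1 by (intro w_mult') auto
      then have "2 * l * \<omega> (norm (lat ?\<xi>)) \<le> 2 * l * (real k * \<omega> (norm (lat \<xi>0)))" using l by (intro mult_left_mono) auto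
      also have "\<dots> = real k * (2 * l * \<omega> (norm (lat \<xi>0)))" by simp
      also have "\<dots> \<le> real k * (Mx / 2)" using l by (intro mult_left_mono) auto
      finally have e2: "2 * l * \<omega> (norm (lat ?\<xi>)) \<le> real k * (Mx / 2)" .
      have "exp (- (real k * Mx)) * exp (d * \<omega> (real k)) \<le> exp (- 2 * l * \<omega> (norm (lat ?\<xi>)))"
        unfolding exp_add[symmetric] using e1 e2 by simp
      then have e: "exp (- (real k * Mx)) * exp (d * \<omega> (real k)) * M (d / (4 * real A2)) j \<le> exp (- 2 * l * \<omega> (norm (lat ?\<xi>))) * M l j"
        using M_antimono[OF l(1,2), of j] by (intro mult_mono) auto
      have "cmod (H j t) \<le> 2 * (exp (- (real k * Mx)) * exp (d * \<omega> 1) * exp (d * \<omega> (real k)) * M (d / (4 * real A2)) j)"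
        unfolding H_def norm_mult using Db F(3) by (intro mult_mono) auto
      also have "\<dots> = C * (exp (- (real k * Mx)) * exp (d * \<omega> (real k)) * M (d / (4 * real A2)) j)" unfolding C_def by (simp only: mult_ac)
      also have "\<dots> \<le> C * (exp (- 2 * l * \<omega> (norm (lat ?\<xi>))) * M l j)" using e by (intro mult_left_mono) (auto simp: C_def)
      finally show ?thesis by (simp only: mult_ac)
    qed
    note sol = symb_continuous[of UNIV ?\<xi>] cf symb_periodic[of ?\<xi>] perf
    have intu: "((\<lambda>r. exp (- \<i> * (of_nat k * P t - of_nat k * P r)) * f r) has_integral u t) {t - 2 * pi..t}" for t
      using periodic_sol_integral[OF sol, of t] unfolding u_def primk .
    have kern: "exp (- \<i> * (of_nat k * P t - of_nat k * P r)) * f r =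
        exp (of_real (real k * (G t - G r - Mx))) * exp (\<i> * of_real (\<theta> * r - real k * A t))" for t r
    proof -
      have "- \<i> * (of_nat k * P t - of_nat k * P r) + (of_real (- (real k * Mx)) + \<i> * of_real (\<theta> * r - real k * A r))
        = of_real (real k * (G t - G r - Mx)) + \<i> * of_real (\<theta> * r - real k * A t)"
        by (simp add: complex_eq_iff A_def G_def algebra_simps)
      then show ?thesis unfolding f_def exp_add[symmetric] by simp
    qed
    have ub: "cmod (u t) \<le> 2 * pi" for t
    proof -
      have "cmod (u t) \<le> 2 * pi * 1" unfolding u_def
      proof (rule periodic_sol_bound[OF sol])
        fix r assume r: "r \<in> {t - 2 * pi..t}"
        have "G t - G (t - (t - r)) \<le> Mx" using r by (intro max) auto
        then have "real k * (G t - G r - Mx) \<le> 0" by (intro mult_nonneg_nonpos) auto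
        then show "cmod (exp (- \<i> * (primitive (symb ?\<xi>) t - primitive (symb ?\<xi>) r)) * f r) \<le> 1"
          unfolding primk kern by (simp add: norm_mult norm_exp_eq_Re)
      qed simp
      then show ?thesis by simp
    qed
    have low: "exp (- \<Lambda>) / (2 * real k) \<le> cmod (u ts)"
    proof -
      \<comment> \<open>After multiplication by the unimodular w only the slow phase
        \<open>\<theta> * (r - ts)\<close> is left. It is at most pi / 4 in modulus, so the real
        part of the integrand is nonnegative on the whole period.\<close>
      define w where "w = exp (\<i> * of_real (real k * A ts - \<theta> * ts))"
      define R where "R = (\<lambda>r. exp (real k * (G ts - G r - Mx)) * cos (\<theta> * (r - ts)))"
      have Rint: "(R has_integral Re (w * u ts)) {ts - 2 * pi..ts}"
      proof -
        have "((\<lambda>r. Re (w * (exp (- \<i> * (of_nat k * P ts - of_nat k * P r)) * f r))) has_integral Re (w * u ts)) {ts - 2 * pi..ts}"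
          using has_integral_linear[OF has_integral_mult_right[OF intu[of ts], of w] bounded_linear_Re] by (simp add: o_def)
        moreover have "Re (w * (exp (- \<i> * (of_nat k * P ts - of_nat k * P r)) * f r)) = R r" for r
        proof -
          have "w * (exp (- \<i> * (of_nat k * P ts - of_nat k * P r)) * f r)
             = of_real (exp (real k * (G ts - G r - Mx))) * exp (\<i> * of_real (\<theta> * (r - ts)))"
          proof -
            have "w * exp (\<i> * of_real (\<theta> * r - real k * A ts)) = exp (\<i> * of_real (\<theta> * (r - ts)))"
              unfolding w_def exp_add[symmetric] by (simp add: algebra_simps)
            then show ?thesis unfolding kern exp_of_real mult.left_commute[of w] by (simp only:)
          qed
          moreover have "exp (\<i> * of_real (\<theta> * (r - ts))) = cis (\<theta> * (r - ts))" by (simp add: cis_conv_exp)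
          ultimately show ?thesis by (simp add: R_def)
        qed
        ultimately show ?thesis by (simp only:)
      qed
      define rs where "rs = ts - ss"
      have kk: "0 < 1 / real k" "1 / real k \<le> 1" using k1 by auto
      \<comment> \<open>An interval of length \<open>1 / real k\<close> inside the period with
        \<open>rs\<close> as an endpoint: to the right of \<open>rs\<close> if \<open>ss\<close> is
        at least 1, otherwise to the left. On it the exponent is at least \<open>- \<Lambda>\<close>
        by the Lipschitz bound.\<close>
      obtain j0 where j0: "ts - 2 * pi \<le> j0" "j0 + 1 / real k \<le> ts" "j0 \<le> rs" "rs \<le> j0 + 1 / real k"
      proof (cases "ss \<ge> 1")
        case True
        show ?thesis by (rule that[of rs]; use True ss kk rs_def in linarith)
      next
        case False
        show ?thesis by (rule that[of "rs - 1 / real k"]; use False ss kk pi_gt3 rs_def in linarith)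
      qed
      have sub: "{j0..j0 + 1 / real k} \<subseteq> {ts - 2 * pi..ts}" using j0 by auto
      have cosl: "1 / 2 \<le> cos (\<theta> * (r - ts))" if r: "r \<in> {ts - 2 * pi..ts}" for r
      proof -
        have "\<bar>\<theta> * (r - ts)\<bar> \<le> 1 / 8 * (2 * pi)" unfolding abs_mult using \<theta> r by (intro mult_mono) auto
        then have "\<bar>\<theta> * (r - ts)\<bar> \<le> pi / 3" using pi_gt_zero by linarith
        then have "cos (pi / 3) \<le> cos \<bar>\<theta> * (r - ts)\<bar>" by (intro cos_monotone_0_pi_le) auto
        then show ?thesis by (simp add: cos_60)
      qed
      have "((\<lambda>r. if r \<in> {j0..j0 + 1 / real k} then exp (- \<Lambda>) / 2 else 0) has_integral (1 / real k) * (exp (- \<Lambda>) / 2)) {ts - 2 * pi..ts}"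
        using has_integral_restrict[OF sub, of "\<lambda>_. exp (- \<Lambda>) / 2"] has_integral_const_real[of "exp (- \<Lambda>) / 2" j0 "j0 + 1 / real k"] kk by simp
      then have "(1 / real k) * (exp (- \<Lambda>) / 2) \<le> Re (w * u ts)"
      proof (rule has_integral_le[OF _ Rint])
        fix r assume r: "r \<in> {ts - 2 * pi..ts}"
        show "(if r \<in> {j0..j0 + 1 / real k} then exp (- \<Lambda>) / 2 else 0) \<le> R r"
        proof (cases "r \<in> {j0..j0 + 1 / real k}")
          case True
          have "\<bar>r - rs\<bar> \<le> 1 / real k" using True j0 by auto
          have "G r - G rs \<le> \<Lambda> * \<bar>r - rs\<bar>" by (rule lip)
          also have "\<dots> \<le> \<Lambda> * (1 / real k)" using \<open>\<bar>r - rs\<bar> \<le> _\<close> \<Lambda> by (intro mult_left_mono) auto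
          finally have "- (\<Lambda> * (1 / real k)) \<le> G ts - G r - Mx" by (simp add: Mx_def rs_def)
          then have "real k * - (\<Lambda> * (1 / real k)) \<le> real k * (G ts - G r - Mx)" by (intro mult_left_mono) auto
          then have "- \<Lambda> \<le> real k * (G ts - G r - Mx)" using k1 by simp
          then have "exp (- \<Lambda>) * (1 / 2) \<le> R r" unfolding R_def using cosl[OF r] by (intro mult_mono) auto
          then show ?thesis using True by simp
        next
          case False
          have "0 \<le> R r" unfolding R_def using cosl[OF r] by (intro mult_nonneg_nonneg) auto
          then show ?thesis unfolding if_not_P[OF False] .
        qed
      qed
      also have "Re (w * u ts) \<le> cmod (w * u ts)" by (rule complex_Re_le_cmod)
      also have "\<dots> = cmod (u ts)" by (simp add: norm_mult w_def norm_exp_eq_Re)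
      finally show ?thesis by simp
    qed
    have "singular_mode l C (2 * pi) c ?\<xi> u H" unfolding singular_mode_def
    proof (intro conjI allI)
      show "deriv_seq H" unfolding H_def by (intro deriv_seq_cmult F)
      show "H 0 (t + 2 * pi) = H 0 t" for t by (simp add: H_def F(2) perf)
      show "cmod (H j t) \<le> C * M l j * exp (- 2 * l * \<omega> (norm (lat ?\<xi>)))" for j t by (rule Hb)
      show "u (t + 2 * pi) = u t" for t unfolding u_def by (rule periodic_sol_period[OF sol])
      show "(u has_vector_derivative (H 0 t - \<i> * symb ?\<xi> t * u t)) (at t)" for t
        using periodic_sol_deriv[OF sol, of t] unfolding u_def H_def F(2) D_def .
      show "cmod (u t) \<le> 2 * pi" for t by (rule ub)
      have "c = real k * (exp (- \<Lambda>) / (2 * real k))" using k1 by (simp add: c_def)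
      also have "\<dots> \<le> (1 + norm (lat ?\<xi>)) * cmod (u ts)"
      proof (rule mult_mono[OF _ low])
        have "real k * 1 \<le> real k * norm (lat \<xi>0)" using \<xi>0 by (intro mult_left_mono) auto
        then show "real k \<le> 1 + norm (lat ?\<xi>)" by (simp add: latk)
      qed auto
      finally show "\<exists>t. c \<le> (1 + norm (lat ?\<xi>)) * cmod (u t)" by blast
      show "(\<forall>t. H 0 t = 0) \<or> exp (\<i> * (2 * of_real pi * msymb ?\<xi>)) \<noteq> 1"
      proof (cases "exp (\<i> * (2 * of_real pi * msymb ?\<xi>)) = 1")
        case True
        \<comment> \<open>At a resonant frequency D vanishes and with it the right-hand side, which
          is the other branch of the alternative.\<close>
        have "exp (- \<i> * primitive (symb ?\<xi>) (2 * pi)) = inverse (exp (\<i> * (2 * of_real pi * msymb ?\<xi>)))"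
          unfolding primitive_symb by (simp add: exp_minus)
        then have "D = 0" using True by (simp add: D_def)
        then show ?thesis by (simp add: H_def)
      qed simp
    qed
    then show ?thesis by blast
  qed
  define S where "S = (\<lambda>k::nat. \<lambda>j. int k * \<xi>0 j) ` good"
  have "inj_on (\<lambda>k::nat. \<lambda>j. int k * \<xi>0 j) good"
  proof (rule inj_onI)
    fix k k' :: nat assume e: "(\<lambda>j. int k * \<xi>0 j) = (\<lambda>j. int k' * \<xi>0 j)"
    obtain j where j: "\<xi>0 j \<noteq> 0"
    proof (rule ccontr)
      assume "\<not> thesis"
      then have "\<xi>0 j = 0" for j using that by blast
      then have "lat \<xi>0 = 0" by (simp add: vec_eq_iff)
      then show False using \<xi>0 by simp
    qed
    have "int k * \<xi>0 j = int k' * \<xi>0 j" using e by meson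
    then show "k = k'" using j by simp
  qed
  then have inf: "infinite S" unfolding S_def good_def using infinite_almost_integer_multiples[of a0] finite_imageD by blast
  have C0: "0 \<le> C" and c0: "0 < c" by (auto simp: C_def c_def)
  have ex': "\<exists>u H. singular_mode l C (2 * pi) c \<xi> u H" if "\<xi> \<in> S" for \<xi> using that ex by (auto simp: S_def)
  show ?thesis using singular_mode_conclusion[OF inf l(1) C0 c0 ex'] by blast
qed

text \<open>Passing to the negative of \<xi> exchanges the two signs, so the mean may be taken
  nonpositive.\<close>

lemma sign_change_modes:
  assumes "changes_sign (\<lambda>t. \<Sum>j\<in>UNIV. of_int (\<xi> j) * b j t)"
  shows "\<not> globally_hypoelliptic \<omega> a b" "\<not> strongly_solvable \<omega> a b"
proof -
  obtain t1 t2 where t: "Im (symb \<xi> t1) > 0" "Im (symb \<xi> t2) < 0" using assms unfolding changes_sign_def Im_symb by blast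
  have "\<not> globally_hypoelliptic \<omega> a b \<and> \<not> strongly_solvable \<omega> a b"
  proof (cases "Im (msymb \<xi>) \<le> 0")
    case True
    then show ?thesis by (rule sign_change_modes_aux[OF t(1)])
  next
    case False
    have "symb (\<lambda>j. - \<xi> j) t2 = - symb \<xi> t2" by (simp add: symb_def sum_negf)
    moreover have "msymb (\<lambda>j. - \<xi> j) = - msymb \<xi>" by (simp add: msymb_def sum_negf)
    ultimately show ?thesis using t(2) False by (intro sign_change_modes_aux[of "\<lambda>j. - \<xi> j" t2]) auto
  qed
  then show "\<not> globally_hypoelliptic \<omega> a b" "\<not> strongly_solvable \<omega> a b" by auto
qed

end

theorem theorem2p4:
  fixes \<omega> :: "real \<Rightarrow> real"
    and a b :: "'n::finite \<Rightarrow> real \<Rightarrow> real"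
  assumes "weight_function \<omega>" and "subadditive \<omega>"
    and "\<And>j. (\<lambda>t. complex_of_real (a j t)) \<in> E_om \<omega>"
    and "\<And>j. (\<lambda>t. complex_of_real (b j t)) \<in> E_om \<omega>"
  shows "(strongly_solvable \<omega> a b \<longleftrightarrow> globally_hypoelliptic \<omega> a b)
       \<and> (globally_hypoelliptic \<omega> a b \<longleftrightarrow>
           ((\<forall>\<xi>::'n \<Rightarrow> int. \<not> changes_sign (\<lambda>t. \<Sum>j\<in>UNIV. of_int (\<xi> j) * b j t))
            \<and> EDC1 \<omega> (mean_vec a) (mean_vec b)))"
proof -
  interpret tube_operator \<omega> a b by unfold_locales (use assms in auto)
  let ?cond = "(\<forall>\<xi>::'n \<Rightarrow> int. \<not> changes_sign (\<lambda>t. \<Sum>j\<in>UNIV. of_int (\<xi> j) * b j t)) \<and> EDC1 \<omega> (mean_vec a) (mean_vec b)"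
  have "strongly_solvable \<omega> a b \<and> globally_hypoelliptic \<omega> a b" if ?cond
  proof -
    have "\<exists>\<phi>\<in>E_om \<omega>. L \<phi> = \<psi>" if "\<psi> \<in> E_om \<omega>" "pairing (\<lambda>_. 1) \<psi> = 0" for \<psi>
      using L_onto_mean_zero[OF _ _ that] \<open>?cond\<close> by blast
    then show ?thesis using solvable_of_onto hypoelliptic_of_onto by blast
  qed
  moreover have "\<not> strongly_solvable \<omega> a b \<and> \<not> globally_hypoelliptic \<omega> a b" if "\<not> ?cond"
    using that sign_change_modes small_denominator_modes by blast
  ultimately show ?thesis by blast
qed

end
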